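(* Let $0<s<1$, $a=1-2s$, $r>0$, and let $v\in V^{a,2r,-4r^2,0}$ be a weak solution in $\mathbb B_{2r}^+\times(-4r^2,0]$ of $$\operatorname{div}(y^a\nabla v)=y^av_t,\qquad -\lim_{y\to0}y^av_y=\phi,$$ where $\phi=\phi(x,t)$ is of class $C^2$ if $0<s<1/2$, and of class $C^1$ if $s\ge1/2$, on $B_{2r}\times(-4r^2,0]$. Then there exists $\alpha'>0$, depending on $a,n$, such that $D_iv$ ($i=1,\dots,n$), $v_t$ and $y^av_y$ belong to $\mathbb H^{\alpha'}$ up to $y=0$ in $\mathbb B_r^+\times(-r^2,0]$.
   Context: $X=(x,y)\in\mathbb R^n\times\mathbb R$; $\nabla,\operatorname{div}$ act in $X$; $D_i=\partial_{x_i}$. $B_r=\{x\in\mathbb R^n:|x|<r\}$, $\mathbb B_r^+=\{X:|X|<r,\ y>0\}$. Class $C^k$ means all derivatives $D_x^\alpha D_t^j\phi$ with $|\alpha|+j\le k$ exist, are continuous and bounded. For $T_1<T_2$, $V^{a,r,T_1,T_2}=L^2((T_1,T_2);W^{1,2}(\mathbb B_r^+,y^adX))$. A weak solution in $\mathbb B_\rho^+\times(T_1,T_2)$ of $\operatorname{div}(y^a\nabla v)=y^av_t$, $\lim_{y\to0}y^av_y=g$, is $v\in V^{a,\rho,T_1,T_2}$ such that for every $\eta\in W^{1,2}(\mathbb B_\rho^+\times(T_1,T_2),y^adXdt)$ with compact support in $(\mathbb B_\rho^+\cup B_\rho)\times[T_1,T_2]$ and a.e. $T_1<t_1<t_2<T_2$,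 $$\int_{t_1}^{t_2}\!\!\int_{\mathbb B_\rho^+}\langle\nabla v,\nabla\eta\rangle y^a=\int_{t_1}^{t_2}\!\!\int_{\mathbb B_\rho^+}y^a\eta_tv-\int_{\mathbb B_\rho^+}(\eta v)(\cdot,t_2)y^a+\int_{\mathbb B_\rho^+}(\eta v)(\cdot,t_1)y^a-\int_{t_1}^{t_2}\!\!\int_{B_\rho}g\,\eta\,dx\,dt$$ (here $g=-\phi$, and $\eta$ on $B_\rho$ is the trace at $y=0$). $\mathbb H^{\alpha}(\Omega)$ is the parabolic Hölder space: bounded $f$ with $\sup\frac{|f(X,t)-f(X',t')|}{(|X-X'|+|t-t'|^{1/2})^{\alpha}}<\infty$. *)

theory Defs
  imports "HOL-Analysis.Analysis"
begin

text \<open>A point \<open>X = (x, y)\<close> of \<open>\<real>\<^sup>n \<times> \<real>\<close> has type \<open>(real ^ 'n) \<times> real\<close>, and a space-time point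
  \<open>(X, t)\<close> has type \<open>((real ^ 'n) \<times> real) \<times> real\<close>. The norm of a pair is the Euclidean one.
  Elements of Lebesgue and Sobolev spaces are given by Borel representatives; the Sobolev
  spaces, traces and weak solutions below do not depend on the choice of representative.\<close>

section \<open>Classical partial derivatives and the classes \<open>C\<^sup>k\<close>\<close>

text \<open>The derivative is taken along the part of the line through \<open>p\<close> that stays in \<open>S\<close>. Hence on
  \<open>S = U \<times> {T<..0}\<close> the time derivative is one-sided at \<open>t = 0\<close>.\<close>

definition has_partial_on ::
  "'a::euclidean_space set \<Rightarrow> ('a \<Rightarrow> real) \<Rightarrow> 'a \<Rightarrow> ('a \<Rightarrow> real) \<Rightarrow> bool" where
  "has_partial_on S f b g \<longleftrightarrow>
    (\<forall>p\<in>S. ((\<lambda>h. f (p + h *\<^sub>R b)) has_real_derivative g p) (at 0 within {h. p + h *\<^sub>R b \<in> S}))"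

primrec C_bounded :: "nat \<Rightarrow> 'a::euclidean_space set \<Rightarrow> ('a \<Rightarrow> real) \<Rightarrow> bool" where
  "C_bounded 0 S f \<longleftrightarrow> continuous_on S f \<and> bounded (f ` S)"
| "C_bounded (Suc k) S f \<longleftrightarrow> continuous_on S f \<and> bounded (f ` S) \<and>
     (\<forall>b\<in>Basis. \<exists>g. has_partial_on S f b g \<and> C_bounded k S g)"

section \<open>Weak derivatives and weighted Sobolev spaces\<close>

text \<open>\<open>C\<^sub>c\<^sup>\<infinity>(\<Omega>)\<close>; boundedness of the derivatives is automatic by compactness of the support.\<close>

definition test_function :: "'a::euclidean_space set \<Rightarrow> ('a \<Rightarrow> real) \<Rightarrow> bool" where
  "test_function \<Omega> \<psi> \<longleftrightarrow> (\<forall>k. C_bounded k UNIV \<psi>) \<and>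
    compact (closure {x. \<psi> x \<noteq> 0}) \<and> closure {x. \<psi> x \<noteq> 0} \<subseteq> \<Omega>"

definition locally_integrable :: "'a::euclidean_space set \<Rightarrow> ('a \<Rightarrow> real) \<Rightarrow> bool" where
  "locally_integrable \<Omega> f \<longleftrightarrow> (\<forall>K. compact K \<longrightarrow> K \<subseteq> \<Omega> \<longrightarrow> set_integrable lborel K f)"

definition weak_partial ::
  "'a::euclidean_space set \<Rightarrow> ('a \<Rightarrow> real) \<Rightarrow> 'a \<Rightarrow> ('a \<Rightarrow> real) \<Rightarrow> bool" where
  "weak_partial \<Omega> f b g \<longleftrightarrow> locally_integrable \<Omega> f \<and> locally_integrable \<Omega> g \<and>
    (\<forall>\<psi> \<psi>'. test_function \<Omega> \<psi> \<longrightarrow> has_partial_on UNIV \<psi> b \<psi>' \<longrightarrow>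
      (LINT x:\<Omega>|lborel. f x * \<psi>' x) = - (LINT x:\<Omega>|lborel. g x * \<psi> x))"

definition weak_gradient ::
  "'a::euclidean_space set \<Rightarrow> ('a \<Rightarrow> real) \<Rightarrow> ('a \<Rightarrow> 'a) \<Rightarrow> bool" where
  "weak_gradient \<Omega> f G \<longleftrightarrow> (\<forall>b\<in>Basis. weak_partial \<Omega> f b (\<lambda>x. G x \<bullet> b))"

definition L2_weighted ::
  "'a::euclidean_space set \<Rightarrow> ('a \<Rightarrow> real) \<Rightarrow> ('a \<Rightarrow> 'b::euclidean_space) \<Rightarrow> bool" where
  "L2_weighted \<Omega> w f \<longleftrightarrow> set_borel_measurable lborel \<Omega> f \<and>
    set_integrable lborel \<Omega> (\<lambda>x. (norm (f x))\<^sup>2 * w x)"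

text \<open>\<open>f \<in> W\<^sup>1\<^sup>,\<^sup>2(\<Omega>, w)\<close> with weak gradient \<open>G\<close>.\<close>

definition W12 ::
  "'a::euclidean_space set \<Rightarrow> ('a \<Rightarrow> real) \<Rightarrow> ('a \<Rightarrow> real) \<Rightarrow> ('a \<Rightarrow> 'a) \<Rightarrow> bool" where
  "W12 \<Omega> w f G \<longleftrightarrow> L2_weighted \<Omega> w f \<and> L2_weighted \<Omega> w G \<and> weak_gradient \<Omega> f G"

section \<open>Half balls, the weight \<open>y\<^sup>a\<close> and the space \<open>V\<close>\<close>

definition half_ball :: "real \<Rightarrow> ((real ^ 'n) \<times> real) set" where
  "half_ball r = {X. norm X < r \<and> 0 < snd X}"

text \<open>The union of the half ball with its flat bottom, i.e. with the ball of \<open>\<real>\<^sup>n\<close> at \<open>y = 0\<close>.\<close>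

definition half_ball0 :: "real \<Rightarrow> ((real ^ 'n) \<times> real) set" where
  "half_ball0 r = {X. norm X < r \<and> 0 \<le> snd X}"

definition weight :: "real \<Rightarrow> (real ^ 'n) \<times> real \<Rightarrow> real" where
  "weight a X = snd X powr a"

text \<open>\<open>v \<in> L\<^sup>2((T1,T2); W\<^sup>1\<^sup>,\<^sup>2(half ball, y\<^sup>a dX))\<close>, with \<open>G\<close> the spatial gradient. The Bochner space is
  identified, as usual, with functions of \<open>(X, t)\<close>: since \<open>W\<^sup>1\<^sup>,\<^sup>2\<close> is separable, strong measurability
  of \<open>t \<mapsto> v(\<cdot>,t)\<close> is joint measurability of \<open>v\<close> and \<open>G\<close>, and by Tonelli the
  square-integrability of the norm is that of \<open>v\<close> and \<open>G\<close> over the cylinder.\<close>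

definition in_V :: "real \<Rightarrow> real \<Rightarrow> real \<Rightarrow> real \<Rightarrow>
    (((real ^ 'n) \<times> real) \<times> real \<Rightarrow> real) \<Rightarrow>
    (((real ^ 'n) \<times> real) \<times> real \<Rightarrow> (real ^ 'n) \<times> real) \<Rightarrow> bool" where
  "in_V a r T1 T2 v G \<longleftrightarrow>
    L2_weighted (half_ball r \<times> {T1<..<T2}) (\<lambda>p. weight a (fst p)) v \<and>
    L2_weighted (half_ball r \<times> {T1<..<T2}) (\<lambda>p. weight a (fst p)) G \<and>
    (AE t in lborel. t \<in> {T1<..<T2} \<longrightarrow>
      W12 (half_ball r) (weight a) (\<lambda>X. v (X, t)) (\<lambda>X. G (X, t)))"

section \<open>Traces and weak solutions\<close>

text \<open>The trace at \<open>y = 0\<close> is the continuous extension of the restriction operator: \<open>h\<close> is the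
  \<open>L\<^sup>2\<close>-limit of the restrictions of Sobolev functions that are continuous up to \<open>y = 0\<close> and converge
  to \<open>\<eta>\<close> in \<open>W\<^sup>1\<^sup>,\<^sup>2\<close>. Here \<open>H\<close> is the space-time gradient of \<open>\<eta>\<close>.\<close>

definition is_trace :: "real \<Rightarrow> real \<Rightarrow> real \<Rightarrow> real \<Rightarrow>
    (((real ^ 'n) \<times> real) \<times> real \<Rightarrow> real) \<Rightarrow>
    (((real ^ 'n) \<times> real) \<times> real \<Rightarrow> ((real ^ 'n) \<times> real) \<times> real) \<Rightarrow>
    ((real ^ 'n) \<times> real \<Rightarrow> real) \<Rightarrow> bool" where
  "is_trace a \<rho> T1 T2 \<eta> H h \<longleftrightarrow>
    L2_weighted (ball 0 \<rho> \<times> {T1<..<T2}) (\<lambda>_. 1) h \<and>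
    (\<exists>\<zeta> Z.
      (\<forall>k::nat. W12 (half_ball \<rho> \<times> {T1<..<T2}) (\<lambda>p. weight a (fst p)) (\<zeta> k) (Z k) \<and>
        continuous_on (half_ball0 \<rho> \<times> {T1<..<T2}) (\<zeta> k) \<and>
        L2_weighted (ball 0 \<rho> \<times> {T1<..<T2}) (\<lambda>_. 1) (\<lambda>(x, t). \<zeta> k ((x, 0), t))) \<and>
      (\<lambda>k. LINT p:half_ball \<rho> \<times> {T1<..<T2}|lborel.
          ((\<zeta> k p - \<eta> p)\<^sup>2 + (norm (Z k p - H p))\<^sup>2) * weight a (fst p)) \<longlonglongrightarrow> 0 \<and>
      (\<lambda>k. LINT (x, t):ball 0 \<rho> \<times> {T1<..<T2}|lborel. (\<zeta> k ((x, 0), t) - h (x, t))\<^sup>2) \<longlonglongrightarrow> 0)"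

text \<open>Weak solutions of \<open>div(y\<^sup>a \<nabla>v) = y\<^sup>a v\<^sub>t\<close> with \<open>lim y\<^sup>a v\<^sub>y = g\<close> as \<open>y \<rightarrow> 0\<close>. The components
  \<open>fst (H p)\<close> and \<open>snd (H p)\<close> are \<open>\<nabla>\<eta>\<close> and \<open>\<eta>\<^sub>t\<close>; \<open>h\<close> is the trace of \<open>\<eta>\<close>. The
  exceptional null set of pairs \<open>(t1, t2)\<close> may depend on \<open>\<eta>\<close>.\<close>

definition weak_solution :: "real \<Rightarrow> real \<Rightarrow> real \<Rightarrow> real \<Rightarrow>
    ((real ^ 'n) \<times> real \<Rightarrow> real) \<Rightarrow> (((real ^ 'n) \<times> real) \<times> real \<Rightarrow> real) \<Rightarrow> bool" where
  "weak_solution a \<rho> T1 T2 g v \<longleftrightarrow> (\<exists>G. in_V a \<rho> T1 T2 v G \<and>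
    (\<forall>\<eta> H h.
      W12 (half_ball \<rho> \<times> {T1<..<T2}) (\<lambda>p. weight a (fst p)) \<eta> H \<longrightarrow>
      (\<exists>K. compact K \<and> K \<subseteq> half_ball0 \<rho> \<times> {T1..T2} \<and>
        (AE p in lborel. p \<in> half_ball \<rho> \<times> {T1<..<T2} - K \<longrightarrow> \<eta> p = 0)) \<longrightarrow>
      is_trace a \<rho> T1 T2 \<eta> H h \<longrightarrow>
      (AE (t1, t2) in lborel. T1 < t1 \<and> t1 < t2 \<and> t2 < T2 \<longrightarrow>
        (LINT p:half_ball \<rho> \<times> {t1<..<t2}|lborel. (G p \<bullet> fst (H p)) * weight a (fst p)) =
          (LINT p:half_ball \<rho> \<times> {t1<..<t2}|lborel. weight a (fst p) * snd (H p) * v p)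
          - (LINT X:half_ball \<rho>|lborel. \<eta> (X, t2) * v (X, t2) * weight a X)
          + (LINT X:half_ball \<rho>|lborel. \<eta> (X, t1) * v (X, t1) * weight a X)
          - (LINT q:ball 0 \<rho> \<times> {t1<..<t2}|lborel. g q * h q))))"

section \<open>Parabolic Hoelder spaces\<close>

definition parabolic_holder ::
  "real \<Rightarrow> ('a::real_normed_vector \<times> real) set \<Rightarrow> ('a \<times> real \<Rightarrow> real) \<Rightarrow> bool" where
  "parabolic_holder \<alpha> \<Omega> f \<longleftrightarrow> bounded (f ` \<Omega>) \<and>
    (\<exists>C. \<forall>(X, t)\<in>\<Omega>. \<forall>(X', t')\<in>\<Omega>.
      \<bar>f (X, t) - f (X', t')\<bar> \<le> C * (norm (X - X') + \<bar>t - t'\<bar> powr (1/2)) powr \<alpha>)"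

text \<open>A function on the half cylinder that is Hoelder up to \<open>y = 0\<close>: it has an extension to
  \<open>y = 0\<close> that is Hoelder there as well.\<close>

definition holder_up_to_bottom ::
  "real \<Rightarrow> real \<Rightarrow> (((real ^ 'n) \<times> real) \<times> real \<Rightarrow> real) \<Rightarrow> bool" where
  "holder_up_to_bottom \<alpha> r f \<longleftrightarrow>
    (\<exists>F. parabolic_holder \<alpha> (half_ball0 r \<times> {- r\<^sup>2<..0}) F \<and>
      (\<forall>p\<in>half_ball r \<times> {- r\<^sup>2<..0}. F p = f p))"

end

theory Submission
 imports Defs
begin

text \<open>With \<open>c = (1 + a) / 2\<close>, \<open>m = n / 2 + c\<close> and \<open>l = 1 / (4 (t - \<tau>))\<close>, the parabolic equation in the half space with
 zero flux at \<open>y = 0\<close> has the fundamental solution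
 \<open>l\<^sup>m exp (- l (|x - \<xi>|\<^sup>2 + y\<^sup>2 + z\<^sup>2)) 0F1 (c; l\<^sup>2 y\<^sup>2 z\<^sup>2)\<close>. Tested with this kernel, cut off in space-time and near its
 pole, the weak equation yields in the limit \<open>\<kappa> v = w1 + w2\<close> almost everywhere in the smaller cylinder. Here \<open>w1\<close> integrates
 kernels away from their pole; they are smooth and even in \<open>y\<close>, so that \<open>y\<^sup>a D\<^sub>y w1\<close> is \<open>y\<^bsup>1 + a\<^esup>\<close> times a Lipschitz
 function. The boundary potential \<open>w2\<close> of the truncated flux \<open>f\<close> is a convolution in \<open>(x, t)\<close>, hence its derivatives in
 \<open>x\<close> and \<open>t\<close> are the potentials of those of \<open>f\<close>, and potentials of bounded densities are Hoelder continuous. Scaling turns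
 \<open>y\<^sup>a D\<^sub>y w2\<close> into a Gaussian average of \<open>f\<close> itself, Hoelder continuous because \<open>f\<close> is Lipschitz for \<open>t \<le> 0\<close>.\<close>

text \<open>A weak solution has no point values, and its identity holds for almost every pair of
  times, with a null set that depends on the test function. Hence every test function vanishes near
  both ends of the time interval, where the terms at \<open>t1\<close> and \<open>t2\<close> drop
  out, and \<open>cut_pole\<close> removes the pole. This cutoff leaves behind an average of
  \<open>v\<close> over time differences in \<open>[e, 2 e]\<close>, which is not controlled at a
  fixed pole. It is integrated against a continuous function of the pole; there the mass of the
  kernel, the same for every point, gives the limit as \<open>e\<close> tends to 0. The derivatives
  of the other cutoffs live away from the pole, where the kernel vanishes rapidly as the time
  difference tends to 0, so those integrals are differentiable up to the final time. For a source at
  the bottom the kernel is a Gaussian whose horizontal integral is at most a multiple of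
  \<open>\<sigma>\<close> to the power \<open>- c\<close>, with \<open>\<sigma>\<close> the time
  difference. This is integrable because \<open>c = 1 - s < 1\<close>. A Hoelder exponent
  \<open>\<alpha>\<close> raises \<open>c\<close> to \<open>c + \<alpha> / 2\<close>, and the
  vertical derivative asks for \<open>\<alpha> < c\<close>; this fixes the exponent.\<close>

lemmas
 integrable_add = Bochner_Integration.integrable_add and
 integrable_bound = Bochner_Integration.integrable_bound and
 integrable_cong = Bochner_Integration.integrable_cong and
 integrable_diff = Bochner_Integration.integrable_diff and
 integral_add = Bochner_Integration.integral_add and
 integral_cong = Bochner_Integration.integral_cong and
 integral_diff = Bochner_Integration.integral_diff and
 integral_mono = Bochner_Integration.integral_mono and
 integral_nonneg = Bochner_Integration.integral_nonneg and
 integral_norm_bound_integral = Bochner_Integration.integral_norm_bound_integral and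
 integral_sum = Bochner_Integration.integral_sum

type_synonym 'n space = "(real ^ 'n) \<times> real"
type_synonym 'n event = "'n space \<times> real"

abbreviation open_cyl :: "real => 'n::finite event set" where
 "open_cyl r == half_ball r \<times> {- r\<^sup>2<..0}"

abbreviation big_cyl :: "real => 'n::finite event set" where
 "big_cyl r == half_ball (2 * r) \<times> {- 4 * r^2<..<0}"

section \<open>Integrals depending on a parameter\<close>

text \<open>The mean value inequality on the convex set \<open>S\<close> bounds every difference
  quotient by \<open>B\<close>, so dominated convergence applies. The derivative is relative to
  \<open>S\<close> because time derivatives at \<open>t = 0\<close> are one-sided.\<close>

lemma has_real_derivative_integral:
 fixes F :: "real => 'q => real"
 assumes S: "convex S" "x \<in> S"
  and der: "!!h q. h \<in> S ==> q \<in> space M ==> ((%h. F h q) has_real_derivative F' h q) (at h within S)"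
  and int: "!!h. h \<in> S ==> integrable M (F h)"
  and meas: "F' x \<in> borel_measurable M"
  and B: "integrable M B" "!!h q. h \<in> S ==> q \<in> space M ==> \<bar>F' h q\<bar> <= B q"
 shows "((%h. LINT q|M. F h q) has_real_derivative (LINT q|M. F' x q)) (at x within S)" unfolding has_field_derivative_iff tendsto_at_iff_sequentially
proof (intro allI impI)
 fix X :: "nat => real"
 assume X: "\<forall>i. X i \<in> S - {x}" "X \<longlonglongrightarrow> x"
 define D where "D i q = (F (X i) q - F x q) / (X i - x)" for i q
 have "(%i. LINT q|M. D i q) \<longlonglongrightarrow> (LINT q|M. F' x q)"
 proof (rule integral_dominated_convergence)
  show "D i \<in> borel_measurable M" for i unfolding D_def using X int S(2) by (intro borel_measurable_divide borel_measurable_diff) auto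
  show "AE q in M. (%i. D i q) \<longlonglongrightarrow> F' x q" (is "AE q in _. ?P q")
  proof (rule AE_I2)
   fix q assume q: "q \<in> space M"
   have "((%h. (F h q - F x q) / (h - x)) \<longlongrightarrow> F' x q) (at x within S)" using der[OF S(2) q] unfolding has_field_derivative_iff .
   then show "?P q" using X unfolding tendsto_at_iff_sequentially D_def comp_def by blast
  qed
  show "AE q in M. norm (D i q) <= B q" (is "AE q in _. ?P q") for i
  proof (rule AE_I2)
   fix q assume q: "q \<in> space M"
   have "norm (F (X i) q - F x q) <= B q * norm (X i - x)" using der[OF _ q] B(2)[OF _ q] S X by (intro field_differentiable_bound[of S]) auto
   moreover have "norm (X i - x) > 0" using X by auto
   ultimately show "?P q" unfolding D_def by (simp add: norm_divide divide_le_eq)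
  qed
 qed (use meas B in auto)
 moreover have "(LINT q|M. D i q) = ((LINT q|M. F (X i) q) - (LINT q|M. F x q)) / (X i - x)" for i unfolding D_def using X int[of "X i"] int[OF S(2)] by simp
 ultimately show "((%h. ((LINT q|M. F h q) - (LINT q|M. F x q)) / (h - x)) \<circ> X) \<longlonglongrightarrow> (LINT q|M. F' x q)" by (simp add: comp_def)
qed

lemma continuous_on_integral:
 fixes F :: "'a::metric_space => 'q => real"
 assumes cont: "!!q. q \<in> space M ==> continuous_on S (%p. F p q)"
  and meas: "!!p. p \<in> S ==> F p \<in> borel_measurable M"
  and B: "integrable M B" "!!p q. p \<in> S ==> q \<in> space M ==> \<bar>F p q\<bar> <= B q"
 shows "continuous_on S (%p. LINT q|M. F p q)" unfolding continuous_on_sequentially comp_def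
proof (intro allI ballI impI)
 fix X p assume p: "p \<in> S" and X: "(\<forall>n. X n \<in> S) \<and> X \<longlonglongrightarrow> p"
 show "(%n. LINT q|M. F (X n) q) \<longlonglongrightarrow> (LINT q|M. F p q)"
 proof (rule integral_dominated_convergence)
  show "AE q in M. (%n. F (X n) q) \<longlonglongrightarrow> F p q" using cont p X unfolding continuous_on_sequentially comp_def by (intro AE_I2) blast
 qed (use meas B p X in auto)
qed

section \<open>Bump functions and mollification\<close>

lemma has_partial_on_UNIV:
 "has_partial_on UNIV f b g \<longleftrightarrow> (\<forall>p. ((%h. f (p + h *\<^sub>R b)) has_real_derivative g p) (at 0))" by (simp add: has_partial_on_def)

lemma C_bounded_SucD: "C_bounded (Suc k) S f ==> C_bounded k S f"
proof (induction k arbitrary: f)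
 case (Suc k)
 then show ?case by (fastforce intro: Suc.IH)
qed auto

lemma C_bounded_continuous_bounded: "C_bounded k S f ==> continuous_on S f \<and> bounded (f ` S)" by (cases k) auto

lemma C_bounded_const: "C_bounded k S (%_. c)"
proof (induction k arbitrary: c)
 case (Suc k)
 have "has_partial_on S (%_. c) b (%_. 0)" for b by (simp add: has_partial_on_def)
 then show ?case using Suc by (auto simp: image_constant_conv)
qed (auto simp: image_constant_conv)

lemma bounded_mult_image:
 fixes f g :: "'a => real"
 assumes "bounded (f ` S)" "bounded (g ` S)"
 shows "bounded ((%x. f x * g x) ` S)"
proof -
 from assms obtain a b where "\<forall>x\<in>S. \<bar>f x\<bar> <= a" "\<forall>x\<in>S. \<bar>g x\<bar> <= b" by (auto simp: bounded_real)
 then have "\<forall>x\<in>S. \<bar>f x * g x\<bar> <= a * b" by (auto simp: abs_mult intro!: mult_mono intro: order_trans[OF abs_ge_zero])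
 then show ?thesis by (auto simp: bounded_real)
qed

lemma C_bounded_add:
 "C_bounded k S f ==> C_bounded k S g ==> C_bounded k S (%x. f x + g x)"
proof (induction k arbitrary: f g)
 case (Suc k)
 have "\<exists>h. has_partial_on S (%x. f x + g x) b h \<and> C_bounded k S h" if b: "b \<in> Basis" for b
 proof -
  obtain f' where "has_partial_on S f b f'" "C_bounded k S f'" using Suc.prems(1) b by auto
  moreover obtain g' where "has_partial_on S g b g'" "C_bounded k S g'" using Suc.prems(2) b by auto
  ultimately have "has_partial_on S (%x. f x + g x) b (%x. f' x + g' x)" "C_bounded k S (%x. f' x + g' x)" using Suc.IH by (auto simp: has_partial_on_def intro!: DERIV_add)
  then show ?thesis by blast
 qed
 then show ?case using Suc.prems by (auto intro: continuous_on_add bounded_plus_comp)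
qed (auto intro: continuous_on_add bounded_plus_comp)

lemma has_partial_on_mult:
 assumes "has_partial_on S f b f'" "has_partial_on S g b g'"
 shows "has_partial_on S (%x. f x * g x) b (%x. f' x * g x + f x * g' x)" unfolding has_partial_on_def
proof
 fix p assume "p \<in> S"
 with assms show "((%h. f (p + h *\<^sub>R b) * g (p + h *\<^sub>R b)) has_real_derivative f' p * g p + f p * g' p)
   (at 0 within {h. p + h *\<^sub>R b \<in> S})" unfolding has_partial_on_def by (auto intro!: derivative_eq_intros)
qed

lemma C_bounded_mult:
 "C_bounded k S f ==> C_bounded k S g ==> C_bounded k S (%x. f x * g x)"
proof (induction k arbitrary: f g)
 case (Suc k)
 have "\<exists>h. has_partial_on S (%x. f x * g x) b h \<and> C_bounded k S h" if b: "b \<in> Basis" for b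
 proof -
  obtain f' where f: "has_partial_on S f b f'" "C_bounded k S f'" using Suc.prems(1) b by auto
  obtain g' where g: "has_partial_on S g b g'" "C_bounded k S g'" using Suc.prems(2) b by auto
  have "C_bounded k S (%x. f' x * g x + f x * g' x)" by (intro C_bounded_add Suc.IH f g C_bounded_SucD[OF Suc.prems(1)] C_bounded_SucD[OF Suc.prems(2)])
  then show ?thesis using has_partial_on_mult f g by blast
 qed
 then show ?case using Suc.prems by (auto intro: continuous_on_mult bounded_mult_image)
qed (auto intro: continuous_on_mult bounded_mult_image)

lemma C_bounded_prod:
 "finite I ==> (!!i. i \<in> I ==> C_bounded k S (f i)) ==> C_bounded k S (%x. \<Prod>i\<in>I. f i x)"
 by (induction I rule: finite_induct) (auto intro: C_bounded_const C_bounded_mult)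

section \<open>Smooth bumps built from exp (- 1 / t)\<close>

definition flat :: "real poly => real => real" where
 "flat p t = (if t > 0 then poly p (1 / t) * exp (- (1 / t)) else 0)"

lemma poly_exp_bounded: "\<exists>C\<ge>0. \<forall>u\<ge>0. \<bar>poly p u\<bar> * exp (- u) <= (C::real)"
proof (induction p)
 case (pCons c p)
 have mono: "\<exists>C\<ge>0. \<forall>u\<ge>0. \<bar>u * poly p u\<bar> * exp (- u) <= (C::real)"
 proof -
  have lim: "((%u. \<bar>u * poly p u\<bar> * exp (- u)) \<longlongrightarrow> 0) at_top"
  proof -
   have "((%u. poly q u / exp u) \<longlongrightarrow> 0) at_top" for q :: "real poly"
   proof -
    have "((%u. \<Sum>i\<le>degree q. coeff q i * (u ^ i / exp u)) \<longlongrightarrow> (\<Sum>i\<le>degree q. coeff q i * 0)) at_top"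
     by (intro tendsto_sum tendsto_mult tendsto_const tendsto_power_div_exp_0)
    moreover have "(\<Sum>i\<le>degree q. coeff q i * (u ^ i / exp u)) = poly q u / exp u" for u unfolding poly_altdef sum_divide_distrib by simp
    ultimately show ?thesis by simp
   qed
   from tendsto_rabs[OF this[of "pCons 0 p"]] show ?thesis by (simp add: exp_minus divide_inverse abs_mult)
  qed
  then have "eventually (%u. \<bar>u * poly p u\<bar> * exp (- u) < 1) at_top" by (rule order_tendstoD) simp
  then obtain N where N: "!!u. u >= N ==> \<bar>u * poly p u\<bar> * exp (- u) < 1" by (auto simp: eventually_at_top_linorder)
  have "compact ((%u. \<bar>u * poly p u\<bar> * exp (- u)) ` {0..N})" by (intro compact_continuous_image continuous_intros) auto
  from compact_imp_bounded[OF this] obtain C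
   where "\<forall>x\<in>(%u. \<bar>u * poly p u\<bar> * exp (- u)) ` {0..N}. \<bar>x\<bar> <= C" unfolding bounded_real by (elim exE)
  then have C: "\<bar>\<bar>u * poly p u\<bar> * exp (- u)\<bar> <= C" if "u \<in> {0..N}" for u using that by blast
  show ?thesis
  proof (intro exI[of _ "max C 1"] conjI allI impI)
   fix u :: real assume "u >= 0"
   then show "\<bar>u * poly p u\<bar> * exp (- u) <= max C 1" using C[of u] N[of u] by (cases "u >= N") auto
  qed simp
 qed
 then obtain C where C: "C >= 0" "!!u. u >= 0 ==> \<bar>u * poly p u\<bar> * exp (- u) <= C" by blast
 show ?case
 proof (intro exI[of _ "\<bar>c\<bar> + C"] conjI allI impI)
  fix u :: real assume u: "u >= 0"
  have "\<bar>poly (pCons c p) u\<bar> * exp (- u) <= (\<bar>c\<bar> + \<bar>u * poly p u\<bar>) * exp (- u)" by (intro mult_right_mono) auto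
  also have "... <= \<bar>c\<bar> * 1 + C" unfolding distrib_right using u C by (intro add_mono mult_left_mono) auto
  finally show "\<bar>poly (pCons c p) u\<bar> * exp (- u) <= \<bar>c\<bar> + C" by simp
 qed (use C in simp)
qed auto

lemma flat_bounded: "\<exists>C\<ge>0. \<forall>t. \<bar>flat p t\<bar> <= C"
proof -
 obtain C where C: "C >= 0" "!!u. u >= 0 ==> \<bar>poly p u\<bar> * exp (- u) <= C" using poly_exp_bounded by blast
 have "\<bar>flat p t\<bar> <= C" for t using C(1) C(2)[of "1 / t"] by (auto simp: flat_def abs_mult)
 then show ?thesis using C by auto
qed

text \<open>Polynomials in \<open>1 / t\<close> times \<open>exp (- 1 / t)\<close> are closed under
  differentiation; the inner derivative of \<open>1 / t\<close> accounts for the factor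
  \<open>[:0, 0, 1:]\<close>. Carrying the polynomial as a parameter makes smoothness a plain
  induction.\<close>

definition flat_deriv :: "real poly => real poly" where
 "flat_deriv p = [:0, 0, 1:] * (p - pderiv p)"

lemma flat_has_derivative: "(flat p has_real_derivative flat (flat_deriv p) t) (at t)"
proof -
 consider "t > 0" | "t < 0" | "t = 0" by linarith
 then show ?thesis
 proof cases
  case 1
  have inv: "((%t. 1 / t) has_real_derivative - (1 / t^2)) (at t)" using 1 by (auto intro!: derivative_eq_intros simp: power2_eq_square)
  have "((%t. poly p (1 / t) * exp (- (1 / t))) has_real_derivative
    poly (pderiv p) (1 / t) * - (1 / t^2) * exp (- (1 / t)) + exp (- (1 / t)) * - (- (1 / t^2)) * poly p (1 / t)) (at t)"
   by (intro DERIV_mult DERIV_chain2[OF poly_DERIV inv] DERIV_fun_exp DERIV_minus inv)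
  moreover have "poly (pderiv p) (1 / t) * - (1 / t^2) * exp (- (1 / t)) + exp (- (1 / t)) * - (- (1 / t^2)) * poly p (1 / t)
    = flat (flat_deriv p) t" using 1 by (simp add: flat_def flat_deriv_def algebra_simps power2_eq_square)
  ultimately have "((%t. poly p (1 / t) * exp (- (1 / t))) has_real_derivative flat (flat_deriv p) t) (at t)" by simp
  then show ?thesis by (rule has_field_derivative_transform_within_open[of _ _ _ "{0<..}"]) (use 1 in \<open>auto simp: flat_def\<close>)
 next
  case 2
  have "((%t. 0) has_real_derivative flat (flat_deriv p) t) (at t)" using 2 by (simp add: flat_def)
  then show ?thesis by (rule has_field_derivative_transform_within_open[of _ _ _ "{..<0}"]) (use 2 in \<open>auto simp: flat_def\<close>)
 next
  case 3
  obtain C where C: "!!t. \<bar>flat (pCons 0 (pCons 0 p)) t\<bar> <= C" using flat_bounded by blast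
  \<comment> \<open>Division by \<open>h\<close> is absorbed by two further powers of
    \<open>1 / h\<close>, so the difference quotient at 0 is \<open>h\<close> times a bounded
    function.\<close>
  have eq: "flat p h / h = h * flat (pCons 0 (pCons 0 p)) h" for h by (auto simp: flat_def field_simps)
  have "((%h. h * flat (pCons 0 (pCons 0 p)) h) \<longlongrightarrow> 0) (at 0)"
  proof (rule Lim_null_comparison)
   show "eventually (%h. norm (h * flat (pCons 0 (pCons 0 p)) h) <= \<bar>h\<bar> * C) (at 0)" using C by (auto intro!: always_eventually mult_left_mono simp: abs_mult)
   show "((%h::real. \<bar>h\<bar> * C) \<longlongrightarrow> 0) (at 0)" by (auto intro!: tendsto_eq_intros)
  qed
  then have "((%h. flat p h / h) \<longlongrightarrow> 0) (at 0)" unfolding eq .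
  then show ?thesis using 3 by (simp add: has_field_derivative_iff flat_def[of _ 0])
 qed
qed

lemma C_bounded_flat:
 fixes u :: "'a::euclidean_space"
 shows "C_bounded k UNIV (%x. flat p (c + x \<bullet> u))"
proof (induction k arbitrary: p)
 have cont: "continuous_on UNIV (flat p)" for p by (rule continuous_at_imp_continuous_on, intro ballI, rule DERIV_isCont[OF flat_has_derivative])
 have 1: "continuous_on UNIV (%x. flat p (c + x \<bullet> u))" for p by (rule continuous_on_compose2[OF cont]) (auto intro!: continuous_intros)
 have 2: "bounded (range (%x. flat p (c + x \<bullet> u)))" for p using flat_bounded[of p] by (auto simp: bounded_real)
 {
  case 0
  show ?case using 1 2 by simp
 next
  case (Suc k)
  have "has_partial_on UNIV (%x. flat p (c + x \<bullet> u)) b (%x. (b \<bullet> u) * flat (flat_deriv p) (c + x \<bullet> u))" for b unfolding has_partial_on_UNIV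
  proof
   fix q
   have "((%h. flat p (c + (q + h *\<^sub>R b) \<bullet> u)) has_real_derivative
     flat (flat_deriv p) (c + (q + 0 *\<^sub>R b) \<bullet> u) * (b \<bullet> u)) (at 0)"
    by (rule DERIV_chain2[OF flat_has_derivative]) (auto intro!: derivative_eq_intros simp: inner_add_left)
   then show "((%h. flat p (c + (q + h *\<^sub>R b) \<bullet> u)) has_real_derivative
     b \<bullet> u * flat (flat_deriv p) (c + q \<bullet> u)) (at 0)" by (simp add: mult.commute)
  qed
  moreover have "C_bounded k UNIV (%x. (b \<bullet> u) * flat (flat_deriv p) (c + x \<bullet> u))" for b by (intro C_bounded_mult C_bounded_const Suc)
  ultimately show ?case using 1 2 by (metis C_bounded.simps(2))
 }
qed

text \<open>A product over the coordinates instead of a radial function: each factor is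
  \<open>flat\<close> of an affine function, so \<open>C_bounded_flat\<close> applies directly. The
  support is a cube of half side \<open>d\<close>.\<close>

definition bump :: "real => 'a::euclidean_space => real" where
 "bump d x = (\<Prod>b\<in>Basis. flat 1 (d + x \<bullet> b) * flat 1 (d + x \<bullet> (- b)))"

lemma C_bounded_bump: "C_bounded k UNIV (bump d :: 'a::euclidean_space => real)" unfolding bump_def by (intro C_bounded_prod finite_Basis C_bounded_mult C_bounded_flat)

lemma bump_nonneg: "bump d x >= 0" unfolding bump_def by (intro prod_nonneg) (auto simp: flat_def)

lemma bump_pos: "d > 0 ==> bump d 0 > 0" unfolding bump_def by (intro prod_pos) (auto simp: flat_def)

lemma bump_eq_0:
 fixes x :: "'a::euclidean_space" and d :: real
 assumes "norm x >= d * DIM('a)"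
 shows "bump d x = 0"
proof (rule ccontr)
 assume "bump d x ~= 0"
 then have nz: "flat 1 (d + x \<bullet> b) ~= 0" "flat 1 (d + x \<bullet> (- b)) ~= 0" if "b \<in> Basis" for b
  unfolding bump_def using that prod_zero_iff[OF finite_Basis] by auto
 have *: "\<bar>x \<bullet> b\<bar> < d" if "b \<in> Basis" for b using nz[OF that] unfolding flat_def by (simp split: if_splits)
 have "norm x <= (\<Sum>b\<in>Basis. \<bar>x \<bullet> b\<bar>)" by (rule norm_le_l1)
 also have "... < (\<Sum>b\<in>(Basis::'a set). d)" using * by (intro sum_strict_mono) auto
 finally have "norm x < DIM('a) * d" by simp
 then show False using assms by (simp add: mult.commute)
qed

text \<open>The norm is at most the sum of the coordinates, so the cube of half side
  \<open>d / DIM('a)\<close> lies in the ball of radius \<open>d\<close>.\<close>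

definition mollifier :: "real => 'a::euclidean_space => real" where
 "mollifier d x = bump (d / DIM('a)) x / (LINT x|lborel. bump (d / DIM('a)) (x::'a))"

lemma mollifier:
 fixes d :: real
 assumes d: "d > 0"
 shows "C_bounded k UNIV (mollifier d :: 'a::euclidean_space => real)"
  "mollifier d (x::'a) >= 0" "norm x >= d ==> mollifier d x = 0"
  "integrable lborel (mollifier d :: 'a => real)" "(LINT x|lborel. mollifier d (x::'a)) = 1"
proof -
 define e where "e = d / DIM('a)"
 have e: "e > 0" using d by (simp add: e_def)
 define I where "I = (LINT x|lborel. bump e (x::'a))"
 have m: "mollifier d = (%x::'a. inverse I * bump e x)" by (auto simp: mollifier_def e_def I_def field_simps)
 show "C_bounded k UNIV (mollifier d :: 'a => real)" unfolding m by (intro C_bounded_mult C_bounded_const C_bounded_bump)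
 have cont: "continuous_on UNIV (bump e :: 'a => real)" using C_bounded_continuous_bounded C_bounded_bump by blast
 have out: "bump e x = 0" if "norm x >= d" for x :: 'a using bump_eq_0[of e x] that by (simp add: e_def)
 then have ind: "bump e = (%x::'a. indicator (cball 0 d) x *\<^sub>R bump e x)" by (auto simp: indicator_def fun_eq_iff)
 have int: "integrable lborel (bump e :: 'a => real)" by (subst ind, rule borel_integrable_compact) (auto intro: continuous_on_subset[OF cont])
 have "I >= 0" unfolding I_def by (simp add: bump_nonneg)
 moreover have "I ~= 0"
 proof
  assume "I = 0"
  then have "AE x in lborel. bump e (x::'a) = 0" using integral_nonneg_eq_0_iff_AE[OF int] bump_nonneg by (auto simp: I_def)
  then have "{x::'a. bump e x ~= 0} \<in> null_sets lborel"
   by (intro AE_iff_null_sets[THEN iffD2]) (auto intro!: borel_open open_Collect_neq[OF cont] simp: continuous_on_const)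
  then have "negligible {x::'a. bump e x ~= 0}" by (simp add: negligible_iff_null_sets null_sets_completionI)
  moreover have "open {x::'a. bump e x ~= 0}" using open_Collect_neq[OF cont continuous_on_const] by simp
  ultimately have "{x::'a. bump e x ~= 0} = {}" using open_not_negligible by blast
  then show False using bump_pos[OF e, where 'a='a] by auto
 qed
 ultimately have I: "I > 0" by simp
 show "mollifier d x >= 0" unfolding m using I bump_nonneg[of e x] by simp
 show "norm x >= d ==> mollifier d x = 0" unfolding m using out by simp
 show "integrable lborel (mollifier d :: 'a => real)" unfolding m using int by simp
 show "(LINT x|lborel. mollifier d (x::'a)) = 1" unfolding m using I by (simp add: I_def)
qed

lemma continuous_compact_support_bounded:
 fixes f :: "'a::euclidean_space => real"
 assumes "continuous_on UNIV f" "compact K" "!!x. x \<notin> K ==> f x = 0"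
 obtains C where "C >= 0" "!!x. \<bar>f x\<bar> <= C"
proof -
 have "bounded (f ` K)" using assms by (intro compact_imp_bounded compact_continuous_image) (auto intro: continuous_on_subset)
 then obtain C where C: "!!x. x \<in> K ==> \<bar>f x\<bar> <= C" unfolding bounded_real by blast
 have "\<bar>f x\<bar> <= \<bar>C\<bar>" for x using C[of x] assms(3)[of x] by (cases "x \<in> K") auto
 then show ?thesis by (intro that[of "\<bar>C\<bar>"]) auto
qed

lemma continuous_compact_support_integrable:
 fixes f :: "'a::euclidean_space => real"
 assumes "continuous_on UNIV f" "compact K" "!!x. x \<notin> K ==> f x = 0"
 shows "integrable lborel f"
proof -
 have eq: "f = (%x. indicator K x *\<^sub>R f x)" using assms(3) by (auto simp: indicator_def fun_eq_iff)
 show ?thesis by (subst eq, rule borel_integrable_compact[OF assms(2)]) (rule continuous_on_subset[OF assms(1)], simp)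
qed

lemma has_partial_on_zero_outside:
 assumes "has_partial_on UNIV P b P'" "closed K" "!!x. x \<notin> K ==> P x = 0" "x \<notin> K"
 shows "P' x = 0"
proof -
 have "open (- K)" using assms(2) by (rule open_Compl)
 then have "open ((%h::real. x + h *\<^sub>R b) -` (- K))" by (rule open_vimage) (intro continuous_intros)
 from has_field_derivative_transform_within_open[OF assms(1)[unfolded has_partial_on_UNIV, rule_format, of x] this, of "%_. 0"]
 have "((%h. 0) has_real_derivative P' x) (at 0)" using assms(3,4) by auto
 then show ?thesis using DERIV_unique DERIV_const by blast
qed

lemma lborel_integral_affine:
 fixes f :: "'a::euclidean_space => real"
 assumes "f \<in> borel_measurable borel" "c ~= 0"
 shows "(LINT x|lborel. f x) = \<bar>c\<bar> ^ DIM('a) * (LINT x|lborel. f (t + c *\<^sub>R x))"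
 using assms by (subst lborel_affine[of c t]) (simp_all add: integral_density integral_distr)

lemma lborel_integrable_affine:
 fixes f :: "'a::euclidean_space => real"
 assumes f: "integrable lborel f" "c ~= 0"
 shows "integrable lborel (%x. f (t + c *\<^sub>R x))"
proof -
 have [measurable]: "f \<in> borel_measurable borel" using borel_measurable_integrable[OF f(1)] by simp
 have "integrable (density (distr lborel borel (%x. t + c *\<^sub>R x)) (%_. \<bar>c\<bar> ^ DIM('a))) f" using f(1) lborel_affine[OF f(2), of t] by simp
 then show ?thesis using f(2) by (simp add: integrable_density integrable_distr_eq)
qed

lemma lborel_integral_translate:
 fixes f :: "'a::euclidean_space => real"
 assumes "f \<in> borel_measurable borel"
 shows "(LINT x|lborel. f (c + x)) = (LINT x|lborel. f x)" using lborel_integral_affine[OF assms, of 1 c] by simp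

lemma lborel_integral_reflect:
 fixes f :: "'a::euclidean_space => real"
 assumes "f \<in> borel_measurable borel"
 shows "(LINT x|lborel. f (c - x)) = (LINT x|lborel. f x)" using lborel_integral_affine[OF assms, of "-1" c] by simp

lemma integrable_translate:
 fixes f :: "'a::euclidean_space => real"
 assumes "integrable lborel f"
 shows "integrable lborel (%x. f (c + x))" using lborel_integrable_affine[OF assms, of 1 c] by simp

lemma integrable_indicator_bounded:
 fixes L :: "'a::euclidean_space set"
 assumes "bounded L" "L \<in> sets borel"
 shows "integrable lborel (%x. C * indicator L x :: real)" using assms emeasure_bounded_finite[OF assms(1)] by (intro integrable_mult_right integrable_real_indicator) auto

text \<open>The integral of a translate does not depend on the translation; differentiate in it.\<close>

lemma integral_partial_eq_0:
 fixes F :: "'a::euclidean_space => real"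
 assumes F: "continuous_on UNIV F" "has_partial_on UNIV F b F'" "continuous_on UNIV F'"
  and K: "compact K" "!!x. x \<notin> K ==> F x = 0"
 shows "(LINT x|lborel. F' x) = 0"
proof -
 have F'0: "F' x = 0" if "x \<notin> K" for x using has_partial_on_zero_outside[OF F(2) _ K(2)] that compact_imp_closed[OF K(1)] by blast
 obtain C where C: "C >= 0" "!!x. \<bar>F' x\<bar> <= C" using continuous_compact_support_bounded[OF F(3) K(1) F'0] by blast
 \<comment> \<open>The union of all translates of \<open>K\<close> by \<open>- h *\<^sub>R b\<close>
   with \<open>\<bar>h\<bar> \<le> 1\<close>. It carries one dominating function for all these
   \<open>h\<close>.\<close>
 define L where "L = (%(k, h::real). k - h *\<^sub>R b) ` (K \<times> {-1..1})"
 have L: "compact L" unfolding L_def by (intro compact_continuous_image compact_Times K(1)) (auto intro!: continuous_intros simp: case_prod_beta)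
 have inL: "x \<in> L" if "x + h *\<^sub>R b \<in> K" "h \<in> {-1..1}" for x h unfolding L_def using that by (intro image_eqI[of _ _ "(x + h *\<^sub>R b, h)"]) auto
 have der: "((%h. F (x + h *\<^sub>R b)) has_real_derivative F' (x + h *\<^sub>R b)) (at h within S)" for x h S
 proof -
  have "((%k. F (x + h *\<^sub>R b + k *\<^sub>R b)) has_real_derivative F' (x + h *\<^sub>R b)) (at 0)" using F(2) by (simp add: has_partial_on_UNIV)
  then have "((%k. F (x + h *\<^sub>R b + (k - h) *\<^sub>R b)) has_real_derivative F' (x + h *\<^sub>R b)) (at h)"
   using DERIV_shift[of "%k. F (x + h *\<^sub>R b + (k - h) *\<^sub>R b)" _ 0 h] by (simp add: add.commute)
  then show ?thesis by (auto simp: algebra_simps intro: has_field_derivative_at_within)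
 qed
 have intF: "integrable lborel F" using continuous_compact_support_integrable[OF F(1) K] .
 have "((%h. LINT x|lborel. F (x + h *\<^sub>R b)) has_real_derivative (LINT x|lborel. F' (x + 0 *\<^sub>R b))) (at 0 within {-1..1})"
 proof (rule has_real_derivative_integral[where B="%x. C * indicator L x"])
  show "integrable lborel (%x. F (x + h *\<^sub>R b))" for h using integrable_translate[OF intF, of "h *\<^sub>R b"] by (simp add: add.commute)
  show "(%x. F' (x + 0 *\<^sub>R b)) \<in> borel_measurable lborel" using F(3) by (simp add: borel_measurable_continuous_onI)
  show "integrable lborel (%x. C * indicator L x)" using L by (intro integrable_indicator_bounded compact_imp_bounded borel_closed compact_imp_closed)
  show "\<bar>F' (x + h *\<^sub>R b)\<bar> <= C * indicator L x" if "h \<in> {-1..1}" for x h using C F'0 inL[of x h] that by (cases "x \<in> L") auto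
 qed (use der in auto)
 moreover have "(LINT x|lborel. F (x + h *\<^sub>R b)) = (LINT x|lborel. F x)" for h
  using lborel_integral_translate[of F "h *\<^sub>R b"] F(1) by (simp add: add.commute borel_measurable_continuous_onI)
 ultimately have *: "((%h. LINT x|lborel. F x) has_real_derivative (LINT x|lborel. F' x)) (at 0 within {-1..1})" by simp
 have "at (0::real) within {-1..1} = at 0" by (intro at_within_Icc_at) auto
 with * show ?thesis using DERIV_unique DERIV_const by metis
qed

section \<open>Mollification\<close>

lemma C_bounded_convolution:
 fixes f \<rho> :: "'a::euclidean_space => real"
 assumes f: "integrable lborel f" and \<rho>: "C_bounded k UNIV \<rho>"
 shows "C_bounded k UNIV (%x. LINT y|lborel. f y * \<rho> (x - y))" using \<rho>
proof (induction k arbitrary: \<rho>)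
 have base: "continuous_on UNIV (%x. LINT y|lborel. f y * \<rho> (x - y)) \<and> bounded (range (%x. LINT y|lborel. f y * \<rho> (x - y)))"
  if \<rho>: "continuous_on UNIV \<rho>" "bounded (range \<rho>)" for \<rho> :: "'a => real"
 proof -
  obtain C where C: "!!x. \<bar>\<rho> x\<bar> <= C" using \<rho>(2) unfolding bounded_real by blast
  have le: "\<bar>f y * \<rho> (x - y)\<bar> <= \<bar>f y\<bar> * C" for x y unfolding abs_mult by (intro mult_left_mono C) auto
  have "(%y. \<rho> (x - y)) \<in> borel_measurable borel" for x by (intro borel_measurable_continuous_onI continuous_on_compose2[OF \<rho>(1)] continuous_intros) auto
  then have m: "(%y. f y * \<rho> (x - y)) \<in> borel_measurable lborel" for x using borel_measurable_integrable[OF f] by simp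
  have i: "integrable lborel (%y. \<bar>f y\<bar> * C)" using f by auto
  have "continuous_on UNIV (%x. LINT y|lborel. f y * \<rho> (x - y))" by (rule continuous_on_integral[OF _ _ i])
    (use m le in \<open>auto intro!: continuous_intros continuous_on_compose2[OF \<rho>(1)]\<close>)
  moreover have "\<bar>LINT y|lborel. f y * \<rho> (x - y)\<bar> <= (LINT y|lborel. \<bar>f y\<bar> * C)" for x
  proof (rule integral_abs_bound_integral[OF _ i])
   show "integrable lborel (%y. f y * \<rho> (x - y))" using le by (intro integrable_bound[OF i m] AE_I2) (metis abs_ge_self order_trans real_norm_def)
  qed (use le in simp)
  ultimately show ?thesis by (auto simp: bounded_real)
 qed
 {
  case 0
  then show ?case using base by simp
 next
  case (Suc k)
  have "\<exists>g. has_partial_on UNIV (%x. LINT y|lborel. f y * \<rho> (x - y)) b g \<and> C_bounded k UNIV g" if b: "b \<in> Basis" for b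
  proof -
   \<comment> \<open>All derivatives fall on \<open>\<rho>\<close>, so integrability of
     \<open>f\<close> is enough; the induction hypothesis is applied to
     \<open>\<rho>'\<close>.\<close>
   obtain \<rho>' where \<rho>': "has_partial_on UNIV \<rho> b \<rho>'" "C_bounded k UNIV \<rho>'" using Suc.prems b by auto
   have cont: "continuous_on UNIV \<rho>" and bd: "bounded (range \<rho>)"
    and cont': "continuous_on UNIV \<rho>'" and bd': "bounded (range \<rho>')" using C_bounded_continuous_bounded Suc.prems \<rho>'(2) by blast+
   obtain C where C: "!!x. \<bar>\<rho> x\<bar> <= C" using bd unfolding bounded_real by blast
   obtain C' where C': "!!x. \<bar>\<rho>' x\<bar> <= C'" using bd' unfolding bounded_real by blast
   have "(%y. \<rho> (x - y)) \<in> borel_measurable borel" "(%y. \<rho>' (x - y)) \<in> borel_measurable borel" for x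
    by (intro borel_measurable_continuous_onI continuous_on_compose2[OF cont] continuous_on_compose2[OF cont'] continuous_intros; simp)+
   then have m: "(%y. f y * \<rho> (x - y)) \<in> borel_measurable lborel" "(%y. f y * \<rho>' (x - y)) \<in> borel_measurable lborel" for x
    using borel_measurable_integrable[OF f] by simp_all
   have "((%h. LINT y|lborel. f y * \<rho> (x + h *\<^sub>R b - y)) has_real_derivative (LINT y|lborel. f y * \<rho>' (x + 0 *\<^sub>R b - y))) (at 0 within UNIV)" for x
   proof (rule has_real_derivative_integral[where B="%y. \<bar>f y\<bar> * C'"])
    show "integrable lborel (%y. f y * \<rho> (x + h *\<^sub>R b - y))" for h by (rule integrable_bound[of _ "%y. f y * C"])
      (use f m C in \<open>auto intro!: AE_I2 mult_left_mono simp: abs_mult intro: order_trans[OF _ abs_ge_self]\<close>)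
    show "\<bar>f y * \<rho>' (x + h *\<^sub>R b - y)\<bar> <= \<bar>f y\<bar> * C'" for h y unfolding abs_mult by (intro mult_left_mono C') auto
    have "((%k. \<rho> (x + h *\<^sub>R b - y + k *\<^sub>R b)) has_real_derivative \<rho>' (x + h *\<^sub>R b - y)) (at 0)" for h y
     using \<rho>'(1) by (simp add: has_partial_on_UNIV)
    then have "((%k. \<rho> (x + h *\<^sub>R b - y + (k - h) *\<^sub>R b)) has_real_derivative \<rho>' (x + h *\<^sub>R b - y)) (at h)" for h y
     using DERIV_shift[of "%k. \<rho> (x + h *\<^sub>R b - y + (k - h) *\<^sub>R b)" _ 0 h] by (simp add: add.commute)
    then show "((%h. f y * \<rho> (x + h *\<^sub>R b - y)) has_real_derivative f y * \<rho>' (x + h *\<^sub>R b - y)) (at h within UNIV)" for h y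
     by (intro DERIV_cmult) (simp add: algebra_simps)
   qed (use f m in auto)
   then have "has_partial_on UNIV (%x. LINT y|lborel. f y * \<rho> (x - y)) b (%x. LINT y|lborel. f y * \<rho>' (x - y))" by (simp add: has_partial_on_UNIV)
   then show ?thesis using Suc.IH[OF \<rho>'(2)] by blast
  qed
  moreover have "continuous_on UNIV \<rho>" "bounded (range \<rho>)" using Suc.prems by auto
  ultimately show ?case using base by simp
 }
qed

lemma mollify_eq:
 fixes P \<rho> :: "'a::euclidean_space => real"
 assumes "continuous_on UNIV P" "continuous_on UNIV \<rho>"
 shows "(LINT y|lborel. P y * \<rho> (x - y)) = (LINT y|lborel. P (x - y) * \<rho> y)"
proof -
 have "(%y. P y * \<rho> (x - y)) \<in> borel_measurable borel"
  by (intro borel_measurable_continuous_onI continuous_intros continuous_on_compose2[OF assms(1)] continuous_on_compose2[OF assms(2)]) auto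
 from lborel_integral_reflect[OF this, of x] show ?thesis by simp
qed

lemma mollify_tendsto:
 fixes P :: "'a::euclidean_space => real"
 assumes P: "continuous_on UNIV P"
  and d: "!!n. d n > 0" "d \<longlonglongrightarrow> 0"
 shows "(%n. LINT y|lborel. P y * mollifier (d n) (x - y)) \<longlonglongrightarrow> P x"
proof (rule LIMSEQ_I)
 fix e :: real assume e: "e > 0"
 have cm: "continuous_on UNIV (mollifier (d n) :: 'a => real)" for n using C_bounded_continuous_bounded[OF mollifier(1)[OF d(1)[of n]]] by blast
 have "isCont P x" using P by (simp add: continuous_on_eq_continuous_at)
 then obtain r where r: "r > 0" "!!z. norm (z - x) < r ==> \<bar>P z - P x\<bar> < e / 2"
  using e unfolding continuous_at_eps_delta dist_norm real_norm_def by (meson half_gt_zero)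
 obtain N where N: "!!n. n >= N ==> d n < r" using order_tendstoD(2)[OF d(2) r(1)] unfolding eventually_sequentially by blast
 show "\<exists>no. \<forall>n\<ge>no. norm ((LINT y|lborel. P y * mollifier (d n) (x - y)) - P x) < e"
 proof (intro exI allI impI)
  fix n assume n: "n >= N"
  let ?m = "mollifier (d n) :: 'a => real"
  have bnd: "\<bar>(P (x - y) - P x) * ?m y\<bar> <= e / 2 * ?m y" for y
  proof (cases "norm y < d n")
   case True
   then show ?thesis using r(2)[of "x - y"] N[OF n] mollifier(2)[OF d(1), of n y]
     mult_right_mono[of "\<bar>P (x - y) - P x\<bar>" "e / 2" "mollifier (d n) y"] by (simp add: abs_mult)
  next
   case False then show ?thesis using mollifier(3)[OF d(1)[of n], of y] by simp
  qed
  have im: "integrable lborel (%y. e / 2 * ?m y)" using mollifier(4)[OF d(1)] by (intro integrable_mult_right)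
  have i1: "integrable lborel (%y. (P (x - y) - P x) * ?m y)"
  proof (rule integrable_bound[OF im])
   show "(%y. (P (x - y) - P x) * ?m y) \<in> borel_measurable lborel" unfolding measurable_lborel2
    by (intro borel_measurable_continuous_onI continuous_intros continuous_on_compose2[OF P] cm) auto
   show "AE y in lborel. norm ((P (x - y) - P x) * ?m y) <= norm (e / 2 * ?m y)" using bnd by (intro AE_I2) (metis abs_ge_self order_trans real_norm_def)
  qed
  have "(LINT y|lborel. P (x - y) * ?m y) = (LINT y|lborel. (P (x - y) - P x) * ?m y + P x * ?m y)" by (intro integral_cong) (auto simp: algebra_simps)
  also have "... = (LINT y|lborel. (P (x - y) - P x) * ?m y) + P x" using i1 mollifier(4,5)[OF d(1), where 'a='a, of n] by simp
  finally have "\<bar>(LINT y|lborel. P y * ?m (x - y)) - P x\<bar> = \<bar>LINT y|lborel. (P (x - y) - P x) * ?m y\<bar>" using mollify_eq[OF P cm] by simp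
  also have "... <= (LINT y|lborel. e / 2 * ?m y)" by (rule integral_abs_bound_integral[OF i1 im]) (use bnd in auto)
  also have "... < e" using mollifier(5)[OF d(1), where 'a='a, of n] e by simp
  finally show "norm ((LINT y|lborel. P y * ?m (x - y)) - P x) < e" by simp
 qed
qed

lemma mollify_bound:
 fixes P :: "'a::euclidean_space => real"
 assumes P: "continuous_on UNIV P" and C: "!!x. \<bar>P x\<bar> <= C" and d: "d > 0"
 shows "\<bar>LINT y|lborel. P y * mollifier d (x - y)\<bar> <= C"
proof -
 let ?m = "mollifier d :: 'a => real"
 have cm: "continuous_on UNIV ?m" using C_bounded_continuous_bounded[OF mollifier(1)[OF d]] by blast
 have im: "integrable lborel (%y. C * ?m y)" using mollifier(4)[OF d, where 'a='a] by simp
 have bnd: "\<bar>P (x - y) * ?m y\<bar> <= C * ?m y" for y using C[of "x - y"] mollifier(2)[OF d, of y] by (auto simp: abs_mult intro!: mult_right_mono)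
 have i1: "integrable lborel (%y. P (x - y) * ?m y)"
 proof (rule integrable_bound[OF im])
  show "(%y. P (x - y) * ?m y) \<in> borel_measurable lborel" unfolding measurable_lborel2
   by (intro borel_measurable_continuous_onI continuous_intros continuous_on_compose2[OF P] cm) auto
  show "AE y in lborel. norm (P (x - y) * ?m y) <= norm (C * ?m y)" using bnd by (intro AE_I2) (metis abs_ge_self order_trans real_norm_def)
 qed
 have "\<bar>LINT y|lborel. P (x - y) * ?m y\<bar> <= (LINT y|lborel. C * ?m y)" by (rule integral_abs_bound_integral[OF i1 im]) (use bnd in auto)
 then show ?thesis using mollify_eq[OF P cm] mollifier(5)[OF d, where 'a='a] by simp
qed

lemma mollify_support:
 fixes P :: "'a::euclidean_space => real"
 assumes "!!x. x \<notin> K ==> P x = 0" "d > 0" "!!k y. k \<in> K ==> norm y <= d ==> k + y \<in> L" "x \<notin> L"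
 shows "(LINT y|lborel. P y * mollifier d (x - y)) = 0"
proof -
 have "P y * mollifier d (x - y) = 0" for y
 proof (cases "y \<in> K")
  case True
  then have "\<not> norm (x - y) <= d" using assms(3)[of y "x - y"] assms(4) by auto
  then show ?thesis using mollifier(3)[OF assms(2), of "x - y"] by simp
 qed (use assms in simp)
 then have "(%y. P y * mollifier d (x - y)) = (%y. 0)" by (rule ext)
 then show ?thesis by simp
qed

text \<open>After the reflection \<open>mollify_eq\<close> the variable \<open>x\<close> occurs in
  \<open>P\<close> alone, so the derivative falls on \<open>P\<close>. This identifies the
  derivative of a mollification with the mollification of the derivative, whose limit is
  known.\<close>

lemma has_partial_mollify:
 fixes P :: "'a::euclidean_space => real"
 assumes P: "continuous_on UNIV P" "has_partial_on UNIV P b P'" "continuous_on UNIV P'"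
  and K: "compact K" "!!x. x \<notin> K ==> P x = 0" and d: "d > 0"
 shows "has_partial_on UNIV (%x. LINT y|lborel. P y * mollifier d (x - y)) b (%x. LINT y|lborel. P' y * mollifier d (x - y))" unfolding has_partial_on_UNIV
proof
 fix x
 let ?m = "mollifier d :: 'a => real"
 have cm: "continuous_on UNIV ?m" using C_bounded_continuous_bounded[OF mollifier(1)[OF d]] by blast
 have P'0: "P' x = 0" if "x \<notin> K" for x using has_partial_on_zero_outside[OF P(2) _ K(2)] that compact_imp_closed[OF K(1)] by blast
 obtain C where C: "C >= 0" "!!x. \<bar>P x\<bar> <= C" using continuous_compact_support_bounded[OF P(1) K] by blast
 obtain C' where C': "C' >= 0" "!!x. \<bar>P' x\<bar> <= C'" using continuous_compact_support_bounded[OF P(3) K(1) P'0] by blast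
 have "((%h. LINT y|lborel. P (x + h *\<^sub>R b - y) * ?m y) has_real_derivative (LINT y|lborel. P' (x + 0 *\<^sub>R b - y) * ?m y)) (at 0 within UNIV)"
 proof (rule has_real_derivative_integral[where B="%y. C' * ?m y"])
  have m: "(%y. Q (z - y) * ?m y) \<in> borel_measurable lborel" if "continuous_on UNIV Q" for Q z unfolding measurable_lborel2
   by (intro borel_measurable_continuous_onI continuous_intros continuous_on_compose2[OF that] cm) auto
  show "integrable lborel (%y. P (x + h *\<^sub>R b - y) * ?m y)" for h by (rule integrable_bound[of _ "%y. C * ?m y"])
    (use mollifier(2,4)[OF d, where 'a='a] C m[OF P(1)] in \<open>auto simp: abs_mult intro!: mult_right_mono\<close>)
  show "(%y. P' (x + 0 *\<^sub>R b - y) * ?m y) \<in> borel_measurable lborel" using m[OF P(3)] .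
  show "\<bar>P' (x + h *\<^sub>R b - y) * ?m y\<bar> <= C' * ?m y" for h y using C'(2) mollifier(2)[OF d, of y] by (auto simp: abs_mult intro!: mult_right_mono)
  have "((%k. P (x + h *\<^sub>R b - y + k *\<^sub>R b)) has_real_derivative P' (x + h *\<^sub>R b - y)) (at 0)" for h y using P(2) by (simp add: has_partial_on_UNIV)
  then have "((%k. P (x + h *\<^sub>R b - y + (k - h) *\<^sub>R b)) has_real_derivative P' (x + h *\<^sub>R b - y)) (at h)" for h y
   using DERIV_shift[of "%k. P (x + h *\<^sub>R b - y + (k - h) *\<^sub>R b)" _ 0 h] by (simp add: add.commute)
  then have "((%h. P (x + h *\<^sub>R b - y)) has_real_derivative P' (x + h *\<^sub>R b - y)) (at h)" for h y by (simp add: algebra_simps)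
  then show "((%h. P (x + h *\<^sub>R b - y) * ?m y) has_real_derivative P' (x + h *\<^sub>R b - y) * ?m y) (at h within UNIV)" for h y by (intro DERIV_cmult_right)
 qed (use mollifier(4)[OF d, where 'a='a] in auto)
 then show "((%h. LINT y|lborel. P y * ?m (x + h *\<^sub>R b - y)) has_real_derivative (LINT y|lborel. P' y * ?m (x - y))) (at 0)"
  by (simp add: mollify_eq[OF P(1) cm] mollify_eq[OF P(3) cm])
qed

lemma set_lebesgue_integral_eq:
 fixes g :: "'a => real"
 assumes "!!x. x \<in> A - B ==> g x = 0" "B \<subseteq> A"
 shows "(LINT x:A|M. g x) = (LINT x:B|M. g x)" unfolding set_lebesgue_integral_def using assms by (intro integral_cong) (auto simp: indicator_def)

text \<open>The definition tests with smooth functions, but the cutoffs used below are only C1.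
  Mollifications of \<open>P\<close> and of \<open>P'\<close> converge boundedly, with supports in
  one compact neighbourhood \<open>L\<close> of \<open>K\<close> inside
  \<open>\<Omega>\<close>.\<close>

lemma weak_partial_C1:
 fixes P :: "'a::euclidean_space => real"
 assumes w: "weak_partial \<Omega> f b g" and \<Omega>: "open \<Omega>"
  and P: "continuous_on UNIV P" "has_partial_on UNIV P b P'" "continuous_on UNIV P'"
  and K: "compact K" "K \<subseteq> \<Omega>" "!!x. x \<notin> K ==> P x = 0"
 shows "(LINT x:\<Omega>|lborel. f x * P' x) = - (LINT x:\<Omega>|lborel. g x * P x)"
proof -
 have P'0: "P' x = 0" if "x \<notin> K" for x using has_partial_on_zero_outside[OF P(2) _ K(3)] that compact_imp_closed[OF K(1)] by blast
 obtain C where C: "C >= 0" "!!x. \<bar>P x\<bar> <= C" using continuous_compact_support_bounded[OF P(1) K(1,3)] by blast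
 obtain C' where C': "C' >= 0" "!!x. \<bar>P' x\<bar> <= C'" using continuous_compact_support_bounded[OF P(3) K(1) P'0] by blast
 obtain e where e: "e > 0" "(\<Union>x\<in>K. cball x e) \<subseteq> \<Omega>" using compact_subset_open_imp_cball_epsilon_subset[OF K(1) \<Omega> K(2)] by blast
 define L where "L = (%(k, y). k + y) ` (K \<times> cball 0 e)"
 have L: "compact L" unfolding L_def by (intro compact_continuous_image compact_Times K(1)) (auto intro!: continuous_intros simp: case_prod_beta)
 have L\<Omega>: "L \<subseteq> \<Omega>" using e(2) unfolding L_def by (force simp: dist_norm)
 have KL: "k + y \<in> L" if "k \<in> K" "norm y <= e" for k y unfolding L_def using that by (intro image_eqI[of _ _ "(k, y)"]) auto
 define d where "d n = e / (real n + 1)" for n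
 have d: "d n > 0" "d n <= e" for n using e(1) by (auto simp: d_def field_simps)
 have dlim: "d \<longlonglongrightarrow> 0" unfolding d_def using tendsto_mult[OF tendsto_const[of e] LIMSEQ_inverse_real_of_nat] by (simp add: field_simps)
 define Q where "Q n x = (LINT y|lborel. P y * mollifier (d n) (x - y))" for n x
 define Q' where "Q' n x = (LINT y|lborel. P' y * mollifier (d n) (x - y))" for n x
 have Q0: "Q n x = 0" "Q' n x = 0" if "x \<notin> L" for n x
 proof -
  show "Q n x = 0" unfolding Q_def by (rule mollify_support[where K=K and L=L]) (use K(3) d KL that order_trans in blast)+
  show "Q' n x = 0" unfolding Q'_def by (rule mollify_support[where K=K and L=L]) (use P'0 d KL that order_trans in blast)+
 qed
 have Cb: "C_bounded k UNIV (Q n)" "C_bounded k UNIV (Q' n)" for k n unfolding Q_def Q'_def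
  by (intro C_bounded_convolution mollifier(1) d continuous_compact_support_integrable[OF P(1) K(1,3)]
    continuous_compact_support_integrable[OF P(3) K(1) P'0]; assumption?)+
 have sub: "closure {x. Q n x ~= 0} \<subseteq> L" for n using Q0(1) compact_imp_closed[OF L] by (intro closure_minimal) auto
 have test: "test_function \<Omega> (Q n)" for n unfolding test_function_def
  using Cb sub[of n] L L\<Omega> by (auto intro: bounded_subset[OF compact_imp_bounded[OF L]] simp: compact_eq_bounded_closed)
 have "has_partial_on UNIV (Q n) b (Q' n)" for n unfolding Q_def Q'_def by (rule has_partial_mollify[OF P K(1,3) d(1)])
 then have "(LINT x:\<Omega>|lborel. f x * Q' n x) = - (LINT x:\<Omega>|lborel. g x * Q n x)" for n using w test unfolding weak_partial_def by blast
 then have *: "(LINT x:L|lborel. f x * Q' n x) = - (LINT x:L|lborel. g x * Q n x)" for n using set_lebesgue_integral_eq[OF _ L\<Omega>, of "%x. f x * Q' n x" lborel]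
   set_lebesgue_integral_eq[OF _ L\<Omega>, of "%x. g x * Q n x" lborel] Q0 by simp
 have "set_integrable lborel L f" "set_integrable lborel L g" using w L L\<Omega> unfolding weak_partial_def locally_integrable_def by auto
 have conv: "(%n. LINT x:L|lborel. u x * R n x) \<longlonglongrightarrow> (LINT x:L|lborel. u x * R0 x)"
  if u: "set_integrable lborel L u" and R: "!!n x. \<bar>R n x\<bar> <= D" "!!x. (%n. R n x) \<longlonglongrightarrow> R0 x" "!!n. continuous_on UNIV (R n)"
   "continuous_on UNIV R0"
  for u D and R :: "nat => 'a => real" and R0 unfolding set_lebesgue_integral_def
 proof (rule integral_dominated_convergence)
  have um: "(%x. indicator L x *\<^sub>R u x) \<in> borel_measurable lborel" using u unfolding set_integrable_def by (rule borel_measurable_integrable)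
  have "(%x. (indicator L x *\<^sub>R u x) * h x) \<in> borel_measurable lborel" if "continuous_on UNIV h" for h
   using um that by (intro borel_measurable_times) (auto intro: borel_measurable_continuous_onI)
  then show "(%x. indicator L x *\<^sub>R (u x * R0 x)) \<in> borel_measurable lborel"
   "!!n. (%x. indicator L x *\<^sub>R (u x * R n x)) \<in> borel_measurable lborel" using R(3,4) by (auto simp: mult.assoc)
  show "integrable lborel (%x. norm (indicator L x *\<^sub>R u x) * D)" using u unfolding set_integrable_def by (intro integrable_mult_left integrable_norm)
  show "AE x in lborel. (%n. indicator L x *\<^sub>R (u x * R n x)) \<longlonglongrightarrow> indicator L x *\<^sub>R (u x * R0 x)" by (intro AE_I2 tendsto_intros R(2))
  show "AE x in lborel. norm (indicator L x *\<^sub>R (u x * R n x)) <= norm (indicator L x *\<^sub>R u x) * D" for n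
   using R(1) by (auto intro!: AE_I2 mult_left_mono simp: abs_mult mult.assoc)
 qed
 have cQ: "continuous_on UNIV (Q n)" "continuous_on UNIV (Q' n)" for n using C_bounded_continuous_bounded Cb by blast+
 have "(%n. LINT x:L|lborel. f x * Q' n x) \<longlonglongrightarrow> (LINT x:L|lborel. f x * P' x)"
  by (rule conv[where D=C']) (use \<open>set_integrable lborel L f\<close> P cQ C' d dlim in \<open>auto simp: Q'_def intro!: mollify_bound mollify_tendsto\<close>)
 moreover have "(%n. LINT x:L|lborel. g x * Q n x) \<longlonglongrightarrow> (LINT x:L|lborel. g x * P x)"
  by (rule conv[where D=C]) (use \<open>set_integrable lborel L g\<close> P cQ C d dlim in \<open>auto simp: Q_def intro!: mollify_bound mollify_tendsto\<close>)
 ultimately have "(LINT x:L|lborel. f x * P' x) = - (LINT x:L|lborel. g x * P x)" unfolding * using LIMSEQ_unique tendsto_minus by blast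
 moreover have "x \<in> L" if "x \<in> K" for x using KL[OF that, of 0] e(1) by simp
 ultimately show ?thesis using set_lebesgue_integral_eq[OF _ L\<Omega>, of "%x. f x * P' x" lborel]
   set_lebesgue_integral_eq[OF _ L\<Omega>, of "%x. g x * P x" lborel] K(3) P'0 by force
qed

section \<open>Classical functions as Sobolev functions\<close>

lemma L2_weighted_continuous:
 fixes f :: "'a::euclidean_space => 'b::euclidean_space"
 assumes f: "continuous_on UNIV f" and C: "!!x. norm (f x) <= C"
  and \<Omega>: "\<Omega> \<in> sets borel" and w: "set_integrable lborel \<Omega> w" "!!x. x \<in> \<Omega> ==> w x >= 0"
 shows "L2_weighted \<Omega> w f"
proof -
 have m[measurable]: "f \<in> borel_measurable borel" by (rule borel_measurable_continuous_onI[OF f])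
 have [measurable]: "\<Omega> \<in> sets borel" by fact
 have mw: "(%x. indicator \<Omega> x *\<^sub>R w x) \<in> borel_measurable lborel" using w(1) unfolding set_integrable_def by (rule borel_measurable_integrable)
 have "set_integrable lborel \<Omega> (%x. (norm (f x))^2 * w x)" unfolding set_integrable_def
 proof (rule integrable_bound)
  show "integrable lborel (%x. C^2 * (indicator \<Omega> x *\<^sub>R w x))" using w(1) unfolding set_integrable_def by (intro integrable_mult_right)
  have "(%x. (norm (f x))^2 * (indicator \<Omega> x *\<^sub>R w x)) \<in> borel_measurable lborel" using mw by simp
  then show "(%x. indicator \<Omega> x *\<^sub>R ((norm (f x))^2 * w x)) \<in> borel_measurable lborel" by (simp add: mult.left_commute)
  show "AE x in lborel. norm (indicator \<Omega> x *\<^sub>R ((norm (f x))^2 * w x)) <= norm (C^2 * (indicator \<Omega> x *\<^sub>R w x))" (is "AE x in _. ?P x")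
  proof (rule AE_I2)
   fix x
   have "(norm (f x))^2 <= C^2" using C[of x] by (intro power_mono) auto
   then show "?P x" using w(2)[of x] by (auto simp: indicator_def abs_mult intro!: mult_right_mono)
  qed
 qed
 then show ?thesis unfolding L2_weighted_def set_borel_measurable_def by simp
qed

lemma locally_integrable_continuous:
 fixes f :: "'a::euclidean_space => real"
 assumes "continuous_on UNIV f"
 shows "locally_integrable \<Omega> f" unfolding locally_integrable_def set_integrable_def
 by (intro allI impI borel_integrable_compact continuous_on_subset[OF assms] subset_UNIV)

text \<open>\<open>K\<close> may stick out of \<open>\<Omega>\<close>: it is the smooth function
  \<open>\<psi>\<close> that vanishes off a compact part of \<open>\<Omega>\<close>, so the
  integrals over \<open>\<Omega>\<close> are integrals over the whole space and the product rule
  applies there. This admits a kernel that does not vanish at \<open>y = 0\<close>.\<close>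

lemma W12_C1:
 fixes \<eta> :: "'a::euclidean_space => real"
 assumes \<eta>: "continuous_on UNIV \<eta>" "!!b. b \<in> Basis ==> has_partial_on UNIV \<eta> b (%p. H p \<bullet> b)" "continuous_on UNIV H"
  and K: "compact K" "!!x. x \<notin> K ==> \<eta> x = 0"
  and \<Omega>: "\<Omega> \<in> sets borel" and w: "set_integrable lborel \<Omega> w" "!!x. x \<in> \<Omega> ==> w x >= 0"
 shows "W12 \<Omega> w \<eta> H"
proof -
 have H0: "H x = 0" if "x \<notin> K" for x
 proof (rule euclidean_eqI)
  fix b :: 'a assume "b \<in> Basis"
  from has_partial_on_zero_outside[OF \<eta>(2)[OF this] compact_imp_closed[OF K(1)] K(2) that]
  show "H x \<bullet> b = 0 \<bullet> b" by simp
 qed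
 obtain C where C: "!!x. \<bar>\<eta> x\<bar> <= C" using continuous_compact_support_bounded[OF \<eta>(1) K] by blast
 obtain C' where C': "!!x. \<bar>norm (H x)\<bar> <= C'" using continuous_compact_support_bounded[OF continuous_on_norm[OF \<eta>(3)] K(1)] H0 norm_zero by metis
 have "weak_partial \<Omega> \<eta> b (%x. H x \<bullet> b)" if b: "b \<in> Basis" for b unfolding weak_partial_def
 proof (intro conjI allI impI)
  show "locally_integrable \<Omega> \<eta>" "locally_integrable \<Omega> (%x. H x \<bullet> b)" using \<eta> by (auto intro!: locally_integrable_continuous continuous_intros)
  fix \<psi> \<psi>' assume \<psi>: "test_function \<Omega> \<psi>" "has_partial_on UNIV \<psi> b \<psi>'"
  define S where "S = closure {x. \<psi> x ~= 0}"
  have S: "closed S" "S \<subseteq> \<Omega>" using \<psi>(1) by (auto simp: S_def test_function_def)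
  have \<psi>0: "\<psi> x = 0" if "x \<notin> S" for x using that closure_subset[of "{x. \<psi> x ~= 0}"] unfolding S_def by auto
  have \<psi>'0: "\<psi>' x = 0" if "x \<notin> S" for x using has_partial_on_zero_outside[OF \<psi>(2) S(1) \<psi>0 that] .
  have "C_bounded 1 UNIV \<psi>" using \<psi>(1) by (auto simp: test_function_def)
  then obtain g where g: "has_partial_on UNIV \<psi> b g" "continuous_on UNIV g" and c: "continuous_on UNIV \<psi>" using b by auto
  have "g = \<psi>'" using g(1) \<psi>(2) unfolding has_partial_on_UNIV by (metis DERIV_unique ext)
  then have c': "continuous_on UNIV \<psi>'" using g by simp
  have i0: "(LINT x|lborel. (H x \<bullet> b) * \<psi> x + \<eta> x * \<psi>' x) = 0" by (rule integral_partial_eq_0[of "%x. \<eta> x * \<psi> x" b _ K])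
    (use \<eta> \<psi>(2) b K c c' in \<open>auto intro!: continuous_intros has_partial_on_mult\<close>)
  have int: "integrable lborel (%x. (H x \<bullet> b) * \<psi> x)" "integrable lborel (%x. \<eta> x * \<psi>' x)"
   by (rule continuous_compact_support_integrable[OF _ K(1)]; use \<eta> c c' K(2) H0 in \<open>auto intro!: continuous_intros\<close>)+
  have "(LINT x:\<Omega>|lborel. \<eta> x * \<psi>' x) = (LINT x|lborel. \<eta> x * \<psi>' x)"
   "(LINT x:\<Omega>|lborel. H x \<bullet> b * \<psi> x) = (LINT x|lborel. H x \<bullet> b * \<psi> x)" unfolding set_lebesgue_integral_def
   using S(2) \<psi>0 \<psi>'0 by (intro integral_cong; force simp: indicator_def)+
  then show "(LINT x:\<Omega>|lborel. \<eta> x * \<psi>' x) = - (LINT x:\<Omega>|lborel. H x \<bullet> b * \<psi> x)" using i0 int by simp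
 qed
 moreover have "L2_weighted \<Omega> w \<eta>" "L2_weighted \<Omega> w H" using C C' by (auto intro!: L2_weighted_continuous \<Omega> w \<eta>)
 ultimately show ?thesis by (auto simp: W12_def weak_gradient_def)
qed

section \<open>The weight and a smooth step\<close>

lemma integrable_lborel_times:
 fixes f :: "'a::euclidean_space => real" and g :: "'b::euclidean_space => real"
 assumes f: "integrable lborel f" and g: "integrable lborel g"
 shows "integrable lborel (%p. f (fst p) * g (snd p))"
proof -
 have [measurable]: "f \<in> borel_measurable borel" "g \<in> borel_measurable borel" using f g by (auto dest: borel_measurable_integrable)
 have "integrable (lborel \<Otimes>\<^sub>M lborel) (%p. f (fst p) * g (snd p))" by (rule lborel_pair.Fubini_integrable) (use f g in \<open>auto simp: abs_mult\<close>)
 then show ?thesis by (simp add: lborel_prod)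
qed

lemma integrable_powr_Ioo:
 fixes a c :: real
 assumes "a > -1" "c >= 0"
 shows "integrable lborel (%y. indicator {0<..<c} y * y powr a)"
proof -
 have "set_integrable lebesgue {0<..c} (%y. y powr a)" by (rule nonnegative_absolutely_integrable_1[OF integrable_on_powr_from_0'[OF assms]]) auto
 then have "integrable lebesgue (%y. indicator {0<..c} y *\<^sub>R y powr a)" by (simp add: set_integrable_def)
 then have *: "integrable lborel (%y. indicator {0<..c} y *\<^sub>R y powr a)" by (subst (asm) integrable_completion) auto
 show ?thesis by (rule integrable_bound[OF *]) (auto simp: indicator_def)
qed

lemma open_half_ball: "open (half_ball r)"
proof -
 have "half_ball r = ball 0 r \<inter> {X. 0 < snd X}" by (auto simp: half_ball_def)
 also have "open ..." by (intro open_Int open_ball open_Collect_less continuous_intros)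
 finally show ?thesis .
qed

lemma sets_half_ball[measurable]: "half_ball r \<in> sets borel" by (intro borel_open open_half_ball)

lemma weight_measurable[measurable]: "weight a \<in> borel_measurable borel" unfolding weight_def[abs_def] borel_prod[symmetric] by measurable

lemma weight_nonneg: "weight a X >= 0" by (simp add: weight_def)

lemma set_integrable_weight:
 assumes "a > -1"
 shows "set_integrable lborel (half_ball r) (weight a)" unfolding set_integrable_def
proof (rule integrable_bound)
 show "integrable lborel (%p. (1 * indicator (ball 0 \<bar>r\<bar>) (fst p :: real^'n)) * (indicator {0<..<\<bar>r\<bar>} (snd p) * snd p powr a))"
  by (intro integrable_lborel_times integrable_powr_Ioo integrable_indicator_bounded assms) auto
 show "AE X in lborel. norm (indicator (half_ball r) X *\<^sub>R weight a (X :: (real^'n) \<times> real))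
  <= norm ((1 * indicator (ball 0 \<bar>r\<bar>) (fst X)) * (indicator {0<..<\<bar>r\<bar>} (snd X) * snd X powr a))"
 proof (rule AE_I2)
  fix X :: "(real^'n) \<times> real"
  have "norm (fst X) < \<bar>r\<bar>" "\<bar>snd X\<bar> < \<bar>r\<bar>" if "norm X < r" using that norm_fst_le[of "fst X" "snd X"] norm_snd_le[of "snd X" "fst X"] by auto
  then show "norm (indicator (half_ball r) X *\<^sub>R weight a X)
  <= norm ((1 * indicator (ball 0 \<bar>r\<bar>) (fst X)) * (indicator {0<..<\<bar>r\<bar>} (snd X) * snd X powr a))" by (auto simp: half_ball_def weight_def indicator_def)
 qed
qed measurable

section \<open>A C1 step function\<close>

definition pos :: "real => real" where "pos u = max 0 u"

lemma continuous_on_pos[continuous_intros]: "continuous_on S f ==> continuous_on S (%x. pos (f x))" unfolding pos_def by (intro continuous_intros)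

lemma pos_power2_deriv: "((%u. (pos u)^2) has_real_derivative 2 * pos u) (at u)"
proof -
 consider "u > 0" | "u < 0" | "u = 0" by linarith
 then show ?thesis
 proof cases
  case 1
  have "((%u. u^2) has_real_derivative 2 * pos u) (at u)" using 1 by (auto intro!: derivative_eq_intros simp: pos_def)
  then show ?thesis by (rule has_field_derivative_transform_within_open[of _ _ _ "{0<..}"]) (use 1 in \<open>auto simp: pos_def\<close>)
 next
  case 2
  have "((%u. 0) has_real_derivative 2 * pos u) (at u)" using 2 by (simp add: pos_def)
  then show ?thesis by (rule has_field_derivative_transform_within_open[of _ _ _ "{..<0}"]) (use 2 in \<open>auto simp: pos_def\<close>)
 next
  case 3
  have "((%h. (pos h)^2 / h) \<longlongrightarrow> 0) (at 0)"
  proof (rule Lim_null_comparison)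
   show "eventually (%h. norm ((pos h)^2 / h) <= \<bar>h\<bar>) (at 0)" by (auto intro!: always_eventually simp: pos_def max_def power2_eq_square)
   show "((%h::real. \<bar>h\<bar>) \<longlongrightarrow> 0) (at 0)" by (auto intro!: tendsto_eq_intros)
  qed
  then show ?thesis using 3 by (simp add: has_field_derivative_iff pos_def)
 qed
qed

lemma pos_power3_deriv: "((%u. (pos u)^3) has_real_derivative 3 * (pos u)^2) (at u)"
proof -
 have eq: "(pos u)^3 = (pos u)^2 * u" for u by (auto simp: pos_def max_def power2_eq_square power3_eq_cube)
 show ?thesis unfolding eq by (rule derivative_eq_intros pos_power2_deriv refl)+ (auto simp: pos_def max_def power2_eq_square)
qed

text \<open>The cubic \<open>3 u^2 - 2 u^3\<close> climbs from 0 to 1 with zero slope at both ends.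
  The two terms in \<open>u - 1\<close> stop it at 1, and positive parts replace a case distinction,
  so that C1 regularity follows from that of \<open>pos u\<close> squared and cubed.\<close>

definition step :: "real => real" where
 "step u = 3 * (pos u)^2 - 2 * (pos u)^3 + 3 * (pos (u - 1))^2 + 2 * (pos (u - 1))^3"

definition step' :: "real => real" where
 "step' u = 6 * pos u - 6 * (pos u)^2 + 6 * pos (u - 1) + 6 * (pos (u - 1))^2"

lemma step_deriv: "(step has_real_derivative step' u) (at u)"
proof -
 have 1: "((%u. u - 1) has_real_derivative 1) (at u)" by (auto intro!: derivative_eq_intros)
 have 2: "((%u. (pos (u - 1))^2) has_real_derivative 2 * pos (u - 1)) (at u)"
  and 3: "((%u. (pos (u - 1))^3) has_real_derivative 3 * (pos (u - 1))^2) (at u)" using DERIV_chain2[OF pos_power2_deriv, of "%u. u - 1" 1 u UNIV]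
   DERIV_chain2[OF pos_power3_deriv, of "%u. u - 1" 1 u UNIV]
   1 by simp_all
 show ?thesis unfolding step_def[abs_def] step'_def by (rule derivative_eq_intros pos_power2_deriv pos_power3_deriv 2 3 refl)+ simp
qed

lemma step_deriv'[derivative_intros]:
 assumes "(f has_real_derivative f') (at x within S)"
 shows "((%x. step (f x)) has_real_derivative step' (f x) * f') (at x within S)" by (rule DERIV_chain2[OF step_deriv assms])

lemma continuous_on_step[continuous_intros]: "continuous_on S f ==> continuous_on S (%x. step (f x))" unfolding step_def by (intro continuous_intros)

lemma continuous_on_step'[continuous_intros]: "continuous_on S f ==> continuous_on S (%x. step' (f x))" unfolding step'_def by (intro continuous_intros)

lemma step_measurable[measurable]: "step \<in> borel_measurable borel" "step' \<in> borel_measurable borel" by (intro borel_measurable_continuous_onI continuous_intros)+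

lemma step_0: "u <= 0 ==> step u = 0" by (simp add: step_def pos_def)
lemma step_1: "u >= 1 ==> step u = 1" by (simp add: step_def pos_def power2_eq_square power3_eq_cube algebra_simps)
lemma step'_0: "u <= 0 \<or> u >= 1 ==> step' u = 0" by (auto simp: step'_def pos_def power2_eq_square algebra_simps)

lemma step'_mid: "0 <= u ==> u <= 1 ==> step' u = 6 * u * (1 - u)" by (simp add: step'_def pos_def power2_eq_square algebra_simps)

lemma step'_bounds: "0 <= step' u" "step' u <= 2"
proof -
 have "0 <= step' u \<and> step' u <= 2"
 proof (cases "0 <= u \<and> u <= 1")
  case True
  have "0 <= (u - 1 / 2)^2" by simp
  then have "u * (1 - u) <= 1 / 4" by (simp add: power2_eq_square algebra_simps)
  moreover have "0 <= u * (1 - u)" using True by simp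
  moreover have "step' u = 6 * (u * (1 - u))" using True step'_mid[of u] by simp
  ultimately show ?thesis by linarith
 qed (use step'_0[of u] in auto)
 then show "0 <= step' u" "step' u <= 2" by auto
qed

lemma step_bounds: "0 <= step u" "step u <= 1"
proof -
 have mono: "step u <= step v" if "u <= v" for u v by (rule DERIV_nonneg_imp_nondecreasing[OF that]) (blast intro: step_deriv step'_bounds(1))
 show "0 <= step u" using mono[of "min u 0" u] step_0[of "min u 0"] by auto
 show "step u <= 1" using mono[of u "max u 1"] step_1[of "max u 1"] by auto
qed

section \<open>Integration by parts up to the flat boundary\<close>

text \<open>\<open>P\<close> need not vanish at \<open>y = 0\<close>, so it is first multiplied by
  \<open>step (k y - 1)\<close>, which is 0 for \<open>y \<le> 1 / k\<close> and 1 for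
  \<open>y \<ge> 2 / k\<close>. The derivative of this factor is of size \<open>k\<close>, but it is
  multiplied by \<open>snd b\<close>, and \<open>P X * snd b\<close> is of order \<open>y\<close>
  times the weight: the vertical flux vanishes at the bottom. Dominated convergence then leaves no
  boundary term.\<close>

lemma weak_gradient_half_ball:
 fixes u :: "'n::finite space => real"
 assumes a: "a > -1" and W: "W12 (half_ball \<rho>) (weight a) u g" and b: "b \<in> Basis"
  and P: "continuous_on {X. 0 < snd X} P" "has_partial_on {X. 0 < snd X} P b P'" "continuous_on {X. 0 < snd X} P'"
  and R: "R < \<rho>" "!!X. 0 < snd X ==> norm X >= R ==> P X = 0"
  and C: "!!X. 0 < snd X ==> \<bar>P X\<bar> <= C * weight a X" "!!X. 0 < snd X ==> \<bar>P' X\<bar> <= C * weight a X"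
   "!!X. 0 < snd X ==> \<bar>P X * snd b\<bar> <= C * (snd X * weight a X)"
 shows "(LINT X:half_ball \<rho>|lborel. (g X \<bullet> b) * P X) = - (LINT X:half_ball \<rho>|lborel. u X * P' X)"
proof -
 let ?H = "{X :: 'n space. 0 < snd X}"
 have oH: "open ?H" by (intro open_Collect_less continuous_intros)
 define c where "c k X = step (real k * snd X - 1)" for k and X :: "'n space"
 define c' where "c' k X = step' (real k * snd X - 1) * (real k * snd b)" for k and X :: "'n space"
 define Q where "Q k X = (if 0 < snd X then P X * c k X else 0)" for k X
 define Q' where "Q' k X = (if 0 < snd X then P' X * c k X + P X * c' k X else 0)" for k X
 have c0: "c k X = 0" "c' k X = 0" if "real k * snd X <= 1" for k X using that by (auto simp: c_def c'_def step_0 step'_0)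
 have dP: "((%h. P (X + h *\<^sub>R b)) has_real_derivative P' X) (at 0)" if X: "0 < snd X" for X
 proof -
  have "open ((%h::real. X + h *\<^sub>R b) -` ?H)" by (rule open_vimage[OF oH]) (intro continuous_intros)
  then have eq: "at 0 within {h. X + h *\<^sub>R b \<in> ?H} = at 0" using X by (intro at_within_open) (auto simp: vimage_def)
  have "((%h. P (X + h *\<^sub>R b)) has_real_derivative P' X) (at 0 within {h. X + h *\<^sub>R b \<in> ?H})" using P(2) X unfolding has_partial_on_def by blast
  then show ?thesis unfolding eq .
 qed
 have P'0: "P' X = 0" if X: "0 < snd X" "norm X > R" for X
 proof -
  have "open ((%h::real. X + h *\<^sub>R b) -` (?H \<inter> - cball 0 R))" by (rule open_vimage[OF open_Int[OF oH]]) (auto intro!: continuous_intros)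
  from has_field_derivative_transform_within_open[OF dP[OF X(1)] this, of "%_. 0"]
  have "((%h. 0) has_real_derivative P' X) (at 0)" using X R(2) by auto
  then show ?thesis using DERIV_unique DERIV_const by blast
 qed
 have cQ: "continuous_on ?H (Q k)" "continuous_on ?H (Q' k)" for k
 proof -
  have "continuous_on ?H (%X. P X * c k X)" unfolding c_def by (intro continuous_intros P)
  then show "continuous_on ?H (Q k)" by (rule continuous_on_eq) (simp add: Q_def)
  have "continuous_on ?H (%X. P' X * c k X + P X * c' k X)" unfolding c_def c'_def by (intro continuous_intros P)
  then show "continuous_on ?H (Q' k)" by (rule continuous_on_eq) (simp add: Q'_def)
 qed
 have id: "(LINT X:half_ball \<rho>|lborel. u X * Q' k X) = - (LINT X:half_ball \<rho>|lborel. (g X \<bullet> b) * Q k X)"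
  if k: "k > 0" for k
 proof (rule weak_partial_C1)
  show "weak_partial (half_ball \<rho>) u b (%X. g X \<bullet> b)" using W b by (auto simp: W12_def weak_gradient_def)
  show "open (half_ball \<rho>)" by (rule open_half_ball)
  let ?L = "{X :: 'n space. snd X < 1 / real k}"
  have oL: "open ?L" by (intro open_Collect_less continuous_intros)
  have k1: "0 < 1 / real k" using k by simp
  have un: "UNIV = ?H \<union> ?L" by (auto simp: not_less intro: less_le_trans[OF k1])
  have L: "real k * snd X <= 1" if "X \<in> ?L" for X using that k by (simp add: field_simps)
  have "continuous_on ?L (Q k)" "continuous_on ?L (Q' k)" by (rule continuous_on_eq[OF continuous_on_const[of _ 0]]; use c0[OF L] in \<open>simp add: Q_def Q'_def\<close>)+
  moreover note cQ[of k]
  ultimately show "continuous_on UNIV (Q k)" "continuous_on UNIV (Q' k)" unfolding un using oH oL by (blast intro: continuous_on_open_Un)+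
  show "has_partial_on UNIV (Q k) b (Q' k)" unfolding has_partial_on_UNIV
  proof
   fix X
   show "((%h. Q k (X + h *\<^sub>R b)) has_real_derivative Q' k X) (at 0)"
   proof (cases "0 < snd X")
    case True
    have "((%h. P (X + h *\<^sub>R b) * step (real k * (snd X + h * snd b) - 1)) has_real_derivative
     P' X * c k X + P X * c' k X) (at 0)" using dP[OF True] by (auto intro!: derivative_eq_intros simp: c_def c'_def)
    then have "((%h. P (X + h *\<^sub>R b) * step (real k * (snd X + h * snd b) - 1)) has_real_derivative Q' k X) (at 0)" using True by (simp add: Q'_def)
    moreover have "open ((%h::real. X + h *\<^sub>R b) -` ?H)" by (rule open_vimage[OF oH]) (intro continuous_intros)
    ultimately show ?thesis by (rule has_field_derivative_transform_within_open) (use True in \<open>auto simp: Q_def c_def\<close>)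
   next
    case False
    then have X: "X \<in> ?L" using un by blast
    have "((%h. 0) has_real_derivative Q' k X) (at 0)" using False by (simp add: Q'_def)
    moreover have "open ((%h::real. X + h *\<^sub>R b) -` ?L)" by (rule open_vimage[OF oL]) (intro continuous_intros)
    ultimately show ?thesis by (rule has_field_derivative_transform_within_open) (use X c0[OF L] in \<open>auto simp: Q_def\<close>)
   qed
  qed
  have "closed {X :: 'n space. snd X >= 1 / real k}" by (intro closed_Collect_le continuous_intros)
  then show "compact (cball 0 R \<inter> {X :: 'n space. snd X >= 1 / real k})" by (intro compact_Int_closed) auto
  show "cball 0 R \<inter> {X :: 'n space. snd X >= 1 / real k} \<subseteq> half_ball \<rho>" using R(1) by (auto simp: half_ball_def intro: less_le_trans[OF k1])
  show "Q k X = 0" if "X \<notin> cball 0 R \<inter> {X. snd X >= 1 / real k}" for X using that R(2)[of X] c0(1)[OF L, of X] by (auto simp: Q_def)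
 qed
 have um: "set_borel_measurable lborel (half_ball \<rho>) u" and ui: "set_integrable lborel (half_ball \<rho>) (%x. (norm (u x))^2 * weight a x)"
  and gm: "set_borel_measurable lborel (half_ball \<rho>) g" and gi: "set_integrable lborel (half_ball \<rho>) (%x. (norm (g x))^2 * weight a x)"
  using W by (auto simp: W12_def L2_weighted_def)
 have conv: "(%k. LINT X:half_ball \<rho>|lborel. f X * S k X) \<longlonglongrightarrow> (LINT X:half_ball \<rho>|lborel. f X * S0 X)"
  if f: "set_borel_measurable lborel (half_ball \<rho>) f" "!!X. \<bar>f X\<bar> <= norm (F X)"
    "set_integrable lborel (half_ball \<rho>) (%x. (norm (F x))^2 * weight a x)"
   and S: "!!k X. 0 < snd X ==> \<bar>S k X\<bar> <= D * weight a X" "!!X. 0 < snd X ==> (%k. S k X) \<longlonglongrightarrow> S0 X"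
    "!!k. continuous_on ?H (S k)" "continuous_on ?H S0" and D: "D >= 0"
  for f and F :: "'n space => 'z::euclidean_space" and S S0 D unfolding set_lebesgue_integral_def
 proof (rule integral_dominated_convergence)
  have fm: "(%x. indicator (half_ball \<rho>) x *\<^sub>R f x) \<in> borel_measurable lborel" using f(1) by (simp add: set_borel_measurable_def)
  have "(%X. indicator ?H X *\<^sub>R h X) \<in> borel_measurable borel" if "continuous_on ?H h" for h :: "_ => real"
   using that oH by (intro borel_measurable_continuous_on_indicator) auto
  then have "(%X. (indicator (half_ball \<rho>) X *\<^sub>R f X) * (indicator ?H X *\<^sub>R h X)) \<in> borel_measurable lborel"
   if "continuous_on ?H h" for h using fm that by (intro borel_measurable_times) auto
  then have *: "(%X. indicator (half_ball \<rho>) X *\<^sub>R (f X * h X)) \<in> borel_measurable lborel"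
   if "continuous_on ?H h" for h by (rule measurable_cong[THEN iffD1, rotated]) (use that in \<open>auto simp: indicator_def half_ball_def\<close>)
  show "(%X. indicator (half_ball \<rho>) X *\<^sub>R (f X * S0 X)) \<in> borel_measurable lborel"
   "!!k. (%X. indicator (half_ball \<rho>) X *\<^sub>R (f X * S k X)) \<in> borel_measurable lborel" by (intro * S)+
  have "integrable lborel (%X. D * (indicator (half_ball \<rho>) X *\<^sub>R ((norm (F X))^2 * weight a X) + indicator (half_ball \<rho>) X *\<^sub>R weight a X))"
   using f(3) set_integrable_weight[OF a] unfolding set_integrable_def by (intro integrable_mult_right integrable_add) 
  then show "integrable lborel (%X. D * (indicator (half_ball \<rho>) X *\<^sub>R (((norm (F X))^2 + 1) * weight a X)))" by (simp add: algebra_simps)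
  show "AE X in lborel. (%k. indicator (half_ball \<rho>) X *\<^sub>R (f X * S k X)) \<longlonglongrightarrow> indicator (half_ball \<rho>) X *\<^sub>R (f X * S0 X)" (is "AE X in _. ?P X")
  proof (rule AE_I2)
   fix X show "?P X" using S(2)[of X] by (cases "X \<in> half_ball \<rho>") (auto simp: half_ball_def intro!: tendsto_intros)
  qed
  show "AE X in lborel. norm (indicator (half_ball \<rho>) X *\<^sub>R (f X * S k X)) <= D * (indicator (half_ball \<rho>) X *\<^sub>R (((norm (F X))^2 + 1) * weight a X))" (is "AE X in _. ?P X") for k
  proof (rule AE_I2)
   fix X
   have "\<bar>f X\<bar> * \<bar>S k X\<bar> <= ((norm (F X))^2 + 1) * (D * weight a X)" if "0 < snd X"
   proof (intro mult_mono)
    \<comment> \<open>Expands to \<open>norm (F X) \<le> (norm (F X))^2 + 1\<close>, which turns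
      square integrability into integrability where the weight has finite mass.\<close>
    have "0 <= (norm (F X) - 1)^2 + (norm (F X))^2 + 1" by simp
    then show "\<bar>f X\<bar> <= (norm (F X))^2 + 1" using f(2)[of X] by (simp add: power2_diff)
   qed (use S(1) that in auto)
   then show "?P X" by (auto simp: indicator_def half_ball_def abs_mult mult_ac)
  qed
 qed
 have C0: "C >= 0"
 proof -
  have "0 <= C * weight a ((0, 1) :: 'n space)" using C(1)[of "(0, 1)"] by (simp add: order_trans[OF abs_ge_zero])
  then show ?thesis by (simp add: weight_def)
 qed
 have c1: "\<bar>c k X\<bar> <= 1" for k X using step_bounds by (auto simp: c_def)
 have ev: "eventually (%k. c k X = 1 \<and> c' k X = 0) sequentially" if X: "0 < snd X" for X
 proof -
  obtain N where N: "2 / snd X <= real N" using real_arch_simple by blast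
  have "c k X = 1 \<and> c' k X = 0" if "k >= N" for k
  proof -
   have "2 / snd X <= real k" using N that by linarith
   then have "2 <= real k * snd X" using X by (simp add: field_simps)
   then show ?thesis by (auto simp: c_def c'_def step_1 step'_0)
  qed
  then show ?thesis by (auto simp: eventually_sequentially)
 qed
 \<comment> \<open>The factor 4 is 2 times 2: \<open>step'\<close> is at most 2, and
   \<open>k y \<le> 2\<close> wherever the derivative of the cutoff is not 0. Adding the term with
   \<open>P'\<close> gives the constant \<open>5 * C\<close> below.\<close>
 have Pc': "\<bar>P X * c' k X\<bar> <= 4 * C * weight a X" if X: "0 < snd X" for k X
 proof (cases "real k * snd X <= 2")
  case True
  have "\<bar>P X * c' k X\<bar> = \<bar>P X * snd b\<bar> * (step' (real k * snd X - 1) * real k)" using step'_bounds by (simp add: c'_def abs_mult)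
  also have "... <= (C * (snd X * weight a X)) * (2 * real k)" using C(3)[OF X] C0 X step'_bounds weight_nonneg[of a X] by (intro mult_mono) auto
  also have "... = 2 * C * weight a X * (real k * snd X)" by simp
  also have "... <= 2 * C * weight a X * 2" using True C0 weight_nonneg[of a X] by (intro mult_left_mono) auto
  finally show ?thesis by simp
 next
  case False
  then show ?thesis using C0 weight_nonneg[of a X] by (simp add: c'_def step'_0)
 qed
 have bQ: "\<bar>Q k X\<bar> <= (5 * C) * weight a X" "\<bar>Q' k X\<bar> <= (5 * C) * weight a X" if X: "0 < snd X" for k X
 proof -
  have "\<bar>P X * c k X\<bar> <= C * weight a X" "\<bar>P' X * c k X\<bar> <= C * weight a X"
   using C(1,2)[OF X] c1[of k X] mult_left_le[of "\<bar>c k X\<bar>" "\<bar>P X\<bar>"] mult_left_le[of "\<bar>c k X\<bar>" "\<bar>P' X\<bar>"] by (auto simp: abs_mult)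
  moreover have "0 <= C * weight a X" using C0 weight_nonneg[of a X] by simp
  ultimately show "\<bar>Q k X\<bar> <= (5 * C) * weight a X" "\<bar>Q' k X\<bar> <= (5 * C) * weight a X" using X Pc'[OF X, of k] by (auto simp: Q_def Q'_def)
 qed
 have A: "(%k. LINT X:half_ball \<rho>|lborel. u X * Q' k X) \<longlonglongrightarrow> (LINT X:half_ball \<rho>|lborel. u X * P' X)"
 proof (rule conv[where F=u and D="5 * C"])
  show "(%k. Q' k X) \<longlonglongrightarrow> P' X" if "0 < snd X" for X
   by (rule tendsto_eventually, rule eventually_mono[OF ev[OF that]]) (use that in \<open>auto simp: Q'_def\<close>)
 qed (use um ui bQ cQ C0 P(3) in auto)
 have B: "(%k. LINT X:half_ball \<rho>|lborel. (g X \<bullet> b) * Q k X) \<longlonglongrightarrow> (LINT X:half_ball \<rho>|lborel. (g X \<bullet> b) * P X)"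
 proof (rule conv[where F=g and D="5 * C"])
  have "(%x. (indicator (half_ball \<rho>) x *\<^sub>R g x) \<bullet> b) \<in> borel_measurable lborel"
   using gm unfolding set_borel_measurable_def by (intro borel_measurable_inner) auto
  then show "set_borel_measurable lborel (half_ball \<rho>) (%X. g X \<bullet> b)" by (simp add: set_borel_measurable_def)
  show "\<bar>g X \<bullet> b\<bar> <= norm (g X)" for X using b Basis_le_norm by blast
  show "(%k. Q k X) \<longlonglongrightarrow> P X" if "0 < snd X" for X
   by (rule tendsto_eventually, rule eventually_mono[OF ev[OF that]]) (use that in \<open>auto simp: Q_def\<close>)
 qed (use gi bQ cQ C0 P(1) in auto)
 have "eventually (%k. (LINT X:half_ball \<rho>|lborel. u X * Q' k X) = - (LINT X:half_ball \<rho>|lborel. (g X \<bullet> b) * Q k X)) sequentially"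
  by (rule eventually_mono[OF eventually_gt_at_top[of 0] id])
 then have "(%k. - (LINT X:half_ball \<rho>|lborel. (g X \<bullet> b) * Q k X)) \<longlonglongrightarrow> (LINT X:half_ball \<rho>|lborel. u X * P' X)"
  by (rule Lim_transform_eventually[OF A])
 from LIMSEQ_unique[OF this tendsto_minus[OF B]] show ?thesis by simp
qed

section \<open>The hypergeometric function \<open>0F1\<close>\<close>

definition F01_coeff :: "real => nat => real" where
 "F01_coeff c k = 1 / (fact k * pochhammer c k)"

definition F01 :: "real => real => real" where
 "F01 c \<rho> = (\<Sum>k. F01_coeff c k * \<rho> ^ k)"

lemma F01_coeff_pos: "c > 0 ==> F01_coeff c k > 0" by (simp add: F01_coeff_def pochhammer_pos)

text \<open>All factors of \<open>pochhammer c k\<close> after the first are greater than 1, so the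
  product is at least \<open>min 1 c\<close>. The series is thus dominated by a multiple of the
  exponential series.\<close>

lemma F01_coeff_le:
 assumes "c > 0"
 shows "F01_coeff c k <= max 1 (1 / c) / fact k"
proof -
 have mono: "pochhammer (c + 1) j >= 1" for j
 proof (induction j)
  case (Suc j)
  have "1 * 1 <= pochhammer (c + 1) j * (c + 1 + real j)" using Suc assms by (intro mult_mono) auto
  then show ?case by (simp add: pochhammer_Suc)
 qed simp
 have "1 <= max 1 (1 / c) * pochhammer c k"
 proof (cases k)
  case (Suc j)
  have "1 = (1 / c) * (c * 1)" using assms by simp
  also have "... <= max 1 (1 / c) * (c * pochhammer (c + 1) j)" using assms mono[of j] by (intro mult_mono) auto
  finally show ?thesis using Suc by (simp add: pochhammer_rec)
 qed simp
 moreover have "pochhammer c k > 0" using assms by (rule pochhammer_pos)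
 ultimately show ?thesis by (simp add: F01_coeff_def field_simps)
qed

lemma F01_summable:
 assumes "c > 0"
 shows "summable (%k. F01_coeff c k * \<rho> ^ k)"
proof (rule summable_comparison_test')
 show "summable (%k. max 1 (1 / c) * (inverse (fact k) * \<bar>\<rho>\<bar> ^ k))" by (intro summable_mult summable_exp)
 show "norm (F01_coeff c k * \<rho> ^ k) <= max 1 (1 / c) * (inverse (fact k) * \<bar>\<rho>\<bar> ^ k)" for k using F01_coeff_le[OF assms, of k] F01_coeff_pos[OF assms, of k]
  by (auto simp: abs_mult power_abs divide_inverse intro!: mult_right_mono simp flip: mult.assoc)
qed

lemma F01_deriv:
 assumes "c > 0"
 shows "(F01 c has_real_derivative F01 (c + 1) \<rho> / c) (at \<rho>)"
proof -
 have "(F01 c has_real_derivative (\<Sum>k. diffs (F01_coeff c) k * \<rho> ^ k)) (at \<rho>)"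
  unfolding F01_def[abs_def] by (rule termdiffs_strong_converges_everywhere) (rule F01_summable[OF assms])
 moreover have "diffs (F01_coeff c) k = F01_coeff (c + 1) k / c" for k by (simp add: diffs_def F01_coeff_def pochhammer_rec field_simps del: of_nat_Suc)
 then have "(\<Sum>k. diffs (F01_coeff c) k * \<rho> ^ k) = F01 (c + 1) \<rho> / c" using suminf_divide[OF F01_summable[of "c + 1" \<rho>], of c] assms by (simp add: F01_def)
 ultimately show ?thesis by simp
qed

lemma F01_deriv'[derivative_intros]:
 assumes "c > 0" "(f has_real_derivative f') (at x within S)"
 shows "((%x. F01 c (f x)) has_real_derivative F01 (c + 1) (f x) / c * f') (at x within S)" by (rule DERIV_chain2[OF F01_deriv[OF assms(1)] assms(2)])

lemma continuous_on_F01[continuous_intros]: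
 assumes "c > 0" "continuous_on S f"
 shows "continuous_on S (%x. F01 c (f x))"
proof -
 have "continuous_on UNIV (F01 c)" by (rule continuous_at_imp_continuous_on, intro ballI, rule DERIV_isCont[OF F01_deriv[OF assms(1)]])
 from continuous_on_compose2[OF this assms(2)] show ?thesis by simp
qed

text \<open>This is the Bessel equation for \<open>F01 c\<close>, with its derivatives expressed through contiguous parameters.\<close>

lemma F01_contiguous:
 assumes c: "c > 0"
 shows "F01 c \<rho> = F01 (c + 1) \<rho> + \<rho> / (c * (c + 1)) * F01 (c + 2) \<rho>"
proof -
 have sm: "(%k. F01_coeff d k * \<rho> ^ k) sums F01 d \<rho>" if "d > 0" for d unfolding F01_def by (rule summable_sums[OF F01_summable[OF that]])
 have coeff: "F01_coeff c (Suc k) = F01_coeff (c + 1) (Suc k) + F01_coeff (c + 2) k / (c * (c + 1))" for k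
 proof -
  have p: "pochhammer (c + 2) k > 0" "c + 1 + real k > 0" using c by (auto intro!: pochhammer_pos)
  have 1: "pochhammer c (Suc k) = c * pochhammer (c + 1) k" by (rule pochhammer_rec)
  have 2: "pochhammer (c + 1) (Suc k) = pochhammer (c + 1) k * (c + 1 + real k)" by (rule pochhammer_Suc)
  have 3: "pochhammer (c + 1) (Suc k) = (c + 1) * pochhammer (c + 2) k" using pochhammer_rec[of "c + 1" k] by (simp add: add.assoc)
  have q: "pochhammer (c + 1) k > 0" using c by (auto intro!: pochhammer_pos)
  have "F01_coeff c (Suc k) - F01_coeff (c + 1) (Suc k)
   = 1 / (fact (Suc k)) * (1 / (c * pochhammer (c + 1) k) - 1 / (pochhammer (c + 1) k * (c + 1 + real k)))" unfolding F01_coeff_def 1 2 by (simp add: algebra_simps)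
  also have "... = 1 / (fact (Suc k)) * ((1 + real k) / (c * (pochhammer (c + 1) k * (c + 1 + real k))))"
  proof -
   have "1 / (c * q) - 1 / (q * d) = (d - c) / (c * (q * d))" if "q > 0" "d > 0" for q d using that c by (simp add: field_simps)
   from this[OF q p(2)] show ?thesis by simp
  qed
  also have "... = 1 / (fact k) * (1 / (c * ((c + 1) * pochhammer (c + 2) k)))"
  proof -
   have "1 / ((1 + x) * f) * ((1 + x) / P) = 1 / f * (1 / P)" if "x >= 0" "f > 0" "P > 0" for x f P :: real
   proof -
    have "(1 + x) / (1 + x) = 1" using that by simp
    moreover have "1 / ((1 + x) * f) * ((1 + x) / P) = (1 + x) / (1 + x) * (1 / f * (1 / P))" by (simp add: mult_ac)
    ultimately show ?thesis by simp
   qed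
   from this[of "real k" "fact k" "c * ((c + 1) * pochhammer (c + 2) k)"] show ?thesis unfolding 2[symmetric] 3 using c p(1) by simp
  qed
  also have "... = F01_coeff (c + 2) k / (c * (c + 1))" unfolding F01_coeff_def[of "c + 2"] by (simp add: mult_ac)
  finally show ?thesis by simp
 qed
 have "(%k. \<rho> / (c * (c + 1)) * (F01_coeff (c + 2) k * \<rho> ^ k)) sums (\<rho> / (c * (c + 1)) * F01 (c + 2) \<rho>)" using sm[of "c + 2"] c by (intro sums_mult) auto
 moreover have "(%k. F01_coeff (c + 1) (Suc k) * \<rho> ^ Suc k) sums (F01 (c + 1) \<rho> - 1)" using sm[of "c + 1"] c by (subst sums_Suc_iff) (auto simp: F01_coeff_def)
 ultimately have "(%k. F01_coeff (c + 1) (Suc k) * \<rho> ^ Suc k + \<rho> / (c * (c + 1)) * (F01_coeff (c + 2) k * \<rho> ^ k)) sums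
  (F01 (c + 1) \<rho> - 1 + \<rho> / (c * (c + 1)) * F01 (c + 2) \<rho>)" by (intro sums_add)
 moreover have "F01_coeff (c + 1) (Suc k) * \<rho> ^ Suc k + \<rho> / (c * (c + 1)) * (F01_coeff (c + 2) k * \<rho> ^ k)
  = F01_coeff c (Suc k) * \<rho> ^ Suc k" for k unfolding coeff by (simp add: field_simps)
 ultimately have "(%k. F01_coeff c (Suc k) * \<rho> ^ Suc k) sums (F01 (c + 1) \<rho> - 1 + \<rho> / (c * (c + 1)) * F01 (c + 2) \<rho>)" by simp
 moreover have "(%k. F01_coeff c (Suc k) * \<rho> ^ Suc k) sums (F01 c \<rho> - 1)" using sm[OF c] by (subst sums_Suc_iff) (auto simp: F01_coeff_def)
 ultimately show ?thesis using sums_unique2 by fastforce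
qed

lemma F01_nonneg: "c > 0 ==> \<rho> >= 0 ==> F01 c \<rho> >= 0"
 unfolding F01_def by (intro suminf_nonneg F01_summable) (auto intro!: mult_nonneg_nonneg simp: less_imp_le[OF F01_coeff_pos])

lemma F01_0: "F01 c 0 = 1" unfolding F01_def using powser_zero[of "F01_coeff c"] by (simp add: F01_coeff_def)

text \<open>For \<open>c = 1 / 2\<close> the series is \<open>cosh (2 r)\<close>, whose terms are
  the even ones of the series of \<open>exp (2 r)\<close>. A larger \<open>c\<close> makes every
  coefficient smaller.\<close>

lemma F01_le_exp:
 assumes "c >= 1 / 2" "r >= 0"
 shows "F01 c (r^2) <= exp (2 * r)"
proof -
 have c: "c > 0" using assms by simp
 have poch: "pochhammer (1 / 2) k <= pochhammer c k" for k :: nat using assms by (induction k) (auto simp: pochhammer_Suc intro!: mult_mono pochhammer_nonneg)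
 have summ: "summable (%n. (2 * r) ^ n / fact n)" using summable_exp[of "2 * r"] by (simp add: field_simps)
 have "(\<Sum>k<m. F01_coeff c k * (r^2) ^ k) <= exp (2 * r)" for m
 proof -
  have "F01_coeff c k * (r^2) ^ k <= (2 * r) ^ (2 * k) / fact (2 * k)" for k
  proof -
   have "F01_coeff c k <= F01_coeff (1 / 2) k" unfolding F01_coeff_def using poch[of k] pochhammer_pos[of "1/2::real" k]
    by (intro divide_left_mono mult_left_mono mult_pos_pos) auto
   also have "... = 2 ^ (2 * k) / fact (2 * k)" unfolding F01_coeff_def fact_double by (simp add: field_simps)
   finally have "F01_coeff c k * (r^2) ^ k <= 2 ^ (2 * k) / fact (2 * k) * (r^2) ^ k" by (rule mult_right_mono) simp
   then show ?thesis by (simp add: power_mult_distrib power_mult)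
  qed
  then have "(\<Sum>k<m. F01_coeff c k * (r^2) ^ k) <= (\<Sum>k<m. (2 * r) ^ (2 * k) / fact (2 * k))" by (intro sum_mono)
  also have "... = (\<Sum>n\<in>(%k. 2 * k) ` {..<m}. (2 * r) ^ n / fact n)" by (subst sum.reindex) (auto simp: inj_on_def)
  also have "... <= (\<Sum>n. (2 * r) ^ n / fact n)" using assms by (intro sum_le_suminf summ) auto
  also have "... = exp (2 * r)" by (simp add: exp_def field_simps)
  finally show ?thesis .
 qed
 then show ?thesis unfolding F01_def by (intro suminf_le_const F01_summable c)
qed

text \<open>Parameters below \<open>1 / 2\<close> are reached from \<open>c + 1\<close> and
  \<open>c + 2\<close> by the contiguous relation, at the price of a polynomial factor. With
  \<open>r = l y z\<close> the exponential is exactly what completes the square of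
  \<open>y - z\<close> in the Gaussian.\<close>

lemma F01_bound:
 assumes c: "c > 0"
 obtains K where "K >= 0" "!!r. r >= 0 ==> F01 c (r^2) <= (1 + K * r^2) * exp (2 * r)"
proof
 show "1 / (c * (c + 1)) >= 0" using c by simp
 fix r :: real assume r: "r >= 0"
 have "F01 c (r^2) = F01 (c + 1) (r^2) + r^2 / (c * (c + 1)) * F01 (c + 2) (r^2)" by (rule F01_contiguous[OF c])
 also have "... <= exp (2 * r) + r^2 / (c * (c + 1)) * exp (2 * r)" using c r by (intro add_mono mult_left_mono F01_le_exp) auto
 finally show "F01 c (r^2) <= (1 + 1 / (c * (c + 1)) * r^2) * exp (2 * r)" by (simp add: algebra_simps)
qed

section \<open>Kernels with Gaussian decay off the diagonal\<close>

definition base_kernel :: "real => 'n::finite space => 'n space => real => real" where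
 "base_kernel c X Z l = exp (- (l * ((norm (fst X - fst Z))^2 + (snd X)^2 + (snd Z)^2)))
  * F01 c (l^2 * (snd X)^2 * (snd Z)^2)"

text \<open>These are the factors that differentiation in \<open>X\<close> and in \<open>l\<close>
  produces. \<open>snd X\<close> occurs only squared, which builds evenness in \<open>y\<close> into
  the class; \<open>snd Z\<close> may stand alone because the class is never differentiated in
  \<open>Z\<close>.\<close>

inductive multiplier :: "('n::finite space => 'n space => real => real) => bool" where
 "multiplier (%X Z l. k * l powr q)"
| "multiplier (%X Z l. fst X \<bullet> u)"
| "multiplier (%X Z l. fst Z \<bullet> u)"
| "multiplier (%X Z l. fst X \<bullet> fst Z)"
| "multiplier (%X Z l. fst X \<bullet> fst X)"
| "multiplier (%X Z l. fst Z \<bullet> fst Z)"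
| "multiplier (%X Z l. (snd X)^2)"
| "multiplier (%X Z l. snd Z)"

text \<open>The class is closed under derivatives in \<open>x\<close> and \<open>l\<close> and, up
  to a factor \<open>y\<close>, in \<open>y\<close>, and one Gaussian bound holds for all its
  members. Later estimates of derivatives therefore need no formula for them.\<close>

inductive nice :: "('n::finite space => 'n space => real => real) => bool" where
 nice_base: "c > 0 ==> nice (base_kernel c)"
| nice_add: "nice F ==> nice G ==> nice (%X Z l. F X Z l + G X Z l)"
| nice_mult: "multiplier m ==> nice F ==> nice (%X Z l. m X Z l * F X Z l)"

lemma nice_cmult: "nice F ==> nice (%X Z l. k * l powr q * F X Z l)" using nice_mult[OF multiplier.intros(1)] by blast

lemma nice_zero: "nice (%X Z l. 0 :: real)" using nice_cmult[OF nice_base[of 1], of 0] by simp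

lemma nice_derivative_x:
 assumes "nice F"
 shows "\<exists>F'. nice F' \<and> (\<forall>X Z l. l > 0 --> ((%h. F (X + h *\<^sub>R (u, 0)) Z l) has_real_derivative F' X Z l) (at 0))" using assms
proof (induction F rule: nice.induct)
 case (nice_base c)
 let ?F' = "%X Z l. (- 2) * l powr 1 * ((fst X \<bullet> u) * base_kernel c X Z l) + 2 * l powr 1 * ((fst Z \<bullet> u) * base_kernel c X Z l)"
 have "nice ?F'" by (intro nice_add nice_cmult nice_mult[OF multiplier.intros(2)] nice_mult[OF multiplier.intros(3)] nice.nice_base nice_base)
 moreover have "((%h. base_kernel c (X + h *\<^sub>R (u, 0)) Z l) has_real_derivative ?F' X Z l) (at 0)" if "l > 0" for X Z l
 proof -
  have eq: "(norm (fst (X + h *\<^sub>R (u, 0 :: real)) - fst Z))^2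
    = (norm (fst X - fst Z))^2 + 2 * h * ((fst X - fst Z) \<bullet> u) + h^2 * (u \<bullet> u)" for h
   unfolding power2_norm_eq_inner by (simp add: algebra_simps inner_simps inner_commute power2_eq_square)
  show ?thesis unfolding base_kernel_def eq using that by (auto intro!: derivative_eq_intros simp: algebra_simps inner_simps)
 qed
 ultimately show ?case by blast
next
 case (nice_add F G)
 then obtain F' G' where *: "nice F'" "nice G'"
  "!!X Z l. l > 0 ==> ((%h. F (X + h *\<^sub>R (u, 0)) Z l) has_real_derivative F' X Z l) (at 0)"
  "!!X Z l. l > 0 ==> ((%h. G (X + h *\<^sub>R (u, 0)) Z l) has_real_derivative G' X Z l) (at 0)" by blast
 show ?case by (rule exI[of _ "%X Z l. F' X Z l + G' X Z l"]) (use * in \<open>auto intro!: nice.nice_add DERIV_add\<close>)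
next
 case (nice_mult m F)
 then obtain F' where F': "nice F'"
  "!!X Z l. l > 0 ==> ((%h. F (X + h *\<^sub>R (u, 0)) Z l) has_real_derivative F' X Z l) (at 0)" by blast
 have "\<exists>m'. nice (%X Z l. m' X Z l * F X Z l) \<and> (\<forall>X Z l. l > 0 --> ((%h. m (X + h *\<^sub>R (u, 0)) Z l) has_real_derivative m' X Z l) (at 0))"
  using nice_mult(1)
 proof cases
  case (2 v)
  show ?thesis unfolding 2
  proof (intro exI[of _ "%X Z l. (u \<bullet> v) * l powr 0"] conjI allI impI nice_cmult nice_mult(2))
   show "((%h. fst (X + h *\<^sub>R (u, 0)) \<bullet> v) has_real_derivative (u \<bullet> v) * l powr 0) (at 0)" if "l > 0" for X :: "'a space" and l
    using that by (auto intro!: derivative_eq_intros simp: inner_simps)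
  qed
 next
  case 4
  show ?thesis unfolding 4
  proof (intro exI[of _ "%X Z l. fst Z \<bullet> u"] conjI allI impI nice.nice_mult[OF multiplier.intros(3)] nice_mult(2))
   show "((%h. fst (X + h *\<^sub>R (u, 0)) \<bullet> fst Z) has_real_derivative fst Z \<bullet> u) (at 0)" for X Z :: "'a space"
    by (auto intro!: derivative_eq_intros simp: inner_simps inner_commute)
  qed
 next
  case 5
  have "((%h. (fst X + h *\<^sub>R u) \<bullet> (fst X + h *\<^sub>R u)) has_real_derivative fst X \<bullet> (2 *\<^sub>R u)) (at 0)" for X :: "'a space"
  proof -
   have "(fst X + h *\<^sub>R u) \<bullet> (fst X + h *\<^sub>R u) = fst X \<bullet> fst X + 2 * h * (fst X \<bullet> u) + h^2 * (u \<bullet> u)" for h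
    by (simp add: algebra_simps inner_simps inner_commute power2_eq_square)
   then show ?thesis by (auto intro!: derivative_eq_intros simp: inner_simps inner_commute)
  qed
  then show ?thesis unfolding 5 by (intro exI[of _ "%X Z l. fst X \<bullet> (2 *\<^sub>R u)"])
    (auto intro!: nice.nice_mult[OF multiplier.intros(2)] nice_mult(2) simp del: inner_scaleR_right)
 qed (auto intro!: exI[of _ "%X Z l. 0"] nice_zero)
 then obtain m' where m': "nice (%X Z l. m' X Z l * F X Z l)"
  "!!X Z l. l > 0 ==> ((%h. m (X + h *\<^sub>R (u, 0)) Z l) has_real_derivative m' X Z l) (at 0)" by blast
 show ?case
 proof (intro exI[of _ "%X Z l. m' X Z l * F X Z l + m X Z l * F' X Z l"] conjI allI impI)
  show "nice (%X Z l. m' X Z l * F X Z l + m X Z l * F' X Z l)" by (intro nice.nice_add m'(1) nice.nice_mult nice_mult(1) F'(1))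
  fix X Z :: "'a space" and l :: real assume l: "l > 0"
  show "((%h. m (X + h *\<^sub>R (u, 0)) Z l * F (X + h *\<^sub>R (u, 0)) Z l) has_real_derivative
   m' X Z l * F X Z l + m X Z l * F' X Z l) (at 0)" using DERIV_mult[OF m'(2)[OF l, of X Z] F'(2)[OF l, of X Z]] by (simp add: mult.commute zero_prod_def[symmetric])
 qed
qed

text \<open>The derivative in \<open>y = snd X\<close> is \<open>y\<close> times a kernel of the same class: all kernels are even in \<open>y\<close>.\<close>

lemma nice_derivative_y:
 assumes "nice F"
 shows "\<exists>F'. nice F' \<and> (\<forall>X Z l. l > 0 --> ((%h. F (X + h *\<^sub>R (0, 1)) Z l) has_real_derivative snd X * F' X Z l) (at 0))" using assms
proof (induction F rule: nice.induct)
 case (nice_base c)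
 let ?F' = "%X Z l. (- 2) * l powr 1 * base_kernel c X Z l + (2 / c) * l powr 2 * (snd Z * (snd Z * base_kernel (c + 1) X Z l))"
 have "nice ?F'" using nice_base by (intro nice_add nice_cmult nice_mult[OF multiplier.intros(8)] nice.nice_base) auto
 moreover have "((%h. base_kernel c (X + h *\<^sub>R (0, 1)) Z l) has_real_derivative snd X * ?F' X Z l) (at 0)" if "l > 0" for X Z l
 proof -
  show ?thesis unfolding base_kernel_def using that nice_base by (auto intro!: derivative_eq_intros simp: algebra_simps power2_eq_square powr_numeral)
 qed
 ultimately show ?case by blast
next
 case (nice_add F G)
 then obtain F' G' where *: "nice F'" "nice G'"
  "!!X Z l. l > 0 ==> ((%h. F (X + h *\<^sub>R (0, 1)) Z l) has_real_derivative snd X * F' X Z l) (at 0)"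
  "!!X Z l. l > 0 ==> ((%h. G (X + h *\<^sub>R (0, 1)) Z l) has_real_derivative snd X * G' X Z l) (at 0)" by blast
 show ?case by (rule exI[of _ "%X Z l. F' X Z l + G' X Z l"]) (use * in \<open>auto intro!: nice.nice_add DERIV_add simp: distrib_left\<close>)
next
 case (nice_mult m F)
 then obtain F' where F': "nice F'"
  "!!X Z l. l > 0 ==> ((%h. F (X + h *\<^sub>R (0, 1)) Z l) has_real_derivative snd X * F' X Z l) (at 0)" by blast
 have "\<exists>m'. nice (%X Z l. m' X Z l * F X Z l) \<and> (\<forall>X Z l. l > 0 --> ((%h. m (X + h *\<^sub>R (0, 1)) Z l) has_real_derivative snd X * m' X Z l) (at 0))"
  using nice_mult(1)
 proof cases
  case 7
  show ?thesis unfolding 7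
  proof (intro exI[of _ "%X Z l. 2 * l powr 0"] conjI allI impI nice_cmult nice_mult(2))
   show "((%h. (snd (X + h *\<^sub>R (0, 1)))^2) has_real_derivative snd X * (2 * l powr 0)) (at 0)" if "l > 0" for X :: "'a space" and l
    using that by (auto intro!: derivative_eq_intros)
  qed
 qed (auto intro!: exI[of _ "%X Z l. 0"] nice_zero)
 then obtain m' where m': "nice (%X Z l. m' X Z l * F X Z l)"
  "!!X Z l. l > 0 ==> ((%h. m (X + h *\<^sub>R (0, 1)) Z l) has_real_derivative snd X * m' X Z l) (at 0)" by blast
 show ?case
 proof (intro exI[of _ "%X Z l. m' X Z l * F X Z l + m X Z l * F' X Z l"] conjI allI impI)
  show "nice (%X Z l. m' X Z l * F X Z l + m X Z l * F' X Z l)" by (intro nice.nice_add m'(1) nice.nice_mult nice_mult(1) F'(1))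
  fix X Z :: "'a space" and l :: real assume l: "l > 0"
  show "((%h. m (X + h *\<^sub>R (0, 1)) Z l * F (X + h *\<^sub>R (0, 1)) Z l) has_real_derivative
   snd X * (m' X Z l * F X Z l + m X Z l * F' X Z l)) (at 0)"
   using DERIV_mult[OF m'(2)[OF l, of X Z] F'(2)[OF l, of X Z]] by (simp add: algebra_simps zero_prod_def[symmetric])
 qed
qed

lemma nice_derivative_l:
 assumes "nice F"
 shows "\<exists>F'. nice F' \<and> (\<forall>X Z l. l > 0 --> ((%l. F X Z l) has_real_derivative F' X Z l) (at l))" using assms
proof (induction F rule: nice.induct)
 case (nice_base c)
 let ?B = "base_kernel c :: 'a space => 'a space => real => real"
 let ?F' = "%X Z l. (- 1) * l powr 0 * ((fst X \<bullet> fst X) * ?B X Z l) + (2 * l powr 0 * ((fst X \<bullet> fst Z) * ?B X Z l)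
   + ((- 1) * l powr 0 * ((fst Z \<bullet> fst Z) * ?B X Z l) + ((- 1) * l powr 0 * ((snd X)^2 * ?B X Z l) + ((- 1) * l powr 0 * (snd Z * (snd Z * ?B X Z l))
   + (2 / c) * l powr 1 * ((snd X)^2 * (snd Z * (snd Z * base_kernel (c + 1) X Z l)))))))"
 have "nice ?F'" using nice_base by (intro nice_add nice_cmult nice_mult[OF multiplier.intros(8)] nice_mult[OF multiplier.intros(7)]
   nice_mult[OF multiplier.intros(6)] nice_mult[OF multiplier.intros(5)] nice_mult[OF multiplier.intros(4)] nice.nice_base) auto
 moreover have "((%l. ?B X Z l) has_real_derivative ?F' X Z l) (at l)" if l: "l > 0" for X Z l
 proof -
  have eq: "(norm (fst X - fst Z))^2 = fst X \<bullet> fst X - 2 * (fst X \<bullet> fst Z) + fst Z \<bullet> fst Z"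
   unfolding power2_norm_eq_inner by (simp add: algebra_simps inner_simps inner_commute)
  show ?thesis unfolding base_kernel_def eq using l nice_base by (auto intro!: derivative_eq_intros simp: algebra_simps power2_eq_square)
 qed
 ultimately show ?case by blast
next
 case (nice_add F G)
 then obtain F' G' where *: "nice F'" "nice G'"
  "!!X Z l. l > 0 ==> ((%l. F X Z l) has_real_derivative F' X Z l) (at l)"
  "!!X Z l. l > 0 ==> ((%l. G X Z l) has_real_derivative G' X Z l) (at l)" by blast
 show ?case by (rule exI[of _ "%X Z l. F' X Z l + G' X Z l"]) (use * in \<open>auto intro!: nice.nice_add DERIV_add\<close>)
next
 case (nice_mult m F)
 then obtain F' where F': "nice F'"
  "!!X Z l. l > 0 ==> ((%l. F X Z l) has_real_derivative F' X Z l) (at l)" by blast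
 have "\<exists>m'. nice (%X Z l. m' X Z l * F X Z l) \<and> (\<forall>X Z l. l > 0 --> ((%l. m X Z l) has_real_derivative m' X Z l) (at l))" using nice_mult(1)
 proof cases
  case (1 k q)
  show ?thesis unfolding 1
  proof (intro exI[of _ "%X Z l. (k * q) * l powr (q - 1)"] conjI allI impI nice_cmult nice_mult(2))
   show "((%l. k * l powr q) has_real_derivative (k * q) * l powr (q - 1)) (at l)" if "l > 0" for l using that by (auto intro!: derivative_eq_intros)
  qed
 qed (auto intro!: exI[of _ "%X Z l. 0"] nice_zero)
 then obtain m' where m': "nice (%X Z l. m' X Z l * F X Z l)"
  "!!X Z l. l > 0 ==> ((%l. m X Z l) has_real_derivative m' X Z l) (at l)" by blast
 show ?case
 proof (intro exI[of _ "%X Z l. m' X Z l * F X Z l + m X Z l * F' X Z l"] conjI allI impI)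
  show "nice (%X Z l. m' X Z l * F X Z l + m X Z l * F' X Z l)" by (intro nice.nice_add m'(1) nice.nice_mult nice_mult(1) F'(1))
  fix X Z :: "'a space" and l :: real assume l: "l > 0"
  show "((%l. m X Z l * F X Z l) has_real_derivative m' X Z l * F X Z l + m X Z l * F' X Z l) (at l)"
   using DERIV_mult[OF m'(2)[OF l, of X Z] F'(2)[OF l, of X Z]] by (simp add: mult.commute)
 qed
qed

lemma nice_continuous:
 fixes F :: "'n::finite space => 'n space => real => real"
 assumes "nice F"
 shows "continuous_on (UNIV \<times> UNIV \<times> {0<..}) (%(X, Z, l). F X Z l)" using assms
proof (induction F rule: nice.induct)
 case (nice_base c)
 then show ?case unfolding base_kernel_def case_prod_beta by (intro continuous_intros) auto
next
 case (nice_add F G)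
 then show ?case unfolding case_prod_beta by (intro continuous_intros)
next
 case (nice_mult m F)
 from nice_mult(1) have "continuous_on (UNIV \<times> UNIV \<times> {0<..}) (%(X, Z, l). m X Z l)" by cases (auto simp: case_prod_beta intro!: continuous_intros)
 then show ?case using nice_mult(3) unfolding case_prod_beta by (intro continuous_intros)
qed

text \<open>The growth \<open>exp (2 l y z)\<close> of \<open>F01\<close>, for \<open>y\<close> and
  \<open>z\<close> not negative, turns the Gaussian in \<open>|x - \<xi>|^2 + y^2 + z^2\<close> into
  one in the squared distance of \<open>X\<close> and \<open>Z\<close>. Multipliers cost only powers
  of \<open>l\<close>, because \<open>X\<close> and \<open>Z\<close> are bounded and
  \<open>l\<close> is bounded below.\<close>

lemma nice_bound:
 fixes F :: "'n::finite space => 'n space => real => real"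
 assumes "nice F" and l0: "l0 > 0"
 shows "\<exists>C N. C >= 0 \<and> (\<forall>X Z l. norm X <= R --> norm Z <= R --> snd X >= 0 --> snd Z >= 0 --> l >= l0 -->
  \<bar>F X Z l\<bar> <= C * l ^ N * exp (- (l * (norm (X - Z))^2)))" using assms(1)
proof (induction F rule: nice.induct)
 have raise: "l ^ M <= (1 / l0) ^ (N - M) * l ^ N" if "M <= N" "l >= l0" for l M N
 proof -
  have "1 <= (l / l0) ^ (N - M)" using that l0 by (intro one_le_power) simp
  then have "l ^ M * 1 <= l ^ M * (l / l0) ^ (N - M)" using that l0 by (intro mult_left_mono) auto
  also have "... = (1 / l0) ^ (N - M) * (l ^ M * l ^ (N - M))" by (simp add: power_divide)
  also have "l ^ M * l ^ (N - M) = l ^ N" using that by (simp flip: power_add)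
  finally show ?thesis by simp
 qed
 have nb: "norm (fst X) <= R" "\<bar>snd X\<bar> <= R" if "norm X <= R" for X :: "'n space" using that norm_fst_le[of "fst X" "snd X"] norm_snd_le[of "snd X" "fst X"] by auto
 have nb': "norm (fst X) <= \<bar>R\<bar>" if "norm X <= R" for X :: "'n space" using nb(1)[OF that] by simp
 {
  case (nice_base c)
  obtain K where K: "K >= 0" "!!r. r >= 0 ==> F01 c (r^2) <= (1 + K * r^2) * exp (2 * r)" by (rule F01_bound[OF nice_base]) (rule that; blast)
  show ?case
  proof (intro exI[of _ "(1 / l0)^2 + K * (R * R)^2"] exI[of _ 2] conjI allI impI)
   fix X Z :: "'n space" and l :: real
   assume *: "norm X <= R" "norm Z <= R" "snd X >= 0" "snd Z >= 0" "l >= l0"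
   let ?r = "l * (snd X * snd Z)"
   have l: "l > 0" using * l0 by simp
   have r0: "?r >= 0" using * l by simp
   have Q: "(norm (X - Z))^2 = (norm (fst X - fst Z))^2 + (snd X)^2 + (snd Z)^2 - 2 * (snd X * snd Z)"
    unfolding power2_norm_eq_inner by (simp add: inner_prod_def power2_eq_square algebra_simps)
   have yz: "snd X * snd Z <= R * R" using nb[OF *(1)] nb[OF *(2)] * by (intro mult_mono) auto
   have "1 + K * ?r\<^sup>2 <= (1 / l0)^2 * l^2 + K * (l * (R * R))^2" using raise[of 0 2 l] * yz l K(1) by (intro add_mono mult_left_mono power_mono) auto
   also have "... = ((1 / l0)^2 + K * (R * R)^2) * l^2" by (simp add: algebra_simps power2_eq_square)
   finally have p: "1 + K * ?r\<^sup>2 <= ((1 / l0)^2 + K * (R * R)^2) * l^2" .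
   have "base_kernel c X Z l = exp (- (l * ((norm (fst X - fst Z))^2 + (snd X)^2 + (snd Z)^2))) * F01 c (?r\<^sup>2)"
    unfolding base_kernel_def by (simp add: power_mult_distrib mult.assoc)
   also have "... <= exp (- (l * ((norm (fst X - fst Z))^2 + (snd X)^2 + (snd Z)^2))) * ((1 + K * ?r\<^sup>2) * exp (2 * ?r))" using K(2)[OF r0] by (intro mult_left_mono) auto
   also have "... = (1 + K * ?r\<^sup>2) * exp (- (l * (norm (X - Z))^2))" unfolding Q by (simp add: mult_exp_exp algebra_simps)
   also have "... <= ((1 / l0)^2 + K * (R * R)^2) * l^2 * exp (- (l * (norm (X - Z))^2))" using p by (intro mult_right_mono) auto
   finally show "\<bar>base_kernel c X Z l\<bar> <= ((1 / l0)^2 + K * (R * R)^2) * l^2 * exp (- (l * (norm (X - Z))^2))"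
    using F01_nonneg[OF nice_base, of "l^2 * (snd X)^2 * (snd Z)^2"] by (simp add: base_kernel_def)
  qed (use K in auto)
 next
  case (nice_add F G)
  obtain C M where F: "C >= 0" "!!X Z l. norm X <= R ==> norm Z <= R ==> snd X >= 0 ==> snd Z >= 0 ==> l >= l0 ==>
   \<bar>F X Z l\<bar> <= C * l ^ M * exp (- (l * (norm (X - Z))^2))" using nice_add(3) by blast
  obtain D N where G: "D >= 0" "!!X Z l. norm X <= R ==> norm Z <= R ==> snd X >= 0 ==> snd Z >= 0 ==> l >= l0 ==>
   \<bar>G X Z l\<bar> <= D * l ^ N * exp (- (l * (norm (X - Z))^2))" using nice_add(4) by blast
  show ?case
  proof (intro exI[of _ "C * (1 / l0) ^ (M + N - M) + D * (1 / l0) ^ (M + N - N)"] exI[of _ "M + N"] conjI allI impI)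
   fix X Z :: "'n space" and l :: real
   assume *: "norm X <= R" "norm Z <= R" "snd X >= 0" "snd Z >= 0" "l >= l0"
   let ?e = "exp (- (l * (norm (X - Z))^2))"
   have "\<bar>F X Z l + G X Z l\<bar> <= C * l ^ M * ?e + D * l ^ N * ?e" using F(2)[OF *] G(2)[OF *] by linarith
   also have "... <= C * ((1 / l0) ^ (M + N - M) * l ^ (M + N)) * ?e + D * ((1 / l0) ^ (M + N - N) * l ^ (M + N)) * ?e"
    using *(5) F(1) G(1) by (intro add_mono mult_right_mono mult_left_mono raise) auto
   finally show "\<bar>F X Z l + G X Z l\<bar> <= (C * (1 / l0) ^ (M + N - M) + D * (1 / l0) ^ (M + N - N)) * l ^ (M + N) * ?e" by (simp add: algebra_simps)
  qed (use F(1) G(1) l0 in auto)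
 next
  case (nice_mult m F)
  obtain C M where F: "C >= 0" "!!X Z l. norm X <= R ==> norm Z <= R ==> snd X >= 0 ==> snd Z >= 0 ==> l >= l0 ==>
   \<bar>F X Z l\<bar> <= C * l ^ M * exp (- (l * (norm (X - Z))^2))" using nice_mult(3) by blast
  have inn: "\<bar>x \<bullet> y\<bar> <= a * b" if "norm x <= a" "norm y <= b" for x y :: "real ^ 'n" and a b
   using Cauchy_Schwarz_ineq2[of x y] mult_mono[OF that] norm_ge_zero[of x] norm_ge_zero[of y] that by (meson norm_ge_zero order_trans)
  have "\<exists>D N. D >= 0 \<and> (\<forall>X Z l. norm X <= R --> norm Z <= R --> l >= l0 --> \<bar>m X Z l\<bar> <= D * l ^ N)" using nice_mult(1)
  proof cases
   case (1 k q)
   obtain N :: nat where N: "q <= real N" using real_arch_simple by blast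
   have "\<bar>k * l powr q\<bar> <= \<bar>k\<bar> * l0 powr (q - N) * l ^ N" if "l >= l0" for l
   proof -
    have "l powr q = l powr (q - N) * l powr N" by (simp flip: powr_add)
    \<comment> \<open>The exponent \<open>q - N\<close> is not positive, so the power is largest at
      \<open>l0\<close>.\<close>
    also have "... <= l0 powr (q - N) * l powr N" using that N l0 by (intro mult_right_mono powr_mono2') auto
    also have "l powr N = l ^ N" using that l0 by (simp add: powr_realpow)
    finally show ?thesis by (auto simp: abs_mult mult.assoc intro!: mult_left_mono)
   qed
   then show ?thesis unfolding 1 by (intro exI[of _ "\<bar>k\<bar> * l0 powr (q - N)"] exI[of _ N]) auto
  next
   case (2 u)
   then show ?thesis using inn[OF nb' order_refl, of _ u] by (intro exI[of _ "\<bar>R\<bar> * norm u"] exI[of _ 0] conjI allI impI) simp_all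
  next
   case (3 u)
   then show ?thesis using inn[OF nb' order_refl, of _ u] by (intro exI[of _ "\<bar>R\<bar> * norm u"] exI[of _ 0] conjI allI impI) simp_all
  next
   case 4
   then show ?thesis using inn[OF nb(1) nb(1)] by (intro exI[of _ "R * R"] exI[of _ 0] conjI allI impI) simp_all
  next
   case 5
   have "fst X \<bullet> fst X <= R * R" if "norm X <= R" for X :: "'n space" using inn[OF nb(1)[OF that] nb(1)[OF that]] by linarith
   with 5 show ?thesis by (intro exI[of _ "R * R"] exI[of _ 0] conjI allI impI) simp_all
  next
   case 6
   have "fst X \<bullet> fst X <= R * R" if "norm X <= R" for X :: "'n space" using inn[OF nb(1)[OF that] nb(1)[OF that]] by linarith
   with 6 show ?thesis by (intro exI[of _ "R * R"] exI[of _ 0] conjI allI impI) simp_all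
  next
   case 7
   have "\<bar>(snd X)\<^sup>2\<bar> <= R * R" if "norm X <= R" for X :: "'n space"
    using mult_mono[OF nb(2)[OF that] nb(2)[OF that]] that norm_ge_zero[of X] by (simp add: power2_eq_square)
   then show ?thesis unfolding 7 by (intro exI[of _ "R * R"] exI[of _ 0] conjI allI impI) simp_all
  next
   case 8
   then show ?thesis using nb(2) by (intro exI[of _ "\<bar>R\<bar>"] exI[of _ 0] conjI allI impI) (simp_all, force)
  qed
  then obtain D N where m: "D >= 0" "!!X Z l. norm X <= R ==> norm Z <= R ==> l >= l0 ==> \<bar>m X Z l\<bar> <= D * l ^ N" by blast
  show ?case
  proof (intro exI[of _ "D * C"] exI[of _ "N + M"] conjI allI impI)
   fix X Z :: "'n space" and l :: real
   assume *: "norm X <= R" "norm Z <= R" "snd X >= 0" "snd Z >= 0" "l >= l0"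
   have "\<bar>m X Z l * F X Z l\<bar> <= (D * l ^ N) * (C * l ^ M * exp (- (l * (norm (X - Z))^2)))" unfolding abs_mult using m * F l0 by (intro mult_mono F(2) m(2)) auto
   then show "\<bar>m X Z l * F X Z l\<bar> <= D * C * l ^ (N + M) * exp (- (l * (norm (X - Z))^2))" by (simp add: power_add mult_ac)
  qed (use m F in auto)
 }
qed

section \<open>The heat kernel\<close>

text \<open>The function \<open>F01\<close> replaces the Bessel function \<open>I\<close> of order \<open>c - 1\<close>, which would bring in singular powers of \<open>y\<close> and \<open>z\<close>:
 \<open>0F1 (c; w\<^sup>2 / 4) = \<Gamma>(c) (w / 2)\<^bsup>1 - c\<^esup> I(w)\<close>, here with \<open>w = 2 l y z\<close>. Gradient and Hessian are taken in \<open>Z\<close>.\<close>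

definition gk :: "real => real => 'n::finite space => 'n space => real => real" where
 "gk m c X Z l = l powr m * base_kernel c X Z l"

definition gk_grad :: "real => real => 'n::finite space => 'n space => real => 'n space" where
 "gk_grad m c X Z l = ((2 * l * gk m c X Z l) *\<^sub>R (fst X - fst Z),
  snd Z * (- 2 * l * gk m c X Z l + 2 * l^2 * (snd X)^2 / c * gk m (c + 1) X Z l))"

text \<open>The second derivative along a basis vector \<open>v\<close>. Mixed terms are left out,
  since one of the two components of such a \<open>v\<close> is 0.\<close>

definition gk_hess :: "real => real => 'n::finite space => 'n space => 'n space => real => real" where
 "gk_hess m c v X Z l = (4 * l^2 * ((fst X - fst Z) \<bullet> fst v)^2 - 2 * l * (fst v \<bullet> fst v)) * gk m c X Z l
  + (snd v)^2 * (- 2 * l * gk m c X Z l - 2 * l * snd Z * snd (gk_grad m c X Z l)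
   + 2 * l^2 * (snd X)^2 / c * gk m (c + 1) X Z l
   + 2 * l^2 * (snd X)^2 * snd Z / c * snd (gk_grad m (c + 1) X Z l))"

definition gk_l :: "real => real => 'n::finite space => 'n space => real => real" where
 "gk_l m c X Z l = (m / l - ((norm (fst X - fst Z))^2 + (snd X)^2 + (snd Z)^2)) * gk m c X Z l
  + 2 * l * (snd X)^2 * (snd Z)^2 / c * gk m (c + 1) X Z l"

lemma gk_deriv_Z:
 fixes X Z :: "'n::finite space"
 assumes c: "c > 0"
 shows "((%h. gk m c X (Z + h *\<^sub>R v) l) has_real_derivative gk_grad m c X Z l \<bullet> v) (at 0)"
proof -
 have eq: "(norm (fst X - fst (Z + h *\<^sub>R v)))^2
   = (norm (fst X - fst Z))^2 - 2 * h * ((fst X - fst Z) \<bullet> fst v) + h^2 * (fst v \<bullet> fst v)" for h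
  unfolding power2_norm_eq_inner by (simp add: algebra_simps inner_simps inner_commute power2_eq_square)
 show ?thesis unfolding gk_def base_kernel_def eq gk_grad_def inner_prod_def using c by (auto intro!: derivative_eq_intros simp: algebra_simps inner_simps power2_eq_square)
qed

lemma gk_grad_deriv:
 fixes X Z v :: "'n::finite space"
 assumes c: "c > 0" and v: "v \<in> Basis"
 shows "((%h. gk_grad m c X (Z + h *\<^sub>R v) l \<bullet> v) has_real_derivative gk_hess m c v X Z l) (at 0)"
proof -
 have gg: "((%h. gk m d X (Z + h *\<^sub>R v) l) has_real_derivative gk_grad m d X Z l \<bullet> v) (at 0)" if "d > 0" for d by (rule gk_deriv_Z[OF that])
 from v consider u where "v = (u, 0)" | "v = (0, 1)" by (auto simp: Basis_prod_def)
 then show ?thesis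
 proof cases
  case 1
  have eq: "gk_grad m c X (Z + h *\<^sub>R v) l \<bullet> v = 2 * l * gk m c X (Z + h *\<^sub>R v) l * ((fst X - fst Z) \<bullet> u - h * (u \<bullet> u))" for h
   unfolding gk_grad_def 1 by (simp add: inner_simps algebra_simps)
  have "((%h. 2 * l * gk m c X (Z + h *\<^sub>R v) l * ((fst X - fst Z) \<bullet> u - h * (u \<bullet> u))) has_real_derivative
   2 * l * (gk_grad m c X Z l \<bullet> v) * ((fst X - fst Z) \<bullet> u) + 2 * l * gk m c X Z l * (- (u \<bullet> u))) (at 0)"
   by (rule derivative_eq_intros gg[OF c] refl)+ simp
  moreover have "2 * l * (gk_grad m c X Z l \<bullet> v) * ((fst X - fst Z) \<bullet> u) + 2 * l * gk m c X Z l * (- (u \<bullet> u)) = gk_hess m c v X Z l"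
   unfolding gk_hess_def gk_grad_def 1 by (simp add: inner_simps algebra_simps power2_eq_square)
  ultimately show ?thesis unfolding eq by simp
 next
  case 2
  have eq: "gk_grad m c X (Z + h *\<^sub>R v) l \<bullet> v = (snd Z + h) * (- 2 * l * gk m c X (Z + h *\<^sub>R v) l + 2 * l^2 * (snd X)^2 / c * gk m (c + 1) X (Z + h *\<^sub>R v) l)" for h
   unfolding gk_grad_def 2 by simp
  have "((%h. (snd Z + h) * (- 2 * l * gk m c X (Z + h *\<^sub>R v) l + 2 * l^2 * (snd X)^2 / c * gk m (c + 1) X (Z + h *\<^sub>R v) l)) has_real_derivative
   1 * (- 2 * l * gk m c X Z l + 2 * l^2 * (snd X)^2 / c * gk m (c + 1) X Z l)
   + snd Z * (- 2 * l * (gk_grad m c X Z l \<bullet> v) + 2 * l^2 * (snd X)^2 / c * (gk_grad m (c + 1) X Z l \<bullet> v))) (at 0)"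
   using c by - (rule derivative_eq_intros gg refl | simp)+
  moreover have "1 * (- 2 * l * gk m c X Z l + 2 * l^2 * (snd X)^2 / c * gk m (c + 1) X Z l)
   + snd Z * (- 2 * l * (gk_grad m c X Z l \<bullet> v) + 2 * l^2 * (snd X)^2 / c * (gk_grad m (c + 1) X Z l \<bullet> v)) = gk_hess m c v X Z l"
   unfolding gk_hess_def 2 by (simp add: inner_prod_def algebra_simps)
  ultimately show ?thesis unfolding eq by simp
 qed
qed

lemma gk_deriv_l:
 assumes c: "c > 0" and l: "l > 0"
 shows "((%l. gk m c X Z l) has_real_derivative gk_l m c X Z l) (at l)"
proof -
 have "l powr (m - 1) = l powr m / l" using l by (simp add: powr_diff)
 then show ?thesis unfolding gk_def base_kernel_def gk_l_def using c l by (auto intro!: derivative_eq_intros simp: algebra_simps power2_eq_square)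
qed

lemma sum_Basis_prod:
 fixes f :: "'a::euclidean_space \<times> 'b::euclidean_space => real"
 shows "sum f Basis = (\<Sum>i\<in>Basis. f (i, 0)) + (\<Sum>i\<in>Basis. f (0, i))"
proof -
 have "inj_on (%u. (u::'a, 0::'b)) Basis" "inj_on (%u. (0::'a, u::'b)) Basis" by (auto intro!: inj_onI)
 then show ?thesis unfolding Basis_prod_def by (subst sum.union_disjoint) (auto simp: sum.reindex)
qed

text \<open>Since \<open>l = 1 / (4 (t - \<tau>))\<close> has the \<open>\<tau>\<close>-derivative
  \<open>4 l^2\<close>, this is the backward equation in \<open>(Z, \<tau>)\<close>, with
  \<open>2 c - 1 = a\<close> from the weight. After sorting, the multiples of \<open>l\<close>
  cancel through \<open>4 m = 2 n + 4 c\<close>, and what is left is the contiguous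
  relation.\<close>

lemma gk_heat_equation:
 fixes X Z :: "'n::finite space"
 assumes c: "c > 0" and l: "l > 0" and z: "snd Z ~= 0" and m: "m = real CARD('n) / 2 + c"
 shows "4 * l^2 * gk_l m c X Z l + (\<Sum>v\<in>Basis. gk_hess m c v X Z l) + (2 * c - 1) / snd Z * snd (gk_grad m c X Z l) = 0"
proof -
 define g0 g1 g2 where "g0 = gk m c X Z l" "g1 = gk m (c + 1) X Z l" "g2 = gk m (c + 2) X Z l"
 define y z N where "y = snd X" "z = snd Z" "N = (norm (fst X - fst Z))^2"
 have g: "g0 = g1 + l^2 * y^2 * z^2 / (c * (c + 1)) * g2" unfolding g0_g1_g2_def y_z_N_def gk_def base_kernel_def by (subst F01_contiguous[OF c]) (simp add: algebra_simps)
 have s1: "(\<Sum>i\<in>Basis. ((fst X - fst Z) \<bullet> i)\<^sup>2) = N" unfolding y_z_N_def power2_norm_eq_inner by (subst euclidean_inner) (simp add: power2_eq_square)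
 have s2: "(\<Sum>i\<in>(Basis :: (real ^ 'n) set). i \<bullet> i) = real CARD('n)" by (simp add: inner_same_Basis)
 have h1: "(\<Sum>v\<in>Basis. gk_hess m c v X Z l)
  = (\<Sum>i\<in>(Basis :: (real ^ 'n) set). (4 * l^2 * ((fst X - fst Z) \<bullet> i)^2 - 2 * l * (i \<bullet> i)) * g0)
   + (- 2 * l * g0 - 2 * l * z * (z * (- 2 * l * g0 + 2 * l^2 * y^2 / c * g1))
   + 2 * l^2 * y^2 / c * g1
   + 2 * l^2 * y^2 * z / c * (z * (- 2 * l * g1 + 2 * l^2 * y^2 / (c + 1) * g2)))"
  unfolding gk_hess_def gk_grad_def g0_g1_g2_def y_z_N_def by (subst sum_Basis_prod) (simp add: add.assoc inner_same_Basis)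
 have h2: "(\<Sum>i\<in>(Basis :: (real ^ 'n) set). (4 * l^2 * ((fst X - fst Z) \<bullet> i)^2 - 2 * l * (i \<bullet> i)) * g0)
  = (4 * l^2 * N - 2 * l * real CARD('n)) * g0" unfolding sum_distrib_right[symmetric] sum_subtractf sum_distrib_left[symmetric] s1 s2 ..
 note h = h1[unfolded h2]
 have gl: "gk_l m c X Z l = (m / l - (N + y^2 + z^2)) * g0 + 2 * l * y^2 * z^2 / c * g1" unfolding gk_l_def g0_g1_g2_def y_z_N_def ..
 have gr: "(2 * c - 1) / snd Z * snd (gk_grad m c X Z l) = (2 * c - 1) * (- 2 * l * g0 + 2 * l^2 * y^2 / c * g1)" using z unfolding gk_grad_def g0_g1_g2_def y_z_N_def by simp
 \<comment> \<open>In these unknowns the identity contains no division, so it becomes a polynomial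
   identity.\<close>
 define k1 k2 q where "k1 = g1 / c" "k2 = g2 / (c * (c + 1))" "q = m / l"
 have k: "g1 = c * k1" "g2 / (c + 1) = c * k2" "g2 = c * ((c + 1) * k2)" "l * q = real CARD('n) / 2 + c" using c l m by (auto simp: k1_k2_q_def)
 have g': "g0 = c * k1 + l^2 * y^2 * z^2 * k2" using g c by (simp add: k1_k2_q_def)
 have "4 * l^2 * ((q - (N + y^2 + z^2)) * g0 + 2 * l * y^2 * z^2 * k1)
   + ((4 * l^2 * N - 2 * l * real CARD('n)) * g0
   + (- 2 * l * g0 - 2 * l * z * (z * (- 2 * l * g0 + 2 * l^2 * y^2 * k1))
   + 2 * l^2 * y^2 * k1
   + 2 * l^2 * y^2 * z * (z * (- 2 * l * k1 + 2 * l^2 * y^2 * k2))))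
   + (2 * c - 1) * (- 2 * l * g0 + 2 * l^2 * y^2 * k1)
   = 4 * l * (l * q) * g0 - 2 * l * real CARD('n) * g0 - 4 * l * c * g0
   + 4 * l^2 * y^2 * (c * k1 + l^2 * y^2 * z^2 * k2 - g0)" by algebra
 also have "... = 0" unfolding k(4) g'[symmetric] by (simp add: algebra_simps)
 finally have E: "4 * l^2 * ((q - (N + y^2 + z^2)) * g0 + 2 * l * y^2 * z^2 * k1)
   + ((4 * l^2 * N - 2 * l * real CARD('n)) * g0
   + (- 2 * l * g0 - 2 * l * z * (z * (- 2 * l * g0 + 2 * l^2 * y^2 * k1))
   + 2 * l^2 * y^2 * k1
   + 2 * l^2 * y^2 * z * (z * (- 2 * l * k1 + 2 * l^2 * y^2 * k2))))
   + (2 * c - 1) * (- 2 * l * g0 + 2 * l^2 * y^2 * k1) = 0" .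
 have d: "x / c * g1 = x * k1" "x / (c + 1) * g2 = x * (c * k2)" "x / c * (z * (- 2 * l * (c * k1) + w * (c * k2))) = x * (z * (- 2 * l * k1 + w * k2))" for x w
  using c by (auto simp: k(1,3) field_simps)
 show ?thesis unfolding h gl gr d k1_k2_q_def(3)[symmetric] k(1)[symmetric] unfolding k(1) d using E by simp
qed

lemma gk_nice: "c > 0 ==> nice (gk m c)" using nice_cmult[OF nice_base, of c 1 m] by (simp add: gk_def[abs_def])

lemma gk_nonneg: "c > 0 ==> gk m c X Z l >= 0" unfolding gk_def base_kernel_def by (intro mult_nonneg_nonneg F01_nonneg) auto

lemma continuous_on_gk[continuous_intros]:
 assumes "c > 0" "continuous_on S f" "continuous_on S g" "!!x. x \<in> S ==> g x > 0"
 shows "continuous_on S (%x. gk m c X (f x) (g x))"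
proof -
 have "!!x. x \<in> S ==> g x ~= 0" using assms(4) by force
 then show ?thesis unfolding gk_def base_kernel_def using assms(1-3) by (intro continuous_intros) auto
qed

lemma continuous_on_gk_grad[continuous_intros]:
 assumes "c > 0" "continuous_on S f" "continuous_on S g" "!!x. x \<in> S ==> g x > 0"
 shows "continuous_on S (%x. gk_grad m c X (f x) (g x))" unfolding gk_grad_def using assms by (intro continuous_intros) auto

lemma continuous_on_gk_l[continuous_intros]:
 assumes "c > 0" "continuous_on S f" "continuous_on S g" "!!x. x \<in> S ==> g x > 0"
 shows "continuous_on S (%x. gk_l m c X (f x) (g x))"
proof -
 have "!!x. x \<in> S ==> g x ~= 0" using assms(4) by force
 then show ?thesis unfolding gk_l_def using assms by (intro continuous_intros) auto
qed

lemma continuous_on_gk_hess[continuous_intros]: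
 assumes "c > 0" "continuous_on S f" "continuous_on S g" "!!x. x \<in> S ==> g x > 0"
 shows "continuous_on S (%x. gk_hess m c v X (f x) (g x))" unfolding gk_hess_def using assms by (intro continuous_intros) auto

text \<open>\<open>cut_space_grad\<close> is a multiple of \<open>Z\<close>, so only the radial part
  of the gradient of the kernel enters the representation. Being scalar, it stays within the class
  \<open>nice\<close>.\<close>

lemma gk_grad_nice:
 assumes c: "c > 0"
 shows "\<exists>F. nice F \<and> (\<forall>X (Z :: 'n::finite space) l. l > 0 --> F X Z l = Z \<bullet> gk_grad m c X Z l)"
proof (intro exI conjI allI impI)
 show "nice (%X Z l. 2 * l powr 1 * ((fst X \<bullet> fst Z) * gk m c X Z l) + ((- 2) * l powr 1 * ((fst Z \<bullet> fst Z) * gk m c X Z l)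
  + ((- 2) * l powr 1 * (snd Z * (snd Z * gk m c X Z l)) + (2 / c) * l powr 2 * ((snd X)^2 * (snd Z * (snd Z * gk m (c + 1) X Z l))))))"
  using c by (intro nice_add nice_cmult nice_mult[OF multiplier.intros(8)] nice_mult[OF multiplier.intros(7)]
   nice_mult[OF multiplier.intros(6)] nice_mult[OF multiplier.intros(4)] gk_nice) auto
 show "2 * l powr 1 * ((fst X \<bullet> fst Z) * gk m c X Z l) + ((- 2) * l powr 1 * ((fst Z \<bullet> fst Z) * gk m c X Z l)
  + ((- 2) * l powr 1 * (snd Z * (snd Z * gk m c X Z l)) + (2 / c) * l powr 2 * ((snd X)^2 * (snd Z * (snd Z * gk m (c + 1) X Z l)))))
  = Z \<bullet> gk_grad m c X Z l" if "l > 0" for X Z :: "'n space" and l :: real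
  using that by (simp add: gk_grad_def inner_prod_def inner_simps algebra_simps power2_eq_square powr_numeral inner_commute)
qed

section \<open>The truncated kernel as a test function\<close>

lemma AE_ex_open:
 fixes U :: "'a::euclidean_space set"
 assumes "AE p in lborel. P p" "open U" "U ~= {}"
 shows "\<exists>p\<in>U. P p"
proof (rule ccontr)
 assume "\<not> ?thesis"
 with assms(1) have "AE p in lborel. p \<notin> U" by (auto elim: AE_mp)
 then have "U \<in> null_sets lborel" using assms(2) by (intro AE_iff_null_sets[THEN iffD2]) auto
 then have "negligible U" by (simp add: negligible_iff_null_sets null_sets_completionI)
 then show False using open_not_negligible assms by blast
qed

lemma L2_weighted_integrable:
 fixes f k :: "'a::euclidean_space => 'b::euclidean_space"
 assumes f: "L2_weighted \<Omega> w f" and w: "set_integrable lborel \<Omega> w" "!!x. x \<in> \<Omega> ==> w x >= 0"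
  and k: "k \<in> borel_measurable borel" "!!x. x \<in> \<Omega> ==> norm (k x) <= C"
 shows "set_integrable lborel \<Omega> (%x. (f x \<bullet> k x) * w x)" unfolding set_integrable_def
proof (rule integrable_bound)
 have fm: "(%x. indicator \<Omega> x *\<^sub>R f x) \<in> borel_measurable lborel"
  and fi: "integrable lborel (%x. indicator \<Omega> x *\<^sub>R ((norm (f x))^2 * w x))" using f by (auto simp: L2_weighted_def set_integrable_def set_borel_measurable_def)
 have wi: "integrable lborel (%x. indicator \<Omega> x *\<^sub>R w x)" using w(1) by (simp add: set_integrable_def)
 show "integrable lborel (%x. \<bar>C\<bar> * (indicator \<Omega> x *\<^sub>R ((norm (f x))^2 * w x) + indicator \<Omega> x *\<^sub>R w x))"
  using fi wi by (intro integrable_mult_right integrable_add)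
 have "(%x. ((indicator \<Omega> x *\<^sub>R f x) \<bullet> k x) * (indicator \<Omega> x *\<^sub>R w x)) \<in> borel_measurable lborel"
  using fm k(1) borel_measurable_integrable[OF wi] by (intro borel_measurable_times borel_measurable_inner) auto
 then show "(%x. indicator \<Omega> x *\<^sub>R ((f x \<bullet> k x) * w x)) \<in> borel_measurable lborel"
  by (rule measurable_cong[THEN iffD1, rotated]) (auto simp: indicator_def)
 show "AE x in lborel. norm (indicator \<Omega> x *\<^sub>R ((f x \<bullet> k x) * w x))
   <= norm (\<bar>C\<bar> * (indicator \<Omega> x *\<^sub>R ((norm (f x))^2 * w x) + indicator \<Omega> x *\<^sub>R w x))" (is "AE x in _. ?P x")
 proof (rule AE_I2)
  fix x
  show "?P x"
  proof (cases "x \<in> \<Omega>")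
   case True
   have "0 <= (norm (f x) - 1)^2 + (norm (f x))^2 + 1" by simp
   then have n: "norm (f x) <= (norm (f x))^2 + 1" by (simp add: power2_diff)
   have "\<bar>f x \<bullet> k x\<bar> <= norm (f x) * norm (k x)" by (rule Cauchy_Schwarz_ineq2)
   also have "... <= ((norm (f x))^2 + 1) * \<bar>C\<bar>" using n k(2)[OF True] by (intro mult_mono) auto
   finally have "\<bar>f x \<bullet> k x\<bar> * w x <= ((norm (f x))^2 + 1) * \<bar>C\<bar> * w x" using w(2)[OF True] by (rule mult_right_mono)
   then show ?thesis using True w(2)[OF True] by (simp add: abs_mult algebra_simps)
  qed simp
 qed
qed

text \<open>A function of the squared norm is differentiable at the origin as well. It is 1 for
  \<open>(norm Z)^2 \<le> 2 r^2\<close> and 0 from \<open>3 r^2\<close> on, which leaves a gap both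
  to the half ball of radius \<open>r\<close> and to the sphere of radius
  \<open>2 r\<close>.\<close>

definition cut_space :: "real => 'n::finite space => real" where
 "cut_space r Z = step (3 - (norm Z)^2 / r^2)"

definition cut_space_grad :: "real => 'n::finite space => 'n space" where
 "cut_space_grad r Z = (step' (3 - (norm Z)^2 / r^2) * (- 2 / r^2)) *\<^sub>R Z"

definition cut_time :: "real => real => real" where
 "cut_time r \<tau> = step (3 + \<tau> / r^2)"

definition cut_time' :: "real => real => real" where
 "cut_time' r \<tau> = step' (3 + \<tau> / r^2) / r^2"

text \<open>0 for time differences up to \<open>e\<close> and 1 from \<open>2 e\<close> on. The
  derivative is thus a probability density on \<open>[e, 2 e]\<close>, which makes the term that
  contains it an approximate identity as \<open>e\<close> tends to 0.\<close>

definition cut_pole :: "real => real => real" where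
 "cut_pole e \<sigma> = step (\<sigma> / e - 1)"

definition cut_pole' :: "real => real => real" where
 "cut_pole' e \<sigma> = step' (\<sigma> / e - 1) / e"

lemma cut_space_deriv: "((%h. cut_space r (Z + h *\<^sub>R v)) has_real_derivative cut_space_grad r Z \<bullet> v) (at 0)"
proof -
 have eq: "(norm (Z + h *\<^sub>R v))^2 = (norm Z)^2 + 2 * h * (Z \<bullet> v) + h^2 * (v \<bullet> v)" for h
  unfolding power2_norm_eq_inner by (simp add: algebra_simps inner_simps inner_commute power2_eq_square)
 define k where "k = 1 / r^2"
 have k: "x / r^2 = x * k" for x by (simp add: k_def)
 show ?thesis unfolding cut_space_def eq cut_space_grad_def k by (auto intro!: derivative_eq_intros simp: inner_simps)
qed

lemma continuous_on_cut[continuous_intros]: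
 assumes "continuous_on S f"
 shows "r ~= 0 ==> continuous_on S (%x. cut_space r (f x))" "r ~= 0 ==> continuous_on S (%x. cut_space_grad r (f x))"
 using assms by (auto simp: cut_space_def[abs_def] cut_space_grad_def[abs_def] intro!: continuous_intros)

lemma continuous_on_cut_time[continuous_intros]:
 assumes "continuous_on S f"
 shows "r ~= 0 ==> continuous_on S (%x. cut_time r (f x))" "r ~= 0 ==> continuous_on S (%x. cut_time' r (f x))"
  "e ~= 0 ==> continuous_on S (%x. cut_pole e (f x))" "e ~= 0 ==> continuous_on S (%x. cut_pole' e (f x))"
 using assms by (auto simp: cut_time_def[abs_def] cut_time'_def[abs_def] cut_pole_def[abs_def] cut_pole'_def[abs_def] intro!: continuous_intros)

lemma cut_space_0:
 assumes "r > 0" "(norm Z)^2 >= 3 * r^2"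
 shows "cut_space r Z = 0" "cut_space_grad r Z = 0"
proof -
 have "3 - (norm Z)^2 / r^2 <= 0" using assms by (simp add: field_simps)
 then show "cut_space r Z = 0" "cut_space_grad r Z = 0" by (auto simp: cut_space_def cut_space_grad_def step_0 step'_0)
qed

lemma cut_space_1:
 assumes "r > 0" "(norm Z)^2 <= 2 * r^2"
 shows "cut_space r Z = 1" "cut_space_grad r Z = 0"
proof -
 have "3 - (norm Z)^2 / r^2 >= 1" using assms by (simp add: field_simps)
 then show "cut_space r Z = 1" "cut_space_grad r Z = 0" by (auto simp: cut_space_def cut_space_grad_def step_1 step'_0)
qed

lemma cut_time_0:
 assumes "r > 0" "\<tau> <= - 3 * r^2"
 shows "cut_time r \<tau> = 0" "cut_time' r \<tau> = 0"
proof -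
 have "3 + \<tau> / r^2 <= 0" using assms by (simp add: field_simps)
 then show "cut_time r \<tau> = 0" "cut_time' r \<tau> = 0" by (auto simp: cut_time_def cut_time'_def step_0 step'_0)
qed

lemma cut_time_1:
 assumes "r > 0" "\<tau> >= - 2 * r^2"
 shows "cut_time r \<tau> = 1" "cut_time' r \<tau> = 0"
proof -
 have "3 + \<tau> / r^2 >= 1" using assms by (simp add: field_simps)
 then show "cut_time r \<tau> = 1" "cut_time' r \<tau> = 0" by (auto simp: cut_time_def cut_time'_def step_1 step'_0)
qed

lemma cut_pole_0:
 assumes "e > 0" "\<sigma> <= e"
 shows "cut_pole e \<sigma> = 0" "cut_pole' e \<sigma> = 0"
proof -
 have "\<sigma> / e - 1 <= 0" using assms by (simp add: field_simps)
 then show "cut_pole e \<sigma> = 0" "cut_pole' e \<sigma> = 0" by (auto simp: cut_pole_def cut_pole'_def step_0 step'_0)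
qed

lemma cut_bounds: "0 <= cut_space r Z" "cut_space r Z <= 1" "0 <= cut_time r \<tau>" "cut_time r \<tau> <= 1"
 "0 <= cut_pole e \<sigma>" "cut_pole e \<sigma> <= 1" by (auto simp: cut_space_def cut_time_def cut_pole_def step_bounds)

section \<open>The kernel truncated near its pole\<close>

definition pole_l :: "real => real => real" where "pole_l t \<tau> = 1 / (4 * (t - \<tau>))"

definition trunc :: "real => real => real => 'n::finite space => real => 'n event => real" where
 "trunc m c e X t p = cut_pole e (t - snd p) * gk m c X (fst p) (pole_l t (snd p))"

definition trunc_grad :: "real => real => real => 'n::finite space => real => 'n event => 'n space" where
 "trunc_grad m c e X t p = cut_pole e (t - snd p) *\<^sub>R gk_grad m c X (fst p) (pole_l t (snd p))"

text \<open>The time derivative of \<open>trunc\<close> is \<open>trunc_time - trunc_jump\<close>;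
  the minus sign arises because \<open>cut_pole\<close> depends on \<open>t - \<tau>\<close>. The
  two parts are kept apart: \<open>trunc_time\<close> cancels by the heat equation, while
  \<open>trunc_jump\<close> reproduces \<open>v\<close>.\<close>

definition trunc_jump :: "real => real => real => 'n::finite space => real => 'n event => real" where
 "trunc_jump m c e X t p = cut_pole' e (t - snd p) * gk m c X (fst p) (pole_l t (snd p))"

definition trunc_time :: "real => real => real => 'n::finite space => real => 'n event => real" where
 "trunc_time m c e X t p = cut_pole e (t - snd p) * (4 * (pole_l t (snd p))^2 * gk_l m c X (fst p) (pole_l t (snd p)))"

text \<open>The times before \<open>t\<close> and the times after \<open>t - e\<close> form an open
  cover, and \<open>f\<close> is 0 on the second set. So the formula for \<open>pole_l\<close>
  matters only where it is positive.\<close>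

lemma continuous_on_past_glue:
 fixes f :: "'n::finite event => 'b::real_normed_vector"
 assumes "e > 0" "continuous_on {p. snd p < t} f" "!!p. t - snd p <= e ==> f p = 0"
 shows "continuous_on UNIV f"
proof -
 have un: "UNIV = {p :: 'n event. snd p < t} \<union> {p. t - e < snd p}" using assms(1) by auto
 have "continuous_on {p. t - e < snd p} f" by (rule continuous_on_eq[OF continuous_on_const[of _ 0]]) (use assms(3) in auto)
 then show ?thesis unfolding un by (intro continuous_on_open_Un assms open_Collect_less continuous_intros)
qed

lemma continuous_on_trunc:
 fixes X :: "'n::finite space"
 assumes "e > 0" "c > 0"
 shows "continuous_on UNIV (trunc m c e X t)" "continuous_on UNIV (trunc_grad m c e X t)"
  "continuous_on UNIV (trunc_jump m c e X t)" "continuous_on UNIV (trunc_time m c e X t)"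
proof -
 have l: "continuous_on {p :: 'n event. snd p < t} (%p. pole_l t (snd p))" unfolding pole_l_def by (intro continuous_intros) auto
 have l0: "pole_l t (snd p) > 0" if "p \<in> {p :: 'n event. snd p < t}" for p using that by (simp add: pole_l_def)
 show "continuous_on UNIV (trunc m c e X t)" by (rule continuous_on_past_glue[OF assms(1)])
   (use assms l l0 in \<open>auto simp: trunc_def[abs_def] cut_pole_0 intro!: continuous_intros\<close>)
 show "continuous_on UNIV (trunc_grad m c e X t)" by (rule continuous_on_past_glue[OF assms(1)])
   (use assms l l0 in \<open>auto simp: trunc_grad_def[abs_def] cut_pole_0 intro!: continuous_intros\<close>)
 show "continuous_on UNIV (trunc_jump m c e X t)" by (rule continuous_on_past_glue[OF assms(1)])
   (use assms l l0 in \<open>auto simp: trunc_jump_def[abs_def] cut_pole_0 intro!: continuous_intros\<close>)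
 show "continuous_on UNIV (trunc_time m c e X t)" by (rule continuous_on_past_glue[OF assms(1)])
   (use assms l l0 in \<open>auto simp: trunc_time_def[abs_def] cut_pole_0 intro!: continuous_intros\<close>)
qed

lemma trunc_deriv_Z:
 assumes "c > 0"
 shows "((%h. trunc m c e X t (p + h *\<^sub>R (v, 0))) has_real_derivative trunc_grad m c e X t p \<bullet> v) (at 0)"
 unfolding trunc_def trunc_grad_def using DERIV_cmult[OF gk_deriv_Z[OF assms]] by (simp add: inner_simps)

lemma trunc_deriv_t:
 assumes c: "c > 0" and e: "e > 0"
 shows "((%h. trunc m c e X t (p + h *\<^sub>R (0, 1))) has_real_derivative trunc_time m c e X t p - trunc_jump m c e X t p) (at 0)"
proof (cases "snd p < t")
 case True
 have l: "pole_l t (snd p) > 0" using True by (simp add: pole_l_def)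
 have dl: "((%h. pole_l t (snd p + h)) has_real_derivative 4 * (pole_l t (snd p))^2) (at 0)" unfolding pole_l_def using True
  by (auto intro!: derivative_eq_intros simp: field_simps power2_eq_square)
 have dg: "((%h. gk m c X (fst p) (pole_l t (snd p + h))) has_real_derivative gk_l m c X (fst p) (pole_l t (snd p)) * (4 * (pole_l t (snd p))^2)) (at 0)"
  by (rule DERIV_chain2[OF _ dl]) (use gk_deriv_l[OF c l] in simp)
 have dc: "((%h. cut_pole e (t - (snd p + h))) has_real_derivative - cut_pole' e (t - snd p)) (at 0)"
  unfolding cut_pole_def cut_pole'_def using e by (auto intro!: derivative_eq_intros)
 from DERIV_mult[OF dc dg] show ?thesis by (simp add: trunc_def trunc_time_def trunc_jump_def mult_ac)
next
 case False
 have "((%h. 0) has_real_derivative trunc_time m c e X t p - trunc_jump m c e X t p) (at 0)" using False e by (simp add: trunc_time_def trunc_jump_def cut_pole_0)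
 then show ?thesis by (rule has_field_derivative_transform_within_open[of _ _ _ "{-e<..<e}"])
   (use False e in \<open>auto simp: trunc_def cut_pole_0\<close>)
qed

definition test :: "real => real => real => real => 'n::finite space => real => 'n event => real" where
 "test r m c e X t p = cut_space r (fst p) * cut_time r (snd p) * trunc m c e X t p"

definition test_grad :: "real => real => real => real => 'n::finite space => real => 'n event => 'n event" where
 "test_grad r m c e X t p = ((cut_time r (snd p) * trunc m c e X t p) *\<^sub>R cut_space_grad r (fst p)
   + (cut_space r (fst p) * cut_time r (snd p)) *\<^sub>R trunc_grad m c e X t p,
  cut_space r (fst p) * (cut_time' r (snd p) * trunc m c e X t p
   + cut_time r (snd p) * (trunc_time m c e X t p - trunc_jump m c e X t p)))"

lemma test_C1:
 fixes X :: "'n::finite space"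
 assumes r: "r > 0" and c: "c > 0" and e: "e > 0"
 shows "continuous_on UNIV (test r m c e X t)" "continuous_on UNIV (test_grad r m c e X t)"
  "b \<in> Basis ==> has_partial_on UNIV (test r m c e X t) b (%p. test_grad r m c e X t p \<bullet> b)"
  "p \<notin> cball 0 (sqrt 3 * r) \<times> {-3 * r^2..t} ==> test r m c e X t p = 0"
  "snd p <= -3 * r^2 \<or> snd p >= t ==> test r m c e X t p = 0 \<and> test_grad r m c e X t p = 0"
proof -
 have r0: "r ~= 0" using r by simp
 have cf: "continuous_on UNIV (%p::'n event. fst p)" "continuous_on UNIV (%p::'n event. snd p)" by (intro continuous_intros)+
 note ct = continuous_on_trunc[OF e c, of m X t]
 show "continuous_on UNIV (test r m c e X t)" unfolding test_def[abs_def] by (intro continuous_intros ct r0)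
 show "continuous_on UNIV (test_grad r m c e X t)" unfolding test_grad_def[abs_def] by (intro continuous_intros ct r0)
 show "has_partial_on UNIV (test r m c e X t) b (%p. test_grad r m c e X t p \<bullet> b)" if b: "b \<in> Basis" unfolding has_partial_on_UNIV
 proof
  fix p :: "'n event"
  from b consider v where "b = (v, 0)" | "b = (0, 1)" by (auto simp: Basis_prod_def)
  then show "((%h. test r m c e X t (p + h *\<^sub>R b)) has_real_derivative test_grad r m c e X t p \<bullet> b) (at 0)"
  proof cases
   case 1
   have "((%h. cut_space r (fst p + h *\<^sub>R v) * cut_time r (snd p) * trunc m c e X t (p + h *\<^sub>R (v, 0))) has_real_derivative
     (cut_space_grad r (fst p) \<bullet> v * cut_time r (snd p)) * trunc m c e X t p + trunc_grad m c e X t p \<bullet> v * (cut_space r (fst p) * cut_time r (snd p))) (at 0)"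
    using DERIV_mult[OF DERIV_cmult_right[OF cut_space_deriv, of r "fst p" v "cut_time r (snd p)"] trunc_deriv_Z[OF c, of m e X t p v]] by (simp add: zero_prod_def[symmetric])
   then show ?thesis unfolding 1 test_def test_grad_def by (simp add: inner_simps algebra_simps)
  next
   case 2
   define k where "k = 1 / r^2"
   have k: "x / r^2 = x * k" for x by (simp add: k_def)
   have dc: "((%h. cut_time r (snd p + h)) has_real_derivative cut_time' r (snd p)) (at 0)" unfolding cut_time_def cut_time'_def k by (auto intro!: derivative_eq_intros)
   have "((%h. cut_space r (fst p) * (cut_time r (snd p + h) * trunc m c e X t (p + h *\<^sub>R (0, 1)))) has_real_derivative
     cut_space r (fst p) * (cut_time' r (snd p) * trunc m c e X t p + (trunc_time m c e X t p - trunc_jump m c e X t p) * cut_time r (snd p))) (at 0)"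
    using DERIV_cmult[OF DERIV_mult[OF dc trunc_deriv_t[OF c e, of m X t p]], of "cut_space r (fst p)"] by (simp add: zero_prod_def[symmetric])
   then show ?thesis unfolding 2 test_def test_grad_def by (simp add: inner_simps algebra_simps)
  qed
 qed
 show "snd p <= -3 * r^2 \<or> snd p >= t ==> test r m c e X t p = 0 \<and> test_grad r m c e X t p = 0"
  using r e by (auto simp: test_def test_grad_def cut_time_0 trunc_def trunc_grad_def trunc_time_def trunc_jump_def cut_pole_0 zero_prod_def)
 assume p: "p \<notin> cball 0 (sqrt 3 * r) \<times> {-3 * r^2..t}"
 show "test r m c e X t p = 0"
 proof (cases "norm (fst p) <= sqrt 3 * r")
  case True
  then have "snd p <= -3 * r^2 \<or> snd p >= t" using p by (cases p) auto
  then show ?thesis using r e by (auto simp: test_def cut_time_0 trunc_def cut_pole_0)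
 next
  case False
  then have "(sqrt 3 * r)^2 <= (norm (fst p))^2" using r by (intro power_mono) auto
  then show ?thesis using cut_space_0[OF r, of "fst p"] by (simp add: test_def power_mult_distrib)
 qed
qed

section \<open>The representation identity for the truncated kernel\<close>

lemma set_integrable_weight_cylinder:
 assumes "a > -1"
 shows "set_integrable lborel (half_ball \<rho> \<times> {T1<..<T2::real}) (%p. weight a (fst p :: 'n::finite space))"
proof -
 have "integrable lborel (%p. (indicator (half_ball \<rho>) (fst p) *\<^sub>R weight a (fst p :: 'n space)) * (1 * indicator {T1<..<T2} (snd p)))"
  using set_integrable_weight[OF assms, of \<rho>] unfolding set_integrable_def by (intro integrable_lborel_times integrable_indicator_bounded) auto
 then show ?thesis unfolding set_integrable_def by (rule integrable_cong[THEN iffD1, rotated 2]) (auto simp: indicator_def)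
qed

lemma sets_cylinder[measurable]: "half_ball \<rho> \<times> {T1<..<T2::real} \<in> sets borel" by (intro borel_open open_Times open_half_ball) auto

text \<open>The body of \<open>weak_solution\<close> with the gradient \<open>G\<close> fixed, so
  that one and the same \<open>G\<close> serves for \<open>in_V\<close> and for testing.\<close>

definition weak_identity :: "real => real => ('n::finite space => real) => ('n event => real) => ('n event => 'n space) => bool" where
 "weak_identity a r g v G \<longleftrightarrow> (\<forall>\<eta> H h.
   W12 (big_cyl r) (%p. weight a (fst p)) \<eta> H -->
   (\<exists>K. compact K \<and> K \<subseteq> half_ball0 (2 * r) \<times> {- 4 * r^2..0} \<and>
    (AE p in lborel. p \<in> big_cyl r - K --> \<eta> p = 0)) -->
   is_trace a (2 * r) (- 4 * r^2) 0 \<eta> H h -->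
   (AE (t1, t2) in lborel. - 4 * r^2 < t1 \<and> t1 < t2 \<and> t2 < 0 -->
    (LINT p:half_ball (2 * r) \<times> {t1<..<t2}|lborel. (G p \<bullet> fst (H p)) * weight a (fst p)) =
     (LINT p:half_ball (2 * r) \<times> {t1<..<t2}|lborel. weight a (fst p) * snd (H p) * v p)
     - (LINT X:half_ball (2 * r)|lborel. \<eta> (X, t2) * v (X, t2) * weight a X)
     + (LINT X:half_ball (2 * r)|lborel. \<eta> (X, t1) * v (X, t1) * weight a X)
     - (LINT q:ball 0 (2 * r) \<times> {t1<..<t2}|lborel. g q * h q)))"

text \<open>The test function vanishes for times up to \<open>- 3 r^2\<close> and from
  \<open>t\<close> on. The pairs with \<open>t1\<close> in \<open>(- 4 r^2, - 3 r^2)\<close> and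
  \<open>t2\<close> in \<open>(t, 0)\<close> fill a nonempty open set, so one of them is admissible.
  For it both boundary terms in time are 0, and the time integrals extend to the whole
  interval.\<close>

lemma weak_solution_test:
 fixes v :: "'n::finite event => real"
 assumes a: "a > -1" and r: "r > 0" and c: "c > 0" and e: "e > 0" and t: "-3 * r^2 < t" "t < 0"
  and V: "in_V a (2 * r) (- 4 * r^2) 0 v G"
  and weak: "weak_identity a r g v G"
 shows "(LINT p:big_cyl r|lborel. (G p \<bullet> fst (test_grad r m c e X t p)) * weight a (fst p)) =
   (LINT p:big_cyl r|lborel. weight a (fst p) * snd (test_grad r m c e X t p) * v p)
   - (LINT q:ball 0 (2 * r) \<times> {- 4 * r^2<..<0}|lborel. g q * test r m c e X t ((fst q, 0), snd q))"
proof -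
 let ?\<eta> = "test r m c e X t" and ?H = "test_grad r m c e X t"
 let ?h = "%q. test r m c e X t ((fst q, 0), snd q)"
 let ?B = "half_ball (2 * r) :: 'n space set" and ?b = "ball 0 (2 * r) :: (real ^ 'n) set"
 note C1 = test_C1[OF r c e, where m=m and X=X and t=t]
 have s3: "sqrt 3 < 2" by (rule real_less_lsqrt) auto
 let ?K = "cball 0 (sqrt 3 * r) \<times> {-3 * r^2..t} :: ('n event) set"
 have K: "compact ?K" by (intro compact_Times) auto
 have W: "W12 (?B \<times> {- 4 * r^2<..<0}) (%p. weight a (fst p)) ?\<eta> ?H"
  by (rule W12_C1[OF C1(1) C1(3) C1(2) K C1(4)]) (use set_integrable_weight_cylinder[OF a] in \<open>auto simp: weight_nonneg\<close>)
 let ?S = "(cball 0 (sqrt 3 * r) \<inter> {Z :: 'n space. 0 <= snd Z}) \<times> {-3 * r^2..t}"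
 have supp: "\<exists>K. compact K \<and> K \<subseteq> half_ball0 (2 * r) \<times> {- 4 * r^2..0} \<and>
    (AE p in lborel. p \<in> ?B \<times> {- 4 * r^2<..<0} - K --> ?\<eta> p = 0)"
 proof (intro exI conjI)
  have "closed {Z :: 'n space. 0 <= snd Z}" by (intro closed_Collect_le continuous_intros)
  then show "compact ?S" by (intro compact_Times compact_Int_closed) auto
  have "norm Z < 2 * r" if "norm Z <= sqrt 3 * r" for Z :: "'n space" using that s3 r by (meson le_less_trans mult_strict_right_mono)
  then show "?S \<subseteq> half_ball0 (2 * r) \<times> {- 4 * r^2..0}"
   using t by (auto simp: half_ball0_def)
  show "AE p in lborel. p \<in> ?B \<times> {- 4 * r^2<..<0} - ?S --> ?\<eta> p = 0"
  proof (intro AE_I2 impI)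
   fix p assume "p \<in> ?B \<times> {- 4 * r^2<..<0} - ?S"
   then have "p \<notin> ?K" by (auto simp: half_ball_def)
   then show "?\<eta> p = 0" by (rule C1(4))
  qed
 qed
 have ch: "continuous_on UNIV ?h" by (rule continuous_on_compose2[OF C1(1)]) (auto intro!: continuous_intros)
 have L2h: "L2_weighted (?b \<times> {- 4 * r^2<..<0}) (%_. 1) ?h"
 proof -
  obtain D where D: "!!p. \<bar>?\<eta> p\<bar> <= D" using continuous_compact_support_bounded[OF C1(1) K C1(4)] by blast
  have ob: "open (?b \<times> {- 4 * r^2<..<0})" by (intro open_Times) auto
  have bb: "bounded (?b \<times> {- 4 * r^2<..<0})" by (intro bounded_Times) auto
  have "set_integrable lborel (?b \<times> {- 4 * r^2<..<0}) (%_. 1 :: real)" unfolding set_integrable_def using integrable_indicator_bounded[OF bb, of 1] ob by simp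
  then show ?thesis using D ob by (intro L2_weighted_continuous[OF ch, of D]) auto
 qed
 \<comment> \<open>The test function is continuous up to \<open>y = 0\<close>, so the constant
   sequence shows that its trace is its restriction.\<close>
 have tr: "is_trace a (2 * r) (- 4 * r^2) 0 ?\<eta> ?H ?h" unfolding is_trace_def
 proof (intro conjI L2h exI[of _ "%_. ?\<eta>"] exI[of _ "%_. ?H"] allI W)
  show "continuous_on (half_ball0 (2 * r) \<times> {- 4 * r^2<..<0}) ?\<eta>" by (rule continuous_on_subset[OF C1(1)]) simp
  show "L2_weighted (?b \<times> {- 4 * r^2<..<0}) (%_. 1) (%(x, t'). ?\<eta> ((x, 0), t'))" using L2h by (simp add: case_prod_beta')
 qed (auto simp: case_prod_beta')
 have ae: "AE q in lborel. - 4 * r^2 < fst q \<and> fst q < snd q \<and> snd q < 0 -->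
    (LINT p:?B \<times> {fst q<..<snd q}|lborel. (G p \<bullet> fst (?H p)) * weight a (fst p)) =
     (LINT p:?B \<times> {fst q<..<snd q}|lborel. weight a (fst p) * snd (?H p) * v p)
     - (LINT X:?B|lborel. ?\<eta> (X, snd q) * v (X, snd q) * weight a X)
     + (LINT X:?B|lborel. ?\<eta> (X, fst q) * v (X, fst q) * weight a X)
     - (LINT p:?b \<times> {fst q<..<snd q}|lborel. g p * ?h p)" (is "AE q in _. ?P q") using weak W supp tr unfolding weak_identity_def case_prod_beta' by blast
 have r2: "r^2 > 0" using r by simp
 have "\<exists>q\<in>{- 4 * r^2<..<- 3 * r^2} \<times> {t<..<0}. ?P q" using r2 t by (intro AE_ex_open[OF ae] open_Times) (auto simp: greaterThanLessThan_empty_iff)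
 then obtain t1 t2 where tt: "- 4 * r^2 < t1" "t1 < - 3 * r^2" "t < t2" "t2 < 0"
  and id: "(LINT p:?B \<times> {t1<..<t2}|lborel. (G p \<bullet> fst (?H p)) * weight a (fst p)) =
     (LINT p:?B \<times> {t1<..<t2}|lborel. weight a (fst p) * snd (?H p) * v p)
     - (LINT X:?B|lborel. ?\<eta> (X, t2) * v (X, t2) * weight a X)
     + (LINT X:?B|lborel. ?\<eta> (X, t1) * v (X, t1) * weight a X)
     - (LINT p:?b \<times> {t1<..<t2}|lborel. g p * ?h p)" using t by fastforce
 have z: "?\<eta> p = 0" "?H p = 0" if "\<not> (t1 < snd p \<and> snd p < t2)" for p using C1(5)[of p] that tt by auto
 have "(LINT p:?B \<times> {- 4 * r^2<..<0}|lborel. f p) = (LINT p:?B \<times> {t1<..<t2}|lborel. f p)"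
  if "!!p. \<not> (t1 < snd p \<and> snd p < t2) ==> f p = 0" for f :: "'n event => real"
 proof (rule set_lebesgue_integral_eq)
  fix p assume "p \<in> ?B \<times> {- 4 * r^2<..<0} - ?B \<times> {t1<..<t2}"
  then have "\<not> (t1 < snd p \<and> snd p < t2)" by auto
  then show "f p = 0" by (rule that)
 qed (use tt in auto)
 moreover have "(LINT p:?b \<times> {- 4 * r^2<..<0}|lborel. f p) = (LINT p:?b \<times> {t1<..<t2}|lborel. f p)"
  if "!!p. \<not> (t1 < snd p \<and> snd p < t2) ==> f p = 0" for f :: "'n space => real"
 proof (rule set_lebesgue_integral_eq)
  fix p assume "p \<in> ?b \<times> {- 4 * r^2<..<0} - ?b \<times> {t1<..<t2}"
  then have "\<not> (t1 < snd p \<and> snd p < t2)" by auto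
  then show "f p = 0" by (rule that)
 qed (use tt in auto)
 moreover have "?\<eta> (X, t2) = 0" "?\<eta> (X, t1) = 0" for X by (auto intro: z)
 ultimately show ?thesis using id z by simp
qed

text \<open>At a fixed time the derivative is moved from \<open>u\<close> to the kernel, and the
  heat equation trades the weighted divergence of the kernel's gradient for its time derivative. No
  boundary term appears, because the vertical derivative of the kernel is a multiple of
  \<open>snd Z\<close>.\<close>

lemma slice_identity:
 fixes u :: "'n::finite space => real" and X :: "'n space"
 assumes c: "c > 0" and a: "a = 2 * c - 1" and m: "m = real CARD('n) / 2 + c" and r: "r > 0" and l: "l > 0"
  and W: "W12 (half_ball (2 * r)) (weight a) u g"
 shows "(LINT Z:half_ball (2 * r)|lborel. (g Z \<bullet> (cut_space r Z *\<^sub>R gk_grad m c X Z l)) * weight a Z)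
  = - (LINT Z:half_ball (2 * r)|lborel. (u Z \<bullet> (cut_space_grad r Z \<bullet> gk_grad m c X Z l
    - cut_space r Z * (4 * l^2 * gk_l m c X Z l))) * weight a Z)"
proof -
 let ?B = "half_ball (2 * r) :: 'n space set"
 have a1: "a > -1" using a c by simp
 have r0: "r ~= 0" using r by simp
 \<comment> \<open>The vertical derivative of the kernel divided by \<open>z\<close>. It is
   continuous through \<open>z = 0\<close>, so the singular coefficient \<open>a / z\<close> of the
   equation contributes the regular term \<open>a * \<kappa> Z\<close>.\<close>
 define \<kappa> where "\<kappa> Z = - 2 * l * gk m c X Z l + 2 * l^2 * (snd X)^2 / c * gk m (c + 1) X Z l" for Z
 have \<kappa>: "snd (gk_grad m c X Z l) = snd Z * \<kappa> Z" for Z by (simp add: gk_grad_def \<kappa>_def)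
 define A where "A v Z = cut_space r Z * (gk_grad m c X Z l \<bullet> v)" for v Z
 define D where "D v Z = cut_space_grad r Z \<bullet> v * (gk_grad m c X Z l \<bullet> v)
  + cut_space r Z * gk_hess m c v X Z l + a * (snd v)^2 * (cut_space r Z * \<kappa> Z)" for v Z
 have cA: "continuous_on UNIV (A v)" "continuous_on UNIV (D v)" "continuous_on UNIV (%Z. cut_space r Z * \<kappa> Z)" for v
  unfolding A_def[abs_def] D_def[abs_def] \<kappa>_def using c l r0 by (auto intro!: continuous_intros)
 let ?K = "cball 0 (sqrt 3 * r) :: 'n space set"
 have out: "cut_space r Z = 0" "cut_space_grad r Z = 0" if "sqrt 3 * r <= norm Z" for Z :: "'n space"
 proof -
  have "(sqrt 3 * r)^2 <= (norm Z)^2" using r that by (intro power_mono) auto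
  then show "cut_space r Z = 0" "cut_space_grad r Z = 0" using cut_space_0[OF r, of Z] by (auto simp: power_mult_distrib)
 qed
 have out': "A v Z = 0" "D v Z = 0" "cut_space r Z * \<kappa> Z = 0" if "Z \<notin> ?K" for v Z using out[of Z] that by (auto simp: A_def D_def)
 obtain C3 where C3: "C3 >= 0" "!!Z. \<bar>cut_space r Z * \<kappa> Z\<bar> <= C3" using continuous_compact_support_bounded[OF cA(3) compact_cball out'(3)] by blast
 have each: "(LINT Z:?B|lborel. (g Z \<bullet> v) * (A v Z * weight a Z)) = - (LINT Z:?B|lborel. u Z * (D v Z * weight a Z))"
  if v: "v \<in> Basis" for v
 proof -
  obtain C1 where C1: "C1 >= 0" "!!Z. \<bar>A v Z\<bar> <= C1" using continuous_compact_support_bounded[OF cA(1)[of v] compact_cball out'(1)] by blast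
  obtain C2 where C2: "C2 >= 0" "!!Z. \<bar>D v Z\<bar> <= C2" using continuous_compact_support_bounded[OF cA(2)[of v] compact_cball out'(2)] by blast
  have Av: "A v Z * snd v = snd Z * ((snd v)^2 * (cut_space r Z * \<kappa> Z))" for Z using v \<kappa>[of Z] by (auto simp: A_def Basis_prod_def inner_prod_def)
  have v1: "(snd v)^2 <= 1" using v by (auto simp: Basis_prod_def)
  show ?thesis
  proof (rule weak_gradient_half_ball[OF a1 W v, where R="sqrt 3 * r" and C="C1 + C2 + C3"])
   have cw: "continuous_on {Z :: 'n space. 0 < snd Z} (weight a)" unfolding weight_def[abs_def] by (intro continuous_intros) auto
   show "continuous_on {Z. 0 < snd Z} (%Z. A v Z * weight a Z)" "continuous_on {Z. 0 < snd Z} (%Z. D v Z * weight a Z)"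
    by (intro continuous_intros cw continuous_on_subset[OF cA(1)] continuous_on_subset[OF cA(2)]; simp)+
   show "has_partial_on {Z. 0 < snd Z} (%Z. A v Z * weight a Z) v (%Z. D v Z * weight a Z)" unfolding has_partial_on_def
   proof
    fix Z :: "'n space" assume "Z \<in> {Z. 0 < snd Z}"
    then have z: "0 < snd Z" by simp
    have dw: "((%h. weight a (Z + h *\<^sub>R v)) has_real_derivative a * (weight a Z / snd Z) * snd v) (at 0)"
     unfolding weight_def using z by (auto intro!: derivative_eq_intros simp: powr_diff)
    have dA: "((%h. A v (Z + h *\<^sub>R v)) has_real_derivative
      cut_space_grad r Z \<bullet> v * (gk_grad m c X Z l \<bullet> v) + gk_hess m c v X Z l * cut_space r Z) (at 0)"
     unfolding A_def using DERIV_mult[OF cut_space_deriv[of r Z v] gk_grad_deriv[OF c v, of m X Z l]] by (simp add: algebra_simps)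
    have "a * (weight a Z / snd Z) * snd v * A v Z = a * (weight a Z / snd Z) * (A v Z * snd v)" by simp
    also have "... = a * weight a Z * ((snd v)^2 * (cut_space r Z * \<kappa> Z))" unfolding Av using z by simp
    finally have "(cut_space_grad r Z \<bullet> v * (gk_grad m c X Z l \<bullet> v) + gk_hess m c v X Z l * cut_space r Z) * weight a Z
      + a * (weight a Z / snd Z) * snd v * A v Z = D v Z * weight a Z" by (simp add: D_def algebra_simps)
    with DERIV_mult[OF dA dw]
    have "((%h. A v (Z + h *\<^sub>R v) * weight a (Z + h *\<^sub>R v)) has_real_derivative D v Z * weight a Z) (at 0)" by simp
    then show "((%h. A v (Z + h *\<^sub>R v) * weight a (Z + h *\<^sub>R v)) has_real_derivative D v Z * weight a Z)
      (at 0 within {h. Z + h *\<^sub>R v \<in> {Z. 0 < snd Z}})" by (rule has_field_derivative_at_within)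
   qed
   have "sqrt 3 < 2" by (rule real_less_lsqrt) auto
   then show "sqrt 3 * r < 2 * r" using r by simp
   show "A v Z * weight a Z = 0" if "sqrt 3 * r <= norm Z" for Z using out[OF that] by (simp add: A_def)
   show "\<bar>A v Z * weight a Z\<bar> <= (C1 + C2 + C3) * weight a Z" "\<bar>D v Z * weight a Z\<bar> <= (C1 + C2 + C3) * weight a Z" for Z
    using C1(2)[of Z] C2(2)[of Z] C1(1) C2(1) C3(1) weight_nonneg[of a Z] by (auto simp: abs_mult intro!: mult_right_mono)
   show "\<bar>A v Z * weight a Z * snd v\<bar> <= (C1 + C2 + C3) * (snd Z * weight a Z)" if z: "0 < snd Z" for Z
   proof -
    have "A v Z * weight a Z * snd v = (A v Z * snd v) * weight a Z" by simp
    also have "\<bar>...\<bar> = ((snd v)^2 * \<bar>cut_space r Z * \<kappa> Z\<bar>) * (snd Z * weight a Z)"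
     unfolding Av using z weight_nonneg[of a Z] by (simp add: abs_mult)
    also have "... <= (1 * C3) * (snd Z * weight a Z)" using v1 C3(1) C3(2)[of Z] z weight_nonneg[of a Z] by (intro mult_right_mono mult_mono) auto
    also have "... <= (C1 + C2 + C3) * (snd Z * weight a Z)" using C1(1) C2(1) z weight_nonneg[of a Z] by (intro mult_right_mono) auto
    finally show ?thesis .
   qed
  qed
 qed
 have L2: "L2_weighted ?B (weight a) u" "L2_weighted ?B (weight a) g" using W by (auto simp: W12_def)
 have wi: "set_integrable lborel ?B (weight a)" by (rule set_integrable_weight[OF a1])
 have meas: "f \<in> borel_measurable borel" if "continuous_on UNIV f" for f :: "'n space => 'z::euclidean_space" using that by (rule borel_measurable_continuous_onI)
 have i1: "set_integrable lborel ?B (%Z. (g Z \<bullet> v) * (A v Z * weight a Z))" for v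
 proof -
  obtain C1 where C1: "!!Z. \<bar>A v Z\<bar> <= C1" using continuous_compact_support_bounded[OF cA(1)[of v] compact_cball out'(1)] by blast
  have "set_integrable lborel ?B (%Z. (g Z \<bullet> (A v Z *\<^sub>R v)) * weight a Z)"
   using C1 by (intro L2_weighted_integrable[OF L2(2) wi, where C="C1 * norm v"] meas continuous_intros cA)
    (auto simp: weight_nonneg intro!: mult_right_mono)
  then show ?thesis by (simp add: mult_ac)
 qed
 have i2: "set_integrable lborel ?B (%Z. u Z * (D v Z * weight a Z))" for v
 proof -
  obtain C1 where C1: "!!Z. \<bar>D v Z\<bar> <= C1" using continuous_compact_support_bounded[OF cA(2)[of v] compact_cball out'(2)] by blast
  have "set_integrable lborel ?B (%Z. (u Z \<bullet> D v Z) * weight a Z)"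
   using C1 by (intro L2_weighted_integrable[OF L2(1) wi, where C=C1] meas cA) (auto simp: weight_nonneg)
  then show ?thesis by (simp add: mult_ac)
 qed
 have s1: "(\<Sum>v\<in>Basis. (g Z \<bullet> v) * (A v Z * weight a Z)) = (g Z \<bullet> (cut_space r Z *\<^sub>R gk_grad m c X Z l)) * weight a Z" for Z
  unfolding inner_scaleR_right euclidean_inner[of "g Z" "gk_grad m c X Z l"] A_def by (simp add: sum_distrib_left sum_distrib_right mult_ac)
 have s2: "(\<Sum>v\<in>Basis. u Z * (D v Z * weight a Z))
   = (u Z \<bullet> (cut_space_grad r Z \<bullet> gk_grad m c X Z l - cut_space r Z * (4 * l^2 * gk_l m c X Z l))) * weight a Z"
  if Z: "Z \<in> ?B" for Z
 proof -
  have z: "snd Z ~= 0" using Z by (simp add: half_ball_def)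
  have sv: "(\<Sum>v\<in>(Basis :: 'n space set). (snd v)\<^sup>2) = 1" by (subst sum_Basis_prod) simp
  have "(\<Sum>v\<in>Basis. D v Z) = cut_space_grad r Z \<bullet> gk_grad m c X Z l + cut_space r Z * (\<Sum>v\<in>Basis. gk_hess m c v X Z l) + a * (\<Sum>v\<in>(Basis :: 'n space set). (snd v)\<^sup>2) * (cut_space r Z * \<kappa> Z)"
   unfolding D_def euclidean_inner[of "cut_space_grad r Z" "gk_grad m c X Z l"] by (simp add: sum.distrib sum_distrib_left sum_distrib_right)
  also have "... = cut_space_grad r Z \<bullet> gk_grad m c X Z l + cut_space r Z * ((\<Sum>v\<in>Basis. gk_hess m c v X Z l) + a * \<kappa> Z)"
   unfolding sv by (simp add: algebra_simps)
  also have "(\<Sum>v\<in>Basis. gk_hess m c v X Z l) + a * \<kappa> Z = - (4 * l^2 * gk_l m c X Z l)" using gk_heat_equation[OF c l z m, of X] z \<kappa>[of Z] a by simp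
  finally have "(\<Sum>v\<in>Basis. D v Z) = cut_space_grad r Z \<bullet> gk_grad m c X Z l - cut_space r Z * (4 * l^2 * gk_l m c X Z l)" by simp
  then show ?thesis by (simp add: sum_distrib_left[symmetric] sum_distrib_right[symmetric])
 qed
 have "(LINT Z:?B|lborel. (g Z \<bullet> (cut_space r Z *\<^sub>R gk_grad m c X Z l)) * weight a Z)
  = (LINT Z:?B|lborel. (\<Sum>v\<in>Basis. (g Z \<bullet> v) * (A v Z * weight a Z)))" unfolding s1 ..
 also have "... = (\<Sum>v\<in>Basis. LINT Z:?B|lborel. (g Z \<bullet> v) * (A v Z * weight a Z))"
  using i1 unfolding set_lebesgue_integral_def set_integrable_def scaleR_sum_right by (intro integral_sum) auto
 also have "... = - (\<Sum>v\<in>Basis. LINT Z:?B|lborel. u Z * (D v Z * weight a Z))" using each by (simp add: sum_negf)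
 also have "(\<Sum>v\<in>Basis. LINT Z:?B|lborel. u Z * (D v Z * weight a Z)) = (LINT Z:?B|lborel. (\<Sum>v\<in>Basis. u Z * (D v Z * weight a Z)))"
  using i2 unfolding set_lebesgue_integral_def set_integrable_def scaleR_sum_right by (intro integral_sum[symmetric]) auto
 also have "... = (LINT Z:?B|lborel. (u Z \<bullet> (cut_space_grad r Z \<bullet> gk_grad m c X Z l
    - cut_space r Z * (4 * l^2 * gk_l m c X Z l))) * weight a Z)" by (rule set_lebesgue_integral_cong) (use s2 in auto)
 finally show ?thesis .
qed

lemma set_integral_Times:
 fixes f :: "'a::euclidean_space \<times> 'b::euclidean_space => real"
 assumes f: "set_integrable lborel (A \<times> B) f"
 shows "(LINT p:A \<times> B|lborel. f p) = (LINT y:B|lborel. LINT x:A|lborel. f (x, y))"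
  "set_integrable lborel B (%y. LINT x:A|lborel. f (x, y))"
proof -
 let ?F = "%x y. indicator (A \<times> B) (x, y) *\<^sub>R f (x, y)"
 have int: "integrable (lborel \<Otimes>\<^sub>M lborel) (case_prod ?F)" using f unfolding set_integrable_def lborel_prod by (simp add: case_prod_beta')
 have eq: "(LINT x|lborel. ?F x y) = indicator B y *\<^sub>R (LINT x:A|lborel. f (x, y))" for y unfolding set_lebesgue_integral_def
  by (cases "y \<in> B") (auto intro!: integral_cong simp: indicator_def)
 show "(LINT p:A \<times> B|lborel. f p) = (LINT y:B|lborel. LINT x:A|lborel. f (x, y))"
  using lborel_pair.integral_snd[OF int] unfolding eq unfolding lborel_prod set_lebesgue_integral_def by (simp add: case_prod_beta')
 show "set_integrable lborel B (%y. LINT x:A|lborel. f (x, y))" using lborel_pair.integrable_snd[OF int] unfolding eq set_integrable_def .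
qed

lemma set_integral_Times_cong:
 fixes f g :: "'a::euclidean_space \<times> 'b::euclidean_space => real"
 assumes f: "set_integrable lborel (A \<times> B) f" and g: "set_integrable lborel (A \<times> B) g"
  and eq: "AE y in lborel. y \<in> B --> (LINT x:A|lborel. f (x, y)) = (LINT x:A|lborel. g (x, y))"
 shows "(LINT p:A \<times> B|lborel. f p) = (LINT p:A \<times> B|lborel. g p)" unfolding set_integral_Times(1)[OF f] set_integral_Times(1)[OF g]
 unfolding set_lebesgue_integral_def[of lborel B]
proof (rule integral_cong_AE)
 show "(%y. indicator B y *\<^sub>R (LINT x:A|lborel. f (x, y))) \<in> borel_measurable lborel"
  "(%y. indicator B y *\<^sub>R (LINT x:A|lborel. g (x, y))) \<in> borel_measurable lborel"
  using set_integral_Times(2)[OF f] set_integral_Times(2)[OF g] unfolding set_integrable_def by (auto dest: borel_measurable_integrable)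
 show "AE y in lborel. indicator B y *\<^sub>R (LINT x:A|lborel. f (x, y)) = indicator B y *\<^sub>R (LINT x:A|lborel. g (x, y))"
  using eq by eventually_elim (auto simp: indicator_def)
qed

lemma L2_weighted_cylinder_integrable:
 fixes f k :: "'n::finite event => 'b::euclidean_space"
 assumes a: "a > -1" and f: "L2_weighted (big_cyl r) (%p. weight a (fst p)) f" and k: "continuous_on UNIV k"
 shows "set_integrable lborel (big_cyl r) (%p. (f p \<bullet> k p) * weight a (fst p))"
proof -
 let ?K = "cball 0 (2 * r) \<times> {-4 * r^2..0} :: ('n event) set"
 have "bounded (k ` ?K)" by (intro compact_imp_bounded compact_continuous_image continuous_on_subset[OF k] compact_Times) auto
 then obtain C where C: "!!p. p \<in> ?K ==> norm (k p) <= C" unfolding bounded_iff by blast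
 have "big_cyl r \<subseteq> ?K" by (auto simp: half_ball_def)
 then have "norm (k p) <= C" if "p \<in> big_cyl r" for p using that by (intro C) blast
 from L2_weighted_integrable[OF f set_integrable_weight_cylinder[OF a] weight_nonneg borel_measurable_continuous_onI[OF k] this]
 show ?thesis by blast
qed

text \<open>The terms with \<open>trunc_time\<close> cancel between the weak identity and the slice
  identity, since the kernel solves the adjoint equation away from its pole. Every surviving term
  carries a derivative of one of the three cutoffs or lives at \<open>y = 0\<close>.\<close>

lemma truncated_representation:
 fixes v :: "'n::finite event => real" and X :: "'n space"
 assumes c: "c > 0" and a: "a = 2 * c - 1" and m: "m = real CARD('n) / 2 + c"
  and r: "r > 0" and e: "e > 0" and t: "-3 * r^2 < t" "t < 0"
  and V: "in_V a (2 * r) (- 4 * r^2) 0 v G"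
  and weak: "weak_identity a r g v G"
 shows "(LINT p:big_cyl r|lborel. (v p \<bullet> (cut_space r (fst p) * cut_time r (snd p) * trunc_jump m c e X t p)) * weight a (fst p))
  = (LINT p:big_cyl r|lborel. (v p \<bullet> (cut_space r (fst p) * cut_time' r (snd p) * trunc m c e X t p)) * weight a (fst p))
  + (LINT p:big_cyl r|lborel. (v p \<bullet> (cut_time r (snd p) * (cut_space_grad r (fst p) \<bullet> trunc_grad m c e X t p))) * weight a (fst p))
  - (LINT p:big_cyl r|lborel. (G p \<bullet> ((cut_time r (snd p) * trunc m c e X t p) *\<^sub>R cut_space_grad r (fst p))) * weight a (fst p))
  - (LINT q:ball 0 (2 * r) \<times> {- 4 * r^2<..<0}|lborel. g q * test r m c e X t ((fst q, 0), snd q))"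
proof -
 have a1: "a > -1" using a c by simp
 have r0: "r ~= 0" using r by simp
 have L2: "L2_weighted (big_cyl r) (%p. weight a (fst p)) v" "L2_weighted (big_cyl r) (%p. weight a (fst p)) G"
  and slices: "AE t in lborel. t \<in> {- 4 * r^2<..<0} --> W12 (half_ball (2 * r)) (weight a) (%X. v (X, t)) (%X. G (X, t))" using V by (auto simp: in_V_def)
 note ct = continuous_on_trunc[OF e c, where m=m and X=X and t=t]
 note int = L2_weighted_cylinder_integrable[OF a1]
 let ?cs = "%p :: 'n event. cut_space r (fst p)" and ?ct = "%p :: 'n event. cut_time r (snd p)"
  and ?w = "%p :: 'n event. weight a (fst p)" and ?cg = "%p :: 'n event. cut_space_grad r (fst p)"
 define J where "J p = ?cs p * ?ct p * trunc_jump m c e X t p" for p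
 define T1 where "T1 p = ?cs p * cut_time' r (snd p) * trunc m c e X t p" for p
 define T2 where "T2 p = ?ct p * (?cg p \<bullet> trunc_grad m c e X t p)" for p
 define T3 where "T3 p = ?cs p * ?ct p * trunc_time m c e X t p" for p
 define G1 where "G1 p = (?ct p * trunc m c e X t p) *\<^sub>R ?cg p" for p
 define G2 where "G2 p = (?cs p * ?ct p) *\<^sub>R trunc_grad m c e X t p" for p
 have cont: "continuous_on UNIV J" "continuous_on UNIV T1" "continuous_on UNIV T2" "continuous_on UNIV T3"
  "continuous_on UNIV G1" "continuous_on UNIV G2"
  unfolding J_def[abs_def] T1_def[abs_def] T2_def[abs_def] T3_def[abs_def] G1_def[abs_def] G2_def[abs_def] by (intro continuous_intros ct r0)+
 have slice: "(LINT p:big_cyl r|lborel. (G p \<bullet> G2 p) * ?w p) = (LINT p:big_cyl r|lborel. (v p \<bullet> (T3 p - T2 p)) * ?w p)"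
 proof (rule set_integral_Times_cong)
  show "set_integrable lborel (big_cyl r) (%p. (G p \<bullet> G2 p) * ?w p)" using int[OF L2(2) cont(6)] .
  show "set_integrable lborel (big_cyl r) (%p. (v p \<bullet> (T3 p - T2 p)) * ?w p)"
   using int[OF L2(1), of "%p. T3 p - T2 p"] cont by (simp add: continuous_on_diff)
  show "AE \<tau> in lborel. \<tau> \<in> {- 4 * r^2<..<0} -->
   (LINT Z:half_ball (2 * r)|lborel. (G (Z, \<tau>) \<bullet> G2 (Z, \<tau>)) * ?w (Z, \<tau>)) =
   (LINT Z:half_ball (2 * r)|lborel. (v (Z, \<tau>) \<bullet> (T3 (Z, \<tau>) - T2 (Z, \<tau>))) * ?w (Z, \<tau>))" using slices
  proof eventually_elim
   case (elim \<tau>)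
   let ?L = "LINT Z:half_ball (2 * r)|lborel. (G (Z, \<tau>) \<bullet> G2 (Z, \<tau>)) * ?w (Z, \<tau>)" and ?R = "LINT Z:half_ball (2 * r)|lborel. (v (Z, \<tau>) \<bullet> (T3 (Z, \<tau>) - T2 (Z, \<tau>))) * ?w (Z, \<tau>)"
   show ?case
   proof
    assume "\<tau> \<in> {- 4 * r^2<..<0}"
    with elim have W: "W12 (half_ball (2 * r)) (weight a) (%X. v (X, \<tau>)) (%X. G (X, \<tau>))" by blast
    show "?L = ?R"
    proof (cases "\<tau> < t")
     case True
     let ?l = "pole_l t \<tau>" and ?k = "cut_time r \<tau> * cut_pole e (t - \<tau>)"
     let ?d = "%Z. (v (Z, \<tau>) \<bullet> (cut_space_grad r Z \<bullet> gk_grad m c X Z ?l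
       - cut_space r Z * (4 * ?l\<^sup>2 * gk_l m c X Z ?l))) * weight a Z"
     have l: "?l > 0" using True by (simp add: pole_l_def)
     have "?L
      = (LINT Z:half_ball (2 * r)|lborel. ?k * ((G (Z, \<tau>) \<bullet> (cut_space r Z *\<^sub>R gk_grad m c X Z ?l)) * weight a Z))"
      by (simp add: G2_def trunc_grad_def mult_ac)
     also have "... = ?k * (LINT Z:half_ball (2 * r)|lborel. (G (Z, \<tau>) \<bullet> (cut_space r Z *\<^sub>R gk_grad m c X Z ?l)) * weight a Z)"
      by (rule set_integral_mult_right)
     also have "... = - (?k * (LINT Z:half_ball (2 * r)|lborel. ?d Z))" unfolding slice_identity[OF c a m r l W] by simp
     also have "... = (- ?k) * (LINT Z:half_ball (2 * r)|lborel. ?d Z)" by simp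
     also have "... = (LINT Z:half_ball (2 * r)|lborel. (- ?k) * ?d Z)" by (rule set_integral_mult_right[symmetric])
     also have "... = ?R"
      by (simp add: T3_def T2_def trunc_grad_def trunc_time_def algebra_simps)
     finally show ?thesis .
    next
     case False
     then have "cut_pole e (t - \<tau>) = 0" using e by (simp add: cut_pole_0)
     then show ?thesis by (simp add: G2_def T2_def T3_def trunc_grad_def trunc_time_def)
    qed
   qed
  qed
 qed
 let ?N = "LINT q:ball 0 (2 * r) \<times> {- 4 * r^2<..<0}|lborel. g q * test r m c e X t ((fst q, 0), snd q)"
 have tg: "fst (test_grad r m c e X t p) = G1 p + G2 p" "snd (test_grad r m c e X t p) = T1 p + T3 p - J p" for p
  by (auto simp: test_grad_def G1_def G2_def T1_def T3_def J_def algebra_simps)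
 have "(LINT p:big_cyl r|lborel. (G p \<bullet> G1 p) * ?w p) + (LINT p:big_cyl r|lborel. (G p \<bullet> G2 p) * ?w p)
  = (LINT p:big_cyl r|lborel. (G p \<bullet> (G1 p + G2 p)) * ?w p)"
  unfolding inner_add_right distrib_right by (rule set_integral_add(2)[OF int[OF L2(2) cont(5)] int[OF L2(2) cont(6)], symmetric])
 also have "... = (LINT p:big_cyl r|lborel. ?w p * (T1 p + T3 p - J p) * v p)
   - ?N"
  using weak_solution_test[OF a1 r c e t V weak, of m X] unfolding tg by blast
 also have "(LINT p:big_cyl r|lborel. ?w p * (T1 p + T3 p - J p) * v p)
  = (LINT p:big_cyl r|lborel. (v p \<bullet> T1 p) * ?w p + (v p \<bullet> T3 p) * ?w p - (v p \<bullet> J p) * ?w p)" by (simp add: algebra_simps)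
 also have "... = (LINT p:big_cyl r|lborel. (v p \<bullet> T1 p) * ?w p) + (LINT p:big_cyl r|lborel. (v p \<bullet> T3 p) * ?w p) - (LINT p:big_cyl r|lborel. (v p \<bullet> J p) * ?w p)"
  unfolding set_integral_diff(2)[OF set_integral_add(1)[OF int[OF L2(1) cont(2)] int[OF L2(1) cont(4)]] int[OF L2(1) cont(1)]]
   set_integral_add(2)[OF int[OF L2(1) cont(2)] int[OF L2(1) cont(4)]] ..
 finally have 1: "(LINT p:big_cyl r|lborel. (G p \<bullet> G1 p) * ?w p) + (LINT p:big_cyl r|lborel. (G p \<bullet> G2 p) * ?w p)
   = (LINT p:big_cyl r|lborel. (v p \<bullet> T1 p) * ?w p) + (LINT p:big_cyl r|lborel. (v p \<bullet> T3 p) * ?w p) - (LINT p:big_cyl r|lborel. (v p \<bullet> J p) * ?w p)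
   - ?N" .
 have "(LINT p:big_cyl r|lborel. (v p \<bullet> (T3 p - T2 p)) * ?w p) = (LINT p:big_cyl r|lborel. (v p \<bullet> T3 p) * ?w p - (v p \<bullet> T2 p) * ?w p)"
  by (simp add: algebra_simps)
 also have "... = (LINT p:big_cyl r|lborel. (v p \<bullet> T3 p) * ?w p) - (LINT p:big_cyl r|lborel. (v p \<bullet> T2 p) * ?w p)"
  by (rule set_integral_diff(2)[OF int[OF L2(1) cont(4)] int[OF L2(1) cont(3)]])
 finally show ?thesis using 1 slice unfolding J_def T1_def T2_def G1_def by simp
qed

section \<open>The mass of the heat kernel\<close>

lemma absolutely_integrable_lborel:
 fixes f :: "'a::euclidean_space => real"
 assumes "f absolutely_integrable_on S" "S \<in> sets borel" "f \<in> borel_measurable borel"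
 shows "set_integrable lborel S f" "(LINT x:S|lborel. f x) = integral S f"
proof -
 have "(%x. indicator S x *\<^sub>R f x) \<in> borel_measurable lborel" using assms(2,3) by simp
 then show "set_integrable lborel S f" using assms(1) unfolding set_integrable_def by (subst (asm) integrable_completion) auto
 then show "(LINT x:S|lborel. f x) = integral S f" by (rule set_borel_integral_eq_integral(2))
qed

lemma Gamma_has_integral:
 fixes x :: real
 assumes x: "x > 0"
 shows "((%t. t powr (x - 1) / exp t) has_integral Gamma x) {0<..}"
proof -
 have "((%t. if t \<in> {0<..} then t powr (x - 1) / exp t else 0) has_integral Gamma x) {0..}" by (rule has_integral_spike[of "{0}", OF _ _ Gamma_integral_real[OF x]]) auto
 then show ?thesis by (subst (asm) has_integral_restrict) auto
qed

text \<open>Substitute \<open>t = l y^2\<close> in the Gamma integral.\<close>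

lemma powr_gaussian_integral:
 fixes x l :: real
 assumes x: "x > 0" and l: "l > 0"
 shows "set_integrable lborel {0<..} (%y. y powr (2 * x - 1) * exp (- (l * y^2)))"
  "(LINT y:{0<..}|lborel. y powr (2 * x - 1) * exp (- (l * y^2))) = Gamma x / (2 * l powr x)"
proof -
 let ?f = "%t :: real. t powr (x - 1) / exp t" and ?g = "%y. (2 * l powr x) * (y powr (2 * x - 1) * exp (- (l * y^2)))"
 have img: "(%y. l * y^2) ` {0<..} = {0<..}"
 proof (intro equalityI subsetI)
  fix t :: real assume "t \<in> {0<..}"
  then show "t \<in> (%y. l * y^2) ` {0<..}" using l by (intro image_eqI[of _ _ "sqrt (t / l)"]) auto
 qed (use l in auto)
 have "?f absolutely_integrable_on {0<..}" "integral {0<..} ?f = Gamma x" using Gamma_has_integral[OF x]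
  by (auto intro!: nonnegative_absolutely_integrable_1 simp: has_integral_integrable_integral)
 moreover have der: "((%y. l * y^2) has_real_derivative l * (2 * y)) (at y within {0<..})" for y by (auto intro!: derivative_eq_intros)
 moreover have "inj_on (%y. l * y^2) {0<..}" using l by (auto simp: inj_on_def)
 ultimately have A: "(%y. \<bar>l * (2 * y)\<bar> * ?f (l * y^2)) absolutely_integrable_on {0<..} \<and>
   integral {0<..} (%y. \<bar>l * (2 * y)\<bar> * ?f (l * y^2)) = Gamma x"
  using has_absolute_integral_change_of_variables_1'[of "{0<..}" "%y. l * y^2" "%y. l * (2 * y)" ?f "Gamma x"] img by simp
 have eqp: "\<bar>l * (2 * y)\<bar> * ?f (l * y^2) = ?g y" if "y \<in> {0<..}" for y
 proof -
  have y: "y > 0" using that by simp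
  have "(l * y^2) powr (x - 1) = l powr (x - 1) * y powr (2 * (x - 1))" using y l by (simp add: powr_mult powr_powr flip: powr_numeral)
  moreover have "l powr x = l powr (x - 1) * l" using powr_add[of l "x - 1" 1] l by simp
  moreover have "y powr (2 * x - 1) = y powr (2 * (x - 1)) * y" using powr_add[of y "2 * (x - 1)" 1] y by simp
  ultimately show ?thesis using y l by (simp add: exp_minus field_simps)
 qed
 have "?g absolutely_integrable_on {0<..}" unfolding set_integrable_def by (rule integrable_cong[THEN iffD1, OF refl _ conjunct1[OF A, unfolded set_integrable_def]])
   (use eqp in \<open>auto simp: indicator_def\<close>)
 moreover have "integral {0<..} (%y. \<bar>l * (2 * y)\<bar> * ?f (l * y^2))
   = integral {0<..} ?g" by (rule Henstock_Kurzweil_Integration.integral_cong[OF eqp])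
 ultimately have *: "?g absolutely_integrable_on {0<..}"
   "integral {0<..} ?g = Gamma x" using conjunct2[OF A] by simp_all
 have "set_integrable lborel {0<..} ?g"
  and "(LINT y:{0<..}|lborel. ?g y) = Gamma x" using absolutely_integrable_lborel[OF *(1)] *(2) by auto
 moreover have "2 * l powr x ~= 0" using l by simp
 ultimately show "set_integrable lborel {0<..} (%y. y powr (2 * x - 1) * exp (- (l * y^2)))"
  "(LINT y:{0<..}|lborel. y powr (2 * x - 1) * exp (- (l * y^2))) = Gamma x / (2 * l powr x)" by (auto simp: set_integrable_mult_right_iff field_simps)
qed

text \<open>The vertical factor of \<open>gk\<close>. The choice \<open>m = n / 2 + c\<close> splits
  \<open>l powr m\<close> into the normalisation of a Gaussian in \<open>x\<close> and that of this
  kernel.\<close>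

definition bessel_kernel :: "real => real => real => real => real" where
 "bessel_kernel c l z y = l powr c * (exp (- (l * (y^2 + z^2))) * F01 c (l^2 * y^2 * z^2))"

text \<open>Integrate the series of \<open>F01\<close> term by term. By the Gamma integral the k-th
  term yields \<open>(l z^2)^k / k!\<close>, as the Pochhammer symbol in its coefficient cancels;
  the sum \<open>exp (l z^2)\<close> then cancels the Gaussian in \<open>z\<close>, so the mass
  depends neither on \<open>l\<close> nor on \<open>z\<close>.\<close>

lemma bessel_kernel_mass:
 fixes c l z :: real
 assumes c: "c > 0" and l: "l > 0"
 shows "set_integrable lborel {0<..} (%y. bessel_kernel c l z y * y powr (2 * c - 1))"
  "(LINT y:{0<..}|lborel. bessel_kernel c l z y * y powr (2 * c - 1)) = Gamma c / 2"
proof -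
 define q where "q k = l powr c * exp (- (l * z^2)) * F01_coeff c k * (l^2 * z^2) ^ k" for k
 define f where "f k y = indicator {0<..} y *\<^sub>R (q k * (y powr (2 * (c + real k) - 1) * exp (- (l * y^2))))" for k y
 have q0: "q k >= 0" for k using F01_coeff_pos[OF c, of k] by (simp add: q_def)
 have int: "integrable lborel (f k)" and val: "(LINT y|lborel. f k y) = Gamma c / 2 * exp (- (l * z^2)) * ((l * z^2) ^ k / fact k)" for k
 proof -
  have ck: "c + real k > 0" using c by simp
  show "integrable lborel (f k)" unfolding f_def[abs_def] set_integrable_def[symmetric] by (intro set_integrable_mult_right powr_gaussian_integral(1)[OF ck l])
  have "(LINT y|lborel. f k y) = (LINT y:{0<..}|lborel. q k * (y powr (2 * (c + real k) - 1) * exp (- (l * y^2))))" unfolding f_def set_lebesgue_integral_def ..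
  also have "... = q k * (Gamma (c + real k) / (2 * l powr (c + real k)))" unfolding set_integral_mult_right powr_gaussian_integral(2)[OF ck l] ..
  also have "Gamma (c + real k) = pochhammer c k * Gamma c"
  proof -
   have "c \<notin> \<int>\<^sub>\<le>\<^sub>0" using c by (auto dest: nonpos_Ints_nonpos)
   then show ?thesis using pochhammer_Gamma[of c k] Gamma_real_pos[OF c] by simp
  qed
  also have "l powr (c + real k) = l powr c * l ^ k" using l by (simp add: powr_add powr_realpow)
  also have "q k * (pochhammer c k * Gamma c / (2 * (l powr c * l ^ k))) = Gamma c / 2 * exp (- (l * z^2)) * ((l * z^2) ^ k / fact k)"
   unfolding q_def F01_coeff_def using pochhammer_pos[OF c, of k] l by (simp add: field_simps power2_eq_square power_mult_distrib)
  finally show "(LINT y|lborel. f k y) = Gamma c / 2 * exp (- (l * z^2)) * ((l * z^2) ^ k / fact k)" .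
 qed
 have f0: "f k y >= 0" for k y using q0[of k] by (simp add: f_def)
 have sums: "(%k. f k y) sums (indicator {0<..} y *\<^sub>R (bessel_kernel c l z y * y powr (2 * c - 1)))" for y
 proof (cases "y > 0")
  case True
  have "(%k. F01_coeff c k * (l^2 * y^2 * z^2) ^ k) sums F01 c (l^2 * y^2 * z^2)" unfolding F01_def by (rule summable_sums[OF F01_summable[OF c]])
  then have "(%k. (l powr c * exp (- (l * (y^2 + z^2))) * y powr (2 * c - 1)) * (F01_coeff c k * (l^2 * y^2 * z^2) ^ k)) sums
   ((l powr c * exp (- (l * (y^2 + z^2))) * y powr (2 * c - 1)) * F01 c (l^2 * y^2 * z^2))" by (rule sums_mult)
  moreover have "(l powr c * exp (- (l * (y^2 + z^2))) * y powr (2 * c - 1)) * (F01_coeff c k * (l^2 * y^2 * z^2) ^ k) = f k y" for k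
  proof -
   have "y powr (2 * (c + real k) - 1) = y powr (2 * c - 1 + real (2 * k))" by (simp add: algebra_simps)
   also have "... = y powr (2 * c - 1) * (y^2) ^ k" using True by (simp only: powr_add powr_realpow power_mult)
   finally have p: "y powr (2 * (c + real k) - 1) = y powr (2 * c - 1) * (y^2) ^ k" .
   have ee: "exp (- (l * (y^2 + z^2))) = exp (- (l * y^2)) * exp (- (l * z^2))" by (simp add: mult_exp_exp algebra_simps)
   show ?thesis using True unfolding f_def q_def p ee by (simp add: power_mult_distrib mult_ac)
  qed
  ultimately show ?thesis using True by (simp add: bessel_kernel_def mult_ac)
 qed (auto simp: f_def)
 have ex: "(%k. Gamma c / 2 * exp (- (l * z^2)) * ((l * z^2) ^ k / fact k)) sums (Gamma c / 2 * exp (- (l * z^2)) * exp (l * z^2))"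
  using exp_converges[of "l * z^2"] by (intro sums_mult) (simp add: field_simps)
 have A: "AE y in lborel. summable (%k. norm (f k y))" using sums f0 by (auto simp: sums_iff)
 have B: "summable (%k. LINT y|lborel. norm (f k y))" using f0 val sums_summable[OF ex] by simp
 have sf: "(%y. \<Sum>k. f k y) = (%y. indicator {0<..} y *\<^sub>R (bessel_kernel c l z y * y powr (2 * c - 1)))" using sums by (auto simp: sums_iff)
 show "set_integrable lborel {0<..} (%y. bessel_kernel c l z y * y powr (2 * c - 1))" using integrable_suminf[OF int A B] unfolding sf set_integrable_def .
 have "(%k. LINT y|lborel. f k y) sums (LINT y|lborel. (\<Sum>k. f k y))" by (rule sums_integral[OF int A B])
 with ex have "(LINT y|lborel. (\<Sum>k. f k y)) = Gamma c / 2 * exp (- (l * z^2)) * exp (l * z^2)" unfolding val by (rule sums_unique2[symmetric])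
 then show "(LINT y:{0<..}|lborel. bessel_kernel c l z y * y powr (2 * c - 1)) = Gamma c / 2" unfolding sf set_lebesgue_integral_def by (simp add: exp_minus)
qed

lemma integrable_gaussian:
 "integrable lborel (%x :: real ^ 'n. exp (- ((norm x)^2)))"
proof -
 have 1: "integrable lborel (%t::real. exp (- (t^2)))"
 proof -
  \<comment> \<open>For \<open>x = 1 / 2\<close> the power of \<open>y\<close> has exponent 0. The
    half line and its reflection cover the line up to the point 0.\<close>
  let ?h = "%t::real. indicator {0<..} t *\<^sub>R (t powr (2 * (1 / 2) - 1) * exp (- (1 * t^2)))"
  have h: "integrable lborel ?h" using powr_gaussian_integral(1)[of "1/2" 1] by (simp add: set_integrable_def)
  have "integrable lborel (%t. ?h t + ?h (0 + (- 1) *\<^sub>R t))" by (intro integrable_add h lborel_integrable_affine) auto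
  moreover have "AE t in lborel. ?h t + ?h (0 + (- 1) *\<^sub>R t) = exp (- (t^2))" using AE_lborel_singleton[of 0] by eventually_elim (auto simp: indicator_def)
  ultimately show ?thesis by (subst (asm) integrable_cong_AE) auto
 qed
 have eq: "exp (- ((norm x)^2)) = (\<Prod>b\<in>Basis. exp (- ((x \<bullet> b)^2)))" for x :: "real ^ 'n"
 proof -
  have "(norm x)^2 = (\<Sum>b\<in>Basis. (x \<bullet> b)\<^sup>2)" unfolding power2_norm_eq_inner by (subst euclidean_inner) (simp add: power2_eq_square)
  then show ?thesis by (simp add: exp_sum sum_negf[symmetric])
 qed
 have f: "(\<integral>\<^sup>+t. ennreal (exp (- (t^2))) \<partial>lborel) < \<infinity>" using 1 unfolding integrable_iff_bounded by simp
 have "(\<integral>\<^sup>+x. ennreal (exp (- ((norm (x :: real ^ 'n))^2))) \<partial>lborel) = (\<Prod>b\<in>(Basis :: (real^'n) set). \<integral>\<^sup>+t. ennreal (exp (- (t^2))) \<partial>lborel)"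
  unfolding eq by (subst nn_integral_lborel_prod[symmetric]) (auto simp: prod_ennreal)
 also have "... < \<infinity>" using f by (simp add: power_less_top_ennreal)
 finally show ?thesis unfolding integrable_iff_bounded by simp
qed

definition gauss_mass :: "'n::finite itself => real" where
 "gauss_mass _ = (LINT x|lborel. exp (- ((norm (x :: real ^ 'n))^2)))"

lemma gauss_mass_pos: "gauss_mass TYPE('n::finite) > 0"
proof -
 have "gauss_mass TYPE('n) ~= 0"
 proof
  assume "gauss_mass TYPE('n) = 0"
  then have "AE x :: real ^ 'n in lborel. exp (- ((norm x)^2)) = 0" unfolding gauss_mass_def by (subst (asm) integral_nonneg_eq_0_iff_AE[OF integrable_gaussian]) auto
  then show False using AE_ex_open[of "%x :: real ^ 'n. exp (- ((norm x)^2)) = 0" UNIV] by auto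
 qed
 moreover have "gauss_mass TYPE('n) >= 0" unfolding gauss_mass_def by simp
 ultimately show ?thesis by simp
qed

lemma gauss_scaled:
 fixes \<xi> :: "real ^ 'n"
 assumes l: "l > 0"
 shows "integrable lborel (%x. l powr (real CARD('n) / 2) * exp (- (l * (norm (x - \<xi>))^2)))"
  "(LINT x|lborel. l powr (real CARD('n) / 2) * exp (- (l * (norm (x - \<xi>))^2))) = gauss_mass TYPE('n)"
proof -
 have s: "l powr (real CARD('n) / 2) = sqrt l ^ CARD('n)" using l by (simp add: powr_half_sqrt[symmetric] powr_powr flip: powr_realpow)
 have sc: "(norm (sqrt l *\<^sub>R (x - \<xi>)))^2 = l * (norm (x - \<xi>))^2" for x using l by (simp add: power_mult_distrib)
 have "integrable lborel (%x. exp (- ((norm ((- sqrt l *\<^sub>R \<xi>) + sqrt l *\<^sub>R x))^2)))" using l by (intro lborel_integrable_affine integrable_gaussian) auto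
 moreover have eq: "(- sqrt l *\<^sub>R \<xi>) + sqrt l *\<^sub>R x = sqrt l *\<^sub>R (x - \<xi>)" for x by (simp add: algebra_simps)
 ultimately show "integrable lborel (%x. l powr (real CARD('n) / 2) * exp (- (l * (norm (x - \<xi>))^2)))" unfolding eq sc by simp
 have "gauss_mass TYPE('n) = \<bar>sqrt l\<bar> ^ DIM(real ^ 'n) * (LINT x|lborel. exp (- ((norm ((- sqrt l *\<^sub>R \<xi>) + sqrt l *\<^sub>R x))^2)))"
  unfolding gauss_mass_def using l by (intro lborel_integral_affine) auto
 then show "(LINT x|lborel. l powr (real CARD('n) / 2) * exp (- (l * (norm (x - \<xi>))^2))) = gauss_mass TYPE('n)" unfolding eq sc s using l by simp
qed

lemma integral_lborel_times:
 fixes f :: "'a::euclidean_space => real" and g :: "'b::euclidean_space => real"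
 assumes f: "integrable lborel f" and g: "integrable lborel g"
 shows "(LINT p|lborel. f (fst p) * g (snd p)) = (LINT x|lborel. f x) * (LINT y|lborel. g y)"
proof -
 have "integrable (lborel \<Otimes>\<^sub>M lborel) (case_prod (%x y. f x * g y))" using integrable_lborel_times[OF f g] by (simp add: lborel_prod case_prod_beta')
 from lborel_pair.integral_snd[OF this] show ?thesis by (simp add: lborel_prod case_prod_beta')
qed

text \<open>The constant \<open>\<kappa>\<close> of the overview: the integral of the kernel over
  the pole, against the weight, for any point and any \<open>l\<close>.\<close>

definition kernel_mass :: "'n::finite itself => real => real" where
 "kernel_mass _ c = gauss_mass TYPE('n) * (Gamma c / 2)"

lemma kernel_mass_pos: "c > 0 ==> kernel_mass TYPE('n::finite) c > 0" by (simp add: kernel_mass_def gauss_mass_pos Gamma_real_pos)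

lemma gk_mass:
 fixes Z :: "'n::finite space"
 assumes c: "c > 0" and l: "l > 0" and m: "m = real CARD('n) / 2 + c"
 shows "set_integrable lborel {X. 0 < snd X} (%X. gk m c X Z l * weight (2 * c - 1) X)"
  "(LINT X:{X. 0 < snd X}|lborel. gk m c X Z l * weight (2 * c - 1) X) = kernel_mass TYPE('n) c"
proof -
 let ?f = "%x. l powr (real CARD('n) / 2) * exp (- (l * (norm (x - fst Z))^2))"
 let ?g = "%y. indicator {0<..} y *\<^sub>R (bessel_kernel c l (snd Z) y * y powr (2 * c - 1))"
 have g: "integrable lborel ?g" using bessel_kernel_mass(1)[OF c l] by (simp add: set_integrable_def)
 have eq: "indicator {X. 0 < snd X} X *\<^sub>R (gk m c X Z l * weight (2 * c - 1) X) = ?f (fst X) * ?g (snd X)" for X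
  unfolding gk_def base_kernel_def bessel_kernel_def weight_def m powr_add by (auto simp: indicator_def mult_exp_exp algebra_simps)
 show "set_integrable lborel {X. 0 < snd X} (%X. gk m c X Z l * weight (2 * c - 1) X)"
  unfolding set_integrable_def eq by (rule integrable_lborel_times[OF gauss_scaled(1)[OF l] g])
 show "(LINT X:{X. 0 < snd X}|lborel. gk m c X Z l * weight (2 * c - 1) X) = kernel_mass TYPE('n) c"
  unfolding set_lebesgue_integral_def eq integral_lborel_times[OF gauss_scaled(1)[OF l] g] gauss_scaled(2)[OF l]
  using bessel_kernel_mass(2)[OF c l] by (simp add: kernel_mass_def set_lebesgue_integral_def)
qed

section \<open>Functions that integrate to zero against test functions\<close>

text \<open>The functions \<open>max 0 (1 - k * infdist x K)\<close> decrease to the indicator of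
  \<open>K\<close>, and from some \<open>k\<close> on they are supported in a compact neighbourhood
  of \<open>K\<close> inside \<open>D\<close>.\<close>

lemma integral_compact_0:
 fixes f :: "'a::euclidean_space => real"
 assumes f: "integrable lborel f" and D: "open D"
  and test: "!!\<theta>. continuous_on UNIV \<theta> ==> (!!x. 0 <= \<theta> x \<and> \<theta> x <= 1) ==>
   (\<exists>K. compact K \<and> K \<subseteq> D \<and> (\<forall>x. x \<notin> K --> \<theta> x = 0)) ==> (LINT x|lborel. \<theta> x * f x) = 0"
  and K: "compact K" "K \<subseteq> D"
 shows "(LINT x|lborel. indicator K x * f x) = 0"
proof (cases "K = {}")
 case False
 define \<theta> where "\<theta> k x = max 0 (1 - real k * infdist x K)" for k :: nat and x :: 'a
 have c: "continuous_on UNIV (\<theta> k)" for k unfolding \<theta>_def[abs_def] by (intro continuous_intros)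
 have b: "0 <= \<theta> k x \<and> \<theta> k x <= 1" for k x by (auto simp: \<theta>_def infdist_nonneg)
 obtain e where e: "e > 0" "(\<Union>x\<in>K. cball x e) \<subseteq> D" using compact_subset_open_imp_cball_epsilon_subset[OF K(1) D K(2)] by blast
 define L where "L = {x. infdist x K <= e}"
 have L: "compact L" unfolding L_def by (intro compact_infdist_le K False e)
 have LD: "L \<subseteq> D"
 proof
  fix x assume x: "x \<in> L"
  obtain y where "y \<in> K" "infdist x K = dist x y" using infdist_attains_inf[OF compact_imp_closed[OF K(1)] False, of x] by blast
  then show "x \<in> D" using x e(2) by (force simp: L_def dist_commute)
 qed
 obtain N where N: "1 / e < real N" using reals_Archimedean2 by blast
 have z: "(LINT x|lborel. \<theta> k x * f x) = 0" if "k >= N" for k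
 proof (rule test[OF c b])
  have "\<theta> k x = 0" if x: "x \<notin> L" for x
  proof -
   have "1 / e < real k" using N \<open>k >= N\<close> by linarith
   then have "1 < real k * e" using e(1) by (simp add: field_simps)
   also have "... <= real k * infdist x K" using x by (intro mult_left_mono) (auto simp: L_def)
   finally show ?thesis by (simp add: \<theta>_def)
  qed
  then show "\<exists>K. compact K \<and> K \<subseteq> D \<and> (\<forall>x. x \<notin> K --> \<theta> k x = 0)" using L LD by blast
 qed
 have "(%k. LINT x|lborel. \<theta> k x * f x) \<longlonglongrightarrow> (LINT x|lborel. indicator K x * f x)"
 proof (rule integral_dominated_convergence[where w="%x. \<bar>f x\<bar>"])
  have [measurable]: "f \<in> borel_measurable borel" using f by (auto dest: borel_measurable_integrable)
  show "(%x. indicator K x * f x) \<in> borel_measurable lborel" using compact_imp_closed[OF K(1)] by (intro borel_measurable_times borel_measurable_indicator) auto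
  show "(%x. \<theta> k x * f x) \<in> borel_measurable lborel" for k using borel_measurable_continuous_onI[OF c[of k]] by simp
  show "AE x in lborel. (%k. \<theta> k x * f x) \<longlonglongrightarrow> indicator K x * f x" (is "AE x in _. ?P x")
  proof (rule AE_I2)
   fix x
   have "(%k. \<theta> k x) \<longlonglongrightarrow> indicator K x"
   proof (cases "x \<in> K")
    case True
    then show ?thesis by (simp add: \<theta>_def)
   next
    case False
    have d: "infdist x K > 0" using False compact_imp_closed[OF K(1)] \<open>K ~= {}\<close> infdist_nonneg[of x K] by (metis in_closed_iff_infdist_zero order_le_less)
    obtain M where M: "1 / infdist x K < real M" using reals_Archimedean2 by blast
    have "\<theta> k x = 0" if "k >= M" for k
    proof -
     have "1 / infdist x K < real k" using M that by linarith
     then show ?thesis using d by (simp add: \<theta>_def field_simps)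
    qed
    then show ?thesis using False by (intro tendsto_eventually) (auto simp: eventually_sequentially)
   qed
   then show "?P x" by (intro tendsto_intros)
  qed
  show "AE x in lborel. norm (\<theta> k x * f x) <= \<bar>f x\<bar>" for k using b[of k] by (auto simp: abs_mult intro!: AE_I2 mult_left_le_one_le)
 qed (use f in auto)
 moreover have "(%k. LINT x|lborel. \<theta> k x * f x) \<longlonglongrightarrow> 0" using z by (intro tendsto_eventually) (auto simp: eventually_sequentially)
 ultimately show ?thesis by (rule LIMSEQ_unique)
qed simp

text \<open>\<open>ennreal\<close> truncates at 0, so \<open>M\<close> has the positive part of
  \<open>f\<close> as its density. It is a finite measure, hence inner regular, and the set where
  \<open>f\<close> is positive gets measure 0 from its compact subsets.\<close>

lemma AE_nonpos_if_compact_0: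
 fixes f :: "'a::euclidean_space => real"
 assumes f: "integrable lborel f" and K: "!!K. compact K ==> K \<subseteq> {x. f x > 0} ==> (LINT x|lborel. indicator K x * f x) = 0"
 shows "AE x in lborel. f x <= 0"
proof -
 have [measurable]: "f \<in> borel_measurable borel" using f by (auto dest: borel_measurable_integrable)
 define M where "M = density lborel (%x. ennreal (f x))"
 have fin: "emeasure M (space M) ~= \<infinity>" using f unfolding M_def by (auto simp: emeasure_density real_integrable_def)
 have "emeasure M {x. f x > 0} = (SUP K\<in>{K. K \<subseteq> {x. f x > 0} \<and> compact K}. emeasure M K)"
  by (rule inner_regular) (use fin in \<open>auto simp: M_def\<close>)
 also have "... = 0"
 proof -
  have "emeasure M K = 0" if KK: "K \<subseteq> {x. f x > 0}" "compact K" for K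
  proof -
   have [measurable]: "K \<in> sets borel" using compact_imp_closed[OF KK(2)] by auto
   have i: "integrable lborel (%x. indicator K x * f x)" using integrable_mult_indicator[OF _ f, of K] by simp
   have "emeasure M K = (\<integral>\<^sup>+x. ennreal (indicator K x * f x) \<partial>lborel)"
    unfolding M_def using KK(1) by (subst emeasure_density) (auto intro!: nn_integral_cong simp: indicator_def)
   also have "... = ennreal (LINT x|lborel. indicator K x * f x)" using KK(1) by (intro nn_integral_eq_integral[OF i] AE_I2) (auto simp: indicator_def less_imp_le subset_iff)
   finally show ?thesis using K[OF KK(2,1)] by simp
  qed
  then show ?thesis by (auto intro!: antisym SUP_least)
 qed
 finally have "(\<integral>\<^sup>+x. ennreal (f x) * indicator {x. f x > 0} x \<partial>lborel) = 0" unfolding M_def by (subst (asm) emeasure_density) auto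
 then have "AE x in lborel. ennreal (f x) * indicator {x. f x > 0} x = 0" by (subst (asm) nn_integral_0_iff_AE) auto
 then show ?thesis by eventually_elim (auto simp: indicator_def ennreal_eq_0_iff split: if_splits)
qed

lemma AE_0_if_test_0:
 fixes f :: "'a::euclidean_space => real"
 assumes f: "integrable lborel f" and D: "open D" "!!x. x \<notin> D ==> f x = 0"
  and test: "!!\<theta>. continuous_on UNIV \<theta> ==> (!!x. 0 <= \<theta> x \<and> \<theta> x <= 1) ==>
   (\<exists>K. compact K \<and> K \<subseteq> D \<and> (\<forall>x. x \<notin> K --> \<theta> x = 0)) ==> (LINT x|lborel. \<theta> x * f x) = 0"
 shows "AE x in lborel. f x = 0"
proof -
 have K: "(LINT x|lborel. indicator K x * f x) = 0" if "compact K" "K \<subseteq> {x. f x ~= 0}" for K using that D(2) by (intro integral_compact_0[OF f D(1) test]) auto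
 have 1: "AE x in lborel. f x <= 0" by (rule AE_nonpos_if_compact_0[OF f]) (rule K, auto)
 have "AE x in lborel. - f x <= 0"
 proof (rule AE_nonpos_if_compact_0)
  fix L assume "compact L" "L \<subseteq> {x. - f x > 0}"
  then have "(LINT x|lborel. indicator L x * f x) = 0" by (intro K) auto
  then show "(LINT x|lborel. indicator L x * - f x) = 0" by simp
 qed (use f in auto)
 with 1 show ?thesis by eventually_elim auto
qed

section \<open>The heat kernel as an approximate identity\<close>

text \<open>\<open>(l k)^N / N!\<close> is a single term of the series of
  \<open>exp (l k)\<close>.\<close>

lemma power_exp_bound:
 fixes l k :: real
 assumes "l >= 0" "k > 0"
 shows "l ^ N * exp (- (l * k)) <= fact N / k ^ N"
proof -
 have "(l * k) ^ N / fact N <= exp (l * k)"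
 proof -
  have "(\<Sum>n\<in>{N}. inverse (fact n) * (l * k) ^ n) <= (\<Sum>n. inverse (fact n) * (l * k) ^ n)" using assms by (intro sum_le_suminf summable_exp) auto
  then show ?thesis by (simp add: exp_def scaleR_conv_of_real divide_inverse mult.commute)
 qed
 then have "l ^ N * k ^ N * exp (- (l * k)) <= fact N" by (simp add: exp_minus power_mult_distrib field_simps)
 then show ?thesis using assms by (simp add: field_simps)
qed

text \<open>For \<open>l \<ge> 1\<close> the Gaussian is split as
  \<open>exp (- (l - 1) d^2) exp (- d^2)\<close> with \<open>d\<close> the distance to
  \<open>Z\<close>. The second factor is integrable against the weight; the first, where
  \<open>d \<ge> \<delta>\<close>, beats every power of \<open>l\<close>.\<close>

lemma gk_tail:
 fixes Z :: "'n::finite space"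
 assumes c: "c > 0" and \<delta>: "\<delta> > 0" and z: "snd Z >= 0" and m: "m = real CARD('n) / 2 + c"
 shows "\<exists>C\<ge>0. \<forall>l\<ge>1. (LINT X:{X. 0 < snd X \<and> \<delta> <= norm (X - Z)}|lborel. gk m c X Z l * weight (2 * c - 1) X) <= C / l"
proof -
 obtain K where K: "K >= 0" "!!r. r >= 0 ==> F01 c (r^2) <= (1 + K * r^2) * exp (2 * r)" by (rule F01_bound[OF c]) (rule that; blast)
 define g where "g y = indicator {0<..} y *\<^sub>R (exp ((snd Z)^2) * (y powr (2 * c - 1) * exp (- (1 / 2 * y^2))
  + K * (snd Z)^2 * (y powr (2 * (c + 1) - 1) * exp (- (1 / 2 * y^2)))))" for y
 define f where "f x = 1 powr (real CARD('n) / 2) * exp (- (1 * (norm (x - fst Z))^2))" for x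
 have f: "integrable lborel f" unfolding f_def[abs_def] by (rule gauss_scaled(1)) simp
 have "set_integrable lborel {0<..} (%y. exp ((snd Z)^2) * (y powr (2 * c - 1) * exp (- (1 / 2 * y^2))
  + K * (snd Z)^2 * (y powr (2 * (c + 1) - 1) * exp (- (1 / 2 * y^2)))))" using c by (intro set_integrable_mult_right set_integral_add powr_gaussian_integral) auto
 then have g: "integrable lborel g" unfolding g_def[abs_def] set_integrable_def .
 have fg: "integrable lborel (%X. f (fst X) * g (snd X))" by (rule integrable_lborel_times[OF f g])
 define I where "I = (LINT X|lborel. f (fst X) * g (snd X))"
 have f0: "f x >= 0" for x by (simp add: f_def)
 have g0: "g y >= 0" for y using K(1) by (simp add: g_def)
 have I0: "I >= 0" unfolding I_def using f0 g0 by simp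
 obtain N :: nat where N: "m + 2 <= real N" using real_arch_simple by blast
 define C where "C = exp (\<delta>^2) * (fact (Suc N) / (\<delta>^2) ^ Suc N) * I"
 let ?A = "{X :: 'n space. 0 < snd X \<and> \<delta> <= norm (X - Z)}"
 show ?thesis
 proof (intro exI[of _ C] conjI allI impI)
  show "C >= 0" unfolding C_def using I0 \<delta> by simp
  fix l :: real assume l: "l >= 1"
  define q where "q = l powr (m + 2) * exp (- ((l - 1) * \<delta>^2))"
  have q: "q >= 0" by (simp add: q_def)
  have bound: "gk m c X Z l * weight (2 * c - 1) X <= q * (f (fst X) * g (snd X))" if X: "X \<in> ?A" for X
  proof -
   have y: "snd X > 0" and d: "\<delta> <= norm (X - Z)" using X by auto
   let ?r = "l * (snd X * snd Z)"
   have r0: "?r >= 0" using y z l by simp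
   have Q: "(norm (X - Z))^2 = (norm (fst X - fst Z))^2 + (snd X)^2 + (snd Z)^2 - 2 * (snd X * snd Z)"
    unfolding power2_norm_eq_inner by (simp add: inner_prod_def power2_eq_square algebra_simps)
   have "base_kernel c X Z l = exp (- (l * ((norm (fst X - fst Z))^2 + (snd X)^2 + (snd Z)^2))) * F01 c (?r\<^sup>2)"
    unfolding base_kernel_def by (simp add: power_mult_distrib mult.assoc)
   also have "... <= exp (- (l * ((norm (fst X - fst Z))^2 + (snd X)^2 + (snd Z)^2))) * ((1 + K * ?r\<^sup>2) * exp (2 * ?r))" using K(2)[OF r0] by (intro mult_left_mono) auto
   also have "... = (1 + K * ?r\<^sup>2) * exp (- (l * (norm (X - Z))^2))" unfolding Q by (simp add: mult_exp_exp algebra_simps)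
   also have "... <= (l^2 * (1 + K * (snd Z)^2 * (snd X)^2)) * (exp (- ((l - 1) * \<delta>^2)) * exp (- (norm (X - Z))\<^sup>2))"
   proof (intro mult_mono)
    have "1 <= l^2" using l by simp
    then show "1 + K * ?r\<^sup>2 <= l^2 * (1 + K * (snd Z)^2 * (snd X)^2)" by (simp add: power_mult_distrib distrib_left mult_ac)
    have "(l - 1) * \<delta>^2 <= (l - 1) * (norm (X - Z))^2" using l d \<delta> by (intro mult_left_mono power_mono) auto
    then show "exp (- (l * (norm (X - Z))^2)) <= exp (- ((l - 1) * \<delta>^2)) * exp (- (norm (X - Z))\<^sup>2)" by (simp add: mult_exp_exp algebra_simps)
   qed (use K in auto)
   also have "exp (- (norm (X - Z))\<^sup>2) <= f (fst X) * (exp ((snd Z)^2) * exp (- (1 / 2 * (snd X)^2)))"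
   proof -
    \<comment> \<open>Expands to \<open>(y - z)^2 \<ge> y^2 / 2 - z^2\<close>, which replaces the
      Gaussian centred at \<open>z\<close> by one centred at 0 whose moments are known.\<close>
    have "0 <= (snd X - 2 * snd Z)^2 / 2" by simp
    then have "(snd X)^2 / 2 - (snd Z)^2 <= (snd X)^2 + (snd Z)^2 - 2 * (snd X * snd Z)" by (simp add: power2_eq_square algebra_simps)
    then show ?thesis unfolding Q f_def by (simp add: mult_exp_exp)
   qed
   finally have "base_kernel c X Z l <= (l^2 * (1 + K * (snd Z)^2 * (snd X)^2)) * (exp (- ((l - 1) * \<delta>^2)) *
     (f (fst X) * (exp ((snd Z)^2) * exp (- (1 / 2 * (snd X)^2)))))" using K(1) by (simp add: mult_left_mono)
   then have "l powr m * base_kernel c X Z l * weight (2 * c - 1) X <= l powr m * ((l^2 * (1 + K * (snd Z)^2 * (snd X)^2)) * (exp (- ((l - 1) * \<delta>^2)) *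
     (f (fst X) * (exp ((snd Z)^2) * exp (- (1 / 2 * (snd X)^2)))))) * weight (2 * c - 1) X" by (intro mult_right_mono mult_left_mono) (auto simp: weight_nonneg)
   also have "... = q * (f (fst X) * g (snd X))"
   proof -
    have "l powr (m + 2) = l powr m * l^2" using l by (simp add: powr_add powr_numeral)
    moreover have "snd X powr (2 * (c + 1) - 1) = snd X powr (2 * c - 1 + 2)" by (simp add: algebra_simps)
    moreover have "... = snd X powr (2 * c - 1) * (snd X)^2" using y by (simp only: powr_add powr_numeral)
    ultimately show ?thesis using y unfolding q_def g_def weight_def by (simp add: algebra_simps)
   qed
   finally show ?thesis by (simp add: gk_def)
  qed
  have "(LINT X:?A|lborel. gk m c X Z l * weight (2 * c - 1) X) <= (LINT X|lborel. q * (f (fst X) * g (snd X)))" unfolding set_lebesgue_integral_def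
  proof (rule integral_mono_AE')
   show "AE X in lborel. indicator ?A X *\<^sub>R (gk m c X Z l * weight (2 * c - 1) X) <= q * (f (fst X) * g (snd X))"
    using bound q f0 g0 by (auto simp: indicator_def intro!: AE_I2)
   show "AE X in lborel. 0 <= q * (f (fst X) * g (snd X))" using q f0 g0 by auto
  qed (use fg in auto)
  also have "... = q * I" by (simp add: I_def)
  also have "... <= (exp (\<delta>^2) * (fact (Suc N) / (\<delta>^2) ^ Suc N) / l) * I"
  proof (rule mult_right_mono[OF _ I0])
   have "l powr (m + 2) <= l powr real N" using l N by (intro powr_mono) auto
   also have "... = l ^ N" using l by (simp add: powr_realpow)
   finally have "q <= l ^ N * exp (- ((l - 1) * \<delta>^2))" unfolding q_def by (intro mult_right_mono) auto
   also have "... = exp (\<delta>^2) * (l ^ Suc N * exp (- (l * \<delta>^2))) / l" using l by (simp add: mult_exp_exp algebra_simps)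
   also have "... <= exp (\<delta>^2) * (fact (Suc N) / (\<delta>^2) ^ Suc N) / l" using l \<delta> by (intro divide_right_mono mult_left_mono power_exp_bound) auto
   finally show "q <= exp (\<delta>^2) * (fact (Suc N) / (\<delta>^2) ^ Suc N) / l" .
  qed
  finally show "(LINT X:?A|lborel. gk m c X Z l * weight (2 * c - 1) X) <= C / l" by (simp add: C_def)
 qed
qed

lemma cut_pole'_integral:
 assumes e: "e > 0"
 shows "integrable lborel (cut_pole' e)" "(LINT \<sigma>|lborel. cut_pole' e \<sigma>) = 1"
proof -
 have ind: "cut_pole' e = (%x. indicator {e..2 * e} x *\<^sub>R cut_pole' e x)"
 proof
  fix x
  have "x / e - 1 <= 0 \<or> x / e - 1 >= 1" if "x \<notin> {e..2 * e}" using that e by (auto simp: le_divide_eq divide_le_eq)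
  then show "cut_pole' e x = indicator {e..2 * e} x *\<^sub>R cut_pole' e x" by (cases "x \<in> {e..2 * e}") (auto simp: cut_pole'_def step'_0)
 qed
 have "has_bochner_integral lborel (%x. indicator {e..2 * e} x *\<^sub>R cut_pole' e x) (cut_pole e (2 * e) - cut_pole e e)"
 proof (rule has_bochner_integral_FTC_Icc)
  fix x
  have "(cut_pole e has_real_derivative cut_pole' e x) (at x within {e..2 * e})" unfolding cut_pole_def[abs_def] cut_pole'_def using e by (auto intro!: derivative_eq_intros)
  then show "(cut_pole e has_vector_derivative cut_pole' e x) (at x within {e..2 * e})" by (simp add: has_real_derivative_iff_has_vector_derivative)
  show "continuous_on {e..2 * e} (cut_pole' e)" using e by (intro continuous_intros) auto
 qed (use e in auto)
 moreover have "cut_pole e (2 * e) - cut_pole e e = 1" using e by (simp add: cut_pole_def step_1 step_0)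
 ultimately have "has_bochner_integral lborel (cut_pole' e) 1" by (subst ind) simp
 then show "integrable lborel (cut_pole' e)" "(LINT \<sigma>|lborel. cut_pole' e \<sigma>) = 1" by (auto simp: has_bochner_integral_iff)
qed

lemma cut_pole'_nonneg: "e > 0 ==> cut_pole' e \<sigma> >= 0" by (simp add: cut_pole'_def step'_bounds)

section \<open>The jump term as a kernel in its pole\<close>

lemma measurable_gk:
 fixes f g :: "'q => 'n::finite space"
 assumes c: "c > 0" and [measurable]: "f \<in> M \<rightarrow>\<^sub>M borel" "g \<in> M \<rightarrow>\<^sub>M borel" "h \<in> borel_measurable M"
 shows "(%x. gk m c (f x) (g x) (h x)) \<in> borel_measurable M"
proof -
 have "(%(X, Z, l). base_kernel c X Z l) \<in> borel_measurable (borel :: ('n space \<times> 'n event) measure)"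
  unfolding base_kernel_def case_prod_beta by (intro borel_measurable_continuous_onI continuous_intros c)
 moreover have "(%x. (f x, g x, h x)) \<in> M \<rightarrow>\<^sub>M borel" by measurable
 ultimately have "(%x. (%(X, Z, l). base_kernel c X Z l) (f x, g x, h x)) \<in> borel_measurable M" by (rule measurable_compose[rotated])
 then show ?thesis unfolding gk_def by simp
qed

lemma measurable_cut[measurable]:
 "cut_space r \<in> borel_measurable borel" "cut_space_grad r \<in> borel_measurable borel" "cut_time r \<in> borel_measurable borel" "cut_time' r \<in> borel_measurable borel"
 "cut_pole e \<in> borel_measurable borel" "cut_pole' e \<in> borel_measurable borel" "pole_l t \<in> borel_measurable borel"
 unfolding cut_space_def[abs_def] cut_space_grad_def[abs_def] cut_time_def[abs_def] cut_time'_def[abs_def] cut_pole_def[abs_def] cut_pole'_def[abs_def] pole_l_def[abs_def]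
 by measurable

lemma half_space_sets[measurable]: "{X :: 'n::finite space. 0 < snd X} \<in> sets borel" by (intro borel_open open_Collect_less continuous_intros)

lemma measurable_trunc_jump:
 fixes f g :: "'q => 'n::finite event"
 assumes c: "c > 0" and [measurable]: "f \<in> M \<rightarrow>\<^sub>M borel" "g \<in> M \<rightarrow>\<^sub>M borel"
 shows "(%x. trunc_jump m c e (fst (f x)) (snd (f x)) (g x)) \<in> borel_measurable M"
  "(%x. trunc m c e (fst (f x)) (snd (f x)) (g x)) \<in> borel_measurable M"
proof -
 have [measurable]: "(%x. fst (f x)) \<in> M \<rightarrow>\<^sub>M borel" "(%x. snd (f x)) \<in> M \<rightarrow>\<^sub>M borel"
  "(%x. fst (g x)) \<in> M \<rightarrow>\<^sub>M borel" "(%x. snd (g x)) \<in> M \<rightarrow>\<^sub>M borel"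
  by (rule measurable_compose[OF assms(2)] measurable_compose[OF assms(3)],
    intro borel_measurable_continuous_onI continuous_intros)+
 have "(%x. gk m c (fst (f x)) (fst (g x)) (1 / (4 * (snd (f x) - snd (g x))))) \<in> borel_measurable M" by (rule measurable_gk[OF c]) measurable
 then show "(%x. trunc_jump m c e (fst (f x)) (snd (f x)) (g x)) \<in> borel_measurable M"
  "(%x. trunc m c e (fst (f x)) (snd (f x)) (g x)) \<in> borel_measurable M" unfolding trunc_jump_def trunc_def pole_l_def by measurable
qed

lemma trunc_jump_nonneg: "c > 0 ==> e > 0 ==> trunc_jump m c e X t p >= 0" unfolding trunc_jump_def by (intro mult_nonneg_nonneg cut_pole'_nonneg gk_nonneg)

lemma nn_integral_trunc_jump:
 fixes Z :: "'n::finite space"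
 assumes c: "c > 0" and m: "m = real CARD('n) / 2 + c" and e: "e > 0"
  and A: "A \<in> sets borel" "A \<subseteq> {X. 0 < snd X}"
 shows "(\<integral>\<^sup>+p. ennreal (indicator A (fst p) * (trunc_jump m c e (fst p) (snd p) (Z, \<tau>) * weight (2 * c - 1) (fst p))) \<partial>lborel)
  = (\<integral>\<^sup>+t. ennreal (cut_pole' e (t - \<tau>) * (LINT X:A|lborel. gk m c X Z (pole_l t \<tau>) * weight (2 * c - 1) X)) \<partial>lborel)"
proof -
 let ?f = "%p. ennreal (indicator A (fst p) * (trunc_jump m c e (fst p) (snd p) (Z, \<tau>) * weight (2 * c - 1) (fst p)))"
 have [measurable]: "A \<in> sets borel" by (rule A(1))
 have fm: "(fst :: 'n event => 'n space) \<in> borel \<rightarrow>\<^sub>M borel"  by (intro borel_measurable_continuous_onI continuous_intros)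
 have "(%p. trunc_jump m c e (fst p) (snd p) (Z, \<tau>)) \<in> borel_measurable (borel :: ('n event) measure)" by (rule measurable_trunc_jump[OF c]) auto
 moreover have "(%p :: 'n event. weight (2 * c - 1) (fst p)) \<in> borel_measurable borel" by (rule measurable_compose[OF fm weight_measurable])
 moreover have "(%p :: 'n event. indicator A (fst p) :: real) \<in> borel_measurable borel" by (rule measurable_compose[OF fm borel_measurable_indicator[OF A(1)]])
 ultimately have "?f \<in> borel_measurable borel" by measurable
 then have "?f \<in> borel_measurable (lborel \<Otimes>\<^sub>M lborel)" by (simp add: lborel_prod)
 from lborel_pair.nn_integral_snd[OF this]
 have "integral\<^sup>N lborel ?f = (\<integral>\<^sup>+t. \<integral>\<^sup>+X. ?f (X, t) \<partial>lborel \<partial>lborel)" by (simp add: lborel_prod)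
 also have "... = (\<integral>\<^sup>+t. ennreal (cut_pole' e (t - \<tau>) * (LINT X:A|lborel. gk m c X Z (pole_l t \<tau>) * weight (2 * c - 1) X)) \<partial>lborel)"
 proof (rule nn_integral_cong)
  fix t :: real
  show "(\<integral>\<^sup>+X. ?f (X, t) \<partial>lborel) = ennreal (cut_pole' e (t - \<tau>) * (LINT X:A|lborel. gk m c X Z (pole_l t \<tau>) * weight (2 * c - 1) X))"
  proof (cases "t > \<tau>")
   case True
   then have l: "pole_l t \<tau> > 0" by (simp add: pole_l_def)
   have "set_integrable lborel A (%X. gk m c X Z (pole_l t \<tau>) * weight (2 * c - 1) X)" by (rule set_integrable_subset[OF gk_mass(1)[OF c l m]]) (use A in auto)
   then have i: "integrable lborel (%X. cut_pole' e (t - \<tau>) * (indicator A X *\<^sub>R (gk m c X Z (pole_l t \<tau>) * weight (2 * c - 1) X)))"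
    unfolding set_integrable_def by (rule integrable_mult_right)
   have "(\<integral>\<^sup>+X. ?f (X, t) \<partial>lborel) = (\<integral>\<^sup>+X. ennreal (cut_pole' e (t - \<tau>) * (indicator A X *\<^sub>R (gk m c X Z (pole_l t \<tau>) * weight (2 * c - 1) X))) \<partial>lborel)"
    by (intro nn_integral_cong) (simp add: trunc_jump_def mult_ac)
   also have "... = ennreal (LINT X|lborel. cut_pole' e (t - \<tau>) * (indicator A X *\<^sub>R (gk m c X Z (pole_l t \<tau>) * weight (2 * c - 1) X)))"
    by (rule nn_integral_eq_integral[OF i])
     (auto intro!: AE_I2 mult_nonneg_nonneg simp: weight_nonneg gk_nonneg[OF c] cut_pole'_nonneg[OF e])
   finally show ?thesis by (simp add: set_lebesgue_integral_def)
  next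
   case False
   then have "cut_pole' e (t - \<tau>) = 0" using e by (intro cut_pole_0) auto
   then show ?thesis by (simp add: trunc_jump_def)
  qed
 qed
 finally show ?thesis .
qed

text \<open>The roles are exchanged: the point \<open>q\<close> is fixed and the pole
  \<open>p\<close> varies, with the weight at the pole. In this order of integration the mass is
  constant, and no regularity of \<open>v\<close> enters the limit.\<close>

definition jump_kernel :: "real => real => 'n::finite event => 'n event => real" where
 "jump_kernel c e q p = indicator {X. 0 < snd X} (fst p) *
  (trunc_jump (real CARD('n) / 2 + c) c e (fst p) (snd p) q * weight (2 * c - 1) (fst p))"

lemma jump_kernel_nonneg: "c > 0 ==> e > 0 ==> jump_kernel c e q p >= 0" unfolding jump_kernel_def by (intro mult_nonneg_nonneg trunc_jump_nonneg weight_nonneg) auto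

lemma measurable_jump_kernel:
 assumes c: "c > 0" and f: "f \<in> M \<rightarrow>\<^sub>M borel" and g: "g \<in> M \<rightarrow>\<^sub>M borel"
 shows "(%x. jump_kernel c e (f x :: 'n::finite event) (g x)) \<in> borel_measurable M"
proof -
 have [measurable]: "(%x. fst (g x)) \<in> M \<rightarrow>\<^sub>M borel" by (rule measurable_compose[OF g]) (intro borel_measurable_continuous_onI continuous_intros)
 note [measurable] = measurable_trunc_jump(1)[OF c g f]
 show ?thesis unfolding jump_kernel_def by measurable
qed

lemma jump_kernel_mass:
 fixes Z :: "'n::finite space"
 assumes c: "c > 0" and e: "e > 0"
 shows "integrable lborel (jump_kernel c e (Z, \<tau>))" "(LINT p|lborel. jump_kernel c e (Z, \<tau>) p) = kernel_mass TYPE('n) c"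
proof -
 let ?m = "real CARD('n) / 2 + c"
 have pl: "pole_l t \<tau> > 0" if "cut_pole' e (t - \<tau>) ~= 0" for t using that cut_pole_0(2)[OF e, of "t - \<tau>"] e by (force simp: pole_l_def)
 have it: "integrable lborel (%t. cut_pole' e (- \<tau> + t))" by (rule integrable_translate[OF cut_pole'_integral(1)[OF e]])
 have it2: "(LINT t|lborel. cut_pole' e (- \<tau> + t)) = 1" using lborel_integral_translate[of "cut_pole' e" "- \<tau>"] cut_pole'_integral(2)[OF e] by simp
 have "(\<integral>\<^sup>+p. ennreal (jump_kernel c e (Z, \<tau>) p) \<partial>lborel)
  = (\<integral>\<^sup>+t. ennreal (cut_pole' e (t - \<tau>) * (LINT X:{X. 0 < snd X}|lborel. gk ?m c X Z (pole_l t \<tau>) * weight (2 * c - 1) X)) \<partial>lborel)"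
  unfolding jump_kernel_def by (rule nn_integral_trunc_jump[OF c refl e]) auto
 also have "... = (\<integral>\<^sup>+t. ennreal (cut_pole' e (- \<tau> + t) * kernel_mass TYPE('n) c) \<partial>lborel)"
 proof (rule nn_integral_cong)
  fix t
  show "ennreal (cut_pole' e (t - \<tau>) * (LINT X:{X. 0 < snd X}|lborel. gk ?m c X Z (pole_l t \<tau>) * weight (2 * c - 1) X))
   = ennreal (cut_pole' e (- \<tau> + t) * kernel_mass TYPE('n) c)" using gk_mass(2)[OF c pl refl, of t Z] by (cases "cut_pole' e (t - \<tau>) = 0") auto
 qed
 also have "... = ennreal (LINT t|lborel. cut_pole' e (- \<tau> + t) * kernel_mass TYPE('n) c)"
  using it by (intro nn_integral_eq_integral) (auto intro!: mult_nonneg_nonneg cut_pole'_nonneg e less_imp_le[OF kernel_mass_pos[OF c]])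
 also have "... = ennreal (kernel_mass TYPE('n) c)" using it it2 by simp
 finally have n: "(\<integral>\<^sup>+p. ennreal (jump_kernel c e (Z, \<tau>) p) \<partial>lborel) = ennreal (kernel_mass TYPE('n) c)" .
 have m: "jump_kernel c e (Z, \<tau>) \<in> borel_measurable lborel" unfolding measurable_lborel2 by (rule measurable_jump_kernel[OF c, of "%_. (Z, \<tau>)" _ "%p. p"]) auto
 have nn: "AE p in lborel. 0 <= jump_kernel c e (Z, \<tau>) p" by (intro AE_I2 jump_kernel_nonneg[OF c e])
 show "integrable lborel (jump_kernel c e (Z, \<tau>))" by (rule integrableI_nonneg[OF m nn]) (simp add: n)
 show "(LINT p|lborel. jump_kernel c e (Z, \<tau>) p) = kernel_mass TYPE('n) c" unfolding integral_eq_nn_integral[OF m nn] n using kernel_mass_pos[OF c, where 'n='n] by simp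
qed

lemma measurable_far:
 fixes Z :: "'n::finite space"
 shows "(%p :: 'n event. indicator {X. \<delta> <= norm (X - Z)} (fst p) :: real) \<in> borel_measurable borel"
proof -
 have "closed {X :: 'n space. \<delta> <= norm (X - Z)}" by (intro closed_Collect_le continuous_intros)
 moreover have "(fst :: 'n event => 'n space) \<in> borel \<rightarrow>\<^sub>M borel" by (intro borel_measurable_continuous_onI continuous_intros)
 ultimately show ?thesis by (intro measurable_compose[OF _ borel_measurable_indicator]) auto
qed

lemma jump_kernel_tail:
 fixes Z :: "'n::finite space"
 assumes c: "c > 0" and \<delta>: "\<delta> > 0" and z: "snd Z >= 0"
 shows "\<exists>C\<ge>0. \<forall>e. 0 < e \<and> e <= 1 / 8 -->
  (LINT p|lborel. indicator {X. \<delta> <= norm (X - Z)} (fst p) * jump_kernel c e (Z, \<tau>) p) <= C * e"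
proof -
 let ?j = "%e p. indicator {X. \<delta> <= norm (X - Z)} (fst p) * jump_kernel c e (Z, \<tau>) p"
 let ?m = "real CARD('n) / 2 + c"
 let ?A = "{X :: 'n space. 0 < snd X \<and> \<delta> <= norm (X - Z)}"
 have A: "?A \<in> sets borel"
 proof -
  have "closed {X :: 'n space. \<delta> <= norm (X - Z)}" by (intro closed_Collect_le continuous_intros)
  then have "{X. 0 < snd X} \<inter> {X :: 'n space. \<delta> <= norm (X - Z)} \<in> sets borel" by (intro sets.Int) auto
  then show ?thesis by (simp add: Int_def)
 qed
 obtain C where C: "C >= 0" "!!l. l >= 1 ==> (LINT X:?A|lborel. gk ?m c X Z l * weight (2 * c - 1) X) <= C / l" using gk_tail[OF c \<delta> z refl] by blast
 show ?thesis
 \<comment> \<open>The jump lives on time differences of at most \<open>2 e\<close>, so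
   \<open>1 / l = 4 (t - \<tau>) \<le> 8 e\<close>; and \<open>e \<le> 1 / 8\<close> ensures
   \<open>l \<ge> 1\<close>, as the tail estimate requires.\<close>
 proof (intro exI[of _ "8 * C"] conjI allI impI)
  fix e :: real assume ee: "0 < e \<and> e <= 1 / 8"
  then have e: "e > 0" by simp
  have it: "integrable lborel (%t. cut_pole' e (- \<tau> + t))" by (rule integrable_translate[OF cut_pole'_integral(1)[OF e]])
  have it2: "(LINT t|lborel. cut_pole' e (- \<tau> + t)) = 1" using lborel_integral_translate[of "cut_pole' e" "- \<tau>"] cut_pole'_integral(2)[OF e] by simp
  have "(\<integral>\<^sup>+p. ennreal (?j e p) \<partial>lborel)
   = (\<integral>\<^sup>+p. ennreal (indicator ?A (fst p) * (trunc_jump ?m c e (fst p) (snd p) (Z, \<tau>) * weight (2 * c - 1) (fst p))) \<partial>lborel)"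
   by (intro nn_integral_cong) (auto simp: jump_kernel_def indicator_def)
  also have "... = (\<integral>\<^sup>+t. ennreal (cut_pole' e (t - \<tau>) * (LINT X:?A|lborel. gk ?m c X Z (pole_l t \<tau>) * weight (2 * c - 1) X)) \<partial>lborel)"
   by (rule nn_integral_trunc_jump[OF c refl e A]) auto
  also have "... <= (\<integral>\<^sup>+t. ennreal (cut_pole' e (- \<tau> + t) * (8 * C * e)) \<partial>lborel)"
  proof (rule nn_integral_mono, rule ennreal_leI)
   fix t
   show "cut_pole' e (t - \<tau>) * (LINT X:?A|lborel. gk ?m c X Z (pole_l t \<tau>) * weight (2 * c - 1) X) <= cut_pole' e (- \<tau> + t) * (8 * C * e)"
   proof (cases "cut_pole' e (t - \<tau>) = 0")
    case False
    have "t - \<tau> > e" using cut_pole_0(2)[OF e, of "t - \<tau>"] False by fastforce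
    moreover have "t - \<tau> <= 2 * e"
    proof (rule ccontr)
     assume "\<not> t - \<tau> <= 2 * e"
     then have "(t - \<tau>) / e - 1 >= 1" using e by (simp add: field_simps)
     then show False using False by (simp add: cut_pole'_def step'_0)
    qed
    ultimately have s: "0 < t - \<tau>" "t - \<tau> <= 2 * e" using e by auto
    have l1: "pole_l t \<tau> >= 1" using s ee by (simp add: pole_l_def)
    have "(LINT X:?A|lborel. gk ?m c X Z (pole_l t \<tau>) * weight (2 * c - 1) X) <= C / pole_l t \<tau>" by (rule C(2)[OF l1])
    also have "... = C * (4 * (t - \<tau>))" by (simp add: pole_l_def)
    also have "... <= C * (4 * (2 * e))" using s C(1) by (intro mult_left_mono) auto
    finally show ?thesis using cut_pole'_nonneg[OF e, of "t - \<tau>"] by (auto intro!: mult_left_mono)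
   qed auto
  qed
  also have "... = ennreal (LINT t|lborel. cut_pole' e (- \<tau> + t) * (8 * C * e))"
   using it C(1) e by (intro nn_integral_eq_integral) (auto intro!: mult_nonneg_nonneg cut_pole'_nonneg)
  also have "... = ennreal (8 * C * e)" using it2 it by simp
  finally have n: "(\<integral>\<^sup>+p. ennreal (?j e p) \<partial>lborel) <= ennreal (8 * C * e)" .
  have "(LINT p|lborel. ?j e p)
   <= enn2real (\<integral>\<^sup>+p. ennreal (?j e p) \<partial>lborel)"
  proof (rule eq_refl, rule integral_eq_nn_integral)
   have "jump_kernel c e (Z, \<tau>) \<in> borel_measurable borel" using borel_measurable_integrable[OF jump_kernel_mass(1)[OF c e]] by simp
   then show "(?j e) \<in> borel_measurable lborel" unfolding measurable_lborel2 by (intro borel_measurable_times measurable_far)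
   show "AE p in lborel. 0 <= ?j e p" by (intro AE_I2 mult_nonneg_nonneg jump_kernel_nonneg[OF c e]) auto
  qed
  also have "... <= 8 * C * e" using n C(1) e by (intro enn2real_leI) auto
  finally show "(LINT p|lborel. ?j e p) <= 8 * C * e" .
 qed (use C in auto)
qed

text \<open>Time differences lie in \<open>[e, 2 e]\<close>, so closeness in time is automatic and
  only poles at a distance in space need the tail estimate.\<close>

lemma jump_kernel_approximate_identity:
 fixes Z :: "'n::finite space" and \<theta> :: "'n event => real"
 assumes c: "c > 0" and z: "snd Z >= 0" and \<theta>: "continuous_on UNIV \<theta>" "!!p. \<bar>\<theta> p\<bar> <= M"
  and e: "!!n. e n > 0" "e \<longlonglongrightarrow> 0"
 shows "(%n. LINT p|lborel. \<theta> p * jump_kernel c (e n) (Z, \<tau>) p) \<longlonglongrightarrow> kernel_mass TYPE('n) c * \<theta> (Z, \<tau>)"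
proof (rule LIMSEQ_I)
 fix r :: real assume r: "r > 0"
 define \<kappa> where "\<kappa> = kernel_mass TYPE('n) c"
 have \<kappa>: "\<kappa> > 0" unfolding \<kappa>_def by (rule kernel_mass_pos[OF c])
 have M: "M >= 0" using \<theta>(2)[of undefined] by linarith
 have "isCont \<theta> (Z, \<tau>)" using \<theta>(1) continuous_on_eq_continuous_at[OF open_UNIV] by blast
 moreover have "r / (2 * \<kappa>) > 0" using r \<kappa> by simp
 ultimately obtain d where d: "d > 0" "!!p. dist p (Z, \<tau>) < d ==> \<bar>\<theta> p - \<theta> (Z, \<tau>)\<bar> < r / (2 * \<kappa>)"
  unfolding continuous_at_eps_delta dist_real_def by blast
 define \<delta> where "\<delta> = d / 2"
 have \<delta>: "\<delta> > 0" using d by (simp add: \<delta>_def)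
 obtain C where C: "C >= 0" "!!e. 0 < e ==> e <= 1 / 8 ==>
  (LINT p|lborel. indicator {X. \<delta> <= norm (X - Z)} (fst p) * jump_kernel c e (Z, \<tau>) p) <= C * e" using jump_kernel_tail[OF c \<delta> z, of \<tau>] by blast
 \<comment> \<open>Distant poles contribute at most \<open>2 M C e\<close>, which is below
   \<open>r / 2\<close> when \<open>e\<close> is less than the first number; the \<open>+ 1\<close>
   covers \<open>M * C = 0\<close>. The second number is the range of the tail estimate, and the
   third keeps \<open>2 e\<close> below \<open>\<delta>\<close>.\<close>
 have "r / (4 * (M * C + 1)) > 0" "(1 / 8 :: real) > 0" "\<delta> / 2 > 0" using \<delta> r M C(1) by (auto intro!: divide_pos_pos mult_pos_pos add_nonneg_pos)
 note pos = this[THEN order_tendstoD(2)[OF e(2)]]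
 from pos(2,3,1) have "eventually (%n. norm ((LINT p|lborel. \<theta> p * jump_kernel c (e n) (Z, \<tau>) p) - kernel_mass TYPE('n) c * \<theta> (Z, \<tau>)) < r) sequentially"
 proof eventually_elim
  case (elim n)
  let ?k = "jump_kernel c (e n) (Z, \<tau>)" and ?far = "%p. indicator {X. \<delta> <= norm (X - Z)} (fst p) :: real"
  note k = jump_kernel_mass[OF c e(1)[of n], of Z \<tau>]
  have k0: "?k p >= 0" for p by (rule jump_kernel_nonneg[OF c e(1)])
  have km[measurable]: "?k \<in> borel_measurable borel" using borel_measurable_integrable[OF k(1)] by simp
  have [measurable]: "\<theta> \<in> borel_measurable borel" using \<theta>(1) by (rule borel_measurable_continuous_onI)
  have i1: "integrable lborel (%p. \<theta> p * ?k p)"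
   by (rule integrable_bound[of _ "%p. M * ?k p"]) (use k(1) \<theta>(2) k0 in \<open>auto simp: abs_mult intro!: AE_I2 mult_right_mono order_trans[OF _ abs_ge_self]\<close>)
  have i2: "integrable lborel (%p. ?far p * ?k p)"
  proof (rule integrable_bound[OF k(1)])
   show "(%p. ?far p * ?k p) \<in> borel_measurable lborel" unfolding measurable_lborel2 by (intro borel_measurable_times measurable_far km)
   show "AE p in lborel. norm (?far p * ?k p) <= norm (?k p)" by (intro AE_I2) (simp add: indicator_def)
  qed
  have bound: "\<bar>(\<theta> p - \<theta> (Z, \<tau>)) * ?k p\<bar> <= r / (2 * \<kappa>) * ?k p + 2 * M * (?far p * ?k p)" for p
  proof (cases "?k p = 0")
   case False
   have tk: "cut_pole' (e n) (snd p - \<tau>) ~= 0" using False by (auto simp: jump_kernel_def trunc_jump_def)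
   have "snd p - \<tau> > e n" using cut_pole_0(2)[OF e(1)[of n], of "snd p - \<tau>"] tk by fastforce
   moreover have "snd p - \<tau> <= 2 * e n"
   proof (rule ccontr)
    assume "\<not> snd p - \<tau> <= 2 * e n"
    then have "(snd p - \<tau>) / e n - 1 >= 1" using e(1)[of n] by (simp add: field_simps)
    then show False using tk by (simp add: cut_pole'_def step'_0)
   qed
   ultimately have s: "\<bar>snd p - \<tau>\<bar> < \<delta>" using e(1)[of n] elim(2) by auto
   show ?thesis
   proof (cases "\<delta> <= norm (fst p - Z)")
    case True
    have "\<bar>\<theta> p - \<theta> (Z, \<tau>)\<bar> <= 2 * M" using \<theta>(2)[of p] \<theta>(2)[of "(Z, \<tau>)"] by linarith
    then have "\<bar>(\<theta> p - \<theta> (Z, \<tau>)) * ?k p\<bar> <= 2 * M * ?k p" using k0[of p] by (auto simp: abs_mult intro!: mult_right_mono)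
    moreover have "0 <= r / (2 * \<kappa>) * ?k p" using r \<kappa> k0[of p] by simp
    ultimately show ?thesis using True by simp
   next
    case False
    have "dist p (Z, \<tau>) <= norm (fst p - Z) + \<bar>snd p - \<tau>\<bar>" using norm_Pair_le[of "fst p - Z" "snd p - \<tau>"] by (cases p) (simp add: dist_norm)
    also have "... < d" using False s unfolding \<delta>_def by linarith
    finally have "\<bar>\<theta> p - \<theta> (Z, \<tau>)\<bar> <= r / (2 * \<kappa>)" using d(2) by (simp add: less_imp_le)
    then have "\<bar>\<theta> p - \<theta> (Z, \<tau>)\<bar> * ?k p <= r / (2 * \<kappa>) * ?k p" using k0[of p] by (rule mult_right_mono)
    then have "\<bar>(\<theta> p - \<theta> (Z, \<tau>)) * ?k p\<bar> <= r / (2 * \<kappa>) * ?k p" using k0[of p] by (simp only: abs_mult abs_of_nonneg)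
    then show ?thesis using False by simp
   qed
  qed simp
  have i3: "integrable lborel (%p. \<theta> (Z, \<tau>) * ?k p)" using k(1) by simp
  have "(LINT p|lborel. \<theta> p * ?k p) - \<kappa> * \<theta> (Z, \<tau>) = (LINT p|lborel. \<theta> p * ?k p) - (LINT p|lborel. \<theta> (Z, \<tau>) * ?k p)"
   using k(2) by (simp add: \<kappa>_def)
  also have "... = (LINT p|lborel. (\<theta> p - \<theta> (Z, \<tau>)) * ?k p)" using integral_diff[OF i1 i3] by (simp add: left_diff_distrib)
  finally have "\<bar>(LINT p|lborel. \<theta> p * ?k p) - \<kappa> * \<theta> (Z, \<tau>)\<bar> = \<bar>LINT p|lborel. (\<theta> p - \<theta> (Z, \<tau>)) * ?k p\<bar>" by simp
  also have "... <= (LINT p|lborel. r / (2 * \<kappa>) * ?k p + 2 * M * (?far p * ?k p))"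
  proof (rule integral_abs_bound_integral)
   show "integrable lborel (%p. (\<theta> p - \<theta> (Z, \<tau>)) * ?k p)" using integrable_diff[OF i1 i3] by (simp add: left_diff_distrib)
  qed (use bound i2 k(1) in auto)
  also have "... = r / (2 * \<kappa>) * \<kappa> + 2 * M * (LINT p|lborel. ?far p * ?k p)" using i2 k by (simp add: \<kappa>_def)
  also have "... <= r / 2 + 2 * M * (C * e n)" using C(2)[OF e(1)[of n]] elim(1) M \<kappa> by (intro add_mono mult_left_mono) auto
  also have "... < r"
  proof -
   have "e n * (4 * (M * C + 1)) < r" using elim(3) M C(1) by (simp add: pos_less_divide_eq add_nonneg_pos)
   then have "4 * (M * C * e n) + 4 * e n < r" by (simp add: algebra_simps)
   then show ?thesis using e(1)[of n] by (simp add: mult_ac)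
  qed
  finally show ?case by (simp add: \<kappa>_def)
 qed
 then show "\<exists>no. \<forall>n\<ge>no. norm ((LINT p|lborel. \<theta> p * jump_kernel c (e n) (Z, \<tau>) p) - kernel_mass TYPE('n) c * \<theta> (Z, \<tau>)) < r"
  by (simp add: eventually_sequentially)
qed

section \<open>Almost everywhere representation\<close>

text \<open>Integrate over the pole against a test function \<open>\<theta>\<close> and the weight.
  By Fubini the kernel then averages the continuous \<open>\<theta>\<close> instead of
  \<open>V\<close>, and the approximate identity gives the mass times \<open>\<theta>\<close>; on
  the other side dominated convergence gives \<open>R\<close>. Comparing both for all
  \<open>\<theta>\<close> yields the identity almost everywhere.\<close>

lemma AE_eq_from_jump_kernel:
 fixes V R :: "'n::finite event => real"
 assumes c: "c > 0" and V: "integrable lborel V" "!!q. snd (fst q) <= 0 ==> V q = 0"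
  and D: "open D" "D \<subseteq> {p. 0 < snd (fst p)}"
  and w: "set_integrable lborel D (%p. weight (2 * c - 1) (fst p))"
  and e: "!!n. e n > 0" "e \<longlonglongrightarrow> 0"
  and R: "!!p. p \<in> D ==> (%n. LINT q|lborel. V q * trunc_jump (real CARD('n) / 2 + c) c (e n) (fst p) (snd p) q) \<longlonglongrightarrow> R p"
  and C: "!!n p. p \<in> D ==> \<bar>LINT q|lborel. V q * trunc_jump (real CARD('n) / 2 + c) c (e n) (fst p) (snd p) q\<bar> <= C"
 shows "AE p in lborel. p \<in> D --> kernel_mass TYPE('n) c * V p = weight (2 * c - 1) (fst p) * R p"
proof -
 let ?\<kappa> = "kernel_mass TYPE('n) c" and ?w = "%p :: 'n event. weight (2 * c - 1) (fst p)"
 define I where "I n p = (LINT q|lborel. V q * trunc_jump (real CARD('n) / 2 + c) c (e n) (fst p) (snd p) q)" for n and p :: "'n event"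
 have [measurable]: "D \<in> sets borel" using D(1) by simp
 have Vm[measurable]: "V \<in> borel_measurable borel" using V(1) by (auto dest: borel_measurable_integrable)
 have wm[measurable]: "?w \<in> borel_measurable borel" by (rule measurable_compose[OF _ weight_measurable]) (intro borel_measurable_continuous_onI continuous_intros)
 have Im[measurable]: "I n \<in> borel_measurable borel" for n
 proof -
  have "(%x. trunc_jump (real CARD('n) / 2 + c) c (e n) (fst (fst x)) (snd (fst x)) (snd x)) \<in> borel_measurable (borel \<Otimes>\<^sub>M lborel)"
   by (rule measurable_trunc_jump(1)[OF c, of fst _ snd]) measurable
  moreover have "(%x. V (snd x)) \<in> borel_measurable (borel \<Otimes>\<^sub>M lborel)" by measurable
  ultimately have "(%(p, q). V q * trunc_jump (real CARD('n) / 2 + c) c (e n) (fst p) (snd p) q) \<in> borel_measurable (borel \<Otimes>\<^sub>M lborel)"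
   unfolding case_prod_beta by (rule borel_measurable_times[rotated])
  then show ?thesis unfolding I_def[abs_def] by (rule lborel.borel_measurable_lebesgue_integral)
 qed
 have wi: "integrable lborel (%p. indicator D p * ?w p)" using w by (simp add: set_integrable_def)
 have lim: "(%n. indicator D p * (?w p * I n p)) \<longlonglongrightarrow> indicator D p * (?w p * R p)" for p
  using R[of p] by (cases "p \<in> D") (auto simp: I_def intro!: tendsto_intros)
 have Rm[measurable]: "(%p. indicator D p * (?w p * R p)) \<in> borel_measurable borel" by (rule borel_measurable_LIMSEQ_real[OF lim]) measurable
 have C0: "C >= 0" if "p \<in> D" for p using C[OF that, of 0] by linarith
 have RC: "\<bar>R p\<bar> <= C" if "p \<in> D" for p by (rule LIMSEQ_le_const2[OF tendsto_rabs[OF R[OF that]]]) (use C[OF that] in auto)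
 have Ri: "integrable lborel (%p. indicator D p * (?w p * R p))"
 proof (rule integrable_bound)
  show "integrable lborel (%p. C * (indicator D p * ?w p))" using wi by simp
  show "AE p in lborel. norm (indicator D p * (?w p * R p)) <= norm (C * (indicator D p * ?w p))"
   using RC C0 by (intro AE_I2) (auto simp: indicator_def abs_mult weight_nonneg mult.commute intro!: mult_right_mono)
 qed simp
 define f where "f p = ?\<kappa> * (indicator D p * V p) - indicator D p * (?w p * R p)" for p
 have VD: "integrable lborel (%p. indicator D p * V p)" using integrable_mult_indicator[of D lborel V] V(1) by simp
 have "AE p in lborel. f p = 0"
 proof (rule AE_0_if_test_0[OF _ D(1)])
  show "integrable lborel f" unfolding f_def[abs_def] using VD Ri by (intro integrable_diff) auto
  show "f p = 0" if "p \<notin> D" for p using that by (simp add: f_def)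
  fix \<theta> :: "'n event => real"
  assume \<theta>: "continuous_on UNIV \<theta>" "!!x. 0 <= \<theta> x \<and> \<theta> x <= 1" "\<exists>K. compact K \<and> K \<subseteq> D \<and> (\<forall>x. x \<notin> K --> \<theta> x = 0)"
  then have \<theta>0: "\<theta> p = 0" if "p \<notin> D" for p using that by blast
  have [measurable]: "\<theta> \<in> borel_measurable borel" by (rule borel_measurable_continuous_onI[OF \<theta>(1)])
  let ?T = "%n q. LINT p|lborel. \<theta> p * jump_kernel c (e n) q p"
  have fub: "(LINT p|lborel. \<theta> p * (?w p * I n p)) = (LINT q|lborel. V q * ?T n q)"
   and bd: "\<bar>?T n q\<bar> <= ?\<kappa>"
   and im: "?T n \<in> borel_measurable lborel" for n q
  proof -
   let ?k = "jump_kernel c (e n) :: 'n event => 'n event => real"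
   have km: "(%x. ?k (fst x) (snd x)) \<in> borel_measurable (lborel \<Otimes>\<^sub>M lborel)" by (rule measurable_jump_kernel[OF c, of fst _ snd]) measurable
   have k1: "integrable lborel (?k q)" "(LINT p|lborel. ?k q p) = ?\<kappa>" for q using jump_kernel_mass[OF c e(1)[of n], of "fst q" "snd q"] by simp_all
   have k0: "?k q p >= 0" for q p by (rule jump_kernel_nonneg[OF c e(1)])
   have kq[measurable]: "?k q \<in> borel_measurable borel" for q using borel_measurable_integrable[OF k1(1)] by simp
   have tk: "integrable lborel (%p. \<theta> p * ?k q p)" for q
    by (rule integrable_bound[OF k1(1)[of q]]) (use \<theta>(2) k0[of q] in \<open>auto intro!: AE_I2 mult_left_le_one_le simp: abs_mult\<close>)
   let ?J = "%q. LINT p|lborel. \<bar>\<theta> p * ?k q p\<bar>"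
   have tkb: "?J q <= ?\<kappa>" for q unfolding k1(2)[of q, symmetric]
    by (rule integral_mono) (use tk[of q] k1(1)[of q] \<theta>(2) k0[of q] in \<open>auto intro!: mult_left_le_one_le simp: abs_mult\<close>)
   show "\<bar>LINT p|lborel. \<theta> p * ?k q p\<bar> <= ?\<kappa>" for q using integral_abs_bound[of lborel "%p. \<theta> p * ?k q p"] tkb[of q] by linarith
   have mm: "(%x. \<theta> (snd x) * ?k (fst x) (snd x)) \<in> borel_measurable (lborel \<Otimes>\<^sub>M lborel)"
    using km by (rule borel_measurable_times[rotated]) measurable
   have mV: "(%x. V (fst x) * (\<theta> (snd x) * ?k (fst x) (snd x))) \<in> borel_measurable (lborel \<Otimes>\<^sub>M lborel)"
    using mm by (rule borel_measurable_times[rotated]) measurable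
   show "(%q. LINT p|lborel. \<theta> p * ?k q p) \<in> borel_measurable lborel" using mm by (intro lborel.borel_measurable_lebesgue_integral) (simp add: case_prod_beta')
   have mabs: "?J \<in> borel_measurable lborel"
    using mm by (intro lborel.borel_measurable_lebesgue_integral) (simp add: case_prod_beta')
   have joint: "integrable (lborel \<Otimes>\<^sub>M lborel) (case_prod (%q p. V q * (\<theta> p * ?k q p)))"
   proof (rule lborel_pair.Fubini_integrable)
    show "(%(q, p). V q * (\<theta> p * ?k q p)) \<in> borel_measurable (lborel \<Otimes>\<^sub>M lborel)" using mV by (simp add: case_prod_beta')
    have "integrable lborel (%q. \<bar>V q\<bar> * ?J q)"
    proof (rule integrable_bound)
     show "integrable lborel (%q. ?\<kappa> * V q)" using V(1) by simp
     show "(%q. \<bar>V q\<bar> * ?J q) \<in> borel_measurable lborel" using mabs by (intro borel_measurable_times) auto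
     show "AE q in lborel. norm (\<bar>V q\<bar> * ?J q) <= norm (?\<kappa> * V q)" (is "AE q in _. ?P q")
     proof (rule AE_I2)
      fix q
      have "0 <= ?J q" by simp
      with tkb[of q] have "\<bar>V q\<bar> * ?J q <= \<bar>V q\<bar> * ?\<kappa>" by (intro mult_left_mono) auto
      then show "?P q" using kernel_mass_pos[OF c, where 'n='n] by (simp add: abs_mult mult.commute)
     qed
    qed
    then show "integrable lborel (%q. LINT p|lborel. norm (case (q, p) of (q, p) => V q * (\<theta> p * ?k q p)))" by (simp add: abs_mult)
    show "AE q in lborel. integrable lborel (%p. case (q, p) of (q, p) => V q * (\<theta> p * ?k q p))" using tk by simp
   qed
   have "(LINT p|lborel. \<theta> p * (?w p * I n p)) = (LINT p|lborel. (LINT q|lborel. V q * (\<theta> p * ?k q p)))"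
   proof (rule integral_cong[OF refl])
    fix p :: "'n event"
    show "\<theta> p * (?w p * I n p) = (LINT q|lborel. V q * (\<theta> p * ?k q p))"
    proof (cases "p \<in> D")
     case True
     then have "0 < snd (fst p)" using D(2) by auto
     then have "(LINT q|lborel. V q * (\<theta> p * ?k q p)) = (LINT q|lborel. (\<theta> p * ?w p) * (V q * trunc_jump (real CARD('n) / 2 + c) c (e n) (fst p) (snd p) q))"
      by (intro integral_cong) (auto simp: jump_kernel_def mult_ac)
     then show ?thesis by (simp add: I_def)
    qed (simp add: \<theta>0)
   qed
   also have "... = (LINT q|lborel. (LINT p|lborel. V q * (\<theta> p * ?k q p)))" by (rule lborel_pair.Fubini_integral[OF joint])
   finally show "(LINT p|lborel. \<theta> p * (?w p * I n p)) = (LINT q|lborel. V q * (LINT p|lborel. \<theta> p * ?k q p))" by simp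
  qed
  have "(%n. LINT q|lborel. V q * ?T n q) \<longlonglongrightarrow> (LINT q|lborel. V q * (?\<kappa> * \<theta> q))"
  proof (rule integral_dominated_convergence)
   show "integrable lborel (%q. ?\<kappa> * \<bar>V q\<bar>)" using V(1) by simp
   show "(%q. V q * ?T n q) \<in> borel_measurable lborel" for n using im by (intro borel_measurable_times) auto
   show "AE q in lborel. (%n. V q * ?T n q) \<longlonglongrightarrow> V q * (?\<kappa> * \<theta> q)" (is "AE q in _. ?P q")
   proof (rule AE_I2)
    fix q
    show "?P q"
    proof (cases "snd (fst q) <= 0")
     case False
     then have "(%n. LINT p|lborel. \<theta> p * jump_kernel c (e n) (fst q, snd q) p) \<longlonglongrightarrow> ?\<kappa> * \<theta> (fst q, snd q)"
      using \<theta>(2) by (intro jump_kernel_approximate_identity[OF c _ \<theta>(1) _ e, where M=1]) auto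
     then show ?thesis by (intro tendsto_intros) simp
    qed (simp add: V(2))
   qed
   show "AE q in lborel. norm (V q * ?T n q) <= ?\<kappa> * \<bar>V q\<bar>" (is "AE q in _. ?P q") for n
   proof (rule AE_I2)
    fix q
    have "\<bar>V q\<bar> * \<bar>?T n q\<bar> <= \<bar>V q\<bar> * ?\<kappa>" using bd by (intro mult_left_mono) auto
    then show "?P q" by (simp add: abs_mult mult.commute)
   qed
  qed simp
  then have A: "(%n. LINT p|lborel. \<theta> p * (?w p * I n p)) \<longlonglongrightarrow> (LINT q|lborel. V q * (?\<kappa> * \<theta> q))" unfolding fub .
  have B: "(%n. LINT p|lborel. \<theta> p * (?w p * I n p)) \<longlonglongrightarrow> (LINT p|lborel. \<theta> p * (indicator D p * (?w p * R p)))"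
  proof (rule integral_dominated_convergence)
   show "integrable lborel (%p. C * (indicator D p * ?w p))" using wi by simp
   show "AE p in lborel. (%n. \<theta> p * (?w p * I n p)) \<longlonglongrightarrow> \<theta> p * (indicator D p * (?w p * R p))" (is "AE p in _. ?P p")
   proof (rule AE_I2)
    fix p show "?P p" using tendsto_mult_left[OF lim[of p], of "\<theta> p"] \<theta>0[of p] by (cases "p \<in> D") auto
   qed
   show "AE p in lborel. norm (\<theta> p * (?w p * I n p)) <= C * (indicator D p * ?w p)" (is "AE p in _. ?P p") for n
   proof (rule AE_I2)
    fix p
    show "?P p"
    proof (cases "p \<in> D")
     case True
     have "\<bar>\<theta> p\<bar> * (?w p * \<bar>I n p\<bar>) <= 1 * (?w p * C)"
      using C[OF True, of n] \<theta>(2)[of p] by (intro mult_mono) (auto simp: I_def weight_nonneg)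
     then show ?thesis using True by (simp add: abs_mult weight_nonneg mult_ac)
    qed (simp add: \<theta>0)
   qed
  qed measurable
  have "(LINT q|lborel. V q * (?\<kappa> * \<theta> q)) = (LINT p|lborel. \<theta> p * (indicator D p * (?w p * R p)))" by (rule LIMSEQ_unique[OF A B])
  moreover have "(LINT q|lborel. V q * (?\<kappa> * \<theta> q)) = (LINT p|lborel. \<theta> p * (?\<kappa> * (indicator D p * V p)))"
   by (intro integral_cong) (auto simp: indicator_def \<theta>0)
  moreover have "integrable lborel (%p. \<theta> p * h p)" if "integrable lborel h" for h :: "'n event => real" by (rule integrable_bound[OF that])
    (use \<theta>(2) that in \<open>auto intro!: AE_I2 mult_left_le_one_le simp: abs_mult\<close>)
  then have "(LINT p|lborel. \<theta> p * f p) = (LINT p|lborel. \<theta> p * (?\<kappa> * (indicator D p * V p))) - (LINT p|lborel. \<theta> p * (indicator D p * (?w p * R p)))"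
   unfolding f_def right_diff_distrib using VD Ri by (intro integral_diff) auto
  ultimately show "(LINT p|lborel. \<theta> p * f p) = 0" by simp
 qed
 then show ?thesis by eventually_elim (auto simp: f_def)
qed

section \<open>Regularity away from the diagonal\<close>

definition past :: "('n::finite space => 'n space => real => real) => 'n event => 'n event => real" where
 "past F p q = (if snd q < snd p then F (fst p) (fst q) (pole_l (snd p) (snd q)) else 0)"

text \<open>The factor \<open>6 / 5\<close> leaves room on both sides. A coordinate path between
  points of the half ball of radius \<open>r\<close> at distance at most \<open>r / 5\<close> stays
  inside, and points with \<open>(norm Z)^2 \<ge> 2 r^2\<close>, whose norm is at least
  \<open>7 / 5 r\<close>, keep the distance \<open>r / 5\<close>.\<close>

definition near :: "real => ('n::finite event) set" where
 "near r = {p. norm (fst p) <= 6 / 5 * r \<and> 0 <= snd (fst p) \<and> - r\<^sup>2 <= snd p \<and> snd p <= r^2}"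

text \<open>It contains all points of the large cylinder at which the derivative of
  \<open>cut_time\<close> or the gradient of \<open>cut_space\<close> is not 0.\<close>

definition far :: "real => ('n::finite event) set" where
 "far r = {q. norm (fst q) <= 2 * r \<and> 0 <= snd (fst q) \<and> - 4 * r^2 <= snd q \<and> snd q <= 0 \<and>
  (snd q <= - 2 * r^2 \<or> 2 * r^2 <= (norm (fst q))^2)}"

lemma measurable_past:
 fixes F :: "'n::finite space => 'n space => real => real"
 assumes "nice F"
 shows "past F p \<in> borel_measurable borel"
proof -
 let ?S = "{q :: 'n event. snd q < snd p}"
 have "open ?S" by (intro open_Collect_less continuous_intros)
 moreover have "continuous_on ?S (%q. (%(X, Z, l). F X Z l) (fst p, fst q, pole_l (snd p) (snd q)))" by (rule continuous_on_compose2[OF nice_continuous[OF assms]])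
   (auto simp: pole_l_def intro!: continuous_intros)
 ultimately have "(%q. indicator ?S q *\<^sub>R ((%(X, Z, l). F X Z l) (fst p, fst q, pole_l (snd p) (snd q)))) \<in> borel_measurable borel"
  by (intro borel_measurable_continuous_on_indicator) auto
 moreover have "(%q. indicator ?S q *\<^sub>R ((%(X, Z, l). F X Z l) (fst p, fst q, pole_l (snd p) (snd q)))) = past F p" by (auto simp: past_def indicator_def fun_eq_iff)
 ultimately show ?thesis by simp
qed

text \<open>Either the time difference is at least \<open>r^2\<close>, and then \<open>l\<close> is
  bounded, or the distance in space is at least \<open>r / 5\<close>, and then the Gaussian beats
  every power of \<open>l\<close>. The quadratic rate is what makes the extension by 0 to the future
  differentiable in time.\<close>

lemma past_bound:
 fixes F :: "'n::finite space => 'n space => real => real"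
 assumes F: "nice F" and r: "r > 0"
 obtains C where "C >= 0" "!!p q. p \<in> near r ==> q \<in> far r ==> \<bar>past F p q\<bar> <= C * (snd p - snd q)^2"
proof -
 \<comment> \<open>Times in \<open>near\<close> and \<open>far\<close> differ by at most
   \<open>5 r^2\<close>, and \<open>l = 1 / (4 s)\<close> with \<open>s\<close> the
   difference.\<close>
 define l0 where "l0 = 1 / (20 * r^2)"
 have l0: "l0 > 0" using r by (simp add: l0_def)
 obtain C N where C: "C >= 0" "!!X Z l. norm X <= 2 * r ==> norm Z <= 2 * r ==> snd X >= 0 ==> snd Z >= 0 ==> l >= l0 ==>
  \<bar>F X Z l\<bar> <= C * l ^ N * exp (- (l * (norm (X - Z))^2))" using nice_bound[OF F l0, of "2 * r"] by blast
 define k where "k = (r / 5)^2"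
 have k: "k > 0" using r by (simp add: k_def)
 let ?D = "(1 / r^2) ^ N / (r^2)^2 + 16 * (fact (N + 2) / k ^ (N + 2))"
 define D where "D = C * ?D"
 show ?thesis
 proof
  show "D >= 0" unfolding D_def using C(1) r k by (intro mult_nonneg_nonneg add_nonneg_nonneg divide_nonneg_nonneg) auto
  fix p q :: "'n event"
  let ?n = "norm (fst p - fst q)"
  assume p: "p \<in> near r" and q: "q \<in> far r"
  show "\<bar>past F p q\<bar> <= D * (snd p - snd q)^2"
  proof (cases "snd q < snd p")
   case True
   define s where "s = snd p - snd q"
   define l where "l = pole_l (snd p) (snd q)"
   have s: "s > 0" using True by (simp add: s_def)
   have l: "l = 1 / (4 * s)" by (simp add: l_def s_def pole_l_def)
   have "s <= 5 * r^2" using p q by (auto simp: s_def near_def far_def)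
   then have ll: "l >= l0" "l > 0" using s r by (auto simp: l l0_def field_simps)
   have nX: "norm (fst p) <= 2 * r" using p r by (auto simp: near_def)
   have "\<bar>F (fst p) (fst q) l\<bar> <= C * l ^ N * exp (- (l * (?n)^2))" using p q nX ll by (intro C(2)) (auto simp: near_def far_def)
   also have "... = C * (l ^ N * exp (- (l * (?n)^2)))" by simp
   also have "... <= C * (?D * s^2)"
   proof (rule mult_left_mono[OF _ C(1)])
    have n1: "0 <= (1 / r^2) ^ N / (r^2)^2" using r by simp
    have n2: "0 <= 16 * (fact (N + 2) / k ^ (N + 2))" using k by simp
    show "l ^ N * exp (- (l * (?n)^2)) <= ?D * s^2"
    proof (cases "snd q <= - 2 * r^2")
     case True
     then have sr: "r^2 <= s" using p by (auto simp: s_def near_def)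
     have "l <= 1 / r^2" using sr s r by (simp add: l field_simps)
     then have "l ^ N <= (1 / r^2) ^ N" using ll by (intro power_mono) auto
     moreover have "exp (- (l * (?n)^2)) <= 1" using ll by simp
     ultimately have "l ^ N * exp (- (l * (?n)^2)) <= (1 / r^2) ^ N * 1" using ll r by (intro mult_mono) auto
     also have "... <= (1 / r^2) ^ N * (s^2 / (r^2)^2)"
     proof (rule mult_left_mono)
      have "(r^2)^2 <= s^2" using sr by (intro power_mono) auto
      then show "1 <= s^2 / (r^2)^2" using r by simp
     qed (use r in auto)
     also have "... = (1 / r^2) ^ N / (r^2)^2 * s^2" by simp
     also have "... <= ?D * s^2" using n2 by (intro mult_right_mono) auto
     finally show ?thesis .
    next
     case False
     then have nz: "2 * r^2 <= (norm (fst q))^2" using q by (auto simp: far_def)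
     have "(7 / 5 * r)^2 <= (norm (fst q))^2"
     proof (rule order_trans[OF _ nz])
      show "(7 / 5 * r)^2 <= 2 * r^2" by (simp add: power2_eq_square)
     qed
     then have "7 / 5 * r <= norm (fst q)" by (rule power2_le_imp_le) simp
     moreover have "norm (fst p) <= 6 / 5 * r" using p by (auto simp: near_def)
     ultimately have "r / 5 <= ?n" using norm_triangle_ineq2[of "fst q" "fst p"] by (simp add: norm_minus_commute)
     then have "k <= (?n)^2" unfolding k_def using r by (intro power_mono) auto
     then have "l ^ N * exp (- (l * (?n)^2)) <= l ^ N * exp (- (l * k))" using ll by (intro mult_left_mono) auto
     \<comment> \<open>Two further powers of \<open>l = 1 / (4 s)\<close> are bought with the factor
       \<open>16 s^2\<close>.\<close>
     also have "... = l ^ (N + 2) * exp (- (l * k)) * (16 * s^2)" using s by (simp add: l power_add power2_eq_square field_simps)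
     also have "... <= (fact (N + 2) / k ^ (N + 2)) * (16 * s^2)" using ll k by (intro mult_right_mono power_exp_bound) auto
     also have "... = 16 * (fact (N + 2) / k ^ (N + 2)) * s^2" by simp
     also have "... <= ?D * s^2" using n1 by (intro mult_right_mono) auto
     finally show ?thesis .
    qed
   qed
   finally show ?thesis using True by (simp add: past_def D_def l_def s_def)
  next
   case False
   then show ?thesis using \<open>D >= 0\<close> by (simp add: past_def)
  qed
 qed
qed

lemma past_bounded:
 fixes F :: "'n::finite space => 'n space => real => real"
 assumes F: "nice F" and r: "r > 0"
 obtains C where "C >= 0" "!!p q. p \<in> near r ==> q \<in> far r ==> \<bar>past F p q\<bar> <= C"
proof -
 obtain C where C: "C >= 0" "!!p q. p \<in> near r ==> q \<in> far r ==> \<bar>past F p q\<bar> <= C * (snd p - snd q)^2" using past_bound[OF F r] by blast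
 show ?thesis
 proof (rule that[of "C * (5 * r^2)^2"])
  show "C * (5 * r^2)^2 >= 0" using C(1) by simp
  fix p q :: "'n event" assume p: "p \<in> near r" and q: "q \<in> far r"
  have "\<bar>snd p - snd q\<bar> <= \<bar>5 * r^2\<bar>" using p q by (auto simp: near_def far_def)
  then have "(snd p - snd q)^2 <= (5 * r^2)^2" by (rule abs_le_square_iff[THEN iffD1])
  then show "\<bar>past F p q\<bar> <= C * (5 * r^2)^2" using C(2)[OF p q] mult_left_mono[OF _ C(1)] by (meson order_trans)
 qed
qed

lemma past_deriv_x:
 fixes u :: "real ^ 'n"
 assumes "nice F"
 obtains F' where "nice F'" "!!p q. ((%h. past F (p + h *\<^sub>R ((u, 0), 0)) q) has_real_derivative past F' p q) (at 0)"
proof -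
 obtain F' where F': "nice F'"
  "!!X Z l. l > 0 ==> ((%h. F (X + h *\<^sub>R (u, 0)) Z l) has_real_derivative F' X Z l) (at 0)" using nice_derivative_x[OF assms, of u] by blast
 show ?thesis
 proof (rule that[OF F'(1)])
  fix p q :: "'n event"
  show "((%h. past F (p + h *\<^sub>R ((u, 0), 0)) q) has_real_derivative past F' p q) (at 0)"
   using F'(2)[of "pole_l (snd p) (snd q)" "fst p" "fst q"] by (auto simp: past_def pole_l_def)
 qed
qed

lemma past_deriv_y:
 assumes "nice (F :: 'n::finite space => _)"
 obtains F' where "nice F'" "!!p q. ((%h. past F (p + h *\<^sub>R ((0, 1), 0)) q) has_real_derivative snd (fst p) * past F' p q) (at 0)"
proof -
 obtain F' where F': "nice F'"
  "!!X Z l. l > 0 ==> ((%h. F (X + h *\<^sub>R (0, 1)) Z l) has_real_derivative snd X * F' X Z l) (at 0)" using nice_derivative_y[OF assms] by blast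
 show ?thesis
 proof (rule that[OF F'(1)])
  fix p q :: "'n event"
  show "((%h. past F (p + h *\<^sub>R ((0, 1), 0)) q) has_real_derivative snd (fst p) * past F' p q) (at 0)"
   using F'(2)[of "pole_l (snd p) (snd q)" "fst p" "fst q"] by (auto simp: past_def pole_l_def)
 qed
qed

text \<open>Before and after the pole time the chain rule with \<open>dl / dt = - 4 l^2\<close> or
  the constant 0 applies. At equal times the quadratic bound of \<open>past_bound\<close> forces the
  difference quotient to 0, which is also the value of \<open>past\<close> there.\<close>

lemma past_deriv_t:
 fixes F :: "'n::finite space => 'n space => real => real"
 assumes F: "nice F" and r: "r > 0"
 obtains F' where "nice F'" "!!p q. p \<in> near r ==> q \<in> far r ==>
  ((%h. past F (p + h *\<^sub>R (0, 1)) q) has_real_derivative past F' p q) (at 0 within {h. p + h *\<^sub>R (0, 1) \<in> near r})"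
proof -
 obtain F1 where F1: "nice F1"
  "!!X Z l. l > 0 ==> ((%l. F X Z l) has_real_derivative F1 X Z l) (at l)" using nice_derivative_l[OF F] by blast
 let ?F = "%X Z l. (- 4) * l powr 2 * F1 X Z l"
 have n: "nice ?F" by (rule nice_cmult[OF F1(1)])
 obtain C where C: "C >= 0" "!!p q. p \<in> near r ==> q \<in> far r ==> \<bar>past F p q\<bar> <= C * (snd p - snd q)^2" using past_bound[OF F r] by blast
 show ?thesis
 proof (rule that[OF n])
  fix p q :: "'n event" assume p: "p \<in> near r" and q: "q \<in> far r"
  let ?N = "{h. p + h *\<^sub>R (0, 1) \<in> near r}"
  consider "snd q < snd p" | "snd p < snd q" | "snd p = snd q" by linarith
  then show "((%h. past F (p + h *\<^sub>R (0, 1)) q) has_real_derivative past ?F p q) (at 0 within ?N)"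
  proof cases
   case 1
   have l: "pole_l (snd p) (snd q) > 0" using 1 by (simp add: pole_l_def)
   have dl: "((%h. pole_l (snd p + h) (snd q)) has_real_derivative - 4 * (pole_l (snd p) (snd q))^2) (at 0)" unfolding pole_l_def using 1
    by (auto intro!: derivative_eq_intros simp: field_simps power2_eq_square)
   have "((%h. F (fst p) (fst q) (pole_l (snd p + h) (snd q))) has_real_derivative F1 (fst p) (fst q) (pole_l (snd p) (snd q)) * (- 4 * (pole_l (snd p) (snd q))^2)) (at 0)"
    by (rule DERIV_chain2[OF _ dl]) (use F1(2)[OF l] in simp)
   then have "((%h. F (fst p) (fst q) (pole_l (snd p + h) (snd q))) has_real_derivative past ?F p q) (at 0)" using 1 l by (simp add: past_def mult_ac powr_numeral)
   then have "((%h. past F (p + h *\<^sub>R (0, 1)) q) has_real_derivative past ?F p q) (at 0)"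
    by (rule has_field_derivative_transform_within_open[of _ _ _ "{- (snd p - snd q)<..}"]) (use 1 in \<open>auto simp: past_def\<close>)
   then show ?thesis by (rule has_field_derivative_at_within)
  next
   case 2
   have "((%h. 0) has_real_derivative past ?F p q) (at 0)" using 2 by (simp add: past_def)
   then have "((%h. past F (p + h *\<^sub>R (0, 1)) q) has_real_derivative past ?F p q) (at 0)"
    by (rule has_field_derivative_transform_within_open[of _ _ _ "{..<snd q - snd p}"]) (use 2 in \<open>auto simp: past_def\<close>)
   then show ?thesis by (rule has_field_derivative_at_within)
  next
   case 3
   have "((%h. past F (p + h *\<^sub>R (0, 1)) q / h) \<longlongrightarrow> 0) (at 0 within ?N)"
   proof (rule Lim_null_comparison)
    have "\<bar>past F (p + h *\<^sub>R (0, 1)) q / h\<bar> <= C * \<bar>h\<bar>" if h: "h \<in> ?N" "h ~= 0" for h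
    proof -
     have "\<bar>past F (p + h *\<^sub>R (0, 1)) q\<bar> <= C * h^2" using C(2)[of "p + h *\<^sub>R (0, 1)" q] h(1) q 3 by simp
     then show ?thesis using h(2) by (simp add: abs_divide divide_le_eq power2_eq_square mult.assoc flip: abs_mult)
    qed
    then show "eventually (%h. norm (past F (p + h *\<^sub>R (0, 1)) q / h) <= C * \<bar>h\<bar>) (at 0 within ?N)" unfolding eventually_at by (intro exI[of _ 1]) auto
    show "((%h. C * \<bar>h\<bar>) \<longlongrightarrow> 0) (at 0 within ?N)" by (auto intro!: tendsto_eq_intros)
   qed
   then show ?thesis using 3 by (simp add: has_field_derivative_iff past_def)
  qed
 qed
qed

lemma past_deriv_basis:
 fixes F :: "'n::finite space => 'n space => real => real"
 assumes F: "nice F" and r: "r > 0" and b: "b \<in> Basis"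
 obtains F' where "nice F'" "!!p q. p \<in> near r ==> q \<in> far r ==>
   ((%h. past F (p + h *\<^sub>R b) q) has_real_derivative (if b = ((0, 1), 0) then snd (fst p) else 1) * past F' p q)
    (at 0 within {h. p + h *\<^sub>R b \<in> near r})"
proof -
 from b consider u where "b = ((u, 0), 0)" "b ~= ((0, 1), 0)" | "b = ((0, 1), 0)" | "b = (0, 1)" by (auto simp: Basis_prod_def zero_prod_def)
 then show ?thesis
 proof cases
  case 1
  obtain F' where F': "nice F'" "!!p q. ((%h. past F (p + h *\<^sub>R ((u, 0), 0)) q) has_real_derivative past F' p q) (at 0)" using past_deriv_x[OF F, of u] by blast
  show ?thesis by (rule that[OF F'(1)]) (use has_field_derivative_at_within[OF F'(2)] 1 in simp)
 next
  case 2
  obtain F' where F': "nice F'" "!!p q. ((%h. past F (p + h *\<^sub>R ((0, 1), 0)) q) has_real_derivative snd (fst p) * past F' p q) (at 0)" using past_deriv_y[OF F] by blast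
  show ?thesis by (rule that[OF F'(1)]) (use has_field_derivative_at_within[OF F'(2)] 2 in simp)
 next
  case 3
  obtain F' where F': "nice F'" "!!p q. p \<in> near r ==> q \<in> far r ==>
   ((%h. past F (p + h *\<^sub>R (0, 1)) q) has_real_derivative past F' p q) (at 0 within {h. p + h *\<^sub>R (0, 1) \<in> near r})" using past_deriv_t[OF F r] by blast
  show ?thesis by (rule that[OF F'(1)]) (use F'(2) 3 in \<open>simp add: zero_prod_def\<close>)
 qed
qed

section \<open>Lipschitz bounds along coordinate lines\<close>

lemma DERIV_along_line:
 fixes f :: "'a::real_vector => real"
 assumes "((%k. f (x + h *\<^sub>R b + k *\<^sub>R b)) has_real_derivative D) (at 0 within {k. x + h *\<^sub>R b + k *\<^sub>R b \<in> S})"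
 shows "((%h. f (x + h *\<^sub>R b)) has_real_derivative D) (at h within {h. x + h *\<^sub>R b \<in> S})"
proof -
 have eq: "(%k. k - h) ` {k. x + k *\<^sub>R b \<in> S} = {k. x + h *\<^sub>R b + k *\<^sub>R b \<in> S}"
 proof (intro equalityI subsetI)
  fix k assume "k \<in> {k. x + h *\<^sub>R b + k *\<^sub>R b \<in> S}"
  then show "k \<in> (%k. k - h) ` {k. x + k *\<^sub>R b \<in> S}" by (intro image_eqI[of _ _ "k + h"]) (auto simp: algebra_simps)
 qed (auto simp: algebra_simps)
 have "((%k. f (x + h *\<^sub>R b + k *\<^sub>R b)) has_real_derivative D) (at (h - h) within (%k. k - h) ` {k. x + k *\<^sub>R b \<in> S})" using assms by (simp add: eq)
 moreover have "((%k. k - h) has_real_derivative 1) (at h within {k. x + k *\<^sub>R b \<in> S})" by (auto intro!: derivative_eq_intros)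
 ultimately have "((%k. f (x + h *\<^sub>R b + k *\<^sub>R b)) \<circ> (%k. k - h) has_real_derivative D * 1) (at h within {k. x + k *\<^sub>R b \<in> S})"
  by (rule DERIV_image_chain)
 then show ?thesis by (simp add: comp_def algebra_simps)
qed

lemma convex_near: "convex (near r :: (('a::finite) space \<times> real) set)"
proof -
 have eq: "near r = {X. norm X <= 6 / 5 * r \<and> 0 <= snd X} \<times> {- r\<^sup>2..r\<^sup>2}" by (auto simp: near_def)
 have "convex {X :: 'a space. norm X <= 6 / 5 * r \<and> 0 <= snd X}"
 proof -
  have "convex {X :: 'a space. 0 <= snd X}" by (rule convexI) auto
  then have "convex (cball 0 (6 / 5 * r) \<inter> {X :: 'a space. 0 <= snd X})" by (intro convex_Int) auto
  moreover have "cball 0 (6 / 5 * r) \<inter> {X :: 'a space. 0 <= snd X} = {X. norm X <= 6 / 5 * r \<and> 0 <= snd X}" by auto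
  ultimately show ?thesis by simp
 qed
 then show ?thesis unfolding eq by (intro convex_Times) auto
qed

lemma convex_line:
 assumes "convex S"
 shows "convex {h::real. x + h *\<^sub>R b \<in> S}"
proof (rule convexI)
 fix h k u v :: real assume *: "h \<in> {h. x + h *\<^sub>R b \<in> S}" "k \<in> {h. x + h *\<^sub>R b \<in> S}" "0 <= u" "0 <= v" "u + v = 1"
 have "u *\<^sub>R (x + h *\<^sub>R b) + v *\<^sub>R (x + k *\<^sub>R b) \<in> S" using * by (intro convexD[OF assms]) auto
 moreover have "u *\<^sub>R (x + h *\<^sub>R b) + v *\<^sub>R (x + k *\<^sub>R b) = (u + v) *\<^sub>R x + (u *\<^sub>R h + v *\<^sub>R k) *\<^sub>R b"
  by (simp add: algebra_simps)
 ultimately show "u *\<^sub>R h + v *\<^sub>R k \<in> {h. x + h *\<^sub>R b \<in> S}" using *(5) by simp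
qed

lemma bound_along_line:
 fixes f :: "'a::real_vector => real"
 assumes S: "convex S" "z \<in> S" "z + h *\<^sub>R b \<in> S"
  and D: "!!x. x \<in> S ==> ((%h. f (x + h *\<^sub>R b)) has_real_derivative D x) (at 0 within {h. x + h *\<^sub>R b \<in> S})"
   "!!x. x \<in> S ==> \<bar>D x\<bar> <= M"
 shows "\<bar>f (z + h *\<^sub>R b) - f z\<bar> <= M * \<bar>h\<bar>"
proof -
 have "norm (f (z + h *\<^sub>R b) - f (z + 0 *\<^sub>R b)) <= M * norm (h - 0)"
 proof (rule field_differentiable_bound[where f = "%h. f (z + h *\<^sub>R b)" and S = "{h. z + h *\<^sub>R b \<in> S}" and f' = "%h. D (z + h *\<^sub>R b)"])
  show "convex {h. z + h *\<^sub>R b \<in> S}" by (rule convex_line[OF S(1)])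
  fix k assume k: "k \<in> {h. z + h *\<^sub>R b \<in> S}"
  then have k: "z + k *\<^sub>R b \<in> S" by simp
  show "((%h. f (z + h *\<^sub>R b)) has_field_derivative D (z + k *\<^sub>R b)) (at k within {h. z + h *\<^sub>R b \<in> S})" using D(1)[OF k] by (rule DERIV_along_line)
  show "norm (D (z + k *\<^sub>R b)) <= M" using D(2)[OF k] by simp
 qed (use S in auto)
 then show ?thesis by simp
qed

text \<open>Only partial derivatives are at hand, hence the segments of the path move one coordinate at a time.\<close>

lemma lipschitz_from_partials:
 fixes f :: "'a::euclidean_space => real"
 assumes V: "convex V" and D: "!!b. b \<in> Basis ==> \<exists>g C. has_partial_on V f b g \<and> (\<forall>x\<in>V. \<bar>g x\<bar> <= C)"
 obtains L where "L >= 0" "!!x x'. (!!s. \<forall>b\<in>Basis. s \<bullet> b = 0 \<or> s \<bullet> b = (x' - x) \<bullet> b ==> x + s \<in> V) ==> \<bar>f x' - f x\<bar> <= L * norm (x' - x)"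
proof -
 have "\<forall>b\<in>Basis. \<exists>C. \<exists>g. has_partial_on V f b g \<and> (\<forall>x\<in>V. \<bar>g x\<bar> <= C)" using D by blast
 from bchoice[OF this] obtain C where C: "\<forall>b\<in>Basis. \<exists>g. has_partial_on V f b g \<and> (\<forall>x\<in>V. \<bar>g x\<bar> <= C b)" ..
 define M where "M = (\<Sum>b\<in>(Basis :: 'a set). \<bar>C b\<bar>)"
 have M: "C b <= M" if "b \<in> Basis" for b unfolding M_def by (rule order_trans[OF abs_ge_self member_le_sum[OF that]]) auto
 have M0: "M >= 0" unfolding M_def by (intro sum_nonneg) auto
 have step: "\<bar>f (z + h *\<^sub>R b) - f z\<bar> <= M * \<bar>h\<bar>" if b: "b \<in> Basis" and z: "z \<in> V" "z + h *\<^sub>R b \<in> V" for z b h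
 proof -
  obtain g where g: "has_partial_on V f b g" "\<forall>x\<in>V. \<bar>g x\<bar> <= C b" using C b by blast
  show ?thesis
  proof (rule bound_along_line[OF V z, of f g])
   fix x assume x: "x \<in> V"
   show "((%h. f (x + h *\<^sub>R b)) has_real_derivative g x) (at 0 within {h. x + h *\<^sub>R b \<in> V})" using g(1) x unfolding has_partial_on_def by (rule bspec)
   show "\<bar>g x\<bar> <= M" using bspec[OF g(2) x] M[OF b] by linarith
  qed
 qed
 show ?thesis
 proof (rule that[of "M * DIM('a)"])
  show "M * DIM('a) >= 0" using M0 by simp
  fix x x' assume U: "!!s. \<forall>b\<in>Basis. s \<bullet> b = 0 \<or> s \<bullet> b = (x' - x) \<bullet> b ==> x + s \<in> V"
  let ?s = "%B. \<Sum>b\<in>B. ((x' - x) \<bullet> b) *\<^sub>R b"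
  have s: "x + ?s B \<in> V" if B: "B \<subseteq> Basis" for B
  proof (rule U, rule ballI)
   fix b :: 'a assume b: "b \<in> Basis"
   have "?s B \<bullet> b = (\<Sum>b'\<in>B. if b = b' then (x' - x) \<bullet> b' else 0)"
    unfolding inner_sum_left using b B by (intro sum.cong) (auto simp: inner_Basis subset_iff)
   then show "?s B \<bullet> b = 0 \<or> ?s B \<bullet> b = (x' - x) \<bullet> b" using finite_subset[OF B finite_Basis] by simp
  qed
  have "\<bar>f (x + ?s B) - f x\<bar> <= (\<Sum>b\<in>B. M * norm (x' - x))" if "B \<subseteq> Basis" for B using finite_subset[OF that finite_Basis] that
  proof (induction B rule: finite_induct)
   case (insert b B)
   have eq: "x + ?s (insert b B) = x + ?s B + ((x' - x) \<bullet> b) *\<^sub>R b" using insert.hyps by (simp add: add_ac)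
   have b: "b \<in> Basis" "B \<subseteq> Basis" using insert.prems by auto
   have "\<bar>f (x + ?s (insert b B)) - f (x + ?s B)\<bar> <= M * \<bar>(x' - x) \<bullet> b\<bar>" using s[OF b(2)] s[OF insert.prems] unfolding eq by (intro step[OF b(1)])
   also have "... <= M * norm (x' - x)" using Basis_le_norm[OF b(1)] M0 by (intro mult_left_mono)
   finally show ?case using insert.IH[OF b(2)] unfolding sum.insert[OF insert.hyps] by linarith
  qed simp
  from this[OF order_refl] show "\<bar>f x' - f x\<bar> <= M * DIM('a) * norm (x' - x)" unfolding euclidean_representation by (simp add: mult_ac)
 qed
qed

definition cyl :: "real => ('n::finite event) set" where
 "cyl r = half_ball0 r \<times> {- r\<^sup>2<..0}"

section \<open>Hoelder spaces\<close>

definition pdist :: "'a::real_normed_vector \<times> real => 'a \<times> real => real" where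
 "pdist p q = norm (fst p - fst q) + \<bar>snd p - snd q\<bar> powr (1/2)"

lemma pdist_nonneg: "pdist p q >= 0" by (simp add: pdist_def)

lemma parabolic_holder_iff:
 "parabolic_holder \<alpha> \<Omega> f \<longleftrightarrow>
  (\<exists>K\<ge>0. (\<forall>p\<in>\<Omega>. \<bar>f p\<bar> <= K) \<and> (\<forall>p\<in>\<Omega>. \<forall>q\<in>\<Omega>. \<bar>f p - f q\<bar> <= K * pdist p q powr \<alpha>))"
 (is "?L = ?R")
proof
 assume ?L
 then obtain K where "\<forall>x\<in>f ` \<Omega>. norm x <= K" unfolding parabolic_holder_def bounded_iff by blast
 then have K: "\<bar>f p\<bar> <= K" if "p \<in> \<Omega>" for p using that by simp
 from \<open>?L\<close> obtain C where C0: "\<forall>p\<in>\<Omega>. \<forall>q\<in>\<Omega>. \<bar>f p - f q\<bar> <= C * (norm (fst p - fst q) + \<bar>snd p - snd q\<bar> powr (1/2)) powr \<alpha>"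
  unfolding parabolic_holder_def by (auto simp: case_prod_beta)
 show ?R
 proof (intro exI[of _ "\<bar>K\<bar> + \<bar>C\<bar>"] conjI ballI)
  fix p assume "p \<in> \<Omega>" then show "\<bar>f p\<bar> <= \<bar>K\<bar> + \<bar>C\<bar>" using K[of p] by linarith
 next
  fix p q assume "p \<in> \<Omega>" "q \<in> \<Omega>"
  then have "\<bar>f p - f q\<bar> <= C * pdist p q powr \<alpha>" using C0 by (simp add: pdist_def)
  also have "... <= (\<bar>K\<bar> + \<bar>C\<bar>) * pdist p q powr \<alpha>" by (intro mult_right_mono) auto
  finally show "\<bar>f p - f q\<bar> <= (\<bar>K\<bar> + \<bar>C\<bar>) * pdist p q powr \<alpha>" .
 qed simp
next
 assume ?R
 then obtain K where K: "!!p. p \<in> \<Omega> ==> \<bar>f p\<bar> <= K" "!!p q. p \<in> \<Omega> ==> q \<in> \<Omega> ==> \<bar>f p - f q\<bar> <= K * pdist p q powr \<alpha>"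
  by blast
 have "bounded (f ` \<Omega>)" unfolding bounded_iff by (intro exI[of _ K]) (use K(1) in \<open>auto simp del: split_paired_All\<close>)
 moreover have "\<forall>(X, t)\<in>\<Omega>. \<forall>(X', t')\<in>\<Omega>. \<bar>f (X, t) - f (X', t')\<bar> <= K * (norm (X - X') + \<bar>t - t'\<bar> powr (1/2)) powr \<alpha>"
 proof (safe)
  fix X t X' t' assume "(X, t) \<in> \<Omega>" "(X', t') \<in> \<Omega>"
  from K(2)[OF this] show "\<bar>f (X, t) - f (X', t')\<bar> <= K * (norm (X - X') + \<bar>t - t'\<bar> powr (1/2)) powr \<alpha>" by (simp add: pdist_def)
 qed
 ultimately show ?L unfolding parabolic_holder_def by blast
qed

lemma parabolic_holder_add:
 assumes "parabolic_holder \<alpha> \<Omega> f" "parabolic_holder \<alpha> \<Omega> g"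
 shows "parabolic_holder \<alpha> \<Omega> (%p. f p + g p)"
proof -
 obtain K where K: "K >= 0" "!!p. p \<in> \<Omega> ==> \<bar>f p\<bar> <= K" "!!p q. p \<in> \<Omega> ==> q \<in> \<Omega> ==> \<bar>f p - f q\<bar> <= K * pdist p q powr \<alpha>"
  using assms(1) unfolding parabolic_holder_iff by blast
 obtain L where L: "L >= 0" "!!p. p \<in> \<Omega> ==> \<bar>g p\<bar> <= L" "!!p q. p \<in> \<Omega> ==> q \<in> \<Omega> ==> \<bar>g p - g q\<bar> <= L * pdist p q powr \<alpha>"
  using assms(2) unfolding parabolic_holder_iff by blast
 show ?thesis unfolding parabolic_holder_iff
 proof (intro exI[of _ "K + L"] conjI ballI)
  fix p assume "p \<in> \<Omega>" then show "\<bar>f p + g p\<bar> <= K + L" using K(2)[of p] L(2)[of p] by linarith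
 next
  fix p q assume "p \<in> \<Omega>" "q \<in> \<Omega>"
  then show "\<bar>f p + g p - (f q + g q)\<bar> <= (K + L) * pdist p q powr \<alpha>" using K(3)[of p q] L(3)[of p q] unfolding distrib_right by linarith
 qed (use K L in auto)
qed

lemma parabolic_holder_mult:
 assumes "parabolic_holder \<alpha> \<Omega> f" "parabolic_holder \<alpha> \<Omega> g"
 shows "parabolic_holder \<alpha> \<Omega> (%p. f p * g p)"
proof -
 obtain K where K: "K >= 0" "!!p. p \<in> \<Omega> ==> \<bar>f p\<bar> <= K" "!!p q. p \<in> \<Omega> ==> q \<in> \<Omega> ==> \<bar>f p - f q\<bar> <= K * pdist p q powr \<alpha>"
  using assms(1) unfolding parabolic_holder_iff by blast
 obtain L where L: "L >= 0" "!!p. p \<in> \<Omega> ==> \<bar>g p\<bar> <= L" "!!p q. p \<in> \<Omega> ==> q \<in> \<Omega> ==> \<bar>g p - g q\<bar> <= L * pdist p q powr \<alpha>"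
  using assms(2) unfolding parabolic_holder_iff by blast
 show ?thesis unfolding parabolic_holder_iff
 proof (intro exI[of _ "2 * (K * L)"] conjI ballI)
  fix p assume p: "p \<in> \<Omega>"
  have "\<bar>f p * g p\<bar> <= K * L" unfolding abs_mult using K(2)[OF p] L(2)[OF p] K(1) by (intro mult_mono) auto
  moreover have "0 <= K * L" using K(1) L(1) by simp
  ultimately show "\<bar>f p * g p\<bar> <= 2 * (K * L)" by linarith
 next
  fix p q assume p: "p \<in> \<Omega>" and q: "q \<in> \<Omega>"
  have "f p * g p - f q * g q = f p * (g p - g q) + (f p - f q) * g q" by (simp add: algebra_simps)
  then have "\<bar>f p * g p - f q * g q\<bar> <= \<bar>f p\<bar> * \<bar>g p - g q\<bar> + \<bar>f p - f q\<bar> * \<bar>g q\<bar>" by (metis abs_mult abs_triangle_ineq)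
  also have "... <= K * (L * pdist p q powr \<alpha>) + (K * pdist p q powr \<alpha>) * L"
   using K(2)[OF p] K(3)[OF p q] L(2)[OF q] L(3)[OF p q] K(1) L(1) by (intro add_mono mult_mono) auto
  finally show "\<bar>f p * g p - f q * g q\<bar> <= 2 * (K * L) * pdist p q powr \<alpha>" by (simp add: algebra_simps)
 qed (use K L in auto)
qed

lemma parabolic_holder_const: "parabolic_holder \<alpha> \<Omega> (%p. k)" unfolding parabolic_holder_iff by (intro exI[of _ "\<bar>k\<bar>"]) auto

lemma parabolic_holder_cmult:
 "parabolic_holder \<alpha> \<Omega> f ==> parabolic_holder \<alpha> \<Omega> (%p. k * f p)" by (rule parabolic_holder_mult[OF parabolic_holder_const])

lemma holder_up_to_bottomI:
 assumes "parabolic_holder \<alpha> (cyl r) F" "!!p. p \<in> open_cyl r ==> F p = f p"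
 shows "holder_up_to_bottom \<alpha> r f" unfolding holder_up_to_bottom_def using assms unfolding cyl_def by blast

lemma holder_up_to_bottom_add:
 assumes "holder_up_to_bottom \<alpha> r f" "holder_up_to_bottom \<alpha> r g"
 shows "holder_up_to_bottom \<alpha> r (%p. f p + g p)"
proof -
 obtain F G where F: "parabolic_holder \<alpha> (cyl r) F" "!!p. p \<in> open_cyl r ==> F p = f p"
  and G: "parabolic_holder \<alpha> (cyl r) G" "!!p. p \<in> open_cyl r ==> G p = g p" using assms unfolding holder_up_to_bottom_def cyl_def by blast
 show ?thesis by (rule holder_up_to_bottomI[OF parabolic_holder_add[OF F(1) G(1)]]) (simp only: F(2) G(2))
qed

lemma holder_up_to_bottom_cmult:
 assumes "holder_up_to_bottom \<alpha> r f"
 shows "holder_up_to_bottom \<alpha> r (%p. k * f p)"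
proof -
 obtain F where F: "parabolic_holder \<alpha> (cyl r) F" "!!p. p \<in> open_cyl r ==> F p = f p" using assms unfolding holder_up_to_bottom_def cyl_def by blast
 show ?thesis by (rule holder_up_to_bottomI[OF parabolic_holder_cmult[OF F(1)]]) (simp only: F(2))
qed

lemma has_partial_on_add:
 "has_partial_on S f b f' ==> has_partial_on S g b g' ==> has_partial_on S (%p. f p + g p) b (%p. f' p + g' p)"
 unfolding has_partial_on_def by (auto intro!: DERIV_add simp del: split_paired_All)

lemma has_partial_on_cmult:
 "has_partial_on S f b f' ==> has_partial_on S (%p. k * f p) b (%p. k * f' p)" unfolding has_partial_on_def by (auto intro!: DERIV_cmult simp del: split_paired_All)

text \<open>The three claims of the theorem, bundled so that they can be added up over the terms of
  the representation.\<close>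

definition regular :: "real => real => real => ('n::finite event => real) => bool" where
 "regular a \<alpha> r w \<longleftrightarrow>
  (\<forall>i. \<exists>D. has_partial_on (open_cyl r) w ((axis i 1, 0), 0) D \<and> holder_up_to_bottom \<alpha> r D) \<and>
  (\<exists>D. has_partial_on (open_cyl r) w ((0, 0), 1) D \<and> holder_up_to_bottom \<alpha> r D) \<and>
  (\<exists>D. has_partial_on (open_cyl r) w ((0, 1), 0) D \<and>
   holder_up_to_bottom \<alpha> r (%p. weight a (fst p) * D p))"

lemma regular_add:
 assumes f: "regular a \<alpha> r f" and g: "regular a \<alpha> r g"
 shows "regular a \<alpha> r (%p. f p + g p)" unfolding regular_def
proof (intro conjI allI)
 fix i
 obtain D E where "has_partial_on (open_cyl r) f ((axis i 1, 0), 0) D" "holder_up_to_bottom \<alpha> r D"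
  "has_partial_on (open_cyl r) g ((axis i 1, 0), 0) E" "holder_up_to_bottom \<alpha> r E" using f g unfolding regular_def by blast
 then show "\<exists>D. has_partial_on (open_cyl r) (%p. f p + g p) ((axis i 1, 0), 0) D \<and> holder_up_to_bottom \<alpha> r D"
  by (intro exI[of _ "%p. D p + E p"] conjI has_partial_on_add holder_up_to_bottom_add)
next
 obtain D E where "has_partial_on (open_cyl r) f ((0, 0), 1) D" "holder_up_to_bottom \<alpha> r D"
  "has_partial_on (open_cyl r) g ((0, 0), 1) E" "holder_up_to_bottom \<alpha> r E" using f g unfolding regular_def by blast
 then show "\<exists>D. has_partial_on (open_cyl r) (%p. f p + g p) ((0, 0), 1) D \<and> holder_up_to_bottom \<alpha> r D"
  by (intro exI[of _ "%p. D p + E p"] conjI has_partial_on_add holder_up_to_bottom_add)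
next
 obtain D E where "has_partial_on (open_cyl r) f ((0, 1), 0) D" "holder_up_to_bottom \<alpha> r (%p. weight a (fst p) * D p)"
  "has_partial_on (open_cyl r) g ((0, 1), 0) E" "holder_up_to_bottom \<alpha> r (%p. weight a (fst p) * E p)" using f g unfolding regular_def by blast
 then show "\<exists>D. has_partial_on (open_cyl r) (%p. f p + g p) ((0, 1), 0) D \<and>
   holder_up_to_bottom \<alpha> r (%p. weight a (fst p) * D p)" unfolding distrib_left[symmetric]
  by (intro exI[of _ "%p. D p + E p"] conjI has_partial_on_add) (simp_all only: distrib_left holder_up_to_bottom_add)
qed

lemma regular_cmult:
 assumes f: "regular a \<alpha> r f"
 shows "regular a \<alpha> r (%p. k * f p)" unfolding regular_def
proof (intro conjI allI)
 fix i
 obtain D where "has_partial_on (open_cyl r) f ((axis i 1, 0), 0) D" "holder_up_to_bottom \<alpha> r D" using f unfolding regular_def by blast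
 then show "\<exists>D. has_partial_on (open_cyl r) (%p. k * f p) ((axis i 1, 0), 0) D \<and> holder_up_to_bottom \<alpha> r D"
  by (intro exI[of _ "%p. k * D p"] conjI has_partial_on_cmult holder_up_to_bottom_cmult)
next
 obtain D where "has_partial_on (open_cyl r) f ((0, 0), 1) D" "holder_up_to_bottom \<alpha> r D" using f unfolding regular_def by blast
 then show "\<exists>D. has_partial_on (open_cyl r) (%p. k * f p) ((0, 0), 1) D \<and> holder_up_to_bottom \<alpha> r D"
  by (intro exI[of _ "%p. k * D p"] conjI has_partial_on_cmult holder_up_to_bottom_cmult)
next
 obtain D where "has_partial_on (open_cyl r) f ((0, 1), 0) D" "holder_up_to_bottom \<alpha> r (%p. weight a (fst p) * D p)" using f unfolding regular_def by blast
 then show "\<exists>D. has_partial_on (open_cyl r) (%p. k * f p) ((0, 1), 0) D \<and>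
   holder_up_to_bottom \<alpha> r (%p. weight a (fst p) * D p)"
  by (intro exI[of _ "%p. k * D p"] conjI has_partial_on_cmult) (simp_all only: mult.left_commute[of _ k] holder_up_to_bottom_cmult)
qed

text \<open>Times in the cylinder differ by at most \<open>r^2\<close>, so a time difference is at
  most \<open>r\<close> times its square root. Hence a Euclidean Lipschitz bound is also a parabolic
  one.\<close>

lemma pdist_cyl:
 assumes r: "r > 0" and p: "p \<in> cyl r" and q: "q \<in> cyl r"
 shows "pdist p q <= 3 * r" "norm (p - q) <= (1 + r) * pdist p q"
proof -
 have n: "norm (fst p) < r" "norm (fst q) < r" and t: "\<bar>snd p - snd q\<bar> <= r^2" using p q by (auto simp: cyl_def half_ball0_def)
 have "norm (fst p - fst q) <= 2 * r" using norm_triangle_ineq4[of "fst p" "fst q"] n by linarith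
 moreover have s: "\<bar>snd p - snd q\<bar> powr (1/2) <= r" using t r by (simp add: powr_half_sqrt real_le_lsqrt)
 ultimately show "pdist p q <= 3 * r" by (simp add: pdist_def)
 have "\<bar>snd p - snd q\<bar> = \<bar>snd p - snd q\<bar> powr (1/2) * \<bar>snd p - snd q\<bar> powr (1/2)" by (simp add: powr_half_sqrt flip: powr_add)
 also have "... <= r * \<bar>snd p - snd q\<bar> powr (1/2)" using s by (intro mult_right_mono) auto
 finally have "\<bar>snd p - snd q\<bar> <= r * \<bar>snd p - snd q\<bar> powr (1/2)" .
 moreover have "norm (p - q) <= norm (fst p - fst q) + \<bar>snd p - snd q\<bar>" using norm_Pair_le[of "fst p - fst q" "snd p - snd q"] by (cases p; cases q) simp
 moreover have "0 <= r * norm (fst p - fst q)" "0 <= \<bar>snd p - snd q\<bar> powr (1/2)" using r by auto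
 ultimately show "norm (p - q) <= (1 + r) * pdist p q" unfolding pdist_def distrib_right distrib_left mult_1 by linarith
qed

lemma powr_le_smaller_exponent:
 fixes d R :: real
 assumes "0 <= d" "d <= R" "\<alpha> <= \<beta>"
 shows "d powr \<beta> <= R powr (\<beta> - \<alpha>) * d powr \<alpha>"
proof -
 have "d powr \<beta> = d powr (\<beta> - \<alpha>) * d powr \<alpha>" by (simp flip: powr_add)
 also have "... <= R powr (\<beta> - \<alpha>) * d powr \<alpha>" using assms by (intro mult_right_mono powr_mono2) auto
 finally show ?thesis .
qed

text \<open>The fractions \<open>x / (x + d)\<close> and \<open>d / (x + d)\<close> add up to 1 and
  lie in the unit interval, so each is at most its own power with exponent
  \<open>\<beta>\<close>.\<close>

lemma powr_subadditive:
 fixes x d :: real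
 assumes "0 <= x" "0 <= d" "0 < \<beta>" "\<beta> <= 1"
 shows "(x + d) powr \<beta> <= x powr \<beta> + d powr \<beta>"
proof (cases "x + d = 0")
 case False
 have *: "(x + d) powr \<beta> * (u / (x + d)) <= u powr \<beta>" if u: "0 <= u" "u <= x + d" for u
 proof -
  have "u / (x + d) <= (u / (x + d)) powr \<beta>"
  proof (cases "u = 0")
   case False
   have "(u / (x + d)) powr 1 <= (u / (x + d)) powr \<beta>" using assms u False by (intro powr_mono') (auto simp: divide_le_eq)
   then show ?thesis using assms u by simp
  qed simp
  then have "(x + d) powr \<beta> * (u / (x + d)) <= (x + d) powr \<beta> * (u / (x + d)) powr \<beta>" by (intro mult_left_mono) auto
  also have "... = u powr \<beta>" using assms u False by (simp add: powr_divide)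
  finally show ?thesis .
 qed
 have "(x + d) powr \<beta> = (x + d) powr \<beta> * (x / (x + d)) + (x + d) powr \<beta> * (d / (x + d))"
  using False by (simp add: add_divide_distrib[symmetric] distrib_left[symmetric])
 also have "... <= x powr \<beta> + d powr \<beta>" using assms by (intro add_mono *) auto
 finally show ?thesis .
qed simp

lemma parabolic_holder_cyl_bound:
 fixes f :: "'n::finite event => real"
 assumes r: "r > 0" and b: "0 < \<alpha>" "\<alpha> <= \<beta>" and L: "L >= 0" "!!p q. p \<in> cyl r ==> q \<in> cyl r ==> \<bar>f p - f q\<bar> <= L * pdist p q powr \<beta>"
  and K: "!!p. p \<in> cyl r ==> \<bar>f p\<bar> <= K"
 shows "parabolic_holder \<alpha> (cyl r) f" unfolding parabolic_holder_iff
proof (intro exI[of _ "\<bar>K\<bar> + L * (3 * r) powr (\<beta> - \<alpha>)"] conjI ballI)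
 have n: "0 <= L * (3 * r) powr (\<beta> - \<alpha>)" using L(1) by simp
 then show "0 <= \<bar>K\<bar> + L * (3 * r) powr (\<beta> - \<alpha>)" by simp
 fix p :: "'n event" assume p: "p \<in> cyl r"
 show "\<bar>f p\<bar> <= \<bar>K\<bar> + L * (3 * r) powr (\<beta> - \<alpha>)" using K[OF p] n by linarith
 fix q :: "'n event" assume q: "q \<in> cyl r"
 have "\<bar>f p - f q\<bar> <= L * pdist p q powr \<beta>" by (rule L(2)[OF p q])
 also have "... <= L * ((3 * r) powr (\<beta> - \<alpha>) * pdist p q powr \<alpha>)"
  using pdist_cyl[OF r p q] L(1) b pdist_nonneg[of p q] by (intro mult_left_mono powr_le_smaller_exponent) auto
 also have "... <= (\<bar>K\<bar> + L * (3 * r) powr (\<beta> - \<alpha>)) * pdist p q powr \<alpha>" unfolding mult.assoc[symmetric] by (intro mult_right_mono) auto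
 finally show "\<bar>f p - f q\<bar> <= (\<bar>K\<bar> + L * (3 * r) powr (\<beta> - \<alpha>)) * pdist p q powr \<alpha>" .
qed

lemma parabolic_holder_lipschitz:
 fixes f :: "'n::finite event => real"
 assumes r: "r > 0" and \<alpha>: "0 < \<alpha>" "\<alpha> <= 1" and L: "L >= 0" "!!p q. p \<in> cyl r ==> q \<in> cyl r ==> \<bar>f p - f q\<bar> <= L * norm (p - q)"
  and K: "!!p. p \<in> cyl r ==> \<bar>f p\<bar> <= K"
 shows "parabolic_holder \<alpha> (cyl r) f"
proof (rule parabolic_holder_cyl_bound[OF r \<alpha>, of "L * (1 + r)", OF _ _ K])
 fix p q :: "'n event" assume p: "p \<in> cyl r" and q: "q \<in> cyl r"
 have "\<bar>f p - f q\<bar> <= L * norm (p - q)" by (rule L(2)[OF p q])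
 also have "... <= L * ((1 + r) * pdist p q)" using pdist_cyl(2)[OF r p q] L(1) by (rule mult_left_mono)
 finally show "\<bar>f p - f q\<bar> <= L * (1 + r) * pdist p q powr 1" using pdist_nonneg[of p q] by simp
qed (use L(1) r in auto)

lemma powr_diff_le:
 fixes x y :: real
 assumes x: "0 <= x" "x <= R" and y: "0 <= y" "y <= R" and \<beta>: "0 < \<beta>"
 shows "\<bar>x powr \<beta> - y powr \<beta>\<bar> <= (1 + \<beta> * R powr (\<beta> - 1)) * \<bar>x - y\<bar> powr min 1 \<beta>"
proof -
 have *: "y powr \<beta> - x powr \<beta> <= (1 + \<beta> * R powr (\<beta> - 1)) * (y - x) powr min 1 \<beta>"
  if xy: "0 <= x" "x < y" "y <= R" for x y
 proof (cases "\<beta> <= 1")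
  case True
  have "y powr \<beta> = (x + (y - x)) powr \<beta>" by simp
  also have "... <= x powr \<beta> + (y - x) powr \<beta>" using xy True \<beta> by (intro powr_subadditive) auto
  finally have "y powr \<beta> - x powr \<beta> <= 1 * (y - x) powr \<beta>" by simp
  also have "... <= (1 + \<beta> * R powr (\<beta> - 1)) * (y - x) powr \<beta>" using \<beta> by (intro mult_right_mono) auto
  finally show ?thesis using True by (simp add: min_def)
 next
  case False
  have D: "((%z. z powr \<beta>) has_real_derivative \<beta> * z powr (\<beta> - 1)) (at z)" if "x < z" for z using that xy(1) by (intro has_real_derivative_powr) auto
  have "\<exists>l z. x < z \<and> z < y \<and> DERIV (%z. z powr \<beta>) z :> l \<and> y powr \<beta> - x powr \<beta> = (y - x) * l"
  proof (rule MVT[OF xy(2)])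
   show "continuous_on {x..y} (%z. z powr \<beta>)" using xy \<beta> by (intro continuous_on_powr' continuous_intros) auto
  qed (use D in \<open>auto simp: real_differentiable_def\<close>)
  then obtain l z where z: "x < z" "z < y" and l: "DERIV (%z. z powr \<beta>) z :> l" "y powr \<beta> - x powr \<beta> = (y - x) * l" by blast
  note l(2)
  also have "l = \<beta> * z powr (\<beta> - 1)" by (rule DERIV_unique[OF l(1) D[OF z(1)]])
  finally have z3: "y powr \<beta> - x powr \<beta> = (y - x) * (\<beta> * z powr (\<beta> - 1))" .
  have "y powr \<beta> - x powr \<beta> <= (y - x) * (\<beta> * R powr (\<beta> - 1))" unfolding z3 using z xy \<beta> False by (intro mult_left_mono powr_mono2) auto
  also have "... <= (1 + \<beta> * R powr (\<beta> - 1)) * (y - x)" using xy by (simp add: algebra_simps)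
  finally show ?thesis using False xy by (simp add: min_def)
 qed
 consider "x < y" | "y < x" | "x = y" by linarith
 then show ?thesis
 proof cases
  case 1 then show ?thesis using *[OF x(1) 1 y(2)] powr_mono2[of \<beta> x y] x \<beta> by (simp add: abs_if)
 next
  case 2 then show ?thesis using *[OF y(1) 2 x(2)] powr_mono2[of \<beta> y x] y \<beta> by (simp add: abs_if)
 next
  case 3 then show ?thesis by simp
 qed
qed

text \<open>With \<open>\<beta> = 1 + a\<close> this is the factor that remains when the vertical
  derivative of an even function is multiplied by the weight.\<close>

lemma parabolic_holder_height:
 assumes r: "r > 0" and \<alpha>: "0 < \<alpha>" "\<alpha> <= 1" "\<alpha> <= \<beta>"
 shows "parabolic_holder \<alpha> (cyl r) (%p :: 'n::finite event. snd (fst p) powr \<beta>)"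
proof (rule parabolic_holder_cyl_bound[OF r \<alpha>(1), of "min 1 \<beta>" "1 + \<beta> * r powr (\<beta> - 1)" _ "r powr \<beta>"])
 have \<beta>: "0 < \<beta>" using \<alpha> by simp
 show "\<alpha> <= min 1 \<beta>" "0 <= 1 + \<beta> * r powr (\<beta> - 1)" using \<alpha> by auto
 have y: "0 <= snd (fst p)" "snd (fst p) <= r" if "p \<in> cyl r" for p :: "'n event"
  using that norm_snd_le[of "snd (fst p)" "fst (fst p)"] by (auto simp: cyl_def half_ball0_def)
 fix p :: "'n event" assume p: "p \<in> cyl r"
 show "\<bar>snd (fst p) powr \<beta>\<bar> <= r powr \<beta>" using y[OF p] \<beta> by (simp add: powr_mono2)
 fix q :: "'n event" assume q: "q \<in> cyl r"
 have "\<bar>snd (fst p) - snd (fst q)\<bar> <= norm (fst p - fst q)"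
  using norm_snd_le[of "snd (fst p) - snd (fst q)" "fst (fst p) - fst (fst q)"] by (cases "fst p"; cases "fst q") simp
 then have "\<bar>snd (fst p) - snd (fst q)\<bar> <= pdist p q" by (simp add: pdist_def add_increasing2)
 then have "\<bar>snd (fst p) - snd (fst q)\<bar> powr min 1 \<beta> <= pdist p q powr min 1 \<beta>" using \<beta> by (intro powr_mono2) auto
 then have "(1 + \<beta> * r powr (\<beta> - 1)) * \<bar>snd (fst p) - snd (fst q)\<bar> powr min 1 \<beta> <= (1 + \<beta> * r powr (\<beta> - 1)) * pdist p q powr min 1 \<beta>"
  using \<beta> by (intro mult_left_mono) auto
 then show "\<bar>snd (fst p) powr \<beta> - snd (fst q) powr \<beta>\<bar> <= (1 + \<beta> * r powr (\<beta> - 1)) * pdist p q powr min 1 \<beta>"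
  using powr_diff_le[OF y[OF p] y[OF q] \<beta>] by linarith
qed

section \<open>Potentials away from the diagonal\<close>

lemma convex_cylinder: "convex (open_cyl r :: ('n::finite event) set)"
proof (rule convex_Times)
 have "convex (ball 0 r \<inter> {X :: 'n space. 0 < snd X})"
 proof (rule convex_Int)
  have "{X :: 'n space. 0 < snd X} = UNIV \<times> {0<..}" by auto
  then show "convex {X :: 'n space. 0 < snd X}" by (simp add: convex_Times)
 qed simp
 moreover have "ball 0 r \<inter> {X :: 'n space. 0 < snd X} = half_ball r" by (auto simp: half_ball_def)
 ultimately show "convex (half_ball r :: 'n space set)" by simp
qed simp

lemma has_partial_on_subset:
 assumes "has_partial_on S f b g" "T \<subseteq> S"
 shows "has_partial_on T f b g" unfolding has_partial_on_def
proof
 fix p assume "p \<in> T"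
 then have "((%h. f (p + h *\<^sub>R b)) has_real_derivative g p) (at 0 within {h. p + h *\<^sub>R b \<in> S})" using assms unfolding has_partial_on_def by blast
 then show "((%h. f (p + h *\<^sub>R b)) has_real_derivative g p) (at 0 within {h. p + h *\<^sub>R b \<in> T})" by (rule DERIV_subset) (use assms(2) in auto)
qed

definition off :: "('n::finite event => real) => ('n space => 'n space => real => real) => 'n event => real" where
 "off A F p = (LINT q|lborel. A q * past F p q)"

context
 fixes A :: "'n::finite event => real" and r :: real
 assumes A_integrable: "integrable lborel A" and A_far: "\<forall>q. q \<notin> far r --> A q = 0" and r: "r > 0"
begin

lemma density: "integrable lborel A" "q \<notin> far r ==> A q = 0" using A_integrable A_far by blast+

lemma off_integrable:
 assumes F: "nice F" and p: "p \<in> near r"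
 shows "integrable lborel (%q. A q * past F p q)"
proof -
 obtain C where C: "C >= 0" "!!p q. p \<in> near r ==> q \<in> far r ==> \<bar>past F p q\<bar> <= C" using past_bounded[OF F r] by blast
 show ?thesis
 proof (rule integrable_bound)
  show "integrable lborel (%q. C * A q)" using density(1) by simp
  show "(%q. A q * past F p q) \<in> borel_measurable lborel" using borel_measurable_integrable[OF density(1)] measurable_past[OF F, of p] by simp
  show "AE q in lborel. norm (A q * past F p q) <= norm (C * A q)" (is "AE q in _. ?P q")
  proof (rule AE_I2)
   fix q :: "'n event" show "?P q" using C(2)[OF p, of q] density(2)[of q] C(1) mult_left_mono[of "\<bar>past F p q\<bar>" C "\<bar>A q\<bar>"]
     by (cases "q \<in> far r") (auto simp: abs_mult mult.commute)
  qed
 qed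
qed

lemma off_abs_bounded:
 assumes F: "nice F"
 obtains K where "!!p. p \<in> near r ==> (LINT q|lborel. \<bar>A q * past F p q\<bar>) <= K"
proof -
 obtain C where C: "C >= 0" "!!p q. p \<in> near r ==> q \<in> far r ==> \<bar>past F p q\<bar> <= C" using past_bounded[OF F r] by blast
 show ?thesis
 proof (rule that)
  fix p :: "'n event" assume p: "p \<in> near r"
  show "(LINT q|lborel. \<bar>A q * past F p q\<bar>) <= (LINT q|lborel. C * \<bar>A q\<bar>)"
  proof (rule integral_mono)
   show "integrable lborel (%q. \<bar>A q * past F p q\<bar>)" by (rule integrable_abs[OF off_integrable[OF F p]])
   show "integrable lborel (%q. C * \<bar>A q\<bar>)" using density(1) by simp
   fix q :: "'n event" show "\<bar>A q * past F p q\<bar> <= C * \<bar>A q\<bar>"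
    using C(2)[OF p, of q] density(2)[of q] C(1) mult_left_mono[of "\<bar>past F p q\<bar>" C "\<bar>A q\<bar>"] by (cases "q \<in> far r") (auto simp: abs_mult mult.commute)
  qed
 qed
qed

lemma off_bounded:
 assumes F: "nice F"
 obtains K where "!!p. p \<in> near r ==> \<bar>off A F p\<bar> <= K"
proof -
 obtain K where K: "!!p. p \<in> near r ==> (LINT q|lborel. \<bar>A q * past F p q\<bar>) <= K" using off_abs_bounded[OF F] by blast
 show ?thesis
 proof (rule that)
  fix p :: "'n event" assume "p \<in> near r"
  then show "\<bar>off A F p\<bar> <= K" unfolding off_def by (rule order_trans[OF integral_abs_bound K])
 qed
qed

lemma cyl_near: "p \<in> cyl r ==> p \<in> near r" using r by (cases p) (auto simp: cyl_def near_def half_ball0_def)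

lemma near_height: "p \<in> near r ==> \<bar>snd (fst p)\<bar> <= 2 * r" using norm_snd_le[of "snd (fst p)" "fst (fst p)"] r by (auto simp: near_def)

lemma off_partial:
 assumes F: "nice F" and b: "b \<in> Basis"
 obtains F' where "nice F'" "has_partial_on (near r) (off A F) b (%p. (if b = ((0, 1), 0) then snd (fst p) else 1) * off A F' p)"
proof -
 let ?k = "%p :: 'n event. if b = ((0, 1), 0) then snd (fst p) else 1"
 let ?U = "near r :: ('n event) set"
 obtain F' where F': "nice F'" "!!p q. p \<in> ?U ==> q \<in> far r ==>
  ((%h. past F (p + h *\<^sub>R b) q) has_real_derivative ?k p * past F' p q) (at 0 within {h. p + h *\<^sub>R b \<in> ?U})" using past_deriv_basis[OF F r b] by blast
 obtain C where C: "C >= 0" "!!p q. p \<in> ?U ==> q \<in> far r ==> \<bar>past F' p q\<bar> <= C" using past_bounded[OF F'(1) r] by blast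
 have k: "\<bar>?k p\<bar> <= 1 + 2 * r" if "p \<in> ?U" for p using near_height[OF that] r by simp
 have "((%h. off A F (p + h *\<^sub>R b)) has_real_derivative ?k p * off A F' p) (at 0 within {h. p + h *\<^sub>R b \<in> ?U})" if p: "p \<in> ?U" for p
 proof -
  have "((%h. LINT q|lborel. A q * past F (p + h *\<^sub>R b) q) has_real_derivative
   (LINT q|lborel. A q * (?k (p + 0 *\<^sub>R b) * past F' (p + 0 *\<^sub>R b) q))) (at 0 within {h. p + h *\<^sub>R b \<in> ?U})"
  proof (rule has_real_derivative_integral[where F = "%h q. A q * past F (p + h *\<^sub>R b) q" and x = 0 and S = "{h. p + h *\<^sub>R b \<in> ?U}" and F' = "%h q. A q * (?k (p + h *\<^sub>R b) * past F' (p + h *\<^sub>R b) q)" and B = "%q. \<bar>A q\<bar> * ((1 + 2 * r) * C)"])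
   show "convex {h. p + h *\<^sub>R b \<in> ?U}" by (rule convex_line[OF convex_near])
   show "0 \<in> {h. p + h *\<^sub>R b \<in> ?U}" using p by simp
   show "integrable lborel (%q. \<bar>A q\<bar> * ((1 + 2 * r) * C))" using density(1) by simp
   show "(%q. A q * (?k (p + 0 *\<^sub>R b) * past F' (p + 0 *\<^sub>R b) q)) \<in> borel_measurable lborel"
    using borel_measurable_integrable[OF density(1)] measurable_past[OF F'(1), of p] by simp
   fix h assume "h \<in> {h. p + h *\<^sub>R b \<in> ?U}"
   then have h: "p + h *\<^sub>R b \<in> ?U" by simp
   show "integrable lborel (%q. A q * past F (p + h *\<^sub>R b) q)" by (rule off_integrable[OF F h])
   fix q :: "'n event"
   show "\<bar>A q * (?k (p + h *\<^sub>R b) * past F' (p + h *\<^sub>R b) q)\<bar> <= \<bar>A q\<bar> * ((1 + 2 * r) * C)"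
   proof (cases "q \<in> far r")
    case True
    show ?thesis unfolding abs_mult using k[OF h] C(2)[OF h True] r by (intro mult_left_mono mult_mono) auto
   qed (simp add: density(2))
   show "((%h. A q * past F (p + h *\<^sub>R b) q) has_real_derivative A q * (?k (p + h *\<^sub>R b) * past F' (p + h *\<^sub>R b) q)) (at h within {h. p + h *\<^sub>R b \<in> ?U})"
   proof (cases "q \<in> far r")
    case True
    show ?thesis by (rule DERIV_cmult[OF DERIV_along_line[where f = "%z. past F z q", OF F'(2)[OF h True]]])
   qed (simp add: density(2))
  qed
  moreover have "(LINT q|lborel. A q * (?k (p + 0 *\<^sub>R b) * past F' (p + 0 *\<^sub>R b) q)) = ?k p * off A F' p"
   unfolding off_def integral_mult_right_zero[symmetric] by (simp only: scaleR_zero_left add_0_right mult.left_commute)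
  ultimately show ?thesis by (simp only: off_def)
 qed
 then show ?thesis by (intro that[OF F'(1)]) (simp add: has_partial_on_def)
qed

text \<open>Points at distance at most \<open>r / 5\<close> are joined by a coordinate path inside
  \<open>near\<close>, along which the partial derivatives are bounded. For a larger distance
  boundedness by \<open>K\<close> suffices, which explains \<open>10 * K / r\<close>.\<close>

lemma off_holder:
 assumes F: "nice F" and \<alpha>: "0 < \<alpha>" "\<alpha> <= 1"
 shows "parabolic_holder \<alpha> (cyl r) (off A F)"
proof -
 obtain K where K: "!!p. p \<in> near r ==> \<bar>off A F p\<bar> <= K" using off_bounded[OF F] by blast
 have "\<exists>g C. has_partial_on (near r) (off A F) b g \<and> (\<forall>p\<in>near r. \<bar>g p\<bar> <= C)" if b: "b \<in> Basis" for b
 proof -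
  let ?k = "%p :: 'n event. if b = ((0, 1), 0) then snd (fst p) else 1"
  obtain F' where F': "nice F'" "has_partial_on (near r) (off A F) b (%p. ?k p * off A F' p)" using off_partial[OF F b] by blast
  obtain C where C: "!!p. p \<in> near r ==> \<bar>off A F' p\<bar> <= C" using off_bounded[OF F'(1)] by blast
  have "\<bar>?k p * off A F' p\<bar> <= (1 + 2 * r) * C" if p: "p \<in> near r" for p unfolding abs_mult using near_height[OF p] C[OF p] r by (intro mult_mono) auto
  then show ?thesis using F'(2) by blast
 qed
 from lipschitz_from_partials[OF convex_near this] obtain L where L: "L >= 0" "!!p p'. (!!s. \<forall>b\<in>Basis. s \<bullet> b = 0 \<or> s \<bullet> b = (p' - p) \<bullet> b ==> p + s \<in> near r)
   ==> \<bar>off A F p' - off A F p\<bar> <= L * norm (p' - p)" by blast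
 have K0: "K >= 0" using K[of 0] r by (simp add: near_def)
 show ?thesis
 proof (rule parabolic_holder_lipschitz[OF r \<alpha>, of "L + 10 * K / r" _ K])
  show "L + 10 * K / r >= 0" using L(1) K0 r by simp
  fix p :: "'n event" assume p: "p \<in> cyl r"
  show "\<bar>off A F p\<bar> <= K" by (rule K[OF cyl_near[OF p]])
  fix p' :: "'n event" assume p': "p' \<in> cyl r"
  show "\<bar>off A F p - off A F p'\<bar> <= (L + 10 * K / r) * norm (p - p')"
  proof (cases "norm (p - p') <= r / 5")
   case True
   \<comment> \<open>The height and the time of \<open>p' + s\<close> are those of \<open>p\<close>
     or of \<open>p'\<close>. Only the norm of the space component may exceed \<open>r\<close>, and
     by no more than \<open>r / 5\<close>.\<close>
   have "p' + s \<in> near r" if s: "\<forall>b\<in>Basis. s \<bullet> b = 0 \<or> s \<bullet> b = (p - p') \<bullet> b" for s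
   proof -
    have "norm s <= norm (p - p')" by (rule norm_le_componentwise) (use s in fastforce)
    then have "norm (fst s) <= r / 5" using True norm_fst_le[of "fst s" "snd s"] by simp
    then have "norm (fst p' + fst s) <= 6 / 5 * r" using norm_triangle_ineq[of "fst p'" "fst s"] p' by (auto simp: cyl_def half_ball0_def)
    moreover have "((0, 1), 0) \<in> (Basis :: ('n event) set)" "(0, 1) \<in> (Basis :: ('n event) set)" by (auto simp: Basis_prod_def)
    then have "snd (fst s) = 0 \<or> snd (fst s) = snd (fst p) - snd (fst p')" "snd s = 0 \<or> snd s = snd p - snd p'"
     using bspec[OF s, of "((0, 1), 0)"] bspec[OF s, of "(0, 1)"] by (simp_all add: inner_prod_def)
    ultimately show ?thesis using p p' r by (auto simp: near_def cyl_def half_ball0_def)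
   qed
   then have "\<bar>off A F p - off A F p'\<bar> <= L * norm (p - p')" by (rule L(2))
   also have "... <= (L + 10 * K / r) * norm (p - p')" using K0 r by (intro mult_right_mono) auto
   finally show ?thesis .
  next
   case False
   have "\<bar>off A F p - off A F p'\<bar> <= 10 * K / r * (r / 5)" using K[OF cyl_near[OF p]] K[OF cyl_near[OF p']] r by simp
   also have "... <= (L + 10 * K / r) * norm (p - p')" using False L(1) K0 r by (intro mult_mono) auto
   finally show ?thesis .
  qed
 qed
qed

lemma off_regular:
 assumes F: "nice F" and \<alpha>: "0 < \<alpha>" "\<alpha> <= 1" "\<alpha> <= 1 + a"
 shows "regular a \<alpha> r (off A F)"
proof -
 have U: "open_cyl r \<subseteq> (near r :: ('n event) set)" using r by (auto simp: half_ball_def near_def)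
 have P: "\<exists>D. has_partial_on (open_cyl r) (off A F) b D \<and> holder_up_to_bottom \<alpha> r D" if b: "b \<in> Basis" "b ~= ((0, 1), 0)" for b
 proof -
  obtain F' where F': "nice F'" "has_partial_on (near r) (off A F) b (%p. (if b = ((0, 1), 0) then snd (fst p) else 1) * off A F' p)" using off_partial[OF F b(1)] by blast
  then show ?thesis using has_partial_on_subset[OF F'(2) U] holder_up_to_bottomI[OF off_holder[OF F'(1) \<alpha>(1,2)] refl] b(2) by auto
 qed
 show ?thesis unfolding regular_def
 proof (intro conjI allI)
  fix i :: 'n
  show "\<exists>D. has_partial_on (open_cyl r) (off A F) ((axis i 1, 0), 0) D \<and> holder_up_to_bottom \<alpha> r D" by (rule P) (auto simp: Basis_prod_def Basis_vec_def)
  show "\<exists>D. has_partial_on (open_cyl r) (off A F) ((0, 0), 1) D \<and> holder_up_to_bottom \<alpha> r D" by (rule P) (auto simp: Basis_prod_def zero_prod_def)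
 next
  have e: "((0, 1), 0) \<in> (Basis :: ('n event) set)" by (auto simp: Basis_prod_def)
  obtain F' where F': "nice F'" "has_partial_on (near r) (off A F) ((0, 1), 0) (%p. snd (fst p) * off A F' p)"
   using off_partial[OF F e] by (simp only: simp_thms if_True) blast
  have "holder_up_to_bottom \<alpha> r (%p. weight a (fst p) * (snd (fst p) * off A F' p))"
  proof (rule holder_up_to_bottomI)
   show "parabolic_holder \<alpha> (cyl r) (%p. snd (fst p) powr (1 + a) * off A F' p)" by (intro parabolic_holder_mult parabolic_holder_height off_holder r F' \<alpha>)
   fix p :: "'n event" assume "p \<in> open_cyl r"
   then have "0 < snd (fst p)" by (auto simp: half_ball_def)
   then have "snd (fst p) powr (1 + a) = snd (fst p) * snd (fst p) powr a" by (simp add: powr_add)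
   then show "snd (fst p) powr (1 + a) * off A F' p = weight a (fst p) * (snd (fst p) * off A F' p)" by (simp add: weight_def mult_ac)
  qed
  then show "\<exists>D. has_partial_on (open_cyl r) (off A F) ((0, 1), 0) D \<and>
    holder_up_to_bottom \<alpha> r (%p. weight a (fst p) * D p)" using has_partial_on_subset[OF F'(2) U] by blast
 qed
qed

end

section \<open>The limit of the truncated representation\<close>

lemma trunc_past: "e > 0 ==> trunc m c e (fst p) (snd p) q = cut_pole e (snd p - snd q) * past (gk m c) p q" by (simp add: trunc_def past_def cut_pole_0)

lemma cut_pole_limit:
 assumes e: "!!n. e n > 0" "e \<longlonglongrightarrow> 0" and s: "\<sigma> > 0"
 shows "(%n. cut_pole (e n) \<sigma>) \<longlonglongrightarrow> 1"
proof -
 have "eventually (%n. e n < \<sigma> / 2) sequentially" using e(2) s by (intro order_tendstoD) auto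
 then have "eventually (%n. cut_pole (e n) \<sigma> = 1) sequentially"
 proof (rule eventually_mono)
  fix n assume "e n < \<sigma> / 2"
  then have "\<sigma> / e n - 1 >= 1" using e(1)[of n] by (simp add: field_simps)
  then show "cut_pole (e n) \<sigma> = 1" by (simp add: cut_pole_def step_1)
 qed
 then show ?thesis by (rule tendsto_eventually)
qed

lemma integral_cut_pole_limit:
 fixes p :: "'n::finite event" and g :: "'a::euclidean_space \<times> real => real"
 assumes g: "integrable lborel g" "\<forall>q. snd p <= snd q --> g q = 0" and e: "!!n. e n > 0" "e \<longlonglongrightarrow> 0"
 shows "(%n. LINT q|lborel. cut_pole (e n) (snd p - snd q) * g q) \<longlonglongrightarrow> (LINT q|lborel. g q)"
  "\<bar>LINT q|lborel. cut_pole (e n) (snd p - snd q) * g q\<bar> <= (LINT q|lborel. \<bar>g q\<bar>)"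
  "integrable lborel (%q. cut_pole (e n) (snd p - snd q) * g q)"
proof -
 have gm: "g \<in> borel_measurable borel" using g(1) by (auto dest: borel_measurable_integrable)
 have s: "(%q :: 'a \<times> real. snd q) \<in> borel_measurable borel" by (intro borel_measurable_continuous_onI continuous_intros)
 have cm: "(%q :: 'a \<times> real. cut_pole (e n) (snd p - snd q)) \<in> borel_measurable borel" for n
  by (rule measurable_compose[OF _ measurable_cut(5)]) (intro borel_measurable_diff borel_measurable_const s)
 have m: "(%q. cut_pole (e n) (snd p - snd q) * g q) \<in> borel_measurable lborel" for n using gm cm[of n] by simp
 have b: "norm (cut_pole (e n) (snd p - snd q) * g q) <= \<bar>g q\<bar>" for n q using cut_bounds(5,6)[of "e n" "snd p - snd q"] by (simp add: abs_mult mult_left_le_one_le)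
 show i: "integrable lborel (%q. cut_pole (e n) (snd p - snd q) * g q)" for n by (rule integrable_bound[OF g(1) m]) (use b in auto)
 show "\<bar>LINT q|lborel. cut_pole (e n) (snd p - snd q) * g q\<bar> <= (LINT q|lborel. \<bar>g q\<bar>)"
  using integral_norm_bound_integral[OF i integrable_abs[OF g(1)] b] by simp
 show "(%n. LINT q|lborel. cut_pole (e n) (snd p - snd q) * g q) \<longlonglongrightarrow> (LINT q|lborel. g q)"
 proof (rule integral_dominated_convergence[OF _ m integrable_abs[OF g(1)]])
  show "AE q in lborel. (%n. cut_pole (e n) (snd p - snd q) * g q) \<longlonglongrightarrow> g q" (is "AE q in _. ?P q")
  proof (rule AE_I2)
   fix q show "?P q"
   proof (cases "snd q < snd p")
    case True
    then have "(%n. cut_pole (e n) (snd p - snd q) * g q) \<longlonglongrightarrow> 1 * g q" by (intro tendsto_mult_right cut_pole_limit e) simp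
    then show ?thesis by simp
   qed (simp add: g(2))
  qed
 qed (use gm b in auto)
qed

text \<open>For a source at \<open>y = 0\<close> the hypergeometric factor is
  \<open>F01 c 0 = 1\<close>, so this is a Gaussian with the power
  \<open>l powr (n / 2 + c)\<close>. The surplus \<open>c\<close> over the normalised heat kernel is
  integrable in time because \<open>c < 1\<close>.\<close>

definition bker :: "real => 'n::finite event => 'n space => real" where
 "bker c p q = past (gk (real CARD('n) / 2 + c) c) p ((fst q, 0), snd q)"

lemma bker_eq:
 fixes p :: "'n::finite event"
 assumes "snd q < snd p"
 shows "bker c p q = pole_l (snd p) (snd q) powr (real CARD('n) / 2 + c) *
  exp (- (pole_l (snd p) (snd q) * ((norm (fst (fst p) - fst q))^2 + (snd (fst p))^2)))" using assms by (simp add: bker_def past_def gk_def base_kernel_def F01_0)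

lemma bker_0: "snd p <= snd q ==> bker c p q = 0" by (simp add: bker_def past_def)

lemma bker_nonneg: "c > 0 ==> 0 <= bker c p q" unfolding bker_def past_def by (simp add: gk_nonneg)

lemma measurable_bker:
 fixes p :: "'n::finite event"
 assumes c: "c > 0"
 shows "bker c p \<in> borel_measurable borel"
proof -
 have "(%q :: 'n space. ((fst q, 0 :: real), snd q)) \<in> borel_measurable borel" by (intro borel_measurable_continuous_onI continuous_intros)
 from measurable_compose[OF this measurable_past[OF gk_nice[OF c]]]
 show ?thesis unfolding bker_def[abs_def] .
qed

lemma powr_exp_bound:
 fixes k :: real
 assumes k: "k > 0" and m: "m >= 0"
 obtains C where "C >= 0" "!!l. l >= 0 ==> l powr m * exp (- (l * k)) <= C"
proof -
 define N where "N = nat \<lceil>m\<rceil>"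
 have N: "m <= real N" by (simp add: N_def real_nat_ceiling_ge)
 show ?thesis
 proof (rule that[of "1 + fact N / k ^ N"])
  show f: "0 <= 1 + fact N / k ^ N" using k by simp
  fix l :: real assume l: "l >= 0"
  show "l powr m * exp (- (l * k)) <= 1 + fact N / k ^ N"
  proof (cases "l <= 1")
   case True
   have "l powr m * exp (- (l * k)) <= 1 * 1" using l k m True by (intro mult_mono powr_le1) auto
   then show ?thesis using k by (simp add: add_increasing2)
  next
   case False
   have "l powr m <= l powr real N" using False N by (intro powr_mono) auto
   also have "... = l ^ N" using False by (simp add: powr_realpow)
   finally have "l powr m * exp (- (l * k)) <= l ^ N * exp (- (l * k))" by (intro mult_right_mono) auto
   also have "... <= fact N / k ^ N" by (rule power_exp_bound[OF l k])
   finally show ?thesis by simp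
  qed
 qed
qed

lemma bker_bound:
 assumes c: "c > 0" and \<delta>: "\<delta> > 0"
 obtains C where "C >= 0" "!!p :: 'n::finite event. !!q. snd (fst p) >= \<delta> ==> \<bar>bker c p q\<bar> <= C"
proof -
 let ?m = "real CARD('n) / 2 + c"
 obtain C where C: "C >= 0" "!!l. l >= 0 ==> l powr ?m * exp (- (l * \<delta>^2)) <= C" using powr_exp_bound[of "\<delta>^2" ?m] c \<delta> by auto
 show ?thesis
 proof (rule that[OF C(1)])
  fix p :: "'n event" and q assume y: "snd (fst p) >= \<delta>"
  show "\<bar>bker c p q\<bar> <= C"
  proof (cases "snd q < snd p")
   case True
   let ?l = "pole_l (snd p) (snd q)"
   have l: "?l >= 0" using True by (simp add: pole_l_def)
   have "\<delta>^2 <= (snd (fst p))^2" using y \<delta> by (intro power_mono) auto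
   then have "\<delta>^2 <= (norm (fst (fst p) - fst q))^2 + (snd (fst p))^2" by (simp add: add_increasing)
   then have "?l * \<delta>^2 <= ?l * ((norm (fst (fst p) - fst q))^2 + (snd (fst p))^2)" using l by (rule mult_left_mono)
   then have "bker c p q <= ?l powr ?m * exp (- (?l * \<delta>^2))" unfolding bker_eq[OF True] by (intro mult_left_mono) auto
   also have "... <= C" by (rule C(2)[OF l])
   finally show ?thesis using bker_nonneg[OF c, of p q] by simp
  qed (use C(1) in \<open>simp add: bker_0\<close>)
 qed
qed

section \<open>The boundary potential of the truncated flux\<close>

definition bpot :: "real => ('n::finite space => real) => 'n event => real" where
 "bpot c f p = (LINT q|lborel. f q * bker c p q)"

definition bcyl :: "real => ('n::finite space) set" where
 "bcyl r = ball 0 (2 * r) \<times> {- 4 * r^2<..0}"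

text \<open>The flux is set to 0 after time 0. The jump there does no harm: \<open>bker c p\<close>
  sees only times before that of \<open>p\<close>, and the potential is evaluated at times up to
  0.\<close>

definition bdata :: "real => ('n::finite space => real) => 'n space => real" where
 "bdata r \<phi> q = indicator (bcyl r) q * (cut_space r (fst q, 0) * cut_time r (snd q) * \<phi> q)"

lemma sets_bcyl[measurable]: "bcyl r \<in> sets borel" unfolding bcyl_def by (intro borel_Times) auto

lemma bounded_bcyl: "bounded (bcyl r :: ('n::finite space) set)"
proof -
 have "bounded ({- 4 * r^2<..0})" by (rule bounded_subset[OF bounded_closed_interval[of "- 4 * r^2" 0]]) auto
 then show ?thesis unfolding bcyl_def by (intro bounded_Times) auto
qed

lemma measurable_cutoff_data:
 fixes g :: "'n::finite space => real"
 assumes g: "continuous_on (bcyl r) g"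
 shows "(%q. indicator (bcyl r) q * g q) \<in> borel_measurable borel" using borel_measurable_continuous_on_indicator[OF sets_bcyl g] by simp

lemma continuous_on_cutoffs:
 assumes "r ~= 0"
 shows "continuous_on S (%q :: 'n::finite space. cut_space r (fst q, 0) * cut_time r (snd q))" by (intro continuous_intros assms)

lemma measurable_bdata:
 fixes \<phi> :: "'n::finite space => real"
 assumes r: "r ~= 0" and \<phi>: "continuous_on (bcyl r) \<phi>"
 shows "bdata r \<phi> \<in> borel_measurable borel" unfolding bdata_def[abs_def] by (intro measurable_cutoff_data continuous_on_mult continuous_on_cutoffs r \<phi>)

lemma bdata_bound:
 assumes "!!q. q \<in> bcyl r ==> \<bar>\<phi> q\<bar> <= K"
 shows "\<bar>bdata r \<phi> q\<bar> <= \<bar>K\<bar> * indicator (bcyl r) q"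
proof (cases "q \<in> bcyl r")
 case True
 have "\<bar>bdata r \<phi> q\<bar> = \<bar>cut_space r (fst q, 0)\<bar> * \<bar>cut_time r (snd q)\<bar> * \<bar>\<phi> q\<bar>" using True by (simp add: bdata_def abs_mult)
 also have "... <= 1 * 1 * \<bar>K\<bar>" using assms[OF True] cut_bounds(1,2)[of r "(fst q, 0)"] cut_bounds(3,4)[of r "snd q"] by (intro mult_mono) auto
 finally show ?thesis using True by simp
qed (simp add: bdata_def)

lemma bdata_bker_integrable:
 fixes f :: "'n::finite space => real"
 assumes c: "c > 0" and f: "f \<in> borel_measurable borel" "!!q. \<bar>f q\<bar> <= K * indicator (bcyl r) q"
  and C: "!!q. \<bar>bker c p q\<bar> <= C"
 shows "integrable lborel (%q. f q * bker c p q)" "(LINT q|lborel. \<bar>f q * bker c p q\<bar>) <= K * C * measure lborel (bcyl r :: ('n space) set)"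
proof -
 have i: "integrable lborel (%q. (K * C) * indicator (bcyl r :: ('n space) set) q :: real)" by (rule integrable_indicator_bounded[OF bounded_bcyl sets_bcyl])
 have b: "\<bar>f q * bker c p q\<bar> <= (K * C) * indicator (bcyl r) q" for q
 proof -
  have "\<bar>f q * bker c p q\<bar> <= (K * indicator (bcyl r) q) * C" unfolding abs_mult using f(2)[of q] C[of q] by (intro mult_mono) auto
  then show ?thesis by (simp add: mult_ac)
 qed
 have m: "(%q. f q * bker c p q) \<in> borel_measurable lborel" using f(1) measurable_bker[OF c, of p] by simp
 show *: "integrable lborel (%q. f q * bker c p q)"
 proof (rule integrable_bound[OF i m], rule AE_I2)
  fix q show "norm (f q * bker c p q) <= norm (K * C * indicator (bcyl r) q :: real)" unfolding real_norm_def by (rule order_trans[OF b abs_ge_self])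
 qed
 have "(LINT q|lborel. \<bar>f q * bker c p q\<bar>) <= (LINT q|lborel. (K * C) * indicator (bcyl r :: ('n space) set) q)" by (intro integral_mono integrable_abs * i b)
 also have "... = K * C * measure lborel (bcyl r :: ('n space) set)" by simp
 finally show "(LINT q|lborel. \<bar>f q * bker c p q\<bar>) <= K * C * measure lborel (bcyl r :: ('n space) set)" .
qed

lemma AE_snd_neq: "AE p in lborel. snd (p :: 'a::euclidean_space \<times> real) ~= t"
proof -
 have "(0 :: 'a, 1 :: real) ~= 0" by (simp add: zero_prod_def)
 then have "negligible {p :: 'a \<times> real. (0, 1) \<bullet> p = t}" by (intro negligible_hyperplane) auto
 moreover have "{p :: 'a \<times> real. (0, 1) \<bullet> p = t} = {p. snd p = t}" by (auto simp: inner_prod_def)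
 moreover have "closed {p :: 'a \<times> real. snd p = t}" by (intro closed_Collect_eq continuous_intros)
 ultimately have "{p :: 'a \<times> real. snd p = t} \<in> null_sets lborel" by (simp add: negligible_iff_null_sets null_sets_completion_iff)
 then show ?thesis by (auto dest: AE_not_in)
qed

text \<open>The three terms with a derivative of \<open>cut_time\<close> or \<open>cut_space\<close>
  have integrable densities supported in \<open>far\<close>, where the kernels are bounded; the
  boundary term has a bounded kernel as long as the height stays positive. So \<open>e\<close> can
  tend to 0 by dominated convergence, with bounds uniform in the pole, as
  \<open>AE_eq_from_jump_kernel\<close> requires.\<close>

lemma representation:
 fixes v :: "'n::finite event => real" and \<phi> :: "'n space => real"
 assumes c: "c > 0" and a: "a = 2 * c - 1" and r: "r > 0"
  and weak: "weak_solution a (2 * r) (- 4 * r^2) 0 (%q. - \<phi> q) v"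
  and \<phi>: "continuous_on (bcyl r) \<phi>" "!!q. q \<in> bcyl r ==> \<bar>\<phi> q\<bar> <= K"
 obtains A B E F where "integrable lborel A" "integrable lborel B" "integrable lborel E"
  "\<forall>q. q \<notin> far r --> A q = 0" "\<forall>q. q \<notin> far r --> B q = 0" "\<forall>q. q \<notin> far r --> E q = 0" "nice F"
  "AE p in lborel. p \<in> open_cyl r --> kernel_mass TYPE('n) c * v p =
   off A (gk (real CARD('n) / 2 + c) c) p + off B F p + (- 1) * off E (gk (real CARD('n) / 2 + c) c) p + bpot c (bdata r \<phi>) p"
proof -
 let ?m = "real CARD('n) / 2 + c" and ?\<Omega> = "big_cyl r :: ('n event) set"
  and ?w = "%p :: 'n event. weight a (fst p)"
 obtain G where V: "in_V a (2 * r) (- 4 * r^2) 0 v G" and W: "weak_identity a r (%q. - \<phi> q) v G" using weak unfolding weak_solution_def weak_identity_def by blast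
 obtain F where F: "nice F" "!!X (Z :: 'n space) l. l > 0 ==> F X Z l = Z \<bullet> gk_grad ?m c X Z l" using gk_grad_nice[OF c, of ?m] by blast
 \<comment> \<open>The scalar by which \<open>fst q\<close> is multiplied in
   \<open>cut_space_grad\<close>; the remaining factor \<open>fst q\<close> goes into the radial
   kernel \<open>F\<close>.\<close>
 define step_grad where "step_grad q = step' (3 - (norm (fst q))^2 / r^2) * (- 2 / r^2)" for q :: "'n event"
 define A where "A q = indicator ?\<Omega> q *\<^sub>R ((v q \<bullet> (cut_space r (fst q) * cut_time' r (snd q))) * ?w q)" for q
 define B where "B q = indicator ?\<Omega> q *\<^sub>R ((v q \<bullet> (cut_time r (snd q) * step_grad q)) * ?w q)" for q
 define E where "E q = indicator ?\<Omega> q *\<^sub>R ((G q \<bullet> (cut_time r (snd q) *\<^sub>R cut_space_grad r (fst q))) * ?w q)" for q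
 define V0 where "V0 q = indicator ?\<Omega> q *\<^sub>R ((v q \<bullet> (cut_space r (fst q) * cut_time r (snd q))) * ?w q)" for q
 have a1: "a > -1" using a c by simp
 have wi: "set_integrable lborel ?\<Omega> ?w" by (rule set_integrable_weight_cylinder[OF a1])
 have L2: "L2_weighted ?\<Omega> ?w v" "L2_weighted ?\<Omega> ?w G" using V by (auto simp: in_V_def)
 note int = L2_weighted_cylinder_integrable[OF a1, unfolded set_integrable_def]
 have r0: "r ~= 0" using r by simp
 have AI: "integrable lborel A" unfolding A_def[abs_def] by (intro int L2 continuous_intros r0)
 have BI: "integrable lborel B"
 proof -
  define k where "k = 1 / r^2"
  have k: "x / r^2 = x * k" for x by (simp add: k_def)
  show ?thesis unfolding B_def[abs_def] step_grad_def k by (intro int L2 continuous_intros r0)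
 qed
 have EI: "integrable lborel E" unfolding E_def[abs_def] by (intro int L2 continuous_intros r0)
 have VI: "integrable lborel V0" unfolding V0_def[abs_def] by (intro int L2 continuous_intros r0)
 have far: "(snd q > - 2 * r^2 \<and> (norm (fst q))\<^sup>2 < 2 * r^2) \<or> q \<notin> ?\<Omega>" if "q \<notin> far r" for q
  using that by (cases q) (auto simp: far_def half_ball_def not_le)
 have A0: "\<forall>q. q \<notin> far r --> A q = 0"
 proof (intro allI impI)
  fix q :: "'n event" assume "q \<notin> far r"
  from far[OF this] show "A q = 0" using r by (auto simp: A_def cut_time_1)
 qed
 have E0: "\<forall>q. q \<notin> far r --> E q = 0"
 proof (intro allI impI)
  fix q :: "'n event" assume "q \<notin> far r"
  from far[OF this] show "E q = 0" using r by (auto simp: E_def cut_space_1)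
 qed
 have B0: "\<forall>q. q \<notin> far r --> B q = 0"
 proof (intro allI impI)
  fix q :: "'n event" assume *: "q \<notin> far r"
  have "step_grad q = 0" if "(norm (fst q))^2 < 2 * r^2" using that r by (auto simp: step_grad_def field_simps intro!: step'_0)
  then show "B q = 0" using far[OF *] by (auto simp: B_def)
 qed
 define f where "f = bdata r \<phi>"
 have f: "f \<in> borel_measurable borel" "!!q. \<bar>f q\<bar> <= \<bar>K\<bar> * indicator (bcyl r) q"
  unfolding f_def by (rule measurable_bdata[OF r0 \<phi>(1)], rule bdata_bound[OF \<phi>(2)])
 let ?cut = "%e p q. cut_pole e (snd p - snd q)"
 have step1: "(LINT q|lborel. V0 q * trunc_jump ?m c e (fst p) (snd p) q) =
   (LINT q|lborel. ?cut e p q * (A q * past (gk ?m c) p q)) + (LINT q|lborel. ?cut e p q * (B q * past F p q))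
   - (LINT q|lborel. ?cut e p q * (E q * past (gk ?m c) p q)) + (LINT q|lborel. ?cut e p q * (f q * bker c p q))"
  if e: "e > 0" and t: "-3 * r^2 < snd p" "snd p < 0" for e and p :: "'n event"
 proof -
  have 0: "(LINT q:?\<Omega>|lborel. (v q \<bullet> (cut_space r (fst q) * cut_time r (snd q) * trunc_jump ?m c e (fst p) (snd p) q)) * ?w q)
   = (LINT q|lborel. V0 q * trunc_jump ?m c e (fst p) (snd p) q)" unfolding set_lebesgue_integral_def by (rule integral_cong) (simp_all add: V0_def)
  have 1: "(LINT q:?\<Omega>|lborel. (v q \<bullet> (cut_space r (fst q) * cut_time' r (snd q) * trunc ?m c e (fst p) (snd p) q)) * ?w q)
   = (LINT q|lborel. ?cut e p q * (A q * past (gk ?m c) p q))" unfolding set_lebesgue_integral_def by (rule integral_cong) (simp_all add: A_def trunc_past[OF e])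
  have 2: "(LINT q:?\<Omega>|lborel. (v q \<bullet> (cut_time r (snd q) * (cut_space_grad r (fst q) \<bullet> trunc_grad ?m c e (fst p) (snd p) q))) * ?w q)
   = (LINT q|lborel. ?cut e p q * (B q * past F p q))" unfolding set_lebesgue_integral_def
  proof (rule integral_cong[OF refl])
   fix q :: "'n event"
   have "cut_space_grad r (fst q) \<bullet> trunc_grad ?m c e (fst p) (snd p) q = step_grad q * (?cut e p q * past F p q)"
    using e F(2)[of "pole_l (snd p) (snd q)" "fst p" "fst q"]
    by (cases "snd q < snd p") (simp_all add: cut_space_grad_def trunc_grad_def step_grad_def past_def cut_pole_0 pole_l_def)
   then show "indicator ?\<Omega> q *\<^sub>R ((v q \<bullet> (cut_time r (snd q) * (cut_space_grad r (fst q) \<bullet> trunc_grad ?m c e (fst p) (snd p) q))) * ?w q)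
    = ?cut e p q * (B q * past F p q)" by (simp add: B_def)
  qed
  have 3: "(LINT q:?\<Omega>|lborel. (G q \<bullet> ((cut_time r (snd q) * trunc ?m c e (fst p) (snd p) q) *\<^sub>R cut_space_grad r (fst q))) * ?w q)
   = (LINT q|lborel. ?cut e p q * (E q * past (gk ?m c) p q))" unfolding set_lebesgue_integral_def by (rule integral_cong) (simp_all add: E_def trunc_past[OF e])
  have 4: "(LINT q:ball 0 (2 * r) \<times> {- 4 * r^2<..<0}|lborel. - \<phi> q * test r ?m c e (fst p) (snd p) ((fst q, 0), snd q))
   = (LINT q|lborel. - (?cut e p q * (f q * bker c p q)))" unfolding set_lebesgue_integral_def
  proof (rule integral_cong[OF refl])
   fix q :: "'n space"
   show "indicator (ball 0 (2 * r) \<times> {- 4 * r^2<..<0}) q *\<^sub>R (- \<phi> q * test r ?m c e (fst p) (snd p) ((fst q, 0), snd q))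
    = - (?cut e p q * (f q * bker c p q))"
   proof (cases "snd q < 0")
    case True
    then have "indicator (ball 0 (2 * r) \<times> {- 4 * r^2<..<0}) q = (indicator (bcyl r) q :: real)" by (cases q) (auto simp: bcyl_def indicator_def)
    then show ?thesis by (simp add: f_def bdata_def test_def trunc_past[OF e] bker_def)
   next
    case False
    then have "indicator (ball 0 (2 * r) \<times> {- 4 * r^2<..<0}) q = (0 :: real)" by (cases q) (auto simp: indicator_def)
    then show ?thesis using False t(2) by (simp add: bker_0)
   qed
  qed
  from truncated_representation[OF c a refl r e t V W, of "fst p"]
  show ?thesis unfolding 0 1 2 3 4 by simp
 qed
 define R where "R p = off A (gk ?m c) p + off B F p + (- 1) * off E (gk ?m c) p + bpot c f p" for p
 \<comment> \<open>On \<open>D k\<close> the height is bounded below, hence \<open>bker\<close> is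
   bounded. The union over \<open>k\<close> is the cylinder without the slice \<open>t = 0\<close>,
   a null set.\<close>
 define D where "D k = {p :: 'n event. p \<in> half_ball r \<times> {- r\<^sup>2<..<0} \<and> 1 / real (Suc k) < snd (fst p)}" for k
 define e where "e n = inverse (real (Suc n))" for n
 have e: "!!n. e n > 0" "e \<longlonglongrightarrow> 0" unfolding e_def[abs_def] by (simp, rule LIMSEQ_inverse_real_of_nat)
 have AEk: "AE p in lborel. p \<in> D k --> kernel_mass TYPE('n) c * V0 p = weight (2 * c - 1) (fst p) * R p" for k
 proof -
  have Dn: "p \<in> near r" "-3 * r^2 < snd p" "snd p < 0" "1 / real (Suc k) <= snd (fst p)" if "p \<in> D k" for p
   using that r by (cases p; auto simp: D_def near_def half_ball_def)+
  obtain C where C: "C >= 0" "!!p :: 'n event. !!q. snd (fst p) >= 1 / real (Suc k) ==> \<bar>bker c p q\<bar> <= C"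
   by (rule bker_bound[OF c, of "1 / real (Suc k)", where 'n = 'n]) auto
  have oA: "integrable lborel (%q. A q * past (gk ?m c) p q)" "integrable lborel (%q. B q * past F p q)"
    "integrable lborel (%q. E q * past (gk ?m c) p q)" "integrable lborel (%q. f q * bker c p q)" if "p \<in> D k" for p
   by (rule off_integrable[OF AI A0 r gk_nice[OF c] Dn(1)[OF that]])
    (rule off_integrable[OF BI B0 r F(1) Dn(1)[OF that]],
     rule off_integrable[OF EI E0 r gk_nice[OF c] Dn(1)[OF that]],
     rule bdata_bker_integrable(1)[OF c f C(2)[OF Dn(4)[OF that]]])
  have z: "\<forall>q. snd p <= snd q --> A q * past (gk ?m c) p q = 0" "\<forall>q. snd p <= snd q --> B q * past F p q = 0"
   "\<forall>q. snd p <= snd q --> E q * past (gk ?m c) p q = 0" "\<forall>q. snd p <= snd q --> f q * bker c p q = 0" for p by (simp_all add: past_def bker_0)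
  obtain KA where KA: "!!p. p \<in> near r ==> (LINT q|lborel. \<bar>A q * past (gk ?m c) p q\<bar>) <= KA" by (rule off_abs_bounded[OF AI A0 r gk_nice[OF c], of ?m]) blast
  obtain KB where KB: "!!p. p \<in> near r ==> (LINT q|lborel. \<bar>B q * past F p q\<bar>) <= KB" by (rule off_abs_bounded[OF BI B0 r F(1)]) blast
  obtain KE where KE: "!!p. p \<in> near r ==> (LINT q|lborel. \<bar>E q * past (gk ?m c) p q\<bar>) <= KE" by (rule off_abs_bounded[OF EI E0 r gk_nice[OF c], of ?m]) blast
  let ?Kf = "\<bar>K\<bar> * C * measure lborel (bcyl r :: ('n space) set)"
  show ?thesis
  proof (rule AE_eq_from_jump_kernel[OF c VI, of _ e, where C = "KA + KB + KE + ?Kf"])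
   show "V0 q = 0" if "snd (fst q) <= 0" for q using that by (cases q) (auto simp: V0_def half_ball_def)
   show "open (D k)"
   proof -
    have "D k = (half_ball r \<times> {- r\<^sup>2<..<0}) \<inter> {p. 1 / real (Suc k) < snd (fst p)}" by (auto simp: D_def)
    moreover have "open {p :: 'n event. 1 / real (Suc k) < snd (fst p)}" by (intro open_Collect_less continuous_intros)
    ultimately show ?thesis by (simp add: open_Int open_Times open_half_ball)
   qed
   show "D k \<subseteq> {p. 0 < snd (fst p)}" by (auto simp: D_def half_ball_def)
   have "set_integrable lborel (half_ball r \<times> {- r\<^sup>2<..<0}) (%p. weight a (fst p :: 'n space))" by (rule set_integrable_weight_cylinder[OF a1])
   then show "set_integrable lborel (D k) (%p. weight (2 * c - 1) (fst p))"
    unfolding a by (rule set_integrable_subset) (use \<open>open (D k)\<close> in \<open>auto simp: D_def\<close>)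
   fix p assume p: "p \<in> D k"
   have near: "p \<in> near r" and t: "-3 * r^2 < snd p" "snd p < 0" by (rule Dn[OF p])+
   note s1 = step1[OF e(1) t]
   note l1 = integral_cut_pole_limit[where g = "%q. A q * past (gk ?m c) p q" and e = e, OF oA(1)[OF p] z(1) e]
    and l2 = integral_cut_pole_limit[where g = "%q. B q * past F p q" and e = e, OF oA(2)[OF p] z(2) e]
    and l3 = integral_cut_pole_limit[where g = "%q. E q * past (gk ?m c) p q" and e = e, OF oA(3)[OF p] z(3) e]
    and l4 = integral_cut_pole_limit[where g = "%q. f q * bker c p q" and e = e, OF oA(4)[OF p] z(4) e]
   have Req: "R p = (LINT q|lborel. A q * past (gk ?m c) p q) + (LINT q|lborel. B q * past F p q)
    - (LINT q|lborel. E q * past (gk ?m c) p q) + (LINT q|lborel. f q * bker c p q)" by (simp add: R_def off_def bpot_def)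
   show "(%n. LINT q|lborel. V0 q * trunc_jump ?m c (e n) (fst p) (snd p) q) \<longlonglongrightarrow> R p"
    unfolding s1 Req by (intro tendsto_add tendsto_diff l1(1) l2(1) l3(1) l4(1))
   fix n
   show "\<bar>LINT q|lborel. V0 q * trunc_jump ?m c (e n) (fst p) (snd p) q\<bar> <= KA + KB + KE + ?Kf"
    unfolding s1 using l1(2)[of n] l2(2)[of n] l3(2)[of n] l4(2)[of n] KA[OF near] KB[OF near] KE[OF near]
     bdata_bker_integrable(2)[OF c f C(2)[OF Dn(4)[OF p]]] by linarith
  qed (rule e)+
 qed
 have "AE p in lborel. p \<in> open_cyl r --> kernel_mass TYPE('n) c * v p = R p"
 proof -
  have "AE p in lborel. \<forall>k. p \<in> D k --> kernel_mass TYPE('n) c * V0 p = weight (2 * c - 1) (fst p) * R p" unfolding AE_all_countable using AEk by blast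
  moreover have "AE p in lborel. snd (p :: 'n event) ~= 0" by (rule AE_snd_neq)
  ultimately show ?thesis
  proof eventually_elim
   fix p :: "'n event" assume *: "\<forall>k. p \<in> D k --> kernel_mass TYPE('n) c * V0 p = weight (2 * c - 1) (fst p) * R p" and t: "snd p ~= 0"
   show "p \<in> open_cyl r --> kernel_mass TYPE('n) c * v p = R p"
   proof
    assume "p \<in> open_cyl r"
    then have p: "norm (fst p) < r" "0 < snd (fst p)" "- r\<^sup>2 < snd p" "snd p < 0" using t by (cases p; auto simp: half_ball_def)+
    obtain k where "inverse (real (Suc k)) < snd (fst p)" using reals_Archimedean[OF p(2)] by blast
    then have "p \<in> D k" using p by (cases p) (auto simp: D_def half_ball_def inverse_eq_divide)
    then have eq: "kernel_mass TYPE('n) c * V0 p = weight (2 * c - 1) (fst p) * R p" using * by blast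
    have "(norm (fst p))^2 < r^2" using p(1) by (intro power_strict_mono) auto
    then have n: "(norm (fst p))^2 <= 2 * r^2" using zero_le_power2[of r] by linarith
    have t2: "snd p >= - 2 * r^2" using p(3) zero_le_power2[of r] by linarith
    have "p \<in> ?\<Omega>" using p r by (cases p) (auto simp: half_ball_def)
    then have "V0 p = v p * weight (2 * c - 1) (fst p)" using cut_space_1(1)[OF r n] cut_time_1(1)[OF r t2] by (simp add: V0_def a)
    moreover have "weight (2 * c - 1) (fst p) > 0" using p(2) by (simp add: weight_def)
    ultimately show "kernel_mass TYPE('n) c * v p = R p" using eq by (simp add: mult.commute)
   qed
  qed
 qed
 then show ?thesis unfolding R_def f_def by (rule that[OF AI BI EI A0 B0 E0 F(1)])
qed

section \<open>Hoelder continuity of the boundary potential\<close>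

lemma min_1_le_powr:
 fixes d :: real
 assumes "0 <= d" "0 < \<alpha>" "\<alpha> <= 1"
 shows "min 1 d <= d powr \<alpha>"
proof (cases "d <= 1")
 case True
 then show ?thesis using powr_mono'[of \<alpha> 1 d] assms by simp
next
 case False
 then show ?thesis using assms ge_one_powr_ge_zero[of d \<alpha>] by simp
qed

text \<open>The mean value bound and the trivial bound combine to \<open>min 1 d\<close>, with
  \<open>d\<close> the distance of \<open>A\<close> and \<open>B\<close>, and
  \<open>min 1 d \<le> d powr \<alpha>\<close>. Half of the exponent is given up to absorb the
  factor \<open>z\<close> in the derivative of \<open>exp (- z\<^sup>2)\<close>; the sum of both
  Gaussians makes the bound symmetric.\<close>

lemma gauss_diff:
 fixes A B :: real
 assumes A: "0 <= A" and B: "0 <= B" and \<alpha>: "0 < \<alpha>" "\<alpha> <= 1"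
 shows "\<bar>exp (- A\<^sup>2) - exp (- B\<^sup>2)\<bar> <= 2 * \<bar>A - B\<bar> powr \<alpha> * (exp (- (A^2 / 2)) + exp (- (B^2 / 2)))"
proof -
 have *: "\<bar>exp (- x\<^sup>2) - exp (- y\<^sup>2)\<bar> <= 2 * (y - x) powr \<alpha> * (exp (- (x^2 / 2)) + exp (- (y^2 / 2)))"
  if x: "0 <= x" "x < y" for x y :: real
 proof -
  have D: "((%z. exp (- z\<^sup>2)) has_real_derivative - (2 * z * exp (- z\<^sup>2))) (at z)" for z :: real by (auto intro!: derivative_eq_intros)
  obtain z where z: "x < z" "z < y" "exp (- y\<^sup>2) - exp (- x\<^sup>2) = (y - x) * - (2 * z * exp (- z\<^sup>2))"
   using MVT2[OF x(2), of "%z. exp (- z\<^sup>2)" "%z. - (2 * z * exp (- z\<^sup>2))"] D by blast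
  have "0 <= (z - 1)^2" by simp
  then have "z <= 1 + z^2 / 2" by (simp add: power2_diff)
  also have "... <= exp (z^2 / 2)" by (rule exp_ge_add_one_self)
  finally have "z * exp (- z\<^sup>2) <= exp (z^2 / 2) * exp (- z\<^sup>2)" by (intro mult_right_mono) auto
  also have "... = exp (- (z^2 / 2))" by (simp flip: exp_add)
  also have "... <= exp (- (x^2 / 2))" using z x by (simp add: power_mono)
  finally have z1: "z * exp (- z\<^sup>2) <= exp (- (x^2 / 2))" .
  have le: "exp (- y\<^sup>2) <= exp (- x\<^sup>2)" using x by (simp add: power_mono)
  have "exp (- x\<^sup>2) - exp (- y\<^sup>2) = 2 * (y - x) * (z * exp (- z\<^sup>2))" using z(3) by (simp add: algebra_simps)
  also have "... <= 2 * (y - x) * exp (- (x^2 / 2))" using z1 x by (intro mult_left_mono) auto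
  finally have 1: "exp (- x\<^sup>2) - exp (- y\<^sup>2) <= 2 * (y - x) * exp (- (x^2 / 2))" .
  have "exp (- x\<^sup>2) <= exp (- (x^2 / 2))" by simp
  then have 2: "exp (- x\<^sup>2) - exp (- y\<^sup>2) <= 2 * 1 * exp (- (x^2 / 2))" using exp_ge_zero[of "- y\<^sup>2"] exp_ge_zero[of "- (x^2 / 2)"] by linarith
  have "exp (- x\<^sup>2) - exp (- y\<^sup>2) <= 2 * min 1 (y - x) * exp (- (x^2 / 2))" using 1 2 by (simp add: min_def)
  also have "... <= 2 * (y - x) powr \<alpha> * (exp (- (x^2 / 2)) + exp (- (y^2 / 2)))" using min_1_le_powr[of "y - x" \<alpha>] x \<alpha> by (intro mult_mono) auto
  finally show ?thesis using le by simp
 qed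
 consider "A < B" | "B < A" | "A = B" by linarith
 then show ?thesis
 proof cases
  case 1 then show ?thesis using *[OF A 1] by simp
 next
  case 2 then show ?thesis using *[OF B 2] by (simp add: abs_minus_commute add.commute)
 next
  case 3 then show ?thesis by simp
 qed
qed

text \<open>The relation between \<open>l1\<close> and \<open>l2\<close> says that they belong to
  two times at distance \<open>h\<close>. If \<open>4 h l2 \<ge> 1\<close>, both \<open>h l1\<close>
  and \<open>h l2\<close> are bounded below and each term is estimated alone. Otherwise
  \<open>l2 \<le> 2 l1\<close>, the mean value theorem applies, and \<open>h l\<close> is replaced
  by its power with exponent \<open>\<beta>\<close>. Half of the Gaussian pays for the factor
  \<open>z \<rho>\<close>.\<close>

lemma time_kernel_diff:
 fixes l1 l2 h \<rho> m \<beta> :: real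
 assumes l: "0 < l1" "l1 <= l2" and h: "0 <= h" "l2 - l1 = 4 * h * l1 * l2" and \<rho>: "0 <= \<rho>" and m: "0 < m"
  and \<beta>: "0 < \<beta>" "\<beta> <= 1"
 shows "\<bar>l1 powr m * exp (- (l1 * \<rho>)) - l2 powr m * exp (- (l2 * \<rho>))\<bar> \<le>
  8 * (m + 2) * 2 powr m * h powr \<beta> * (l1 powr (m + \<beta>) * exp (- (l1 * \<rho> / 2)) + l2 powr (m + \<beta>) * exp (- (l2 * \<rho> / 2)))"
  (is "_ <= ?C * h powr \<beta> * (?P l1 + ?P l2)")
proof (cases "4 * h * l2 >= 1")
 case True
 have "1 * 1 <= (m + 2) * 2 powr m" using m by (intro mult_mono ge_one_powr_ge_zero) auto
 then have C: "8 <= ?C" unfolding mult.assoc by linarith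
 have *: "l powr m * exp (- (l * \<rho>)) <= 8 * h powr \<beta> * ?P l" if l0: "0 < l" "1 <= 8 * h * l" for l
 proof -
  have "1 <= (8 * h * l) powr \<beta>" using l0 \<beta> by (intro ge_one_powr_ge_zero) auto
  also have "... = 8 powr \<beta> * h powr \<beta> * l powr \<beta>" using l0 h by (simp add: powr_mult)
  also have "... <= 8 * h powr \<beta> * l powr \<beta>" using powr_mono[of \<beta> 1 "8::real"] \<beta> by (intro mult_right_mono) auto
  finally have 1: "1 <= 8 * h powr \<beta> * l powr \<beta>" .
  have "l powr m * exp (- (l * \<rho>)) <= l powr m * exp (- (l * \<rho> / 2))" using l0 \<rho> by (intro mult_left_mono) auto
  also have "... <= (8 * h powr \<beta> * l powr \<beta>) * (l powr m * exp (- (l * \<rho> / 2)))"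
   using mult_right_mono[OF 1, of "l powr m * exp (- (l * \<rho> / 2))"] by simp
  finally show ?thesis using l0 by (simp add: powr_add mult_ac)
 qed
 \<comment> \<open>The bracket is at most \<open>8 h l2\<close> in this case; cancelling
   \<open>l2\<close> gives \<open>1 \<le> 8 h l1\<close>.\<close>
 have "l2 = l1 * (1 + 4 * h * l2)" using h(2) by (simp add: algebra_simps)
 also have "... <= l1 * (2 * (4 * h * l2))" using True l by (intro mult_left_mono) auto
 finally have "l2 * 1 <= l2 * (8 * h * l1)" by (simp add: mult_ac)
 then have 1: "1 <= 8 * h * l1" using l by (simp only: mult_le_cancel_left_pos)
 also have "... <= 8 * h * l2" using l h by (intro mult_left_mono) auto
 finally have 2: "1 <= 8 * h * l2" .
 have "\<bar>l1 powr m * exp (- (l1 * \<rho>)) - l2 powr m * exp (- (l2 * \<rho>))\<bar> <= l1 powr m * exp (- (l1 * \<rho>)) + l2 powr m * exp (- (l2 * \<rho>))"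
  by (rule order_trans[OF abs_triangle_ineq4]) (simp add: abs_mult)
 also have "... <= 8 * h powr \<beta> * ?P l1 + 8 * h powr \<beta> * ?P l2" using *[OF l(1) 1] *[OF _ 2] l by (intro add_mono) auto
 also have "... = 8 * (h powr \<beta> * (?P l1 + ?P l2))" by (simp add: algebra_simps)
 also have "... <= ?C * (h powr \<beta> * (?P l1 + ?P l2))" using C by (intro mult_right_mono) auto
 finally show ?thesis by (simp add: mult_ac)
next
 case False
 show ?thesis
 proof (cases "l1 = l2")
  case True
  then show ?thesis using m by simp
 next
  case l12: False
  define g where "g l = l powr m * exp (- (l * \<rho>))" for l
  have D: "(g has_real_derivative (m * z powr (m - 1) - \<rho> * z powr m) * exp (- (z * \<rho>))) (at z)" if "z > 0" for z
   unfolding g_def using that by (auto intro!: derivative_eq_intros has_real_derivative_powr simp: algebra_simps)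
  obtain z where z: "l1 < z" "z < l2" "g l2 - g l1 = (l2 - l1) * ((m * z powr (m - 1) - \<rho> * z powr m) * exp (- (z * \<rho>)))"
   using MVT2[of l1 l2 g "%z. (m * z powr (m - 1) - \<rho> * z powr m) * exp (- (z * \<rho>))"] D l l12 by fastforce
  have z0: "z > 0" using z l by simp
  have "z powr m = z powr (m - 1) * z" using z0 by (simp add: powr_diff)
  then have "(m * z powr (m - 1) - \<rho> * z powr m) * exp (- (z * \<rho>)) = z powr (m - 1) * ((m - z * \<rho>) * exp (- (z * \<rho>)))" by (simp add: algebra_simps)
  moreover have "\<bar>(m - z * \<rho>) * exp (- (z * \<rho>))\<bar> <= (m + 2) * exp (- (z * \<rho> / 2))"
  proof -
   have "z * \<rho> / 2 <= exp (z * \<rho> / 2)" using exp_ge_add_one_self[of "z * \<rho> / 2"] by linarith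
   then have "z * \<rho> * exp (- (z * \<rho>)) <= (2 * exp (z * \<rho> / 2)) * exp (- (z * \<rho>))" by (intro mult_right_mono) auto
   also have "... = 2 * exp (- (z * \<rho> / 2))" by (simp add: mult.assoc flip: exp_add)
   finally have 1: "z * \<rho> * exp (- (z * \<rho>)) <= 2 * exp (- (z * \<rho> / 2))" .
   have 2: "m * exp (- (z * \<rho>)) <= m * exp (- (z * \<rho> / 2))" using m z0 \<rho> by (intro mult_left_mono) auto
   have "\<bar>(m - z * \<rho>) * exp (- (z * \<rho>))\<bar> <= m * exp (- (z * \<rho>)) + z * \<rho> * exp (- (z * \<rho>))"
    unfolding left_diff_distrib using m z0 \<rho> by (intro order_trans[OF abs_triangle_ineq4]) (simp add: abs_mult)
   then show ?thesis using 1 2 unfolding distrib_right by linarith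
  qed
  ultimately have d: "\<bar>(m * z powr (m - 1) - \<rho> * z powr m) * exp (- (z * \<rho>))\<bar> <= z powr (m - 1) * ((m + 2) * exp (- (z * \<rho> / 2)))"
   by (simp only: abs_mult[of "z powr (m - 1)"] abs_of_nonneg[OF powr_ge_zero] mult_left_mono powr_ge_zero)
  have "4 * h * l1 * l2 = (4 * h * l2) * l1" by simp
  also have "... <= 1 * l1" using False l by (intro mult_right_mono) auto
  finally have l2: "l2 <= 2 * l1" using h(2) by simp
  have "z powr (m - 1) = z powr m / z" using z0 by (simp add: powr_diff)
  also have "... <= (2 * l1) powr m / l1" using z l l2 m by (intro frac_le powr_mono2) auto
  also have "... = 2 powr m * l1 powr m / l1" using l by (simp add: powr_mult)
  finally have "z powr (m - 1) * ((m + 2) * exp (- (z * \<rho> / 2))) <= (2 powr m * l1 powr m / l1) * ((m + 2) * exp (- (l1 * \<rho> / 2)))"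
   using z l \<rho> m by (intro mult_mono) (auto intro: mult_right_mono)
  then have "\<bar>g l2 - g l1\<bar> <= (l2 - l1) * ((2 powr m * l1 powr m / l1) * ((m + 2) * exp (- (l1 * \<rho> / 2))))"
   unfolding z(3) abs_mult[of "l2 - l1"] using d l by (intro mult_mono) auto
  also have "... = (4 * h * l2) * (2 powr m * l1 powr m * ((m + 2) * exp (- (l1 * \<rho> / 2))))" unfolding h(2) using l by simp
  also have "... <= (8 * h powr \<beta> * l1 powr \<beta>) * (2 powr m * l1 powr m * ((m + 2) * exp (- (l1 * \<rho> / 2))))"
  proof (rule mult_right_mono)
   have "4 * h * l2 = min 1 (4 * h * l2)" using False by simp
   also have "... <= (4 * h * l2) powr \<beta>" using h l \<beta> by (intro min_1_le_powr) auto
   also have "... <= (8 * h * l1) powr \<beta>" using h l l2 \<beta> mult_left_mono[OF l2 h(1)] by (intro powr_mono2) auto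
   also have "... = 8 powr \<beta> * h powr \<beta> * l1 powr \<beta>" using l h by (simp add: powr_mult)
   also have "... <= 8 * h powr \<beta> * l1 powr \<beta>" using powr_mono[of \<beta> 1 "8::real"] \<beta> by (intro mult_right_mono) auto
   finally show "4 * h * l2 <= 8 * h powr \<beta> * l1 powr \<beta>" .
  qed (use m in auto)
  also have "... = ?C * h powr \<beta> * ?P l1" by (simp add: powr_add mult_ac)
  also have "... <= ?C * h powr \<beta> * (?P l1 + ?P l2)" using m by (intro mult_left_mono) auto
  finally show ?thesis by (simp add: g_def abs_minus_commute)
 qed
qed

text \<open>A majorant in the differences of \<open>x\<close> and \<open>t\<close> alone: the height
  is dropped and half of the Gaussian is kept. Its integral in space is a multiple of
  \<open>\<sigma> powr (- \<beta>)\<close>, so it is integrable for \<open>\<beta> < 1\<close>. Here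
  \<open>\<beta> = c\<close> bounds the kernel, and \<open>\<beta> = c + \<alpha> / 2\<close> its
  Hoelder quotients.\<close>

definition gmaj :: "real => real => 'n::finite space => real" where
 "gmaj \<beta> T q = (if 0 < snd q \<and> snd q < T then
  pole_l (snd q) 0 powr (real CARD('n) / 2 + \<beta>) * exp (- (pole_l (snd q) 0 * (norm (fst q))^2 / 2)) else 0)"

lemma gmaj_nonneg: "gmaj \<beta> T q >= 0" by (simp add: gmaj_def)

lemma measurable_gmaj: "gmaj \<beta> T \<in> borel_measurable (borel :: ('n::finite space) measure)"
proof -
 let ?S = "UNIV \<times> {0<..<T} :: ('n space) set"
 have "?S \<in> sets borel" by (intro borel_open open_Times) auto
 moreover have "continuous_on ?S (%q. pole_l (snd q) 0 powr (real CARD('n) / 2 + \<beta>) * exp (- (pole_l (snd q) 0 * (norm (fst q))^2 / 2)))"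
  unfolding pole_l_def by (intro continuous_intros) auto
 ultimately have "(%q. indicator ?S q *\<^sub>R (pole_l (snd q) 0 powr (real CARD('n) / 2 + \<beta>) * exp (- (pole_l (snd q) 0 * (norm (fst q))^2 / 2)))) \<in> borel_measurable borel"
  by (rule borel_measurable_continuous_on_indicator)
 moreover have "(%q. indicator ?S q *\<^sub>R (pole_l (snd q) 0 powr (real CARD('n) / 2 + \<beta>) * exp (- (pole_l (snd q) 0 * (norm (fst q))^2 / 2)))) = gmaj \<beta> T"
  by (auto simp: gmaj_def indicator_def)
 ultimately show ?thesis by simp
qed

lemma gmaj_slice:
 assumes \<sigma>: "0 < \<sigma>" "\<sigma> < T"
 shows "integrable lborel (%\<zeta> :: real ^ 'n. gmaj \<beta> T (\<zeta>, \<sigma>))"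
  "(LINT \<zeta>|lborel. gmaj \<beta> T (\<zeta> :: real ^ 'n, \<sigma>)) = 2 powr (real CARD('n) / 2) * gauss_mass TYPE('n) * 4 powr (- \<beta>) * \<sigma> powr (- \<beta>)"
proof -
 let ?l = "pole_l \<sigma> 0" and ?k = "2 powr (real CARD('n) / 2) * pole_l \<sigma> 0 powr \<beta>"
 have l: "?l > 0" using \<sigma> by (simp add: pole_l_def)
 have p: "2 powr (real CARD('n) / 2) * (?l / 2) powr (real CARD('n) / 2) = ?l powr (real CARD('n) / 2)" using l by (simp flip: powr_mult)
 have eq: "gmaj \<beta> T (\<zeta>, \<sigma>) = ?k * ((?l / 2) powr (real CARD('n) / 2) * exp (- (?l / 2 * (norm (\<zeta> - 0))^2)))" for \<zeta> :: "real ^ 'n"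
  using \<sigma> by (simp add: gmaj_def powr_add p[symmetric])
 have g: "integrable lborel (%\<zeta> :: real ^ 'n. (?l / 2) powr (real CARD('n) / 2) * exp (- (?l / 2 * (norm (\<zeta> - 0))^2)))"
  "(LINT \<zeta>|lborel. (?l / 2) powr (real CARD('n) / 2) * exp (- (?l / 2 * (norm ((\<zeta> :: real ^ 'n) - 0))^2))) = gauss_mass TYPE('n)"
  by (rule gauss_scaled; use l in simp)+
 show "integrable lborel (%\<zeta> :: real ^ 'n. gmaj \<beta> T (\<zeta>, \<sigma>))" unfolding eq by (rule integrable_mult_right[OF g(1)])
 have lb: "?l powr \<beta> = 4 powr (- \<beta>) * \<sigma> powr (- \<beta>)" using \<sigma> by (simp add: pole_l_def powr_divide powr_mult powr_minus field_simps)
 show "(LINT \<zeta>|lborel. gmaj \<beta> T (\<zeta> :: real ^ 'n, \<sigma>)) = 2 powr (real CARD('n) / 2) * gauss_mass TYPE('n) * 4 powr (- \<beta>) * \<sigma> powr (- \<beta>)"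
  unfolding eq by (rule trans[OF integral_mult_right_zero]) (simp only: g(2) lb mult_ac)
qed

lemma integrable_lborel_snd_fst:
 fixes f :: "'a::euclidean_space \<times> 'b::euclidean_space => real"
 assumes f: "f \<in> borel_measurable borel" and 1: "!!y. integrable lborel (%x. f (x, y))"
  and 2: "integrable lborel (%y. LINT x|lborel. \<bar>f (x, y)\<bar>)"
 shows "integrable lborel f"
proof -
 have m: "f \<in> borel_measurable (lborel \<Otimes>\<^sub>M lborel)" using f by (simp add: lborel_prod)
 have "integrable (lborel \<Otimes>\<^sub>M lborel) (%(y, x). f (x, y))"
 proof (rule lborel_pair.Fubini_integrable)
  show "(%(y, x). f (x, y)) \<in> borel_measurable (lborel \<Otimes>\<^sub>M lborel)" using m by measurable
 qed (use 1 2 in auto)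
 then have "integrable (lborel \<Otimes>\<^sub>M lborel) f" by (subst (asm) lborel_pair.integrable_product_swap_iff)
 then show ?thesis by (simp add: lborel_prod)
qed

lemma gmaj_integrable:
 assumes \<beta>: "\<beta> < 1" and T: "T >= 0"
 shows "integrable lborel (gmaj \<beta> T :: 'n::finite space => real)"
proof (rule integrable_lborel_snd_fst[OF measurable_gmaj])
 fix \<sigma> show "integrable lborel (%\<zeta> :: real ^ 'n. gmaj \<beta> T (\<zeta>, \<sigma>))"
 proof (cases "0 < \<sigma> \<and> \<sigma> < T")
  case True then show ?thesis using gmaj_slice(1) by blast
 next
  case False
  then have "(%\<zeta> :: real ^ 'n. gmaj \<beta> T (\<zeta>, \<sigma>)) = (%\<zeta>. 0)" by (auto simp: gmaj_def)
  then show ?thesis by simp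
 qed
next
 let ?k = "2 powr (real CARD('n) / 2) * gauss_mass TYPE('n) * 4 powr (- \<beta>)"
 have "(%\<sigma>. LINT \<zeta>|lborel. \<bar>gmaj \<beta> T (\<zeta> :: real ^ 'n, \<sigma>)\<bar>) = (%\<sigma>. ?k * (indicator {0<..<T} \<sigma> * \<sigma> powr (- \<beta>)))"
 proof
  fix \<sigma> show "(LINT \<zeta>|lborel. \<bar>gmaj \<beta> T (\<zeta> :: real ^ 'n, \<sigma>)\<bar>) = ?k * (indicator {0<..<T} \<sigma> * \<sigma> powr (- \<beta>))"
  proof (cases "0 < \<sigma> \<and> \<sigma> < T")
   case True then show ?thesis by (simp add: gmaj_slice gmaj_nonneg)
  next
   case False
   then have "gmaj \<beta> T (\<zeta> :: real ^ 'n, \<sigma>) = 0" for \<zeta> by (auto simp: gmaj_def)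
   moreover have "indicator {0<..<T} \<sigma> = (0 :: real)" using False by (auto simp: indicator_def)
   ultimately show ?thesis by simp
  qed
 qed
 then show "integrable lborel (%\<sigma>. LINT \<zeta>|lborel. \<bar>gmaj \<beta> T (\<zeta> :: real ^ 'n, \<sigma>)\<bar>)"
  using integrable_powr_Ioo[of "- \<beta>" T] \<beta> T by simp
qed

lemma pole_l_shift: "pole_l (t - \<tau>) 0 = pole_l t \<tau>" by (simp add: pole_l_def)

lemma bker_le_gmaj:
 fixes p :: "'n::finite event"
 assumes c: "c > 0" and T: "snd p - snd q < T"
 shows "bker c p q <= gmaj c T (fst (fst p) - fst q, snd p - snd q)"
proof (cases "snd q < snd p")
 case True
 let ?l = "pole_l (snd p) (snd q)"
 have l: "?l >= 0" using True by (simp add: pole_l_def)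
 have "(norm (fst (fst p) - fst q))^2 / 2 <= (norm (fst (fst p) - fst q))^2 + (snd (fst p))^2"
  using zero_le_power2[of "norm (fst (fst p) - fst q)"] zero_le_power2[of "snd (fst p)"] by linarith
 then have "?l * (norm (fst (fst p) - fst q))^2 / 2 <= ?l * ((norm (fst (fst p) - fst q))^2 + (snd (fst p))^2)" using mult_left_mono[OF _ l] by (metis times_divide_eq_right)
 then show ?thesis unfolding bker_eq[OF True] gmaj_def using True T by (simp add: pole_l_shift mult_left_mono)
qed (simp add: bker_0 gmaj_nonneg)

text \<open>The kernel varies on the length scale \<open>l powr (- 1 / 2)\<close>, so a Hoelder
  quotient with exponent \<open>\<alpha>\<close> costs the factor
  \<open>l powr (\<alpha> / 2)\<close>. Here the height is part of the distance, so the estimate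
  holds uniformly down to \<open>y = 0\<close>.\<close>

lemma bker_diff_space:
 fixes X X' :: "'n::finite space"
 assumes c: "c > 0" and T: "t - snd q < T" and \<alpha>: "0 < \<alpha>" "\<alpha> <= 1"
 shows "\<bar>bker c (X, t) q - bker c (X', t) q\<bar> <= 2 * norm (X - X') powr \<alpha> *
  (gmaj (c + \<alpha> / 2) T (fst X - fst q, t - snd q) + gmaj (c + \<alpha> / 2) T (fst X' - fst q, t - snd q))"
proof (cases "snd q < t")
 case True
 let ?m = "real CARD('n) / 2 + c"
 define l where "l = pole_l t (snd q)"
 have l: "l > 0" using True by (simp add: pole_l_def l_def)
 define N where "N Z = norm (Z - (fst q, 0))" for Z :: "'n space"
 have N2: "(N Z)^2 = (norm (fst Z - fst q))^2 + (snd Z)^2" for Z by (cases Z) (simp add: N_def norm_Pair)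
 have k: "bker c (Z, t) q = l powr ?m * exp (- (sqrt l * N Z)\<^sup>2)" for Z using bker_eq[of q "(Z, t)" c] True l by (simp add: l_def[symmetric] power_mult_distrib N2)
 have g: "l powr (?m + \<alpha> / 2) * exp (- ((sqrt l * N Z)^2 / 2)) <= gmaj (c + \<alpha> / 2) T (fst Z - fst q, t - snd q)" for Z
 proof -
  have "exp (- ((sqrt l * N Z)^2 / 2)) <= exp (- (l * (norm (fst Z - fst q))^2 / 2))" using l by (simp add: power_mult_distrib N2)
  then show ?thesis using True T by (simp add: gmaj_def pole_l_shift l_def[symmetric] add.assoc mult_left_mono)
 qed
 have d: "\<bar>N X - N X'\<bar> <= norm (X - X')" unfolding N_def using norm_triangle_ineq3[of "X - (fst q, 0)" "X' - (fst q, 0)"] by simp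
 have "\<bar>bker c (X, t) q - bker c (X', t) q\<bar> = l powr ?m * \<bar>exp (- (sqrt l * N X)\<^sup>2) - exp (- (sqrt l * N X')\<^sup>2)\<bar>"
  unfolding k by (simp add: abs_mult flip: right_diff_distrib)
 also have "... <= l powr ?m * (2 * \<bar>sqrt l * N X - sqrt l * N X'\<bar> powr \<alpha> * (exp (- ((sqrt l * N X)^2 / 2)) + exp (- ((sqrt l * N X')^2 / 2))))"
  using l \<alpha> by (intro mult_left_mono gauss_diff) (auto simp: N_def)
 also have "\<bar>sqrt l * N X - sqrt l * N X'\<bar> powr \<alpha> = l powr (\<alpha> / 2) * \<bar>N X - N X'\<bar> powr \<alpha>"
  using l by (simp add: abs_mult powr_mult powr_powr powr_half_sqrt[symmetric] flip: right_diff_distrib)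
 also have "l powr ?m * (2 * (l powr (\<alpha> / 2) * \<bar>N X - N X'\<bar> powr \<alpha>) * (exp (- ((sqrt l * N X)^2 / 2)) + exp (- ((sqrt l * N X')^2 / 2))))
  = 2 * \<bar>N X - N X'\<bar> powr \<alpha> * (l powr (?m + \<alpha> / 2) * exp (- ((sqrt l * N X)^2 / 2)) + l powr (?m + \<alpha> / 2) * exp (- ((sqrt l * N X')^2 / 2)))"
  by (simp add: powr_add algebra_simps)
 also have "... <= 2 * norm (X - X') powr \<alpha> *
  (gmaj (c + \<alpha> / 2) T (fst X - fst q, t - snd q) + gmaj (c + \<alpha> / 2) T (fst X' - fst q, t - snd q))"
  using d \<alpha> by (intro mult_mono add_mono g powr_mono2) auto
 finally show ?thesis .
qed (simp add: bker_0 gmaj_nonneg)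

text \<open>The kernel varies on the time scale \<open>1 / l\<close>, so the exponent
  \<open>\<alpha> / 2\<close> in time costs \<open>l powr (\<alpha> / 2)\<close>. When the source
  lies between the two times, the earlier kernel is 0 and \<open>4 (t - t') l \<ge> 1\<close>, so
  the later one may be multiplied by a power of that number.\<close>

lemma bker_diff_time:
 fixes X :: "'n::finite space"
 assumes c: "c > 0" and T: "t - snd q < T" and t: "t' <= t" and \<alpha>: "0 < \<alpha>" "\<alpha> <= 1"
 shows "\<bar>bker c (X, t) q - bker c (X, t') q\<bar> <= 8 * (real CARD('n) / 2 + c + 2) * 2 powr (real CARD('n) / 2 + c) * (t - t') powr (\<alpha> / 2) *
  (gmaj (c + \<alpha> / 2) T (fst X - fst q, t - snd q) + gmaj (c + \<alpha> / 2) T (fst X - fst q, t' - snd q))"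
  (is "_ <= ?C * _ * (?G t + ?G t')")
proof -
 let ?m = "real CARD('n) / 2 + c"
 define \<rho> where "\<rho> = (norm (fst X - fst q))^2 + (snd X)^2"
 have \<rho>: "\<rho> >= 0" "(norm (fst X - fst q))^2 <= \<rho>" by (simp_all add: \<rho>_def)
 have G: "pole_l u (snd q) powr (?m + \<alpha> / 2) * exp (- (pole_l u (snd q) * \<rho> / 2)) <= ?G u" if "snd q < u" "u <= t" for u
 proof -
  have "pole_l u (snd q) * (norm (fst X - fst q))^2 <= pole_l u (snd q) * \<rho>" using that \<rho> by (intro mult_left_mono) (auto simp: pole_l_def)
  then show ?thesis using that T by (simp add: gmaj_def pole_l_shift add.assoc mult_left_mono)
 qed
 have m: "?m > 0" using c by simp
 have "1 * 1 <= (?m + 2) * 2 powr ?m" using m by (intro mult_mono ge_one_powr_ge_zero) auto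
 then have C: "8 <= ?C" unfolding mult.assoc by linarith
 consider "t <= snd q" | "t' <= snd q" "snd q < t" | "snd q < t'" by linarith
 then show ?thesis
 proof cases
  case 1 then show ?thesis using t C by (simp add: bker_0 gmaj_nonneg)
 next
  case 2
  let ?l = "pole_l t (snd q)"
  have l: "?l > 0" using 2 by (simp add: pole_l_def)
  have "1 <= 4 * (t - t') * ?l" using 2 by (simp add: pole_l_def field_simps)
  then have "1 <= (4 * (t - t') * ?l) powr (\<alpha> / 2)" using \<alpha> by (intro ge_one_powr_ge_zero) auto
  also have "... = 4 powr (\<alpha> / 2) * (t - t') powr (\<alpha> / 2) * ?l powr (\<alpha> / 2)" using l t by (simp add: powr_mult del: right_diff_distrib_numeral)
  also have "... <= ?C * (t - t') powr (\<alpha> / 2) * ?l powr (\<alpha> / 2)" using powr_mono[of "\<alpha> / 2" 1 "4::real"] \<alpha> C by (intro mult_right_mono) auto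
  finally have 1: "1 <= ?C * (t - t') powr (\<alpha> / 2) * ?l powr (\<alpha> / 2)" .
  have "bker c (X, t) q = ?l powr ?m * exp (- (?l * \<rho>))" using bker_eq[of q "(X, t)" c] 2 by (simp add: \<rho>_def)
  also have "... <= ?l powr ?m * exp (- (?l * \<rho> / 2))" using l \<rho> by (intro mult_left_mono) auto
  also have "... <= (?C * (t - t') powr (\<alpha> / 2) * ?l powr (\<alpha> / 2)) * (?l powr ?m * exp (- (?l * \<rho> / 2)))"
   using mult_right_mono[OF 1, of "?l powr ?m * exp (- (?l * \<rho> / 2))"] by simp
  also have "... = ?C * (t - t') powr (\<alpha> / 2) * (?l powr (?m + \<alpha> / 2) * exp (- (?l * \<rho> / 2)))" by (simp add: powr_add mult_ac)
  also have "... <= ?C * (t - t') powr (\<alpha> / 2) * (?G t + ?G t')"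
   using G[of t] 2 C gmaj_nonneg[of "c + \<alpha> / 2" T "(fst X - fst q, t' - snd q)"] by (intro mult_left_mono) auto
  finally show ?thesis using 2 bker_nonneg[OF c, of "(X, t)" q] by (simp add: bker_0)
 next
  case 3
  let ?l = "pole_l t (snd q)" and ?l' = "pole_l t' (snd q)"
  have "\<bar>?l powr ?m * exp (- (?l * \<rho>)) - ?l' powr ?m * exp (- (?l' * \<rho>))\<bar> \<le>
   ?C * (t - t') powr (\<alpha> / 2) * (?l powr (?m + \<alpha> / 2) * exp (- (?l * \<rho> / 2)) + ?l' powr (?m + \<alpha> / 2) * exp (- (?l' * \<rho> / 2)))"
  proof (rule time_kernel_diff)
   show "0 < ?l" "?l <= ?l'" using 3 t by (auto simp: pole_l_def frac_le)
   show "?l' - ?l = 4 * (t - t') * ?l * ?l'" using 3 t by (simp add: pole_l_def field_simps)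
  qed (use t m \<rho> \<alpha> in auto)
  also have "... <= ?C * (t - t') powr (\<alpha> / 2) * (?G t + ?G t')" using G[of t] G[of t'] 3 t C by (intro mult_left_mono add_mono) auto
  finally show ?thesis using 3 t bker_eq[of q "(X, t)" c] bker_eq[of q "(X, t')" c] by (simp add: \<rho>_def)
 qed
qed

section \<open>Hoelder continuity of potentials of bounded densities\<close>

context
 fixes f :: "'n::finite space => real" and r c K :: real
 assumes r: "r > 0" and c: "0 < c" and f_meas: "f \<in> borel_measurable borel"
  and f_bound: "\<forall>q. \<bar>f q\<bar> <= K * indicator (bcyl r) q"
begin

lemma f_0: "q \<notin> bcyl r ==> f q = 0" using f_bound[rule_format, of q] by simp

lemma f_K: "\<bar>f q\<bar> <= K" "0 <= K"
proof -
 have "0 <= K * indicator (bcyl r) (0 :: 'n space)" using f_bound[rule_format, of 0] by (rule order_trans[OF abs_ge_zero])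
 then show K: "0 <= K" using r by (simp add: bcyl_def zero_prod_def indicator_def)
 show "\<bar>f q\<bar> <= K" using f_bound[rule_format, of q] K by (cases "q \<in> bcyl r") auto
qed

text \<open>Lebesgue measure is invariant under translation and reflection, so the bound does not
  depend on \<open>(x, t)\<close>.\<close>

lemma gmaj_translated:
 assumes \<beta>: "\<beta> < 1"
 shows "integrable lborel (%q. \<bar>f q\<bar> * gmaj \<beta> (4 * r^2) (x - fst q, t - snd q))"
  "(LINT q|lborel. \<bar>f q\<bar> * gmaj \<beta> (4 * r^2) (x - fst q, t - snd q)) <= K * (LINT q|lborel. gmaj \<beta> (4 * r^2) (q :: 'n::finite space))"
proof -
 let ?g = "gmaj \<beta> (4 * r^2) :: 'n space => real"
 have g: "integrable lborel ?g" by (rule gmaj_integrable[OF \<beta>]) simp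
 have e: "(x - fst q, t - snd q) = (x, t) + (- 1) *\<^sub>R q" for q :: "'n space" by (cases q) simp
 have i: "integrable lborel (%q. ?g (x - fst q, t - snd q))" unfolding e by (rule lborel_integrable_affine[OF g]) simp
 have v: "(LINT q|lborel. ?g (x - fst q, t - snd q)) = (LINT q|lborel. ?g q)"
  using lborel_integral_reflect[OF measurable_gmaj, of \<beta> "4 * r^2" "(x, t)"] unfolding e by simp
 have iK: "integrable lborel (%q. K * ?g (x - fst q, t - snd q))" using i by simp
 have b: "\<bar>f q\<bar> * ?g (x - fst q, t - snd q) <= K * ?g (x - fst q, t - snd q)" for q using f_K(1)[of q] by (intro mult_right_mono gmaj_nonneg)
 show *: "integrable lborel (%q. \<bar>f q\<bar> * ?g (x - fst q, t - snd q))"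
 proof (rule integrable_bound[OF iK])
  show "(%q. \<bar>f q\<bar> * ?g (x - fst q, t - snd q)) \<in> borel_measurable lborel" using f_meas borel_measurable_integrable[OF i] by simp
  show "AE q in lborel. norm (\<bar>f q\<bar> * ?g (x - fst q, t - snd q)) <= norm (K * ?g (x - fst q, t - snd q))"
   using b f_K(2) by (intro AE_I2) (simp add: abs_mult gmaj_nonneg)
 qed
 have "(LINT q|lborel. \<bar>f q\<bar> * ?g (x - fst q, t - snd q)) <= (LINT q|lborel. K * ?g (x - fst q, t - snd q))" by (rule integral_mono[OF * iK b])
 then show "(LINT q|lborel. \<bar>f q\<bar> * ?g (x - fst q, t - snd q)) <= K * (LINT q|lborel. ?g q)" by (simp add: v)
qed

text \<open>This is the origin of the cutoff \<open>4 * r^2\<close> in \<open>gmaj\<close>: sources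
  outside \<open>bcyl\<close> carry no density.\<close>

lemma f_time:
 assumes "t <= 0" "f q ~= 0"
 shows "t - snd q < 4 * r^2"
proof -
 have "q \<in> bcyl r" using f_0 assms(2) by blast
 then show ?thesis using assms(1) by (auto simp: bcyl_def mem_Times_iff)
qed

lemma bpot_integrable:
 fixes p :: "'n::finite event"
 assumes c1: "c < 1" and t: "snd p <= 0"
 shows "integrable lborel (%q. f q * bker c p q)" "\<bar>bpot c f p\<bar> <= K * (LINT q|lborel. gmaj c (4 * r^2) (q :: 'n space))"
proof -
 let ?G = "%q. \<bar>f q\<bar> * gmaj c (4 * r^2) (fst (fst p) - fst q, snd p - snd q)"
 have m: "(%q. f q * bker c p q) \<in> borel_measurable lborel" using f_meas measurable_bker[OF c, of p] by simp
 have b: "\<bar>f q * bker c p q\<bar> <= ?G q" for q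
 proof (cases "f q = 0")
  case False
  show ?thesis unfolding abs_mult using bker_le_gmaj[OF c f_time[OF t False]] bker_nonneg[OF c, of p q] by (intro mult_left_mono) auto
 qed simp
 note G = gmaj_translated[OF c1, of "fst (fst p)" "snd p"]
 show *: "integrable lborel (%q. f q * bker c p q)" by (rule integrable_bound[OF G(1) m], rule AE_I2) (use b in \<open>simp add: gmaj_nonneg abs_mult\<close>)
 have "\<bar>bpot c f p\<bar> <= (LINT q|lborel. ?G q)" unfolding bpot_def using integral_norm_bound_integral[OF * G(1)] b by simp
 also note G(2)
 finally show "\<bar>bpot c f p\<bar> <= K * (LINT q|lborel. gmaj c (4 * r^2) (q :: 'n space))" .
qed

lemma bpot_diff:
 fixes p p' :: "'n::finite event"
 assumes \<beta>: "\<beta> < 1" and c1: "c < 1" and t: "snd p <= 0" "snd p' <= 0" and D: "0 <= D"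
  and b: "!!q. f q ~= 0 ==> \<bar>bker c p q - bker c p' q\<bar> <= D * (gmaj \<beta> (4 * r^2) (fst (fst p) - fst q, snd p - snd q)
   + gmaj \<beta> (4 * r^2) (fst (fst p') - fst q, snd p' - snd q))"
 shows "\<bar>bpot c f p - bpot c f p'\<bar> <= D * (2 * K * (LINT q|lborel. gmaj \<beta> (4 * r^2) (q :: 'n space)))"
proof -
 let ?G = "%p q. \<bar>f q\<bar> * gmaj \<beta> (4 * r^2) (fst (fst p) - fst q, snd p - snd q)"
 note G = gmaj_translated[OF \<beta>]
 have eq: "bpot c f p - bpot c f p' = (LINT q|lborel. f q * bker c p q - f q * bker c p' q)"
  unfolding bpot_def by (rule integral_diff[symmetric]) (rule bpot_integrable(1)[OF c1 t(1)], rule bpot_integrable(1)[OF c1 t(2)])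
 have "\<bar>bpot c f p - bpot c f p'\<bar> <= (LINT q|lborel. D * (?G p q + ?G p' q))"
 proof -
  have nb: "norm (f q * bker c p q - f q * bker c p' q) <= D * (?G p q + ?G p' q)" for q
  proof (cases "f q = 0")
   case False
   have "norm (f q * bker c p q - f q * bker c p' q) = \<bar>f q\<bar> * \<bar>bker c p q - bker c p' q\<bar>" unfolding right_diff_distrib[symmetric] by (simp add: abs_mult)
   also have "... <= \<bar>f q\<bar> * (D * (gmaj \<beta> (4 * r^2) (fst (fst p) - fst q, snd p - snd q)
    + gmaj \<beta> (4 * r^2) (fst (fst p') - fst q, snd p' - snd q)))" by (rule mult_left_mono[OF b[OF False] abs_ge_zero])
   also have "... = D * (?G p q + ?G p' q)" by (simp add: algebra_simps)
   finally show ?thesis .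
  next
   case True
   then show ?thesis by (simp only: mult_zero_left diff_self norm_zero abs_zero add_0 mult_zero_right order_refl)
  qed
  have dI: "integrable lborel (%q. f q * bker c p q - f q * bker c p' q)" by (rule integrable_diff) (rule bpot_integrable(1)[OF c1 t(1)], rule bpot_integrable(1)[OF c1 t(2)])
  have GI: "integrable lborel (%q. D * (?G p q + ?G p' q))" by (rule integrable_mult_right[OF integrable_add[OF G(1) G(1)]])
  show ?thesis unfolding eq using integral_norm_bound_integral[OF dI GI nb] by (simp only: real_norm_def)
 qed
 also have "... = D * ((LINT q|lborel. ?G p q) + (LINT q|lborel. ?G p' q))" by (subst integral_mult_right_zero, subst integral_add[OF G(1) G(1)]) (rule refl)
 also have "... <= D * (2 * K * (LINT q|lborel. gmaj \<beta> (4 * r^2) (q :: 'n space)))"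
  using G(2)[of "fst (fst p)" "snd p"] G(2)[of "fst (fst p')" "snd p'"] by (intro mult_left_mono D) linarith
 finally show ?thesis .
qed

lemma bpot_holder:
 assumes \<alpha>: "0 < \<alpha>" "\<alpha> <= 1" "c + \<alpha> / 2 < 1"
 shows "parabolic_holder \<alpha> (cyl r) (bpot c f)"
proof -
 have c1: "c < 1" using \<alpha> by simp
 define M where "M = 2 * K * (LINT q|lborel. gmaj (c + \<alpha> / 2) (4 * r^2) (q :: 'n space))"
 define C where "C = 8 * (real CARD('n) / 2 + c + 2) * 2 powr (real CARD('n) / 2 + c)"
 have C: "C >= 0" using c by (simp add: C_def)
 have M: "M >= 0" unfolding M_def using f_K(2) by (simp add: gmaj_nonneg)
 have time: "\<bar>bpot c f (X, t) - bpot c f (X, t')\<bar> <= C * \<bar>t - t'\<bar> powr (\<alpha> / 2) * M" if "t <= 0" "t' <= 0" for X t t'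
 proof -
  have *: "\<bar>bpot c f (X, t) - bpot c f (X, t')\<bar> <= C * (t - t') powr (\<alpha> / 2) * M" if t: "t <= 0" "t' <= t" for t t' unfolding M_def
  proof (rule bpot_diff[OF \<alpha>(3) c1])
   fix q assume q: "f q ~= 0"
   show "\<bar>bker c (X, t) q - bker c (X, t') q\<bar> <= C * (t - t') powr (\<alpha> / 2) *
    (gmaj (c + \<alpha> / 2) (4 * r^2) (fst (fst (X, t)) - fst q, snd (X, t) - snd q)
     + gmaj (c + \<alpha> / 2) (4 * r^2) (fst (fst (X, t')) - fst q, snd (X, t') - snd q))"
    using bker_diff_time[OF c f_time[OF t(1) q] t(2) \<alpha>(1,2)] by (simp add: C_def)
  qed (use t C in auto)
  show ?thesis
  proof (cases "t' <= t")
   case True then show ?thesis using *[of t t'] that by simp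
  next
   case False then show ?thesis using *[of t' t] that by (simp add: abs_minus_commute)
  qed
 qed
 have space: "\<bar>bpot c f (X, t) - bpot c f (X', t)\<bar> <= 2 * norm (X - X') powr \<alpha> * M" if t: "t <= 0" for X X' t unfolding M_def
 proof (rule bpot_diff[OF \<alpha>(3) c1])
  fix q assume q: "f q ~= 0"
  show "\<bar>bker c (X, t) q - bker c (X', t) q\<bar> <= 2 * norm (X - X') powr \<alpha> *
   (gmaj (c + \<alpha> / 2) (4 * r^2) (fst (fst (X, t)) - fst q, snd (X, t) - snd q)
    + gmaj (c + \<alpha> / 2) (4 * r^2) (fst (fst (X', t)) - fst q, snd (X', t) - snd q))" using bker_diff_space[OF c f_time[OF t q] \<alpha>(1,2)] by simp
 qed (use t in auto)
 show ?thesis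
 proof (rule parabolic_holder_cyl_bound[OF r \<alpha>(1) order_refl, of "(2 + C) * M" _ "K * (LINT q|lborel. gmaj c (4 * r^2) (q :: 'n space))"])
  show "0 <= (2 + C) * M" using C M by simp
  fix p :: "'n event" assume p: "p \<in> cyl r"
  then have tp: "snd p <= 0" by (cases p) (simp add: cyl_def)
  show "\<bar>bpot c f p\<bar> <= K * (LINT q|lborel. gmaj c (4 * r^2) (q :: 'n space))" by (rule bpot_integrable(2)[OF c1 tp])
  fix p' :: "'n event" assume p': "p' \<in> cyl r"
  then have tp': "snd p' <= 0" by (cases p') (simp add: cyl_def)
  have n: "norm (fst p - fst p') powr \<alpha> <= pdist p p' powr \<alpha>" using \<alpha> by (intro powr_mono2) (auto simp: pdist_def)
  have "\<bar>snd p - snd p'\<bar> powr (\<alpha> / 2) = (\<bar>snd p - snd p'\<bar> powr (1/2)) powr \<alpha>" by (simp add: powr_powr)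
  also have "... <= pdist p p' powr \<alpha>" using \<alpha> by (intro powr_mono2) (auto simp: pdist_def)
  finally have tt: "\<bar>snd p - snd p'\<bar> powr (\<alpha> / 2) <= pdist p p' powr \<alpha>" .
  have "\<bar>bpot c f p - bpot c f p'\<bar> <= 2 * norm (fst p - fst p') powr \<alpha> * M + C * \<bar>snd p - snd p'\<bar> powr (\<alpha> / 2) * M"
   using space[OF tp, of "fst p" "fst p'"] time[OF tp tp', of "fst p'"] by simp
  also have "... <= 2 * pdist p p' powr \<alpha> * M + C * pdist p p' powr \<alpha> * M" using n tt C M by (intro add_mono mult_right_mono mult_left_mono) auto
  finally show "\<bar>bpot c f p - bpot c f p'\<bar> <= (2 + C) * M * pdist p p' powr \<alpha>" by (simp add: algebra_simps)
 qed
qed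

end

section \<open>Regularity of the boundary potential\<close>

text \<open>A coordinate path between two points with time at most 0 keeps to such times, so the
  derivatives on the closed half space suffice, with the time derivative one-sided at 0.\<close>

lemma lipschitz_past:
 fixes f :: "'a::euclidean_space \<times> real => real"
 assumes D: "!!b. b \<in> Basis ==> \<exists>g. has_partial_on (UNIV \<times> {..0}) f b g \<and> (\<exists>C. \<forall>q. \<bar>g q\<bar> <= C)"
 obtains L where "L >= 0" "!!q q'. snd q <= 0 ==> snd q' <= 0 ==> \<bar>f q - f q'\<bar> <= L * norm (q - q')"
proof -
 let ?V = "UNIV \<times> {..0} :: ('a \<times> real) set"
 have V: "convex ?V" by (intro convex_Times) auto
 have "\<exists>g C. has_partial_on ?V f b g \<and> (\<forall>x\<in>?V. \<bar>g x\<bar> <= C)" if "b \<in> Basis" for b using D[OF that] by blast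
 from lipschitz_from_partials[OF V this] obtain L where L: "L >= 0" "!!x x'. (!!s. \<forall>b\<in>Basis. s \<bullet> b = 0 \<or> s \<bullet> b = (x' - x) \<bullet> b ==> x + s \<in> ?V)
   ==> \<bar>f x' - f x\<bar> <= L * norm (x' - x)" by blast
 show ?thesis
 proof (rule that[OF L(1) L(2)])
  fix q q' s :: "'a \<times> real" assume q: "snd q <= 0" and q': "snd q' <= 0" and s: "\<forall>b\<in>Basis. s \<bullet> b = 0 \<or> s \<bullet> b = (q - q') \<bullet> b"
  have "(0, 1) \<in> (Basis :: ('a \<times> real) set)" by (auto simp: Basis_prod_def)
  then have "snd s = 0 \<or> snd s = snd q - snd q'" using bspec[OF s, of "(0, 1)"] by (simp add: inner_prod_def)
  then show "q' + s \<in> ?V" using q q' by (auto simp: mem_Times_iff)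
 qed
qed

text \<open>The substitution \<open>\<sigma> = b / \<mu>\<close>. Integrability is assumed after the
  substitution, where an integrable majorant is at hand.\<close>

lemma integral_inversion:
 fixes k :: "real => real"
 assumes b: "b > 0" and k: "k \<in> borel_measurable borel"
  and i: "set_integrable lborel {0<..} (%\<mu>. b / \<mu>^2 * k (b / \<mu>))"
 shows "(LINT \<sigma>:{0<..}|lborel. k \<sigma>) = (LINT \<mu>:{0<..}|lborel. b / \<mu>^2 * k (b / \<mu>))"
proof -
 let ?h = "%\<mu>. b / \<mu>^2 * k (b / \<mu>)"
 have img: "(%\<mu>. b / \<mu>) ` {0<..} = {0<..}"
 proof (intro equalityI subsetI)
  fix t :: real assume "t \<in> {0<..}"
  then show "t \<in> (%\<mu>. b / \<mu>) ` {0<..}" using b by (intro image_eqI[of _ _ "b / t"]) auto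
 qed (use b in auto)
 have ih: "?h absolutely_integrable_on {0<..}" using i unfolding set_integrable_def by (subst integrable_completion) (auto dest: borel_measurable_integrable)
 have eq: "\<bar>- (b / \<mu>^2)\<bar> * k (b / \<mu>) = ?h \<mu>" for \<mu> using b by simp
 have hm: "?h \<in> borel_measurable borel" using k by measurable
 have "k absolutely_integrable_on (%\<mu>. b / \<mu>) ` {0<..} \<and> integral ((%\<mu>. b / \<mu>) ` {0<..}) k = integral {0<..} ?h"
 proof (rule has_absolute_integral_change_of_variables_1'[where g' = "%\<mu>. - (b / \<mu>^2)", THEN iffD1])
  show "inj_on (%\<mu>. b / \<mu>) {0<..}" using b by (auto simp: inj_on_def)
  show "((%\<mu>. b / \<mu>) has_field_derivative - (b / x^2)) (at x within {0<..})" if "x \<in> {0<..}" for x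
   using that by (auto intro!: derivative_eq_intros simp: power2_eq_square)
  show "(%x. \<bar>- (b / x^2)\<bar> * k (b / x)) absolutely_integrable_on {0<..} \<and>
   integral {0<..} (%x. \<bar>- (b / x^2)\<bar> * k (b / x)) = integral {0<..} ?h" unfolding eq using ih by simp
 qed auto
 then have "k absolutely_integrable_on {0<..}" "integral {0<..} k = integral {0<..} ?h" by (simp_all add: img)
 then show ?thesis using absolutely_integrable_lborel(2)[OF _ _ k, of "{0<..}"] absolutely_integrable_lborel(2)[OF ih _ hm] by simp
qed

lemma integrable_powr_exp:
 fixes x :: real
 assumes x: "x > 0"
 shows "integrable lborel (%\<mu>. indicator {0<..} \<mu> * (\<mu> powr (x - 1) * exp (- \<mu>)))"
proof -
 let ?f = "%t :: real. t powr (x - 1) / exp t"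
 have "?f absolutely_integrable_on {0<..}" using Gamma_has_integral[OF x] by (auto intro!: nonnegative_absolutely_integrable_1)
 from absolutely_integrable_lborel(1)[OF this] have "set_integrable lborel {0<..} ?f" by simp
 then show ?thesis by (simp add: set_integrable_def exp_minus field_simps)
qed

text \<open>The kernel depends on \<open>x - \<xi>\<close> and \<open>t - \<tau>\<close> alone, so
  the potential is a convolution in \<open>(x, t)\<close> with the height as a parameter.\<close>

lemma bker_reflected:
 fixes p :: "'n::finite event"
 shows "bker c p ((fst (fst p), snd p) - q) = bker c ((0, snd (fst p)), 0) (- q)"
proof (cases "0 < snd q")
 case True
 have 1: "snd ((fst (fst p), snd p) - q) < snd p" and 2: "snd (- q) < snd ((0 :: real ^ 'n, snd (fst p)), 0 :: real)" using True by simp_all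
 show ?thesis using bker_eq[OF 1, of c] bker_eq[OF 2, of c] by (simp add: pole_l_def)
qed (simp add: bker_0)

lemma gauss_moment:
 "integrable lborel (%\<zeta> :: real ^ 'n::finite. (1 + norm \<zeta>) * exp (- (norm \<zeta>)\<^sup>2))"
proof (rule integrable_bound)
 let ?k = "2 * 2 powr (real CARD('n) / 2)"
 have g: "integrable lborel (%\<zeta> :: real ^ 'n. (1/2) powr (real CARD('n) / 2) * exp (- (1/2 * (norm (\<zeta> - 0))^2)))" by (rule gauss_scaled(1)) simp
 show "integrable lborel (%\<zeta> :: real ^ 'n. ?k * ((1/2) powr (real CARD('n) / 2) * exp (- (1/2 * (norm (\<zeta> - 0))^2))))" by (rule integrable_mult_right[OF g])
 show "AE \<zeta> :: real ^ 'n in lborel. norm ((1 + norm \<zeta>) * exp (- (norm \<zeta>)\<^sup>2)) <= norm (?k * ((1/2) powr (real CARD('n) / 2) * exp (- (1/2 * (norm (\<zeta> - 0))^2))))" (is "AE \<zeta> in _. ?P \<zeta>")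
 proof (rule AE_I2)
  fix \<zeta> :: "real ^ 'n"
  have p: "2 powr (real CARD('n) / 2) * (1/2) powr (real CARD('n) / 2) = (1::real)" by (simp flip: powr_mult)
  have "0 <= (norm \<zeta> - 1)^2" by simp
  then have "norm \<zeta> <= 1 + (norm \<zeta>)^2 / 2" by (simp add: power2_diff)
  also have "... <= exp ((norm \<zeta>)^2 / 2)" by (rule exp_ge_add_one_self)
  finally have "norm \<zeta> <= exp ((norm \<zeta>)^2 / 2)" .
  moreover have "1 <= exp ((norm \<zeta>)^2 / 2)" by simp
  ultimately have "1 + norm \<zeta> <= 2 * exp ((norm \<zeta>)^2 / 2)" by linarith
  then have "(1 + norm \<zeta>) * exp (- (norm \<zeta>)\<^sup>2) <= 2 * exp ((norm \<zeta>)^2 / 2) * exp (- (norm \<zeta>)\<^sup>2)" by (intro mult_right_mono) auto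
  also have "... = 2 * exp (- ((norm \<zeta>)^2 / 2))" by (simp add: mult.assoc flip: exp_add)
  also have "... = 2 * (2 powr (real CARD('n) / 2) * (1/2) powr (real CARD('n) / 2)) * exp (- (1/2 * (norm (\<zeta> - 0))^2))" unfolding p by simp
  also have "... = ?k * ((1/2) powr (real CARD('n) / 2) * exp (- (1/2 * (norm (\<zeta> - 0))^2)))" by (simp only: mult.assoc)
  finally show "?P \<zeta>" by (simp add: abs_mult)
 qed
 show "(%\<zeta> :: real ^ 'n. (1 + norm \<zeta>) * exp (- (norm \<zeta>)\<^sup>2)) \<in> borel_measurable lborel"
  unfolding measurable_lborel2 by (intro borel_measurable_continuous_onI continuous_intros)
qed

context
 fixes f :: "'n::finite space => real" and r c K :: real
 assumes r: "r > 0" and c: "0 < c" "c < 1" and f_meas: "f \<in> borel_measurable borel"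
  and f_bound: "\<forall>q. \<bar>f q\<bar> <= K * indicator (bcyl r) q"
begin

text \<open>Written as a convolution, the potential moves with \<open>f\<close>, and the derivative
  falls on \<open>f\<close>. The kernel vanishes for sources in the future, so \<open>f\<close> is
  evaluated only at times up to 0, where it has its possibly one-sided derivative
  \<open>g\<close>.\<close>

lemma bpot_partial:
 assumes g: "g \<in> borel_measurable borel" "\<forall>q. \<bar>g q\<bar> <= K' * indicator (bcyl r) q"
  and D: "has_partial_on (UNIV \<times> {..0}) f b g"
 shows "has_partial_on (open_cyl r) (bpot c f) ((fst b, 0), snd b) (bpot c g)" unfolding has_partial_on_def
proof
 let ?U = "open_cyl r :: ('n event) set" and ?b = "((fst b, 0), snd b)"
 fix p :: "'n event" assume p: "p \<in> ?U"
 let ?H = "{h. p + h *\<^sub>R ?b \<in> ?U}"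
 define P where "P = (fst (fst p), snd p)"
 define k where "k q = bker c ((0, snd (fst p)), 0) (- q)" for q :: "'n space"
 have eq: "bpot c u (p + h *\<^sub>R ?b) = (LINT q|lborel. u (P + h *\<^sub>R b - q) * k q)"
  if "u \<in> borel_measurable borel" for u h
 proof -
  let ?p = "p + h *\<^sub>R ?b"
  have P: "(fst (fst ?p), snd ?p) = P + h *\<^sub>R b" by (cases b) (simp add: P_def)
  have "(%q. u q * bker c ?p q) \<in> borel_measurable borel" using that measurable_bker[OF c(1), of ?p] by simp
  from lborel_integral_reflect[OF this, of "P + h *\<^sub>R b"]
  have "bpot c u ?p = (LINT q|lborel. u (P + h *\<^sub>R b - q) * bker c ?p (P + h *\<^sub>R b - q))" by (simp add: bpot_def)
  also have "(%q. bker c ?p (P + h *\<^sub>R b - q)) = k" using bker_reflected[of c ?p, unfolded P] by (simp add: k_def fun_eq_iff)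
  then have "(%q. u (P + h *\<^sub>R b - q) * bker c ?p (P + h *\<^sub>R b - q)) = (%q. u (P + h *\<^sub>R b - q) * k q)" by metis
  finally show ?thesis .
 qed
 have k0: "k q = 0" if "snd q <= 0" for q using that by (simp add: k_def bker_0)
 have k1: "\<bar>k q\<bar> <= gmaj c (4 * r^2) q" if "snd q < 4 * r^2" for q
  using bker_le_gmaj[OF c(1), of "((0, snd (fst p)), 0)" "- q" "4 * r^2"] that bker_nonneg[OF c(1), of "((0, snd (fst p)), 0)" "- q"] by (simp add: k_def)
 have km: "k \<in> borel_measurable borel" unfolding k_def[abs_def] by (rule measurable_compose[OF _ measurable_bker[OF c(1)]]) simp
 have sh: "(%q. u (P + h *\<^sub>R b - q)) \<in> borel_measurable borel" if "u \<in> borel_measurable borel" for u :: "'n space => real" and h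
  by (rule measurable_compose[OF _ that]) simp
 have t: "snd (P + h *\<^sub>R b) <= 0" if "p + h *\<^sub>R ?b \<in> ?U" for h using that by (auto simp: P_def mem_Times_iff)
 have gb: "\<bar>u (P + h *\<^sub>R b - q) * k q\<bar> <= M * gmaj c (4 * r^2) q"
  if u: "u \<in> borel_measurable borel" "\<forall>q. \<bar>u q\<bar> <= M * indicator (bcyl r) q" and h: "p + h *\<^sub>R ?b \<in> ?U" for u M h q
 proof (cases "u (P + h *\<^sub>R b - q) = 0")
  case False
  from f_time[OF r c(1) u t[OF h] False] have "snd q < 4 * r^2" by simp
  then show ?thesis unfolding abs_mult using k1[of q] f_K[OF r c(1) u] by (intro mult_mono) auto
 qed (use mult_nonneg_nonneg[OF f_K(2)[OF r c(1) u] gmaj_nonneg] in simp)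
 have "((%h. LINT q|lborel. f (P + h *\<^sub>R b - q) * k q) has_real_derivative (LINT q|lborel. g (P + 0 *\<^sub>R b - q) * k q))
  (at 0 within ?H)"
 proof (rule has_real_derivative_integral[where F = "%h q. f (P + h *\<^sub>R b - q) * k q" and x = 0 and S = "?H"
   and F' = "%h q. g (P + h *\<^sub>R b - q) * k q" and B = "%q. K' * gmaj c (4 * r^2) q"])
  show "convex ?H" by (rule convex_line[OF convex_cylinder])
  show "0 \<in> ?H" using p by (simp only: mem_Collect_eq scaleR_zero_left add_0_right)
  show "integrable lborel (%q :: 'n space. K' * gmaj c (4 * r^2) q)" by (intro integrable_mult_right gmaj_integrable c) simp
  show "(%q. g (P + 0 *\<^sub>R b - q) * k q) \<in> borel_measurable lborel" using sh[OF g(1), of 0] km by simp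
  fix h assume "h \<in> ?H"
  then have h: "p + h *\<^sub>R ?b \<in> ?U" by simp
  show "integrable lborel (%q. f (P + h *\<^sub>R b - q) * k q)"
  proof (rule integrable_bound)
   show "integrable lborel (%q :: 'n space. K * gmaj c (4 * r^2) q)" by (intro integrable_mult_right gmaj_integrable c) simp
   show "(%q. f (P + h *\<^sub>R b - q) * k q) \<in> borel_measurable lborel" using sh[OF f_meas, of h] km by simp
   show "AE q in lborel. norm (f (P + h *\<^sub>R b - q) * k q) <= norm (K * gmaj c (4 * r^2) q)" using order_trans[OF gb[OF f_meas f_bound h] abs_ge_self] by simp
  qed
  fix q :: "'n space"
  show "\<bar>g (P + h *\<^sub>R b - q) * k q\<bar> <= K' * gmaj c (4 * r^2) q" by (rule gb[OF g h])
  show "((%h. f (P + h *\<^sub>R b - q) * k q) has_real_derivative g (P + h *\<^sub>R b - q) * k q) (at h within ?H)"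
  proof (cases "snd q <= 0")
   case False
   let ?V = "UNIV \<times> {..0} :: ('n space) set"
   have V: "P - q + h *\<^sub>R b \<in> ?V" if "p + h *\<^sub>R ?b \<in> ?U" for h using t[OF that] False by (simp add: mem_Times_iff)
   have "((%k. f (P - q + h *\<^sub>R b + k *\<^sub>R b)) has_real_derivative g (P - q + h *\<^sub>R b)) (at 0 within {k. P - q + h *\<^sub>R b + k *\<^sub>R b \<in> ?V})"
    using D V[OF h] unfolding has_partial_on_def by (rule bspec)
   then have "((%h. f (P - q + h *\<^sub>R b)) has_real_derivative g (P - q + h *\<^sub>R b)) (at h within {h. P - q + h *\<^sub>R b \<in> ?V})" by (rule DERIV_along_line)
   then have "((%h. f (P - q + h *\<^sub>R b)) has_real_derivative g (P - q + h *\<^sub>R b)) (at h within ?H)"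
    by (rule DERIV_subset) (use V in \<open>simp add: subset_iff del: mem_Sigma_iff\<close>)
   then have "((%h. f (P - q + h *\<^sub>R b) * k q) has_real_derivative g (P - q + h *\<^sub>R b) * k q) (at h within ?H)" by (rule DERIV_cmult_right)
   moreover have "P - q + h *\<^sub>R b = P + h *\<^sub>R b - q" for h by (simp add: algebra_simps)
   ultimately show ?thesis by simp
  qed (simp add: k0)
 qed
 then show "((%h. bpot c f (p + h *\<^sub>R ?b)) has_real_derivative bpot c g p) (at 0 within ?H)"
  unfolding eq[OF f_meas] using eq[OF g(1), of 0] by (simp only: scaleR_zero_left add_0_right)
qed

text \<open>The functions \<open>moment\<close> and \<open>scaled\<close> are related by \<open>\<mu> = y\<^sup>2 / (4 (t - \<tau>))\<close> and \<open>x - \<xi> = 2 (t - \<tau>)\<^bsup>1/2\<^esup> \<zeta>\<close>.\<close>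

definition "moment p = (LINT q|lborel. f q * (pole_l (snd p) (snd q) * bker c p q))"

lemma pole_bker_bound:
 assumes y: "\<delta> > 0"
 obtains C where "C >= 0" "!!p :: 'n::finite event. !!q. snd (fst p) >= \<delta> ==> \<bar>pole_l (snd p) (snd q) * bker c p q\<bar> <= C"
proof -
 obtain C where C: "C >= 0" "!!p :: 'n event. !!q. snd (fst p) >= \<delta> ==> \<bar>bker (c + 1) p q\<bar> <= C"
  by (rule bker_bound[of "c + 1" \<delta>, where 'n = 'n]) (use c y in auto)
 show ?thesis
 proof (rule that[OF C(1)])
  fix p :: "'n event" and q assume y: "snd (fst p) >= \<delta>"
  \<comment> \<open>An extra factor \<open>l\<close> amounts to the parameter
    \<open>c + 1\<close>.\<close>
  have "pole_l (snd p) (snd q) * bker c p q = bker (c + 1) p q"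
  proof (cases "snd q < snd p")
   case True
   then have "pole_l (snd p) (snd q) > 0" by (simp add: pole_l_def)
   then show ?thesis unfolding bker_eq[OF True] by (simp add: powr_add flip: add.assoc)
  qed (simp add: bker_0)
  then show "\<bar>pole_l (snd p) (snd q) * bker c p q\<bar> <= C" using C(2)[OF y, of q] by simp
 qed
qed

lemma measurable_pole_bker:
 fixes p :: "'n::finite event"
 shows "(%q. pole_l (snd p) (snd q) * bker c p q) \<in> borel_measurable borel"
proof -
 have "(%q :: 'n space. snd q) \<in> borel_measurable borel" by (intro borel_measurable_continuous_onI continuous_intros)
 then have "(%q :: 'n space. pole_l (snd p) (snd q)) \<in> borel_measurable borel" by (rule measurable_compose[OF _ measurable_cut(7)])
 then show ?thesis using measurable_bker[OF c(1), of p] by simp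
qed

lemma bounded_kernel_integrable:
 assumes k: "k \<in> borel_measurable borel" "!!q. \<bar>k q\<bar> <= C"
 shows "integrable lborel (%q. f q * k q)"
proof (rule integrable_bound)
 show "integrable lborel (%q. (K * C) * indicator (bcyl r :: ('n space) set) q :: real)" by (rule integrable_indicator_bounded[OF bounded_bcyl sets_bcyl])
 show "(%q. f q * k q) \<in> borel_measurable lborel" using f_meas k(1) by simp
 show "AE q in lborel. norm (f q * k q) <= norm ((K * C) * indicator (bcyl r) q :: real)" (is "AE q in _. ?P q")
 proof (rule AE_I2)
  fix q
  have "\<bar>f q * k q\<bar> <= (K * indicator (bcyl r) q) * C" unfolding abs_mult using f_bound[rule_format, of q] k(2)[of q] by (intro mult_mono) auto
  then show "?P q" by (simp add: mult_ac)
 qed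
qed

lemma bpot_partial_y:
 "has_partial_on (open_cyl r) (bpot c f) ((0, 1), 0) (%p. - 2 * snd (fst p) * moment p)" unfolding has_partial_on_def
proof
 fix p :: "'n event" assume p: "p \<in> open_cyl r"
 define y where "y = snd (fst p)"
 have y: "y > 0" using p by (auto simp: y_def half_ball_def)
 \<comment> \<open>These shifts keep the height above \<open>y / 2\<close>, where the kernel and
   \<open>l\<close> times the kernel are bounded, and below \<open>3 / 2 * y\<close>, which gives
   the constant \<open>3 * y * C\<close>.\<close>
 let ?S = "{- (y / 2)<..<y / 2}" and ?p = "%h. p + h *\<^sub>R ((0, 1), 0)"
 let ?k = "%h q. pole_l (snd p) (snd q) * bker c (?p h) q"
 obtain C where C: "C >= 0" "!!p :: 'n event. !!q. snd (fst p) >= y / 2 ==> \<bar>pole_l (snd p) (snd q) * bker c p q\<bar> <= C"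
  by (rule pole_bker_bound[of "y / 2"]) (use y in auto)
 obtain C' where C': "C' >= 0" "!!p :: 'n event. !!q. snd (fst p) >= y / 2 ==> \<bar>bker c p q\<bar> <= C'"
  by (rule bker_bound[OF c(1), of "y / 2", where 'n = 'n]) (use y in auto)
 have k: "\<bar>?k h q\<bar> <= C" "\<bar>bker c (?p h) q\<bar> <= C'" if "h \<in> ?S" for h q
  using C(2)[of "?p h" q] C'(2)[of "?p h" q] that by (simp_all add: y_def[symmetric])
 have km: "?k h \<in> borel_measurable borel" for h using measurable_pole_bker[of "?p h"] by simp
 have "((%h. LINT q|lborel. f q * bker c (?p h) q) has_real_derivative (LINT q|lborel. f q * (- 2 * (y + 0) * ?k 0 q))) (at 0 within ?S)"
 proof (rule has_real_derivative_integral[where F = "%h q. f q * bker c (?p h) q" and x = 0 and S = ?S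
   and F' = "%h q. f q * (- 2 * (y + h) * ?k h q)" and B = "%q. (3 * y * C) * \<bar>f q\<bar>"])
  show "convex ?S" by simp
  show "0 \<in> ?S" using y by simp
  show "integrable lborel (%q. (3 * y * C) * \<bar>f q\<bar>)" using integrable_abs[OF bounded_kernel_integrable[of "%_. 1" 1]] by simp
  show "(%q. f q * (- 2 * (y + 0) * ?k 0 q)) \<in> borel_measurable lborel" using f_meas km[of 0] by simp
  fix h assume h: "h \<in> ?S"
  show "integrable lborel (%q. f q * bker c (?p h) q)" by (rule bounded_kernel_integrable[OF measurable_bker[OF c(1)] k(2)[OF h]])
  fix q :: "'n space"
  have "\<bar>- 2 * (y + h) * ?k h q\<bar> <= 3 * y * C" unfolding abs_mult[of "- 2 * (y + h)"] using k(1)[OF h, of q] h y C(1) by (intro mult_mono) auto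
  then show "\<bar>f q * (- 2 * (y + h) * ?k h q)\<bar> <= (3 * y * C) * \<bar>f q\<bar>" unfolding abs_mult[of "f q"] by (subst mult.commute) (rule mult_right_mono, auto)
  have "((%h. bker c (?p h) q) has_real_derivative - 2 * (y + h) * ?k h q) (at h within ?S)"
  proof (cases "snd q < snd p")
   case True
   have e: "bker c (?p h) q = pole_l (snd p) (snd q) powr (real CARD('n) / 2 + c) *
    exp (- (pole_l (snd p) (snd q) * ((norm (fst (fst p) - fst q))^2 + (y + h)^2)))" for h using bker_eq[of q "?p h" c] True by (simp add: y_def)
   show ?thesis unfolding e by (auto intro!: derivative_eq_intros simp: algebra_simps)
  qed (simp add: bker_0)
  then show "((%h. f q * bker c (?p h) q) has_real_derivative f q * (- 2 * (y + h) * ?k h q)) (at h within ?S)" by (rule DERIV_cmult)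
 qed
 moreover have "(%q. f q * (- 2 * (y + 0) * ?k 0 q)) = (%q. (- 2 * y) * (f q * (pole_l (snd p) (snd q) * bker c p q)))" by (simp add: fun_eq_iff flip: zero_prod_def)
 then have "(LINT q|lborel. f q * (- 2 * (y + 0) * ?k 0 q)) = - 2 * y * moment p" by (simp add: moment_def)
 ultimately have "((%h. bpot c f (?p h)) has_real_derivative - 2 * y * moment p) (at 0 within ?S)" by (simp add: bpot_def)
 then have "((%h. bpot c f (?p h)) has_real_derivative - 2 * y * moment p) (at 0)" using y by (subst (asm) at_within_open) auto
 then show "((%h. bpot c f (?p h)) has_real_derivative - 2 * snd (fst p) * moment p) (at 0 within {h. ?p h \<in> open_cyl r})"
  unfolding y_def by (rule has_field_derivative_at_within)
qed

text \<open>Up to the factor \<open>gauss_mass\<close>, the Gaussian mean of \<open>f\<close> at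
  time \<open>t - \<sigma>\<close> around \<open>x\<close>, on the length scale
  \<open>sqrt (4 \<sigma>)\<close>. At \<open>\<sigma> = 0\<close> it is a multiple of
  \<open>f (x, t)\<close>, so it makes sense at the bottom.\<close>

definition "avg x t \<sigma> = (LINT \<zeta>|lborel. f (x - sqrt (4 * \<sigma>) *\<^sub>R \<zeta>, t - \<sigma>) * exp (- (norm \<zeta>)\<^sup>2))"

definition "scaled p = (LINT \<mu>:{0<..}|lborel. \<mu> powr (c - 1) * exp (- \<mu>) * avg (fst (fst p)) (snd p) ((snd (fst p))^2 / 4 / \<mu>))"

lemma measurable_dilated:
 "(%\<zeta>. f (x - s *\<^sub>R \<zeta>, t)) \<in> borel_measurable borel" by (rule measurable_compose[OF _ f_meas]) (intro borel_measurable_continuous_onI continuous_intros)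

lemma avg_integrable: "integrable lborel (%\<zeta>. f (x - s *\<^sub>R \<zeta>, t) * exp (- (norm \<zeta>)\<^sup>2))"
proof (rule integrable_bound)
 show "integrable lborel (%\<zeta> :: real ^ 'n. K * exp (- (norm \<zeta>)\<^sup>2))" using integrable_gaussian by (rule integrable_mult_right)
 show "(%\<zeta>. f (x - s *\<^sub>R \<zeta>, t) * exp (- (norm \<zeta>)\<^sup>2)) \<in> borel_measurable lborel"
  using measurable_dilated borel_measurable_integrable[OF integrable_gaussian] by simp
 show "AE \<zeta> in lborel. norm (f (x - s *\<^sub>R \<zeta>, t) * exp (- (norm \<zeta>)\<^sup>2)) <= norm (K * exp (- (norm \<zeta>)\<^sup>2))"
  using f_K[OF r c(1) f_meas f_bound] by (intro AE_I2) (simp add: abs_mult)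
qed

lemma avg_bound: "\<bar>avg x t \<sigma>\<bar> <= K * gauss_mass TYPE('n)"
proof -
 have "norm (avg x t \<sigma>) <= (LINT \<zeta>|lborel. K * exp (- (norm (\<zeta> :: real ^ 'n))\<^sup>2))" unfolding avg_def
 proof (rule integral_norm_bound_integral[OF avg_integrable])
  show "integrable lborel (%\<zeta> :: real ^ 'n. K * exp (- (norm \<zeta>)\<^sup>2))" using integrable_gaussian by (rule integrable_mult_right)
 qed (use f_K[OF r c(1) f_meas f_bound] in \<open>simp add: abs_mult\<close>)
 then show ?thesis by (simp add: gauss_mass_def)
qed

lemma measurable_avg: "avg x t \<in> borel_measurable borel"
proof -
 have "(%z :: real \<times> (real ^ 'n). f (x - sqrt (4 * fst z) *\<^sub>R snd z, t - fst z) * exp (- (norm (snd z))\<^sup>2)) \<in> borel_measurable borel"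
 proof (rule borel_measurable_times)
  show "(%z :: real \<times> (real ^ 'n). f (x - sqrt (4 * fst z) *\<^sub>R snd z, t - fst z)) \<in> borel_measurable borel"
   by (rule measurable_compose[OF _ f_meas]) (intro borel_measurable_continuous_onI continuous_intros)
 qed (intro borel_measurable_continuous_onI continuous_intros)
 moreover have "sets (borel \<Otimes>\<^sub>M lborel) = sets (borel :: (real \<times> (real ^ 'n)) measure)" by (metis borel_prod sets_lborel sets_pair_measure_cong)
 ultimately have "(%(\<sigma>, \<zeta>). f (x - sqrt (4 * \<sigma>) *\<^sub>R \<zeta>, t - \<sigma>) * exp (- (norm \<zeta>)\<^sup>2)) \<in> borel_measurable (borel \<Otimes>\<^sub>M lborel)"
  by (simp add: case_prod_beta' cong: measurable_cong_sets)
 from lborel.borel_measurable_lebesgue_integral[OF this] show ?thesis by (simp add: avg_def[abs_def])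
qed

lemma scaled_integrable:
 assumes "\<alpha> < c"
 shows "set_integrable lborel {0<..} (%\<mu>. \<mu> powr (c - 1 - \<alpha>) * exp (- \<mu>) * avg x t (b / \<mu>))" unfolding set_integrable_def
proof (rule integrable_bound)
 let ?M = "K * gauss_mass TYPE('n)"
 let ?w = "%\<mu> :: real. indicator {0<..} \<mu> * (\<mu> powr (c - \<alpha> - 1) * exp (- \<mu>))"
  and ?h = "%\<mu> :: real. indicator {0<..} \<mu> *\<^sub>R (\<mu> powr (c - 1 - \<alpha>) * exp (- \<mu>) * avg x t (b / \<mu>))"
 show "integrable lborel (%\<mu>. ?M * ?w \<mu>)" by (rule integrable_mult_right[OF integrable_powr_exp]) (use assms in simp)
 have "(%\<mu>. avg x t (b / \<mu>)) \<in> borel_measurable borel" by (rule measurable_compose[OF _ measurable_avg]) measurable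
 then show "?h \<in> borel_measurable lborel" by measurable
 show "AE \<mu> in lborel. norm (?h \<mu>)
  <= norm (?M * ?w \<mu>)"
 proof (rule AE_I2)
  fix \<mu>
  have "\<bar>avg x t (b / \<mu>)\<bar> <= \<bar>?M\<bar>" using avg_bound[of x t "b / \<mu>"] by linarith
  then have "\<bar>avg x t (b / \<mu>)\<bar> * ?w \<mu> <= \<bar>?M\<bar> * ?w \<mu>" by (intro mult_right_mono) auto
  moreover have "c - 1 - \<alpha> = c - \<alpha> - 1" by simp
  ultimately show "norm (?h \<mu>)
  <= norm (?M * ?w \<mu>)" by (simp only: real_scaleR_def real_norm_def abs_mult abs_indicator abs_of_nonneg[OF powr_ge_zero] abs_exp_cancel mult_ac)
 qed
qed

text \<open>Integrating out \<open>\<xi>\<close> leaves \<open>l powr (1 + c) exp (- l y^2)\<close>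
  times \<open>avg\<close>. With \<open>l = \<mu> / y^2\<close> this power and the Jacobian together
  produce \<open>y powr (- 2 * c)\<close>, which the factor in front cancels; \<open>1 / 4\<close>
  is the constant in \<open>\<sigma> = y^2 / (4 \<mu>)\<close>.\<close>

lemma moment_scaled:
 fixes p :: "'n::finite event"
 assumes y: "snd (fst p) > 0"
 shows "snd (fst p) powr (2 * c) * moment p = 1 / 4 * scaled p"
proof -
 define x t y where "x = fst (fst p)" and "t = snd p" and "y = snd (fst p)"
 have y0: "y > 0" using y by (simp add: y_def)
 obtain C where C: "!!p :: 'n event. !!q. snd (fst p) >= y ==> \<bar>pole_l (snd p) (snd q) * bker c p q\<bar> <= C" by (rule pole_bker_bound[OF y0]) blast
 define h where "h q = f q * (pole_l t (snd q) * bker c p q)" for q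
 have h: "integrable lborel h" unfolding h_def[abs_def] t_def by (rule bounded_kernel_integrable[OF measurable_pole_bker C]) (simp add: y_def)
 have hm: "h \<in> borel_measurable borel" using h by (auto dest: borel_measurable_integrable)
 define k where "k \<sigma> = (1 / (4 * \<sigma>)) powr (1 + c) * exp (- (y^2 / (4 * \<sigma>))) * avg x t \<sigma>" for \<sigma>
 have hi: "integrable lborel (%q. h ((x, t) - q))" using lborel_integrable_affine[OF h, of "- 1" "(x, t)"] by simp
 have inner: "(LINT \<zeta>|lborel. h ((x, t) - (\<zeta>, \<sigma>))) = indicator {0<..} \<sigma> *\<^sub>R k \<sigma>" for \<sigma>
 proof (cases "0 < \<sigma>")
  case False
  then show ?thesis by (simp add: h_def bker_0 t_def)
 next
  case True
  let ?l = "1 / (4 * \<sigma>)" and ?s = "sqrt (4 * \<sigma>)"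
  have l: "?l > 0" "?s > 0" using True by simp_all
  have m: "(%\<zeta>. h ((x, t) - (\<zeta>, \<sigma>))) \<in> borel_measurable borel"
   by (rule measurable_compose[OF _ hm]) (intro borel_measurable_continuous_onI continuous_intros)
  \<comment> \<open>The Jacobian of the dilation by \<open>sqrt (4 \<sigma>)\<close> cancels the
    power of \<open>l\<close> that normalises the Gaussian.\<close>
  have sn: "?s ^ CARD('n) * ?l powr (real CARD('n) / 2) = 1"
  proof -
   have "?l = ?s powr (- 2)" using True by (simp add: powr_minus powr_numeral field_simps)
   then have "?l powr (real CARD('n) / 2) = ?s powr (- real CARD('n))" by (simp add: powr_powr)
   moreover have "?s ^ CARD('n) = ?s powr real CARD('n)" using l by (simp add: powr_realpow)
   ultimately have "?s ^ CARD('n) * ?l powr (real CARD('n) / 2) = ?s powr (real CARD('n) + (- real CARD('n)))" by (simp only: powr_add)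
   then show ?thesis using l by simp
  qed
  have e: "h ((x, t) - (?s *\<^sub>R \<zeta>, \<sigma>)) = (?l powr (real CARD('n) / 2) * (?l powr (1 + c) * exp (- (y^2 / (4 * \<sigma>))))) * (f (x - ?s *\<^sub>R \<zeta>, t - \<sigma>) * exp (- (norm \<zeta>)\<^sup>2))" for \<zeta>
  proof -
   have lt: "snd ((x, t) - (?s *\<^sub>R \<zeta>, \<sigma>)) < snd p" using True by (simp add: t_def)
   have n: "?l * ((norm (?s *\<^sub>R \<zeta>))^2 + y^2) = (norm \<zeta>)^2 + y^2 / (4 * \<sigma>)" using True by (simp add: power_mult_distrib field_simps)
   have "bker c p ((x, t) - (?s *\<^sub>R \<zeta>, \<sigma>)) = ?l powr (real CARD('n) / 2 + c) * exp (- (?l * ((norm (?s *\<^sub>R \<zeta>))^2 + y^2)))"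
    unfolding bker_eq[OF lt] by (simp add: x_def t_def y_def pole_l_def)
   also have "... = ?l powr (real CARD('n) / 2) * ?l powr c * (exp (- (norm \<zeta>)\<^sup>2) * exp (- (y^2 / (4 * \<sigma>))))"
    unfolding n by (simp add: powr_add flip: exp_add)
   finally show ?thesis using l by (simp add: h_def pole_l_def powr_add mult_ac)
  qed
  have "(LINT \<zeta>|lborel. h ((x, t) - (\<zeta>, \<sigma>))) = \<bar>?s\<bar> ^ DIM(real ^ 'n) * (LINT \<zeta>|lborel. h ((x, t) - (0 + ?s *\<^sub>R \<zeta>, \<sigma>)))"
   by (rule lborel_integral_affine[OF m]) (use l in simp)
  also have "... = ?s ^ CARD('n) * ((?l powr (real CARD('n) / 2) * (?l powr (1 + c) * exp (- (y^2 / (4 * \<sigma>))))) * avg x t \<sigma>)"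
   using l unfolding add_0 e avg_def by simp
  also have "... = (?s ^ CARD('n) * ?l powr (real CARD('n) / 2)) * k \<sigma>" by (simp add: k_def)
  finally show ?thesis using True unfolding sn by simp
 qed
 have "moment p = (LINT q|lborel. h q)" by (simp add: moment_def h_def t_def)
 also have "... = (LINT q|lborel. h ((x, t) - q))" by (rule lborel_integral_reflect[OF hm, symmetric])
 also have "... = (LINT \<sigma>|lborel. (LINT \<zeta>|lborel. h ((x, t) - (\<zeta>, \<sigma>))))"
 proof -
  have "integrable (lborel \<Otimes>\<^sub>M lborel) (case_prod (%\<zeta> \<sigma>. h ((x, t) - (\<zeta>, \<sigma>))))"
   using hi by (simp add: lborel_prod case_prod_beta' minus_prod_def)
  from lborel_pair.integral_snd[OF this] show ?thesis by (simp add: lborel_prod case_prod_beta' minus_prod_def)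
 qed
 also have "... = (LINT \<sigma>:{0<..}|lborel. k \<sigma>)" unfolding inner set_lebesgue_integral_def ..
 finally have mk: "moment p = (LINT \<sigma>:{0<..}|lborel. k \<sigma>)" .
 let ?b = "y^2 / 4"
 let ?a = "%\<mu>. \<mu> powr (c - 1) * exp (- \<mu>) * avg x t (?b / \<mu>)"
 have b: "?b > 0" using y0 by simp
 have km: "k \<in> borel_measurable borel" unfolding k_def[abs_def] using measurable_avg by measurable
 have e: "y powr (2 * c) * (?b / \<mu>^2 * k (?b / \<mu>)) = 1 / 4 * ?a \<mu>" if "\<mu> > 0" for \<mu>
 proof -
  have 1: "1 / (4 * (?b / \<mu>)) = \<mu> / y^2" "y^2 / (4 * (?b / \<mu>)) = \<mu>" using y0 that by simp_all
  have 2: "(\<mu> / y^2) powr (1 + c) = \<mu> powr (c - 1) * \<mu>^2 / (y powr (2 * c) * y^2)"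
  proof -
   have "y\<^sup>2 powr (1 + c) = y powr (2 * c) * y^2" using y0 by (simp add: powr_add[symmetric] powr_powr flip: powr_numeral) (simp add: algebra_simps)
   moreover have "\<mu> powr (1 + c) = \<mu> powr (c - 1) * \<mu>^2" using that by (simp add: powr_add[symmetric] flip: powr_numeral)
   ultimately show ?thesis using that y0 by (simp add: powr_divide)
  qed
  have 3: "y powr (2 * c) > 0" using y0 by simp
  show ?thesis unfolding k_def 1 2 using y0 that 3 by (simp add: field_simps)
 qed
 have g: "set_integrable lborel {0<..} ?a" using scaled_integrable[OF c(1), of x t ?b] by (simp only: diff_zero)
 have "set_integrable lborel {0<..} (%\<mu>. ?b / \<mu>^2 * k (?b / \<mu>))"
 proof -
  have "set_integrable lborel {0<..} (%\<mu>. 1 / (4 * y powr (2 * c)) * ?a \<mu>)" using g by (rule set_integrable_mult_right)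
  moreover have "1 / (4 * y powr (2 * c)) * ?a \<mu> = ?b / \<mu>^2 * k (?b / \<mu>)" if "\<mu> \<in> {0<..}" for \<mu> using e[of \<mu>] that y0 by (simp add: field_simps)
  then have "set_integrable lborel {0<..} (%\<mu>. 1 / (4 * y powr (2 * c)) * ?a \<mu>)
   = set_integrable lborel {0<..} (%\<mu>. ?b / \<mu>^2 * k (?b / \<mu>))" by (rule set_integrable_cong[OF refl refl])
  ultimately show ?thesis by (simp only:)
 qed
 from integral_inversion[OF b km this]
 have "y powr (2 * c) * moment p = y powr (2 * c) * (LINT \<mu>:{0<..}|lborel. ?b / \<mu>^2 * k (?b / \<mu>))" by (simp add: mk)
 also have "... = (LINT \<mu>:{0<..}|lborel. y powr (2 * c) * (?b / \<mu>^2 * k (?b / \<mu>)))" by (rule set_integral_mult_right[symmetric])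
 also have "... = (LINT \<mu>:{0<..}|lborel. 1 / 4 * ?a \<mu>)" by (rule set_lebesgue_integral_cong) (use e in auto)
 also have "... = 1 / 4 * scaled p" by (simp add: scaled_def x_def t_def y_def)
 finally show ?thesis by (simp add: y_def)
qed

context
 fixes L :: real
 assumes L: "L >= 0" "\<forall>q q'. snd q <= 0 --> snd q' <= 0 --> \<bar>f q - f q'\<bar> <= L * norm (q - q')"
begin

text \<open>The Lipschitz bound serves for distances up to 1 and the bound by \<open>K\<close>
  beyond; \<open>min 1 d \<le> d powr \<alpha>\<close> joins the two.\<close>

lemma f_holder:
 assumes \<alpha>: "0 < \<alpha>" "\<alpha> <= 1" and q: "snd q <= 0" "snd q' <= 0"
 shows "\<bar>f q - f q'\<bar> <= (2 * K + L) * norm (q - q') powr \<alpha>"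
proof -
 note K = f_K[OF r c(1) f_meas f_bound]
 have "\<bar>f q - f q'\<bar> <= (2 * K + L) * min 1 (norm (q - q'))"
 proof (cases "norm (q - q') <= 1")
  case True
  have "\<bar>f q - f q'\<bar> <= L * norm (q - q')" using L(2) q by blast
  also have "... <= (2 * K + L) * norm (q - q')" using K(2) by (intro mult_right_mono) auto
  finally show ?thesis using True by simp
 next
  case False
  then show ?thesis using K(1)[of q] K(1)[of q'] L(1) by simp
 qed
 also have "... <= (2 * K + L) * norm (q - q') powr \<alpha>" using \<alpha> K(2) L(1) by (intro mult_left_mono min_1_le_powr) auto
 finally show ?thesis .
qed

text \<open>The arguments of \<open>f\<close> differ by at most \<open>1 + norm \<zeta>\<close>
  times the bracket, and the power of that factor is at most the factor itself. Its Gaussian moment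
  is finite.\<close>

lemma avg_diff:
 assumes \<alpha>: "0 < \<alpha>" "\<alpha> <= 1" and t: "t <= 0" "t' <= 0" and \<sigma>: "0 <= \<sigma>" "0 <= \<sigma>'"
 shows "\<bar>avg x t \<sigma> - avg x' t' \<sigma>'\<bar> <= (2 * K + L) * (LINT \<zeta>|lborel. (1 + norm (\<zeta> :: real ^ 'n)) * exp (- (norm \<zeta>)\<^sup>2))
  * (norm (x - x') + \<bar>sqrt (4 * \<sigma>) - sqrt (4 * \<sigma>')\<bar> + \<bar>t - t'\<bar> + \<bar>\<sigma> - \<sigma>'\<bar>) powr \<alpha>"
  (is "_ <= ?M * ?G * ?E powr \<alpha>")
proof -
 let ?f = "%x t \<sigma> \<zeta>. f (x - sqrt (4 * \<sigma>) *\<^sub>R \<zeta>, t - \<sigma>) * exp (- (norm \<zeta>)\<^sup>2)"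
 have M: "?M >= 0" using f_K(2)[OF r c(1) f_meas f_bound] L(1) by simp
 have eq: "avg x t \<sigma> - avg x' t' \<sigma>' = (LINT \<zeta>|lborel. ?f x t \<sigma> \<zeta> - ?f x' t' \<sigma>' \<zeta>)"
  unfolding avg_def by (rule integral_diff[symmetric]) (rule avg_integrable)+
 have i: "integrable lborel (%\<zeta>. ?f x t \<sigma> \<zeta> - ?f x' t' \<sigma>' \<zeta>)" by (rule integrable_diff) (rule avg_integrable)+
 have g: "integrable lborel (%\<zeta> :: real ^ 'n. (?M * ?E powr \<alpha>) * ((1 + norm \<zeta>) * exp (- (norm \<zeta>)\<^sup>2)))"
  by (rule integrable_mult_right[OF gauss_moment])
 have b: "norm (?f x t \<sigma> \<zeta> - ?f x' t' \<sigma>' \<zeta>) <= (?M * ?E powr \<alpha>) * ((1 + norm \<zeta>) * exp (- (norm \<zeta>)\<^sup>2))" for \<zeta> :: "real ^ 'n"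
 proof -
  let ?q = "(x - sqrt (4 * \<sigma>) *\<^sub>R \<zeta>, t - \<sigma>)" and ?q' = "(x' - sqrt (4 * \<sigma>') *\<^sub>R \<zeta>, t' - \<sigma>')"
  have "norm (?q - ?q') <= norm ((x - x') - (sqrt (4 * \<sigma>) - sqrt (4 * \<sigma>')) *\<^sub>R \<zeta>) + \<bar>(t - t') - (\<sigma> - \<sigma>')\<bar>"
   using norm_Pair_le[of "fst (?q - ?q')" "snd (?q - ?q')"] by (simp add: algebra_simps)
  also have "... <= (norm (x - x') + \<bar>sqrt (4 * \<sigma>) - sqrt (4 * \<sigma>')\<bar> * norm \<zeta>) + (\<bar>t - t'\<bar> + \<bar>\<sigma> - \<sigma>'\<bar>)"
   using norm_triangle_ineq4[of "x - x'" "(sqrt (4 * \<sigma>) - sqrt (4 * \<sigma>')) *\<^sub>R \<zeta>"]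
    abs_triangle_ineq4[of "t - t'" "\<sigma> - \<sigma>'"] by (simp only: norm_scaleR)
  also have "... <= (1 + norm \<zeta>) * ?E" by (simp add: algebra_simps mult_nonneg_nonneg)
  finally have n: "norm (?q - ?q') <= (1 + norm \<zeta>) * ?E" .
  have "norm (?q - ?q') powr \<alpha> <= ((1 + norm \<zeta>) * ?E) powr \<alpha>" using n \<alpha> by (intro powr_mono2) auto
  also have "... = (1 + norm \<zeta>) powr \<alpha> * ?E powr \<alpha>" by (simp add: powr_mult)
  also have "... <= (1 + norm \<zeta>) * ?E powr \<alpha>" using powr_mono[of \<alpha> 1 "1 + norm \<zeta>"] \<alpha> by (intro mult_right_mono) auto
  finally have "?M * norm (?q - ?q') powr \<alpha> <= ?M * ((1 + norm \<zeta>) * ?E powr \<alpha>)" using M by (intro mult_left_mono)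
  then have "\<bar>f ?q - f ?q'\<bar> <= ?M * ((1 + norm \<zeta>) * ?E powr \<alpha>)" using f_holder[OF \<alpha>, of ?q ?q'] t \<sigma> by simp
  then have "\<bar>f ?q - f ?q'\<bar> * exp (- (norm \<zeta>)\<^sup>2) <= ?M * ((1 + norm \<zeta>) * ?E powr \<alpha>) * exp (- (norm \<zeta>)\<^sup>2)"
   by (intro mult_right_mono) auto
  moreover have "norm (?f x t \<sigma> \<zeta> - ?f x' t' \<sigma>' \<zeta>) = \<bar>f ?q - f ?q'\<bar> * exp (- (norm \<zeta>)\<^sup>2)"
   unfolding left_diff_distrib[symmetric] by (simp add: abs_mult)
  ultimately show ?thesis by (simp add: mult_ac)
 qed
 have "norm (LINT \<zeta>|lborel. ?f x t \<sigma> \<zeta> - ?f x' t' \<sigma>' \<zeta>) <= (LINT \<zeta>|lborel. (?M * ?E powr \<alpha>) * ((1 + norm (\<zeta> :: real ^ 'n)) * exp (- (norm \<zeta>)\<^sup>2)))"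
  by (rule integral_norm_bound_integral[OF i g b])
 also have "... = ?M * ?G * ?E powr \<alpha>" by simp
 finally show ?thesis unfolding eq by simp
qed

text \<open>Both \<open>sqrt (4 \<sigma>) = y / sqrt \<mu>\<close> and
  \<open>\<sigma> = y^2 / (4 \<mu>)\<close> are Lipschitz in \<open>y\<close>, with constants at
  most a multiple of \<open>1 + 1 / \<mu>\<close>. Raising to the power \<open>\<alpha>\<close>
  leaves \<open>1 + \<mu> powr (- \<alpha>)\<close>.\<close>

lemma avg_diff_cyl:
 assumes \<alpha>: "0 < \<alpha>" "\<alpha> <= 1" and p: "p \<in> cyl r" "p' \<in> cyl r" and \<mu>: "\<mu> > 0"
 shows "\<bar>avg (fst (fst p)) (snd p) ((snd (fst p))^2 / 4 / \<mu>) - avg (fst (fst p')) (snd p') ((snd (fst p'))^2 / 4 / \<mu>)\<bar> \<le>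
  (2 * K + L) * (LINT \<zeta>|lborel. (1 + norm (\<zeta> :: real ^ 'n)) * exp (- (norm \<zeta>)\<^sup>2)) * (3 * (1 + r) * (1 + \<mu> powr (- \<alpha>)) * pdist p p' powr \<alpha>)"
proof -
 define x y t x' y' t' where "x = fst (fst p)" and "y = snd (fst p)" and "t = snd p"
  and "x' = fst (fst p')" and "y' = snd (fst p')" and "t' = snd p'"
 define d where "d = pdist p p'"
 have d: "d >= 0" by (simp add: d_def pdist_nonneg)
 have y: "0 <= y" "0 <= y'" "y <= r" "y' <= r" and t: "t <= 0" "t' <= 0" using p norm_snd_le[of y x] norm_snd_le[of y' x']
  by (auto simp: cyl_def half_ball0_def mem_Times_iff x_def y_def t_def x'_def y'_def t'_def)
 let ?\<sigma> = "y^2 / 4 / \<mu>" and ?\<sigma>' = "y'^2 / 4 / \<mu>"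
 have "norm (x - x') <= norm (fst p - fst p')" "\<bar>y - y'\<bar> <= norm (fst p - fst p')"
  using norm_fst_le[of "x - x'" "y - y'"] norm_snd_le[of "y - y'" "x - x'"] by (cases "fst p"; cases "fst p'"; simp add: x_def y_def x'_def y'_def)+
 then have dx: "norm (x - x') <= d" and dy: "\<bar>y - y'\<bar> <= d" by (simp_all add: d_def pdist_def add_increasing2)
 have "\<bar>t - t'\<bar> <= norm (p - p')" using norm_snd_le[of "t - t'" "fst p - fst p'"] by (cases p; cases p') (simp add: t_def t'_def)
 then have dt: "\<bar>t - t'\<bar> <= (1 + r) * d" using pdist_cyl(2)[OF r p] by (simp add: d_def)
 have s: "sqrt (4 * (u^2 / 4 / \<mu>)) = u / sqrt \<mu>" if "u >= 0" for u using that \<mu> by (simp add: real_sqrt_divide)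
 have "1 / sqrt \<mu> <= 1 + 1 / \<mu>"
 proof (cases "\<mu> >= 1")
  case True
  then have "1 / sqrt \<mu> <= 1" by simp
  then show ?thesis using \<mu> by (simp add: add_increasing2)
 next
  case False
  then have "\<mu> <= sqrt \<mu>" using \<mu> by (intro real_le_rsqrt) (simp add: power2_eq_square)
  then have "1 / sqrt \<mu> <= 1 / \<mu>" using \<mu> by (intro frac_le) auto
  then show ?thesis by simp
 qed
 then have ds: "\<bar>sqrt (4 * ?\<sigma>) - sqrt (4 * ?\<sigma>')\<bar> <= (1 + 1 / \<mu>) * d"
 proof -
  assume 1: "1 / sqrt \<mu> <= 1 + 1 / \<mu>"
  have "\<bar>sqrt (4 * ?\<sigma>) - sqrt (4 * ?\<sigma>')\<bar> = 1 / sqrt \<mu> * \<bar>y - y'\<bar>"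
   unfolding s[OF y(1)] s[OF y(2)] using \<mu> by (simp add: abs_divide flip: diff_divide_distrib)
  also have "... <= (1 + 1 / \<mu>) * d" using 1 dy \<mu> by (intro mult_mono) auto
  finally show ?thesis .
 qed
 have d\<sigma>: "\<bar>?\<sigma> - ?\<sigma>'\<bar> <= r / \<mu> * d"
 proof -
  have "?\<sigma> - ?\<sigma>' = (y + y') / (4 * \<mu>) * (y - y')" by (simp add: power2_eq_square algebra_simps diff_divide_distrib)
  then have "\<bar>?\<sigma> - ?\<sigma>'\<bar> = (y + y') / (4 * \<mu>) * \<bar>y - y'\<bar>" using y \<mu> by (simp add: abs_mult)
  also have "... <= r / \<mu> * d"
  proof (intro mult_mono dy)
   have "(y + y') / (4 * \<mu>) <= (4 * r) / (4 * \<mu>)" using y \<mu> r by (intro divide_right_mono) auto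
   then show "(y + y') / (4 * \<mu>) <= r / \<mu>" using \<mu> by simp
  qed (use r \<mu> in auto)
  finally show ?thesis .
 qed
 let ?E = "norm (x - x') + \<bar>sqrt (4 * ?\<sigma>) - sqrt (4 * ?\<sigma>')\<bar> + \<bar>t - t'\<bar> + \<bar>?\<sigma> - ?\<sigma>'\<bar>"
 have "?E <= d + (1 + 1 / \<mu>) * d + (1 + r) * d + r / \<mu> * d" using dx ds dt d\<sigma> by linarith
 also have "... = ((1 + r) * (1 + 1 / \<mu>) + 2) * d" by (simp add: algebra_simps add_divide_distrib)
 also have "... <= (3 * (1 + r) * (1 + 1 / \<mu>)) * d"
 proof (intro mult_right_mono d)
  have "1 * 1 <= (1 + r) * (1 + 1 / \<mu>)" using r \<mu> by (intro mult_mono) auto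
  then show "(1 + r) * (1 + 1 / \<mu>) + 2 <= 3 * (1 + r) * (1 + 1 / \<mu>)" by linarith
 qed
 finally have E: "?E <= (3 * (1 + r)) * ((1 + 1 / \<mu>) * d)" by (simp only: mult.assoc)
 have "?E powr \<alpha> <= ((3 * (1 + r)) * ((1 + 1 / \<mu>) * d)) powr \<alpha>" using E \<alpha> by (intro powr_mono2) auto
 also have "... = (3 * (1 + r)) powr \<alpha> * ((1 + 1 / \<mu>) powr \<alpha> * d powr \<alpha>)" using r \<mu> d by (subst powr_mult; simp) (subst powr_mult; simp)
 also have "... <= (3 * (1 + r)) * ((1 + \<mu> powr (- \<alpha>)) * d powr \<alpha>)"
 proof (intro mult_mono)
  show "(3 * (1 + r)) powr \<alpha> <= 3 * (1 + r)" using powr_mono[of \<alpha> 1 "3 * (1 + r)"] \<alpha> r by simp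
  have "(1 + 1 / \<mu>) powr \<alpha> <= 1 powr \<alpha> + (1 / \<mu>) powr \<alpha>" using \<mu> \<alpha> by (intro powr_subadditive) auto
  then show "(1 + 1 / \<mu>) powr \<alpha> <= 1 + \<mu> powr (- \<alpha>)" using \<mu> by (simp add: powr_divide powr_minus_divide)
 qed (use r in auto)
 finally have E': "?E powr \<alpha> <= 3 * (1 + r) * (1 + \<mu> powr (- \<alpha>)) * d powr \<alpha>" by (simp add: mult.assoc)
 have M: "0 <= (2 * K + L) * (LINT \<zeta>|lborel. (1 + norm (\<zeta> :: real ^ 'n)) * exp (- (norm \<zeta>)\<^sup>2))"
  using f_K(2)[OF r c(1) f_meas f_bound] L(1) by (intro mult_nonneg_nonneg integral_nonneg) auto
 have "\<bar>avg x t ?\<sigma> - avg x' t' ?\<sigma>'\<bar> <= (2 * K + L) * (LINT \<zeta>|lborel. (1 + norm (\<zeta> :: real ^ 'n)) * exp (- (norm \<zeta>)\<^sup>2)) * ?E powr \<alpha>"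
  using \<mu> by (intro avg_diff \<alpha> t) auto
 also have "... <= (2 * K + L) * (LINT \<zeta>|lborel. (1 + norm (\<zeta> :: real ^ 'n)) * exp (- (norm \<zeta>)\<^sup>2)) * (3 * (1 + r) * (1 + \<mu> powr (- \<alpha>)) * d powr \<alpha>)"
  by (rule mult_left_mono[OF E' M])
 finally show ?thesis by (simp only: x_def y_def t_def x'_def y'_def t'_def d_def)
qed

text \<open>In the scaled form the height enters only through the argument of \<open>avg\<close>, so
  nothing degenerates at \<open>y = 0\<close>. The loss \<open>\<mu> powr (- \<alpha>)\<close> is
  integrable against \<open>\<mu> powr (c - 1) * exp (- \<mu>)\<close> precisely because
  \<open>\<alpha> < c\<close>.\<close>

lemma scaled_holder:
 assumes \<alpha>: "0 < \<alpha>" "\<alpha> <= 1" "\<alpha> < c"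
 shows "parabolic_holder \<alpha> (cyl r) scaled"
proof -
 define C where "C = (2 * K + L) * (LINT \<zeta>|lborel. (1 + norm (\<zeta> :: real ^ 'n)) * exp (- (norm \<zeta>)\<^sup>2)) * (3 * (1 + r))"
 have C: "C >= 0" unfolding C_def using f_K(2)[OF r c(1) f_meas f_bound] L(1) r by (intro mult_nonneg_nonneg integral_nonneg) auto
 let ?w = "%\<beta> \<mu>. indicator {0<..} \<mu> * (\<mu> powr (\<beta> - 1) * exp (- \<mu>)) :: real"
 let ?u = "%p \<mu>. avg (fst (fst p)) (snd p) ((snd (fst p))^2 / 4 / \<mu>)"
 have w: "integrable lborel (?w c)" "integrable lborel (?w (c - \<alpha>))" by (rule integrable_powr_exp; use c \<alpha> in simp)+
 have w0: "0 <= ?w \<beta> \<mu>" for \<beta> \<mu> by simp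
 have sc: "scaled p = (LINT \<mu>|lborel. ?w c \<mu> * ?u p \<mu>)" for p :: "'n event" unfolding scaled_def set_lebesgue_integral_def by (rule integral_cong) simp_all
 have i: "integrable lborel (%\<mu>. ?w c \<mu> * ?u p \<mu>)" for p :: "'n event"
 proof -
  have "set_integrable lborel {0<..} (%\<mu>. \<mu> powr (c - 1) * exp (- \<mu>) * ?u p \<mu>)" using scaled_integrable[OF c(1)] by (simp only: diff_zero)
  then show ?thesis by (simp add: set_integrable_def mult_ac)
 qed
 show ?thesis
 proof (rule parabolic_holder_cyl_bound[OF r \<alpha>(1) order_refl, of "C * (LINT \<mu>|lborel. ?w c \<mu> + ?w (c - \<alpha>) \<mu>)" _ "LINT \<mu>|lborel. (K * gauss_mass TYPE('n)) * ?w c \<mu>"])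
  show "0 <= C * (LINT \<mu>|lborel. ?w c \<mu> + ?w (c - \<alpha>) \<mu>)" using C w0 by (intro mult_nonneg_nonneg integral_nonneg add_nonneg_nonneg) auto
  fix p :: "'n event" assume p: "p \<in> cyl r"
  have "norm (LINT \<mu>|lborel. ?w c \<mu> * ?u p \<mu>) <= (LINT \<mu>|lborel. (K * gauss_mass TYPE('n)) * ?w c \<mu>)"
  proof (rule integral_norm_bound_integral[OF i integrable_mult_right[OF w(1)]])
   fix \<mu>
   have "\<bar>?u p \<mu>\<bar> * ?w c \<mu> <= (K * gauss_mass TYPE('n)) * ?w c \<mu>" by (rule mult_right_mono[OF avg_bound w0])
   then show "norm (?w c \<mu> * ?u p \<mu>) <= (K * gauss_mass TYPE('n)) * ?w c \<mu>"
    unfolding real_norm_def abs_mult[of "?w c \<mu>"] abs_of_nonneg[OF w0] by (simp only: mult.commute)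
  qed
  then show "\<bar>scaled p\<bar> <= (LINT \<mu>|lborel. (K * gauss_mass TYPE('n)) * ?w c \<mu>)" unfolding sc real_norm_def .
  fix p' :: "'n event" assume p': "p' \<in> cyl r"
  have eq: "scaled p - scaled p' = (LINT \<mu>|lborel. ?w c \<mu> * ?u p \<mu> - ?w c \<mu> * ?u p' \<mu>)" unfolding sc by (rule integral_diff[OF i i, symmetric])
  have gi: "integrable lborel (%\<mu>. (C * pdist p p' powr \<alpha>) * (?w c \<mu> + ?w (c - \<alpha>) \<mu>))" by (rule integrable_mult_right[OF integrable_add[OF w]])
  have b: "norm (?w c \<mu> * ?u p \<mu> - ?w c \<mu> * ?u p' \<mu>) <= (C * pdist p p' powr \<alpha>) * (?w c \<mu> + ?w (c - \<alpha>) \<mu>)" for \<mu>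
  proof (cases "\<mu> > 0")
   case True
   have "norm (?w c \<mu> * ?u p \<mu> - ?w c \<mu> * ?u p' \<mu>) = ?w c \<mu> * \<bar>?u p \<mu> - ?u p' \<mu>\<bar>"
    unfolding right_diff_distrib[symmetric] real_norm_def abs_mult[of "?w c \<mu>"] abs_of_nonneg[OF w0] ..
   also have "... <= ?w c \<mu> * ((2 * K + L) * (LINT \<zeta>|lborel. (1 + norm (\<zeta> :: real ^ 'n)) * exp (- (norm \<zeta>)\<^sup>2)) * (3 * (1 + r) * (1 + \<mu> powr (- \<alpha>)) * pdist p p' powr \<alpha>))"
    by (rule mult_left_mono[OF avg_diff_cyl[OF \<alpha>(1,2) p p' True] w0])
   also have "... = (C * pdist p p' powr \<alpha>) * (?w c \<mu> * (1 + \<mu> powr (- \<alpha>)))" by (simp only: C_def mult_ac)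
   also have "?w c \<mu> * (1 + \<mu> powr (- \<alpha>)) = ?w c \<mu> + ?w (c - \<alpha>) \<mu>"
   proof -
    have "\<mu> powr (c - \<alpha> - 1) = \<mu> powr (c - 1) * \<mu> powr (- \<alpha>)" using powr_add[of \<mu> "c - 1" "- \<alpha>"] by (simp add: algebra_simps)
    then show ?thesis using True by (simp add: algebra_simps)
   qed
   finally show ?thesis .
  qed simp
  have "norm (LINT \<mu>|lborel. ?w c \<mu> * ?u p \<mu> - ?w c \<mu> * ?u p' \<mu>) <= (LINT \<mu>|lborel. (C * pdist p p' powr \<alpha>) * (?w c \<mu> + ?w (c - \<alpha>) \<mu>))"
   by (rule integral_norm_bound_integral[OF integrable_diff[OF i i] gi b])
  also have "... = (C * pdist p p' powr \<alpha>) * (LINT \<mu>|lborel. ?w c \<mu> + ?w (c - \<alpha>) \<mu>)" by (rule integral_mult_right_zero)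
  finally show "\<bar>scaled p - scaled p'\<bar> <= C * (LINT \<mu>|lborel. ?w c \<mu> + ?w (c - \<alpha>) \<mu>) * pdist p p' powr \<alpha>"
   unfolding eq by (simp only: real_norm_def mult_ac)
 qed
qed

end

lemma bpot_regular:
 assumes \<alpha>: "0 < \<alpha>" "\<alpha> <= 1" "c + \<alpha> / 2 < 1" "\<alpha> < c" and a: "a = 2 * c - 1"
  and D: "!!b. b \<in> Basis ==> \<exists>g K'. g \<in> borel_measurable borel \<and> (\<forall>q. \<bar>g q\<bar> <= K' * indicator (bcyl r) q) \<and>
   has_partial_on (UNIV \<times> {..0}) f b g"
 shows "regular a \<alpha> r (bpot c f)"
proof -
 have P: "\<exists>D. has_partial_on (open_cyl r) (bpot c f) ((fst b, 0), snd b) D \<and> holder_up_to_bottom \<alpha> r D"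
  if b: "b \<in> Basis" for b :: "'n space"
 proof -
  obtain g K' where g: "g \<in> borel_measurable borel" "\<forall>q. \<bar>g q\<bar> <= K' * indicator (bcyl r) q" "has_partial_on (UNIV \<times> {..0}) f b g"
   using D[OF b] by blast
  have "holder_up_to_bottom \<alpha> r (bpot c g)" by (rule holder_up_to_bottomI[OF bpot_holder[OF r c(1) g(1,2) \<alpha>(1,2,3)] refl])
  then show ?thesis using bpot_partial[OF g] by blast
 qed
 obtain L where L: "L >= 0" "!!q q'. snd q <= 0 ==> snd q' <= 0 ==> \<bar>f q - f q'\<bar> <= L * norm (q - q')"
 proof (rule lipschitz_past[of f])
  fix b :: "'n space" assume "b \<in> Basis"
  then obtain g K' where g: "g \<in> borel_measurable borel" "\<forall>q. \<bar>g q\<bar> <= K' * indicator (bcyl r) q" "has_partial_on (UNIV \<times> {..0}) f b g"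
   using D by blast
  have "\<forall>q. \<bar>g q\<bar> <= K'" using f_K(1)[OF r c(1) g(1,2)] by blast
  then show "\<exists>g. has_partial_on (UNIV \<times> {..0}) f b g \<and> (\<exists>C. \<forall>q. \<bar>g q\<bar> <= C)" using g(3) by blast
 qed blast
 have L': "\<forall>q q'. snd q <= 0 --> snd q' <= 0 --> \<bar>f q - f q'\<bar> <= L * norm (q - q')" using L(2) by blast
 show ?thesis unfolding regular_def
 proof (intro conjI allI)
  fix i :: 'n
  have "(axis i 1, 0) \<in> (Basis :: ('n space) set)" by (auto simp: Basis_prod_def Basis_vec_def)
  from P[OF this] show "\<exists>D. has_partial_on (open_cyl r) (bpot c f) ((axis i 1, 0), 0) D \<and> holder_up_to_bottom \<alpha> r D" by simp
 next
  have "(0, 1) \<in> (Basis :: ('n space) set)" by (auto simp: Basis_prod_def)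
  from P[OF this] show "\<exists>D. has_partial_on (open_cyl r) (bpot c f) ((0, 0), 1) D \<and> holder_up_to_bottom \<alpha> r D" by simp
 next
  have "holder_up_to_bottom \<alpha> r (%p :: 'n event. weight a (fst p) * (- 2 * snd (fst p) * moment p))"
  proof (rule holder_up_to_bottomI)
   \<comment> \<open>The factor \<open>- 1 / 2\<close> is the \<open>- 2\<close> from
     differentiating \<open>exp (- l y^2)\<close> times the \<open>1 / 4\<close> of
     \<open>moment_scaled\<close>.\<close>
   show "parabolic_holder \<alpha> (cyl r) (%p. (- 1 / 2) * scaled p)" by (rule parabolic_holder_cmult[OF scaled_holder[OF L(1) L' \<alpha>(1,2,4)]])
   fix p :: "'n event" assume "p \<in> open_cyl r"
   then have y: "snd (fst p) > 0" by (auto simp: half_ball_def)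
   have "weight a (fst p) * (- 2 * snd (fst p) * moment p) = - 2 * (snd (fst p) powr (a + 1) * moment p)" using y by (simp add: weight_def powr_add)
   also have "a + 1 = 2 * c" using a by simp
   also have "- 2 * (snd (fst p) powr (2 * c) * moment p) = (- 1 / 2) * scaled p" unfolding moment_scaled[OF y] by simp
   finally show "(- 1 / 2) * scaled p = weight a (fst p) * (- 2 * snd (fst p) * moment p)" ..
  qed
  then show "\<exists>D. has_partial_on (open_cyl r) (bpot c f) ((0, 1), 0) D \<and>
   holder_up_to_bottom \<alpha> r (%p. weight a (fst p) * D p)" using bpot_partial_y by blast
 qed
qed

end

section \<open>Bounded derivatives of the truncated flux\<close>

lemma cutoff_deriv:
 fixes q b :: "'n::finite space"
 assumes r: "r > 0"
 shows "((%h. cut_space r (fst (q + h *\<^sub>R b), 0) * cut_time r (snd (q + h *\<^sub>R b))) has_real_derivative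
  cut_space_grad r (fst q, 0) \<bullet> (fst b, 0) * cut_time r (snd q) + snd b * cut_time' r (snd q) * cut_space r (fst q, 0)) (at 0)"
proof -
 have s: "((%h. cut_space r (fst (q + h *\<^sub>R b), 0)) has_real_derivative cut_space_grad r (fst q, 0) \<bullet> (fst b, 0)) (at 0)"
  using cut_space_deriv[of r "(fst q, 0)" "(fst b, 0)"] by simp
 have "((%h. snd q + h * snd b) has_real_derivative snd b) (at 0)" by (auto intro!: derivative_eq_intros)
 from DERIV_add[OF DERIV_const DERIV_cdivide[OF this]]
 have "((%h. 3 + (snd q + h * snd b) / r^2) has_real_derivative snd b / r^2) (at 0)" by simp
 then have "((%h. step (3 + (snd q + h * snd b) / r^2)) has_real_derivative step' (3 + (snd q + 0 * snd b) / r^2) * (snd b / r^2)) (at 0)"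
  by (rule DERIV_chain2[OF step_deriv])
 then have t: "((%h. cut_time r (snd (q + h *\<^sub>R b))) has_real_derivative snd b * cut_time' r (snd q)) (at 0)" by (simp add: cut_time_def cut_time'_def mult.commute)
 show ?thesis using DERIV_mult[OF s t] by simp
qed

text \<open>Where one of the cutoffs vanishes in a whole neighbourhood, the function is locally 0.
  Elsewhere \<open>q\<close> lies in \<open>bcyl\<close>, away from its lateral and initial
  boundary, so near \<open>q\<close> the half space of times up to 0 and \<open>bcyl\<close>
  coincide and the one-sided derivative of \<open>\<phi>\<close> at the final time carries
  over.\<close>

lemma bdata_partial:
 fixes \<phi> g :: "'n::finite space => real"
 assumes r: "r > 0" and g: "has_partial_on (bcyl r) \<phi> b g"
 shows "has_partial_on (UNIV \<times> {..0}) (bdata r \<phi>) b (%q. indicator (bcyl r) q *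
  ((cut_space_grad r (fst q, 0) \<bullet> (fst b, 0) * cut_time r (snd q) + snd b * cut_time' r (snd q) * cut_space r (fst q, 0)) * \<phi> q
   + g q * (cut_space r (fst q, 0) * cut_time r (snd q))))" (is "has_partial_on ?V _ _ ?D") unfolding has_partial_on_def
proof
 fix q :: "'n space" assume q: "q \<in> ?V"
 have r4: "- 4 * r^2 < - 3 * r^2" using r by simp
 let ?H = "{h. q + h *\<^sub>R b \<in> bcyl r}"
 show "((%h. bdata r \<phi> (q + h *\<^sub>R b)) has_real_derivative ?D q) (at 0 within {h. q + h *\<^sub>R b \<in> ?V})"
 proof (cases "3 * r^2 < (norm (fst q))^2 \<or> snd q < - 3 * r^2")
  case True
  let ?T = "{h. 3 * r^2 < (norm (fst (q + h *\<^sub>R b)))^2} \<union> {h. snd (q + h *\<^sub>R b) < - 3 * r^2}"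
  have z: "cut_space r (fst z, 0) * cut_time r (snd z) = 0" "?D z = 0"
   if "3 * r^2 < (norm (fst z))^2 \<or> snd z < - 3 * r^2" for z :: "'n space"
  proof -
   have n: "(norm (fst z, 0 :: real))^2 = (norm (fst z))^2" by (simp add: norm_Pair)
   from that show "cut_space r (fst z, 0) * cut_time r (snd z) = 0" "?D z = 0" using cut_space_0[OF r, of "(fst z, 0)"] cut_time_0[OF r, of "snd z"] unfolding n by auto
  qed
  have "((%h. 0) has_real_derivative ?D q) (at 0)" unfolding z(2)[OF True] by simp
  then have "((%h. bdata r \<phi> (q + h *\<^sub>R b)) has_real_derivative ?D q) (at 0)"
  proof (rule has_field_derivative_transform_within_open[of _ _ _ ?T])
   show "open ?T" by (intro open_Un open_Collect_less continuous_intros)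
   show "0 \<in> ?T" using True by simp
   fix h assume "h \<in> ?T"
   then have "3 * r^2 < (norm (fst (q + h *\<^sub>R b)))^2 \<or> snd (q + h *\<^sub>R b) < - 3 * r^2" by blast
   from z(1)[OF this] show "0 = bdata r \<phi> (q + h *\<^sub>R b)" by (simp only: bdata_def mult_zero_left mult_zero_right)
  qed
  then show ?thesis by (rule has_field_derivative_at_within)
 next
  case False
  let ?T = "{h. norm (fst (q + h *\<^sub>R b)) < 2 * r} \<inter> {h. - 4 * r^2 < snd (q + h *\<^sub>R b)}"
  have q3: "(norm (fst q))^2 <= 3 * r^2" "- 3 * r^2 <= snd q" using False by auto
  have "0 < r^2" using r by simp
  then have "(norm (fst q))^2 < 4 * r^2" using q3(1) by linarith
  then have "(norm (fst q))^2 < (2 * r)^2" by (simp add: power_mult_distrib)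
  then have n: "norm (fst q) < 2 * r" by (rule power2_less_imp_less) (use r in simp)
  have s4: "- 4 * r^2 < snd q" using q3 r4 by linarith
  have qb: "q \<in> bcyl r" using n q s4 by (simp add: bcyl_def mem_Times_iff)
  have "at 0 within {h. q + h *\<^sub>R b \<in> ?V} = at 0 within ?H"
  proof (rule at_within_nhd[of _ ?T])
   show "0 \<in> ?T" using n s4 by simp
   show "open ?T" by (intro open_Int open_Collect_less continuous_intros)
   show "{h. q + h *\<^sub>R b \<in> ?V} \<inter> ?T - {0} = ?H \<inter> ?T - {0}" by (auto simp: bcyl_def mem_Times_iff)
  qed
  moreover have "((%h. bdata r \<phi> (q + h *\<^sub>R b)) has_real_derivative ?D q) (at 0 within ?H)"
  proof (rule has_field_derivative_transform_within[of _ _ _ _ 1])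
   have "((%h. \<phi> (q + h *\<^sub>R b)) has_real_derivative g q) (at 0 within ?H)" using g qb unfolding has_partial_on_def by (rule bspec)
   from DERIV_mult[OF has_field_derivative_at_within[OF cutoff_deriv[OF r, of q b]] this]
   show "((%h. cut_space r (fst (q + h *\<^sub>R b), 0) * cut_time r (snd (q + h *\<^sub>R b)) * \<phi> (q + h *\<^sub>R b)) has_real_derivative ?D q)
    (at 0 within ?H)" using qb by simp
   show "0 \<in> ?H" using qb by simp
   fix h assume "h \<in> ?H"
   then show "cut_space r (fst (q + h *\<^sub>R b), 0) * cut_time r (snd (q + h *\<^sub>R b)) * \<phi> (q + h *\<^sub>R b) = bdata r \<phi> (q + h *\<^sub>R b)"
    unfolding bdata_def by simp
  qed simp
  ultimately show ?thesis by (simp only:)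
 qed
qed

lemma bdata_regular:
 fixes \<phi> :: "'n::finite space => real"
 assumes r: "r > 0" and \<phi>: "C_bounded 1 (bcyl r) \<phi>" and b: "b \<in> Basis"
 shows "\<exists>g K'. g \<in> borel_measurable borel \<and> (\<forall>q. \<bar>g q\<bar> <= K' * indicator (bcyl r) q) \<and>
  has_partial_on (UNIV \<times> {..0}) (bdata r \<phi>) b g"
proof -
 have r0: "r ~= 0" using r by simp
 note C = \<phi>[unfolded One_nat_def C_bounded.simps]
 have c: "continuous_on (bcyl r) \<phi>" "bounded (\<phi> ` bcyl r)" using C by blast+
 obtain g where g: "has_partial_on (bcyl r) \<phi> b g" "continuous_on (bcyl r) g" "bounded (g ` bcyl r)" using C b by blast
 let ?x = "%q. cut_space_grad r (fst q, 0) \<bullet> (fst b, 0) * cut_time r (snd q) + snd b * cut_time' r (snd q) * cut_space r (fst q, 0)"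
 let ?y = "%q :: 'n space. cut_space r (fst q, 0) * cut_time r (snd q)"
 let ?D = "%q. ?x q * \<phi> q + g q * ?y q"
 have cx: "continuous_on S ?x" "continuous_on S ?y" for S :: "('n space) set" by (intro continuous_intros r0)+
 have bd: "bounded (u ` bcyl r)" if "!!S :: ('n space) set. continuous_on S u" for u :: "'n space => real"
 proof -
  have "compact (closure (bcyl r :: ('n space) set))" using bounded_bcyl compact_closure by blast
  then have "bounded (u ` closure (bcyl r))" by (intro compact_imp_bounded compact_continuous_image that)
  then show ?thesis by (rule bounded_subset) (intro image_mono closure_subset)
 qed
 have bdd: "\<exists>C. \<forall>q\<in>bcyl r. \<bar>u q\<bar> <= C" if "bounded (u ` bcyl r)" for u :: "'n space => real" using that unfolding bounded_iff by simp
 from bdd[OF bd[OF cx(1)]] obtain K1 where K1: "\<forall>q\<in>bcyl r. \<bar>?x q\<bar> <= K1" ..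
 from bdd[OF c(2)] obtain K2 where K2: "\<forall>q\<in>bcyl r. \<bar>\<phi> q\<bar> <= K2" ..
 from bdd[OF g(3)] obtain K3 where K3: "\<forall>q\<in>bcyl r. \<bar>g q\<bar> <= K3" ..
 from bdd[OF bd[OF cx(2)]] obtain K4 where K4: "\<forall>q\<in>bcyl r. \<bar>?y q\<bar> <= K4" ..
 note K = K1[rule_format] K2[rule_format] K3[rule_format] K4[rule_format]
 have "\<bar>indicator (bcyl r) q * ?D q\<bar> <= (K1 * K2 + K3 * K4) * indicator (bcyl r) q" for q
 proof (cases "q \<in> bcyl r")
  case True
  have "\<bar>?D q\<bar> <= \<bar>?x q\<bar> * \<bar>\<phi> q\<bar> + \<bar>g q\<bar> * \<bar>?y q\<bar>" unfolding abs_mult[symmetric] by (rule abs_triangle_ineq)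
  also have "... <= K1 * K2 + K3 * K4" by (intro add_mono mult_mono K True abs_ge_zero order_trans[OF abs_ge_zero K(1)[OF True]] order_trans[OF abs_ge_zero K(3)[OF True]])
  finally show ?thesis using True by simp
 qed simp
 moreover have "(%q. indicator (bcyl r) q * ?D q) \<in> borel_measurable borel" by (intro measurable_cutoff_data continuous_on_add continuous_on_mult cx c g)
 ultimately show ?thesis using bdata_partial[OF r g(1)] by blast
qed

theorem lemma5p5:
  fixes s a :: real
  assumes "0 < s" and "s < 1" and "a = 1 - 2 * s"
  shows "\<exists>\<alpha>'>0. \<forall>r>0. \<forall>(v :: ((real ^ 'n) \<times> real) \<times> real \<Rightarrow> real) (\<phi> :: (real ^ 'n) \<times> real \<Rightarrow> real).
    C_bounded (if s < 1/2 then 2 else 1) (ball 0 (2 * r) \<times> {- 4 * r\<^sup>2<..0}) \<phi> \<longrightarrow>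
    weak_solution a (2 * r) (- 4 * r\<^sup>2) 0 (\<lambda>q. - \<phi> q) v \<longrightarrow>
    (\<exists>w. (AE p in lborel. p \<in> half_ball r \<times> {- r\<^sup>2<..0} \<longrightarrow> w p = v p) \<and>
      (\<forall>i. \<exists>Diw. has_partial_on (half_ball r \<times> {- r\<^sup>2<..0}) w ((axis i 1, 0), 0) Diw \<and>
        holder_up_to_bottom \<alpha>' r Diw) \<and>
      (\<exists>wt. has_partial_on (half_ball r \<times> {- r\<^sup>2<..0}) w ((0, 0), 1) wt \<and>
        holder_up_to_bottom \<alpha>' r wt) \<and>
      (\<exists>wy. has_partial_on (half_ball r \<times> {- r\<^sup>2<..0}) w ((0, 1), 0) wy \<and>
        holder_up_to_bottom \<alpha>' r (\<lambda>p. weight a (fst p) * wy p)))"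
proof -
 define c where "c = 1 - s"
 \<comment> \<open>Three conditions meet here: \<open>\<alpha> < 2 s\<close>, that is
   \<open>c + \<alpha> / 2 < 1\<close>, for the boundary potential;
   \<open>\<alpha> < c = 1 - s\<close> for its vertical derivative;
   \<open>\<alpha> \<le> 1 + a = 2 c\<close> for the terms away from the pole. The choice depends on
   \<open>s\<close>, hence on \<open>a\<close>, alone.\<close>
 define \<alpha> where "\<alpha> = min s (1 - s) / 2"
 have c: "0 < c" "c < 1" and a: "a = 2 * c - 1" using assms by (auto simp: c_def)
 have \<alpha>: "0 < \<alpha>" "\<alpha> <= 1" "c + \<alpha> / 2 < 1" "\<alpha> < c" "\<alpha> <= 1 + a" using assms by (auto simp: c_def \<alpha>_def min_def field_simps)
 show ?thesis
 proof (intro exI[of _ \<alpha>] conjI[OF \<alpha>(1)] allI impI)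
  fix r :: real and v :: "('n space) \<times> real => real" and \<phi> :: "'n space => real"
  assume r: "0 < r" and C: "C_bounded (if s < 1/2 then 2 else 1) (ball 0 (2 * r) \<times> {- 4 * r^2<..0}) \<phi>"
   and weak: "weak_solution a (2 * r) (- 4 * r^2) 0 (%q. - \<phi> q) v"
  have C1: "C_bounded 1 (bcyl r) \<phi>" using C C_bounded_SucD[of 1 "bcyl r" \<phi>] unfolding bcyl_def by (simp only: Suc_1 split: if_splits)
  then have \<phi>: "continuous_on (bcyl r) \<phi>" "bounded (\<phi> ` bcyl r)" unfolding One_nat_def C_bounded.simps by blast+
  from \<phi>(2) obtain K where K: "!!q. q \<in> bcyl r ==> \<bar>\<phi> q\<bar> <= K" unfolding bounded_iff by (simp only: ball_simps real_norm_def) blast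
  let ?k = "kernel_mass TYPE('n) c" and ?gk = "gk (real CARD('n) / 2 + c) c :: 'n space => 'n space => real => real"
  obtain A B E F where I: "integrable lborel A" "integrable lborel B" "integrable lborel E"
   and far: "\<forall>q. q \<notin> far r --> A q = 0" "\<forall>q. q \<notin> far r --> B q = 0" "\<forall>q. q \<notin> far r --> E q = 0" and F: "nice F"
   and AE: "AE p in lborel. p \<in> open_cyl r --> ?k * v p =
    off A ?gk p + off B F p + (- 1) * off E ?gk p + bpot c (bdata r \<phi>) p" by (rule representation[OF c(1) a r weak \<phi>(1) K]) blast+
  \<comment> \<open>The integrals define a function at every point; this is the representative of
    \<open>v\<close> for which the classical derivatives are claimed.\<close>
  let ?w = "%p. 1 / ?k * (off A ?gk p + off B F p + (- 1) * off E ?gk p + bpot c (bdata r \<phi>) p)"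
  have "AE p in lborel. p \<in> open_cyl r --> ?w p = v p" using AE
  proof (rule AE_mp, intro AE_I2 impI)
   fix p assume "p \<in> open_cyl r --> ?k * v p =
    off A ?gk p + off B F p + (- 1) * off E ?gk p + bpot c (bdata r \<phi>) p" and "p \<in> open_cyl r"
   then have eq: "?k * v p = off A ?gk p + off B F p + (- 1) * off E ?gk p + bpot c (bdata r \<phi>) p" by blast
   show "?w p = v p" unfolding eq[symmetric] using kernel_mass_pos[OF c(1), where 'n = 'n] by simp
  qed
  moreover have "regular a \<alpha> r ?w"
  proof (intro regular_cmult regular_add)
   show "regular a \<alpha> r (off A ?gk)" by (rule off_regular[OF I(1) far(1) r gk_nice[OF c(1)] \<alpha>(1,2,5)])
   show "regular a \<alpha> r (off B F)" by (rule off_regular[OF I(2) far(2) r F \<alpha>(1,2,5)])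
   show "regular a \<alpha> r (off E ?gk)" by (rule off_regular[OF I(3) far(3) r gk_nice[OF c(1)] \<alpha>(1,2,5)])
   have m: "bdata r \<phi> \<in> borel_measurable borel" using r by (intro measurable_bdata \<phi>(1)) simp
   have b: "\<forall>q. \<bar>bdata r \<phi> q\<bar> <= \<bar>K\<bar> * indicator (bcyl r) q" by (intro allI bdata_bound K)
   show "regular a \<alpha> r (bpot c (bdata r \<phi>))" by (rule bpot_regular[OF r c m b \<alpha>(1-4) a]) (rule bdata_regular[OF r C1])
  qed
  ultimately show "\<exists>w. (AE p in lborel. p \<in> open_cyl r --> w p = v p) \<and>
   (\<forall>i. \<exists>Diw. has_partial_on (open_cyl r) w ((axis i 1, 0), 0) Diw \<and>
    holder_up_to_bottom \<alpha> r Diw) \<and>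
   (\<exists>wt. has_partial_on (open_cyl r) w ((0, 0), 1) wt \<and>
    holder_up_to_bottom \<alpha> r wt) \<and>
   (\<exists>wy. has_partial_on (open_cyl r) w ((0, 1), 0) wy \<and>
    holder_up_to_bottom \<alpha> r (%p. weight a (fst p) * wy p))" unfolding regular_def by - (rule exI[of _ ?w], rule conjI)
 qed
qed

end
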